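(* Let $V_0,V_1,V_2$ be complex vector spaces with $\dim V_i=k_i+1$, where $k_0=k_1+k_2$. Let $A\in \mathbf{P}(V_0\otimes V_1\otimes V_2)$ (a matrix of boundary format) be such that $\mathrm{Det}\,A\neq 0$. Then there exists a $2$-dimensional vector space $U$ such that $SL(U)$ acts on $V_i\simeq S^{k_i}U$ ($i=0,1,2$) and, according to this action on $V_0\otimes V_1\otimes V_2$, one has $\mathrm{Stab}(A)^0\subset SL(U)$. Moreover the following cases are possible: $$\mathrm{Stab}(A)^0\simeq 0,\quad \mathbf{C},\quad \mathbf{C}^*,\quad\text{or}\quad SL(2),$$ and the case $SL(2)$ occurs if and only if $A$ is an identity.
   Context: Elements of $V_0\otimes V_1\otimes V_2$ with $\dim V_i=k_i+1$, $k_0=k_1+k_2$, are $3$-dimensional matrices of boundary format. The same letter denotes a nonzero tensor and its class in $\mathbf{P}(V_0\otimes V_1\otimes V_2)$. Given bases of the $V_j$ (indexed by $0,\dots,k_j$), $a_{i_0,i_1,i_2}$ denote the coordinates of $A$. $S^kU$ denotes the $k$-th symmetric power of $U$. $\mathrm{Det}$ denotes the hyperdeterminant of Gelfand–Kapranov–Zelevinsky, i.e. the equation of the dual variety (a hypersurface for this format) of the Segre variety $\mathbf{P}(V_0)\times\mathbf{P}(V_1)\times\mathbf{P}(V_2)$. For boundary format, $\mathrm{Det}\,A\ne0$ if and only if there are no nonzero $v_1\in V_1^*,v_2\in V_2^*$ such that the contraction $A(v_1\otimes v_2)\in V_0$ vanishes. $A$ is called an identity if there exist bases in the $V_j$ such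 that (for a representative) $a_{i_0,i_1,i_2}=0$ for $i_0\neq i_1+i_2$ and $a_{i_0,i_1,i_2}=1$ for $i_0=i_1+i_2$. Equivalently, there are a $2$-dimensional space $U$ and isomorphisms $V_j\simeq S^{k_j}U$ such that $A$ belongs to the unique one-dimensional $SL(U)$-invariant subspace of $S^{k_0}U\otimes S^{k_1}U\otimes S^{k_2}U$. $\mathrm{Stab}(A)\subset SL(V_0)\times SL(V_1)\times SL(V_2)$ is the stabilizer subgroup of the point $A$ for the natural action and $\mathrm{Stab}(A)^0$ its connected component containing the identity. The symbol $0$ denotes the trivial group.
   Formalization: Here $k_1,k_2\ge 1$ is assumed (for $k_1=0$, $k_2\ge2$ one gets $SL(k_2+1)$), and when $k_0,k_1,k_2$ are all even the case $SL(2)$ means $SL(2)/\{\pm1\}$, since $-1$ then acts trivially and an identity has $\mathrm{Stab}(A)^0\simeq PSL(2)$. *)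

theory Defs
  imports "HOL-Analysis.Analysis" "HOL-Algebra.Coset"
begin

section \<open>Regular functions and isomorphisms of affine algebraic groups\<close>

text \<open>The algebra of complex functions generated by a set of functions: for the coordinate
  functions of an affine space these are the polynomial functions.\<close>

inductive_set generated_algebra :: "('a \<Rightarrow> complex) set \<Rightarrow> ('a \<Rightarrow> complex) set"
  for L :: "('a \<Rightarrow> complex) set"
where
  const: "(\<lambda>_. c) \<in> generated_algebra L"
| gen: "l \<in> L \<Longrightarrow> l \<in> generated_algebra L"
| add: "p \<in> generated_algebra L \<Longrightarrow> q \<in> generated_algebra L \<Longrightarrow>
    (\<lambda>x. p x + q x) \<in> generated_algebra L"
| mult: "p \<in> generated_algebra L \<Longrightarrow> q \<in> generated_algebra L \<Longrightarrow>
    (\<lambda>x. p x * q x) \<in> generated_algebra L"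

definition regular_on :: "'a set \<Rightarrow> ('a \<Rightarrow> complex) set \<Rightarrow> ('a \<Rightarrow> complex) set" where
  "regular_on S L = {p. \<exists>q \<in> generated_algebra L. \<forall>x \<in> S. p x = q x}"

text \<open>An affine algebraic group is given by a group \<open>G\<close> and the set \<open>R\<close> of its regular functions.
  Values outside the carrier are irrelevant, so \<open>R\<close> always consists of all functions whose restriction
  to the carrier is regular. For a bijection \<open>f\<close> the last condition says that pulling back along \<open>f\<close>
  identifies the two coordinate rings, i.e. that \<open>f\<close> and its inverse are morphisms of varieties.\<close>

definition alg_group_iso ::
  "'a monoid \<Rightarrow> ('a \<Rightarrow> complex) set \<Rightarrow> 'b monoid \<Rightarrow> ('b \<Rightarrow> complex) set \<Rightarrow> bool" where
  "alg_group_iso G R H S \<longleftrightarrow> (\<exists>f \<in> iso G H. \<forall>q. q \<in> S \<longleftrightarrow> q \<circ> f \<in> R)"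

definition Ga :: "complex monoid" where
  "Ga = \<lparr>carrier = UNIV, mult = (+), one = 0\<rparr>"

definition Ga_regular :: "(complex \<Rightarrow> complex) set" where
  "Ga_regular = regular_on UNIV {\<lambda>t. t}"

definition Gm :: "complex monoid" where
  "Gm = \<lparr>carrier = UNIV - {0}, mult = (*), one = 1\<rparr>"

definition Gm_regular :: "(complex \<Rightarrow> complex) set" where
  "Gm_regular = regular_on (UNIV - {0}) {\<lambda>t. t, \<lambda>t. inverse t}"

definition SL :: "(complex^'n::finite^'n) set" where
  "SL = {g. det g = 1}"

definition SL2 :: "(complex^2^2) monoid" where
  "SL2 = \<lparr>carrier = SL, mult = (**), one = mat 1\<rparr>"

definition SL2_regular :: "(complex^2^2 \<Rightarrow> complex) set" where
  "SL2_regular = regular_on SL {\<lambda>g. g $ i $ j | i j. True}"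

definition PSL2 :: "(complex^2^2) set monoid" where
  "PSL2 = SL2 Mod {mat 1, - mat 1}"

text \<open>Regular functions on the quotient are those whose pullback to \<open>SL(2)\<close> is regular.\<close>

definition PSL2_regular :: "((complex^2^2) set \<Rightarrow> complex) set" where
  "PSL2_regular = {p. (\<lambda>g. p ({mat 1, - mat 1} #>\<^bsub>SL2\<^esub> g)) \<in> SL2_regular}"


section \<open>Three-dimensional matrices\<close>

text \<open>\<open>V\<^sub>j\<close> is \<open>\<complex>\<^bsup>n\<^sub>j\<^esup>\<close>, and a tensor in \<open>V\<^sub>0 \<otimes> V\<^sub>1 \<otimes> V\<^sub>2\<close> is the array \<open>A $ i\<^sub>0 $ i\<^sub>1 $ i\<^sub>2\<close>.\<close>

type_synonym ('n0, 'n1, 'n2) tensor = "complex^'n2^'n1^'n0"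

definition tensor3 ::
  "complex^'n0::finite \<Rightarrow> complex^'n1::finite \<Rightarrow> complex^'n2::finite \<Rightarrow> ('n0, 'n1, 'n2) tensor" where
  "tensor3 x y z = (\<chi> i j l. x $ i * y $ j * z $ l)"

definition scale3 :: "complex \<Rightarrow> ('n0::finite, 'n1::finite, 'n2::finite) tensor \<Rightarrow> ('n0, 'n1, 'n2) tensor" where
  "scale3 c A = (\<chi> i j l. c * A $ i $ j $ l)"

definition pairing :: "('n0::finite, 'n1::finite, 'n2::finite) tensor \<Rightarrow> ('n0, 'n1, 'n2) tensor \<Rightarrow> complex"
  where "pairing A T = (\<Sum>i\<in>UNIV. \<Sum>j\<in>UNIV. \<Sum>l\<in>UNIV. A $ i $ j $ l * T $ i $ j $ l)"

text \<open>The affine cone over the dual variety of the Segre variety: the tensors \<open>A\<close> whose hyperplane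
  contains the embedded tangent space of the Segre variety at some point \<open>x \<otimes> y \<otimes> z\<close>, which is
  \<open>V\<^sub>0 \<otimes> y \<otimes> z + x \<otimes> V\<^sub>1 \<otimes> z + x \<otimes> y \<otimes> V\<^sub>2\<close> (the \<open>V\<^sub>j\<close> being identified with their duals by the
  coordinates). The Segre variety is smooth and projective, so these hyperplanes form a closed set.\<close>

definition segre_dual_cone :: "('n0::finite, 'n1::finite, 'n2::finite) tensor set" where
  "segre_dual_cone = {A. \<exists>x y z. x \<noteq> 0 \<and> y \<noteq> 0 \<and> z \<noteq> 0 \<and>
     (\<forall>x'. pairing A (tensor3 x' y z) = 0) \<and>
     (\<forall>y'. pairing A (tensor3 x y' z) = 0) \<and>
     (\<forall>z'. pairing A (tensor3 x y z') = 0)}"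

definition tensor_polynomials :: "(('n0::finite, 'n1::finite, 'n2::finite) tensor \<Rightarrow> complex) set" where
  "tensor_polynomials = generated_algebra {\<lambda>A. A $ i $ j $ l | i j l. True}"

text \<open>\<open>D\<close> is a hyperdeterminant (which is unique up to a nonzero constant): an irreducible
  polynomial whose zero locus is the dual variety. Over the infinite field \<open>\<complex>\<close> polynomials and
  polynomial functions agree, and the nonzero constants are the units.\<close>

definition is_hyperdeterminant :: "(('n0::finite, 'n1::finite, 'n2::finite) tensor \<Rightarrow> complex) \<Rightarrow> bool"
  where "is_hyperdeterminant D \<longleftrightarrow>
    D \<in> tensor_polynomials \<and>
    \<not> D constant_on UNIV \<and>
    (\<forall>p \<in> tensor_polynomials. \<forall>q \<in> tensor_polynomials.
       D = (\<lambda>A. p A * q A) \<longrightarrow> p constant_on UNIV \<or> q constant_on UNIV) \<and>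
    {A. D A = 0} = segre_dual_cone"

definition is_basis :: "nat \<Rightarrow> (nat \<Rightarrow> complex^'n::finite) \<Rightarrow> bool" where
  "is_basis k b \<longleftrightarrow> inj_on b {..k} \<and> vec.independent (b ` {..k}) \<and> vec.span (b ` {..k}) = UNIV"

text \<open>The factor \<open>c\<close> is the choice of a representative of the point of the projective space.\<close>

definition is_identity :: "nat \<Rightarrow> nat \<Rightarrow> nat \<Rightarrow> ('n0::finite, 'n1::finite, 'n2::finite) tensor \<Rightarrow> bool" where
  "is_identity k0 k1 k2 A \<longleftrightarrow>
    (\<exists>c b0 b1 b2. c \<noteq> 0 \<and> is_basis k0 b0 \<and> is_basis k1 b1 \<and> is_basis k2 b2 \<and>
      scale3 c A = (\<Sum>i0\<le>k0. \<Sum>i1\<le>k1. \<Sum>i2\<le>k2.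
        scale3 (if i0 = i1 + i2 then 1 else 0) (tensor3 (b0 i0) (b1 i1) (b2 i2))))"


section \<open>Stabilizers\<close>

type_synonym ('n0, 'n1, 'n2) triple = "(complex^'n0^'n0) \<times> (complex^'n1^'n1) \<times> (complex^'n2^'n2)"

fun tensor_act ::
  "('n0::finite, 'n1::finite, 'n2::finite) triple \<Rightarrow> ('n0, 'n1, 'n2) tensor \<Rightarrow> ('n0, 'n1, 'n2) tensor" where
  "tensor_act (g0, g1, g2) A = (\<chi> i j l. \<Sum>i'\<in>UNIV. \<Sum>j'\<in>UNIV. \<Sum>l'\<in>UNIV.
     g0 $ i $ i' * g1 $ j $ j' * g2 $ l $ l' * A $ i' $ j' $ l')"

text \<open>The stabilizer of the point of the projective space represented by \<open>A\<close>.\<close>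

definition Stab :: "('n0::finite, 'n1::finite, 'n2::finite) tensor \<Rightarrow> ('n0, 'n1, 'n2) triple set" where
  "Stab A = {g \<in> SL \<times> SL \<times> SL. \<exists>c. c \<noteq> 0 \<and> tensor_act g A = scale3 c A}"

definition Stab0 :: "('n0::finite, 'n1::finite, 'n2::finite) tensor \<Rightarrow> ('n0, 'n1, 'n2) triple set" where
  "Stab0 A = connected_component_set (Stab A) (mat 1, mat 1, mat 1)"

definition Stab0_group :: "('n0::finite, 'n1::finite, 'n2::finite) tensor \<Rightarrow> ('n0, 'n1, 'n2) triple monoid" where
  "Stab0_group A = \<lparr>carrier = Stab0 A,
     mult = (\<lambda>(g0, g1, g2) (h0, h1, h2). (g0 ** h0, g1 ** h1, g2 ** h2)),
     one = (mat 1, mat 1, mat 1)\<rparr>"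

definition Stab0_regular ::
  "('n0::finite, 'n1::finite, 'n2::finite) tensor \<Rightarrow> (('n0, 'n1, 'n2) triple \<Rightarrow> complex) set" where
  "Stab0_regular A = regular_on (Stab0 A)
     ({\<lambda>(g0, g1, g2). g0 $ i $ j | i j. True} \<union>
      {\<lambda>(g0, g1, g2). g1 $ i $ j | i j. True} \<union>
      {\<lambda>(g0, g1, g2). g2 $ i $ j | i j. True})"

text \<open>\<open>-1 \<in> SL(U)\<close> acts on \<open>S\<^sup>kU\<close> as \<open>(-1)\<^sup>k\<close>. Hence if all the \<open>k\<^sub>j\<close> are even, the action of \<open>SL(U)\<close>
  on \<open>V\<^sub>0\<close>, \<open>V\<^sub>1\<close>, \<open>V\<^sub>2\<close> is not faithful, and the group of automorphisms that it defines, the group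
  meant by ``\<open>SL(2)\<close>'', is \<open>SL(2)/{1, -1}\<close>. In all other cases it is \<open>SL(2)\<close> itself.\<close>

definition Stab0_is_SL2 ::
  "nat \<Rightarrow> nat \<Rightarrow> nat \<Rightarrow> ('n0::finite, 'n1::finite, 'n2::finite) tensor \<Rightarrow> bool" where
  "Stab0_is_SL2 k0 k1 k2 A \<longleftrightarrow>
    (if even k0 \<and> even k1 \<and> even k2
     then alg_group_iso (Stab0_group A) (Stab0_regular A) PSL2 PSL2_regular
     else alg_group_iso (Stab0_group A) (Stab0_regular A) SL2 SL2_regular)"


section \<open>Symmetric powers of a two-dimensional space\<close>

text \<open>For \<open>U = \<complex>\<^sup>2\<close>, the symmetric power \<open>S\<^sup>kU\<close> is the space of homogeneous polynomials of degree \<open>k\<close>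
  on the dual space of \<open>U\<close>. The vector \<open>u \<in> U\<close> is the linear form \<open>\<xi> \<mapsto> u \<cdot> \<xi>\<close>, so that
  \<open>g u\<close> is the form \<open>\<xi> \<mapsto> u \<cdot> (g\<^sup>T \<xi>)\<close>.\<close>

definition sym_power :: "nat \<Rightarrow> (complex^2 \<Rightarrow> complex) set" where
  "sym_power k = {f. \<exists>c :: nat \<Rightarrow> complex. \<forall>\<xi>. f \<xi> = (\<Sum>i\<le>k. c i * (\<xi> $ 1) ^ (k - i) * (\<xi> $ 2) ^ i)}"

definition sym_act :: "complex^2^2 \<Rightarrow> (complex^2 \<Rightarrow> complex) \<Rightarrow> (complex^2 \<Rightarrow> complex)" where
  "sym_act g f = (\<lambda>\<xi>. f (transpose g *v \<xi>))"

definition sym_power_iso :: "nat \<Rightarrow> ((complex^2 \<Rightarrow> complex) \<Rightarrow> complex^'n::finite) \<Rightarrow> bool" where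
  "sym_power_iso k \<phi> \<longleftrightarrow> bij_betw \<phi> (sym_power k) UNIV \<and>
    (\<forall>f \<in> sym_power k. \<forall>g \<in> sym_power k. \<phi> (\<lambda>\<xi>. f \<xi> + g \<xi>) = \<phi> f + \<phi> g) \<and>
    (\<forall>c. \<forall>f \<in> sym_power k. \<phi> (\<lambda>\<xi>. c * f \<xi>) = c *s \<phi> f)"

text \<open>The image of \<open>SL(U)\<close> under its action on \<open>V\<^sub>0\<close>, \<open>V\<^sub>1\<close>, \<open>V\<^sub>2\<close> transported from the symmetric
  powers along isomorphisms \<open>\<phi>\<^sub>j\<close> from \<open>S\<^bsup>k\<^sub>j\<^esup>U\<close> to \<open>V\<^sub>j\<close>.\<close>

definition SL_U_image ::
  "nat \<Rightarrow> nat \<Rightarrow> nat \<Rightarrow> ((complex^2 \<Rightarrow> complex) \<Rightarrow> complex^'n0::finite) \<Rightarrow>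
   ((complex^2 \<Rightarrow> complex) \<Rightarrow> complex^'n1::finite) \<Rightarrow> ((complex^2 \<Rightarrow> complex) \<Rightarrow> complex^'n2::finite) \<Rightarrow>
   ('n0, 'n1, 'n2) triple set" where
  "SL_U_image k0 k1 k2 \<phi>0 \<phi>1 \<phi>2 = {(h0, h1, h2). \<exists>g \<in> SL.
     (\<forall>f \<in> sym_power k0. h0 *v \<phi>0 f = \<phi>0 (sym_act g f)) \<and>
     (\<forall>f \<in> sym_power k1. h1 *v \<phi>1 f = \<phi>1 (sym_act g f)) \<and>
     (\<forall>f \<in> sym_power k2. h2 *v \<phi>2 f = \<phi>2 (sym_act g f))}"

end

theory Submission
  imports Defs "HOL-Computational_Algebra.Fundamental_Theorem_Algebra"
begin

text \<open>Regard \<open>A\<close> as a bilinear map from \<open>V\<^sub>1\<^sup>* \<times> V\<^sub>2\<^sup>*\<close> to \<open>V\<^sub>0\<close>. Since \<open>Det A \<noteq> 0\<close>, it has no large blocks of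
  zeros, in whatever bases. For a nilpotent element of the Lie algebra of the stabilizer this bound
  forces all three components to be regular nilpotent, that is, conjugate to the action of the raising
  operator of \<open>sl(2)\<close> on \<open>S\<^bsup>k\<^sub>j\<^esup>U\<close>. For a non-nilpotent element it forces the eigenvalues on the
  three spaces to be arithmetic progressions with a common difference, and \<open>A\<close> to be supported on
  \<open>i\<^sub>0 + i\<^sub>1 + i\<^sub>2 = k\<^sub>0\<close> in an eigenbasis (the support of an identity, up to reversing the basis of
  \<open>V\<^sub>0\<close>), so that the torus of \<open>SL(2)\<close> stabilizes \<open>A\<close>.

  If the torus stabilizes \<open>A\<close> and the Lie algebra contains something else, its component of degree
  one (or minus one) gives a recursion of Pascal type for the entries of \<open>A\<close>, which makes \<open>A\<close> an
  identity. If no torus stabilizes \<open>A\<close>, the Lie algebra consists of nilpotent elements, and it is at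
  most a line since every one of them is regular.

  To pass to the group, a connected subgroup of the stabilizer that contains all its elements close
  to \<open>1\<close> is the identity component. Such elements are described by logarithms of their eigenvalues,
  by the one-parameter groups of their unipotent parts, and for an identity by the conjugation action
  on \<open>sl(2)\<close>.\<close>

declare transpose_matrix_vector [simp del]

section \<open>Contractions and base change\<close>

text \<open>That a large zero block forces \<open>D A = 0\<close> is classically an intersection
  statement: bilinear equations on a product of projective spaces, no more of them than the
  dimension, have a common solution. Here a deformation replaces it. On a line joining a special
  tensor \<open>A0\<close> to the given one, Brouwer's theorem yields solutions near
  \<open>A0\<close>; so \<open>D\<close>, a polynomial in one variable along the line, has
  infinitely many zeros and vanishes at the far end too. The resulting bound serves twice: in
  coordinates sorted by eigenvalues, and for kernels and images of nilpotent maps.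

  Stabilizing a point of projective space leaves a scalar \<open>c\<close> free. Scalar matrices
  absorb it, and the determinant conditions remove these near the identity. Multiplicative relations
  between eigenvalues become additive ones only after taking logarithms, which is why every argument
  about group elements is confined to a neighbourhood of the identity and why constants such as
  \<open>pi / 3\<close> occur.\<close>

definition mode0 :: "complex^'n0^'n0 \<Rightarrow> ('n0::finite, 'n1::finite, 'n2::finite) tensor \<Rightarrow> ('n0, 'n1, 'n2) tensor" where
  "mode0 g A = (\<chi> i j l. \<Sum>i'\<in>UNIV. g $ i $ i' * A $ i' $ j $ l)"

definition mode1 :: "complex^'n1^'n1 \<Rightarrow> ('n0::finite, 'n1::finite, 'n2::finite) tensor \<Rightarrow> ('n0, 'n1, 'n2) tensor" where
  "mode1 g A = (\<chi> i j l. \<Sum>j'\<in>UNIV. g $ j $ j' * A $ i $ j' $ l)"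

definition mode2 :: "complex^'n2^'n2 \<Rightarrow> ('n0::finite, 'n1::finite, 'n2::finite) tensor \<Rightarrow> ('n0, 'n1, 'n2) tensor" where
  "mode2 g A = (\<chi> i j l. \<Sum>l'\<in>UNIV. g $ l $ l' * A $ i $ j $ l')"

definition contr :: "('n0::finite, 'n1::finite, 'n2::finite) tensor \<Rightarrow> complex^'n1 \<Rightarrow> complex^'n2 \<Rightarrow> complex^'n0" where
  "contr A y z = (\<chi> i. \<Sum>j\<in>UNIV. \<Sum>l\<in>UNIV. A $ i $ j $ l * y $ j * z $ l)"

lemma tensor_act_modes: "tensor_act (g0, g1, g2) A = mode0 g0 (mode1 g1 (mode2 g2 A))"
  by (simp add: vec_eq_iff mode0_def mode1_def mode2_def sum_distrib_left mult.assoc)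

lemma contr_mode0: "contr (mode0 g A) y z = g *v contr A y z"
proof -
  have "(\<Sum>j\<in>UNIV. \<Sum>l\<in>UNIV. (\<Sum>i'\<in>UNIV. g $ i $ i' * A $ i' $ j $ l) * y $ j * z $ l) =
    (\<Sum>i'\<in>UNIV. g $ i $ i' * (\<Sum>j\<in>UNIV. \<Sum>l\<in>UNIV. A $ i' $ j $ l * y $ j * z $ l))" for i
  proof -
    have "(\<Sum>j\<in>UNIV. \<Sum>l\<in>UNIV. (\<Sum>i'\<in>UNIV. g $ i $ i' * A $ i' $ j $ l) * y $ j * z $ l) =
      (\<Sum>j\<in>UNIV. \<Sum>l\<in>UNIV. \<Sum>i'\<in>UNIV. g $ i $ i' * (A $ i' $ j $ l * y $ j * z $ l))"
      by (simp add: sum_distrib_right mult.assoc)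
    also have "\<dots> = (\<Sum>j\<in>UNIV. \<Sum>i'\<in>UNIV. \<Sum>l\<in>UNIV. g $ i $ i' * (A $ i' $ j $ l * y $ j * z $ l))"
      by (rule sum.cong[OF refl], rule sum.swap)
    also have "\<dots> = (\<Sum>i'\<in>UNIV. \<Sum>j\<in>UNIV. \<Sum>l\<in>UNIV. g $ i $ i' * (A $ i' $ j $ l * y $ j * z $ l))"
      by (rule sum.swap)
    finally show ?thesis by (simp add: sum_distrib_left)
  qed
  then show ?thesis
    by (simp add: vec_eq_iff contr_def mode0_def matrix_vector_mult_def)
qed

lemma contr_mode1: "contr (mode1 g A) y z = contr A (transpose g *v y) z"
proof -
  have "(\<Sum>j\<in>UNIV. \<Sum>l\<in>UNIV. (\<Sum>j'\<in>UNIV. g $ j $ j' * A $ i $ j' $ l) * y $ j * z $ l) =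
    (\<Sum>j'\<in>UNIV. \<Sum>l\<in>UNIV. A $ i $ j' $ l * (\<Sum>j\<in>UNIV. g $ j $ j' * y $ j) * z $ l)" for i
  proof -
    have "(\<Sum>j\<in>UNIV. \<Sum>l\<in>UNIV. (\<Sum>j'\<in>UNIV. g $ j $ j' * A $ i $ j' $ l) * y $ j * z $ l) =
      (\<Sum>j\<in>UNIV. \<Sum>l\<in>UNIV. \<Sum>j'\<in>UNIV. A $ i $ j' $ l * (g $ j $ j' * y $ j) * z $ l)"
      by (simp add: sum_distrib_left sum_distrib_right mult_ac)
    also have "\<dots> = (\<Sum>j\<in>UNIV. \<Sum>j'\<in>UNIV. \<Sum>l\<in>UNIV. A $ i $ j' $ l * (g $ j $ j' * y $ j) * z $ l)"
      by (rule sum.cong[OF refl], rule sum.swap)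
    also have "\<dots> = (\<Sum>j'\<in>UNIV. \<Sum>j\<in>UNIV. \<Sum>l\<in>UNIV. A $ i $ j' $ l * (g $ j $ j' * y $ j) * z $ l)"
      by (rule sum.swap)
    also have "\<dots> = (\<Sum>j'\<in>UNIV. \<Sum>l\<in>UNIV. \<Sum>j\<in>UNIV. A $ i $ j' $ l * (g $ j $ j' * y $ j) * z $ l)"
      by (rule sum.cong[OF refl], rule sum.swap)
    finally show ?thesis by (simp add: sum_distrib_left sum_distrib_right)
  qed
  then show ?thesis
    by (simp add: vec_eq_iff contr_def mode1_def matrix_vector_mult_def transpose_def)
qed

lemma contr_mode2: "contr (mode2 g A) y z = contr A y (transpose g *v z)"
proof -
  have "(\<Sum>j\<in>UNIV. \<Sum>l\<in>UNIV. (\<Sum>l'\<in>UNIV. g $ l $ l' * A $ i $ j $ l') * y $ j * z $ l) =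
    (\<Sum>j\<in>UNIV. \<Sum>l'\<in>UNIV. A $ i $ j $ l' * y $ j * (\<Sum>l\<in>UNIV. g $ l $ l' * z $ l))" for i
  proof (rule sum.cong[OF refl])
    fix j
    have "(\<Sum>l\<in>UNIV. (\<Sum>l'\<in>UNIV. g $ l $ l' * A $ i $ j $ l') * y $ j * z $ l) =
      (\<Sum>l\<in>UNIV. \<Sum>l'\<in>UNIV. A $ i $ j $ l' * y $ j * (g $ l $ l' * z $ l))"
      by (simp add: sum_distrib_left sum_distrib_right mult_ac)
    also have "\<dots> = (\<Sum>l'\<in>UNIV. \<Sum>l\<in>UNIV. A $ i $ j $ l' * y $ j * (g $ l $ l' * z $ l))"
      by (rule sum.swap)
    finally show "(\<Sum>l\<in>UNIV. (\<Sum>l'\<in>UNIV. g $ l $ l' * A $ i $ j $ l') * y $ j * z $ l) =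
       (\<Sum>l'\<in>UNIV. A $ i $ j $ l' * y $ j * (\<Sum>l\<in>UNIV. g $ l $ l' * z $ l))"
      by (simp add: sum_distrib_left)
  qed
  then show ?thesis
    by (simp add: vec_eq_iff contr_def mode2_def matrix_vector_mult_def transpose_def)
qed

text \<open>The vectors \<open>y\<close> and \<open>z\<close> stand for elements of the dual spaces,
  hence the transposes. Together with \<open>contr_ext\<close> it replaces manipulations of triple
  sums by associativity of matrix-vector multiplication.\<close>

lemma contr_tensor_act:
  "contr (tensor_act (g0, g1, g2) A) y z = g0 *v contr A (transpose g1 *v y) (transpose g2 *v z)"
  by (simp only: tensor_act_modes contr_mode0 contr_mode1 contr_mode2)

lemma contr_scale3: "contr (scale3 c A) y z = c *s contr A y z"
  by (simp add: vec_eq_iff contr_def scale3_def sum_distrib_left mult.assoc)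

lemma contr_add: "contr (A + B) y z = contr A y z + contr B y z"
  by (simp add: vec_eq_iff contr_def sum.distrib algebra_simps)

lemma contr_0: "contr 0 y z = 0"
  by (simp add: vec_eq_iff contr_def)

lemma contr_axis: "contr A (axis j 1) (axis l 1) $ i = A $ i $ j $ l"
  by (simp add: contr_def axis_def if_distrib[of "\<lambda>x. _ * x"] cong: if_cong)

lemma contr_ext: "(\<And>y z. contr A y z = contr B y z) \<Longrightarrow> A = B"
  by (simp add: vec_eq_iff flip: contr_axis)

lemma contr_add1: "contr A (y + y') z = contr A y z + contr A y' z"
  and contr_add2: "contr A y (z + z') = contr A y z + contr A y z'"
  by (simp_all add: vec_eq_iff contr_def sum.distrib algebra_simps)

lemma contr_scale1: "contr A (c *s y) z = c *s contr A y z"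
  and contr_scale2: "contr A y (c *s z) = c *s contr A y z"
  by (simp_all add: vec_eq_iff contr_def sum_distrib_left mult_ac)

lemma contr_zero1 [simp]: "contr A 0 z = 0"
  and contr_zero2 [simp]: "contr A y 0 = 0"
  by (simp_all add: vec_eq_iff contr_def)

lemma linear_contr1: "Vector_Spaces.linear (*s) (*s) (\<lambda>y. contr A y z)"
  and linear_contr2: "Vector_Spaces.linear (*s) (*s) (contr A y)"
  by (unfold_locales, simp_all add: contr_add1 contr_add2 contr_scale1 contr_scale2)

lemma tensor_act_mult:
  "tensor_act (g0 ** h0, g1 ** h1, g2 ** h2) A = tensor_act (g0, g1, g2) (tensor_act (h0, h1, h2) A)"
  by (rule contr_ext)
    (simp add: contr_tensor_act matrix_transpose_mul matrix_vector_mul_assoc del: tensor_act.simps)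

lemma tensor_act_one: "tensor_act (mat 1, mat 1, mat 1) A = A"
  by (rule contr_ext) (simp add: contr_tensor_act transpose_mat del: tensor_act.simps)

lemma tensor_act_scale3: "tensor_act g (scale3 c A) = scale3 c (tensor_act g A)"
  by (cases g, rule contr_ext)
    (simp add: contr_tensor_act contr_scale3 vec.scale del: tensor_act.simps)

lemma invertibleE:
  fixes g :: "complex^'n^'n"
  assumes "invertible g"
  obtains h where "g ** h = mat 1" "h ** g = mat 1" "invertible h"
  using assms unfolding invertible_def by blast

lemma matrix_mul_cancel [simp]:
  fixes P Q :: "complex^'n^'n"
  assumes "P ** Q = mat 1"
  shows "P ** (Q ** X) = X" "P *v (Q *v v) = v"
  using assms by (simp_all add: matrix_mul_assoc matrix_vector_mul_assoc)

section \<open>The Hopf-type dimension bound\<close>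

text \<open>A homogeneous system with fewer equations than unknowns. Padding the equations with zero
  rows gives a square matrix \<open>M\<close> whose rows do not span, hence a nontrivial
  kernel.\<close>

lemma exists_orthogonal:
  fixes S :: "(complex^'n) set"
  assumes "finite S" "card S < CARD('n::finite)"
  shows "\<exists>x. x \<noteq> 0 \<and> (\<forall>r\<in>S. (\<Sum>i\<in>UNIV. r $ i * x $ i) = 0)"
proof -
  obtain g :: "complex^'n \<Rightarrow> 'n" where g: "inj_on g S"
    using assms by (metis card_le_inj finite less_imp_le top_greatest)
  define M :: "complex^'n^'n" where "M = (\<chi> i. if i \<in> g ` S then inv_into S g i else 0)"
  have rM: "row (g r) M = r" if "r \<in> S" for r
    using that g by (simp add: M_def row_def vec_lambda_eta)
  have "rows M \<subseteq> insert 0 S"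
    by (auto simp: rows_def row_def M_def vec_lambda_eta inv_into_into)
  then have "vec.span (rows M) \<subseteq> vec.span S"
    by (metis vec.span_insert_0 vec.span_mono)
  moreover have "vec.span S \<noteq> UNIV"
    using assms by (metis vec.dim_le_card' vec.dim_span vec_dim_card not_less)
  ultimately have "vec.span (rows M) \<noteq> UNIV" by blast
  then obtain x where x: "M *v x = 0" "x \<noteq> 0"
    using matrix_left_invertible_ker[of M] matrix_left_invertible_span_rows_gen[of M] by blast
  have "(\<Sum>i\<in>UNIV. r $ i * x $ i) = 0" if "r \<in> S" for r
  proof -
    have "(M *v x) $ g r = (\<Sum>i\<in>UNIV. row (g r) M $ i * x $ i)"
      by (simp add: matrix_vector_mult_def row_def)
    then show ?thesis using rM[OF that] x by simp
  qed
  with x show ?thesis by blast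
qed

lemma contr_expand1: "contr A y z $ i = (\<Sum>j\<in>UNIV. y $ j * (\<Sum>l\<in>UNIV. A $ i $ j $ l * z $ l))"
  by (simp add: contr_def sum_distrib_left mult_ac)

lemma contr_expand2: "contr A y z $ i = (\<Sum>l\<in>UNIV. z $ l * (\<Sum>j\<in>UNIV. A $ i $ j $ l * y $ j))"
  by (simp add: contr_def, subst sum.swap) (simp add: sum_distrib_left mult_ac)

text \<open>The tangency conditions on \<open>x\<close> are \<open>k\<^sub>1 + 1\<close> plus \<open>k\<^sub>2 + 1\<close> linear equations, of which one each
  is redundant because \<open>A (x, y, z) = 0\<close>.\<close>

lemma degenerate_in_segre_dual_cone:
  fixes A :: "('n0::finite, 'n1::finite, 'n2::finite) tensor"
  assumes card: "CARD('n0) + 1 = CARD('n1) + CARD('n2)"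
    and yz: "contr A y z = 0" "y \<noteq> 0" "z \<noteq> 0"
  shows "A \<in> segre_dual_cone"
proof -
  obtain j0 where j0: "y $ j0 \<noteq> 0" using yz by (auto simp: vec_eq_iff)
  obtain l0 where l0: "z $ l0 \<noteq> 0" using yz by (auto simp: vec_eq_iff)
  define r where "r j = (\<chi> i. \<Sum>l\<in>UNIV. A $ i $ j $ l * z $ l)" for j
  define s where "s l = (\<chi> i. \<Sum>j\<in>UNIV. A $ i $ j $ l * y $ j)" for l
  have "card (r ` (UNIV - {j0}) \<union> s ` (UNIV - {l0})) \<le> card (r ` (UNIV - {j0})) + card (s ` (UNIV - {l0}))"
    by (rule card_Un_le)
  also have "\<dots> \<le> card (UNIV - {j0}) + card (UNIV - {l0})"
    by (intro add_mono card_image_le) auto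
  also have "\<dots> = CARD('n1) - 1 + (CARD('n2) - 1)" by (simp add: card_Diff_singleton)
  also have "\<dots> < CARD('n0)"
    using card zero_less_card_finite[where 'a='n1] zero_less_card_finite[where 'a='n2] by linarith
  finally obtain x where x: "x \<noteq> 0"
    "\<And>v. v \<in> r ` (UNIV - {j0}) \<union> s ` (UNIV - {l0}) \<Longrightarrow> (\<Sum>i\<in>UNIV. v $ i * x $ i) = 0"
    using exists_orthogonal[of "r ` (UNIV - {j0}) \<union> s ` (UNIV - {l0})"] by auto
  have c0: "(\<Sum>i\<in>UNIV. contr A y z $ i * x $ i) = 0" using yz by simp
  have c1: "(\<Sum>i\<in>UNIV. contr A y z $ i * x $ i) = (\<Sum>j\<in>UNIV. y $ j * (\<Sum>i\<in>UNIV. r j $ i * x $ i))"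
  proof -
    have "(\<Sum>i\<in>UNIV. contr A y z $ i * x $ i) = (\<Sum>i\<in>UNIV. \<Sum>j\<in>UNIV. y $ j * r j $ i * x $ i)"
      by (simp add: contr_expand1 r_def sum_distrib_right)
    also have "\<dots> = (\<Sum>j\<in>UNIV. \<Sum>i\<in>UNIV. y $ j * r j $ i * x $ i)" by (rule sum.swap)
    finally show ?thesis by (simp add: sum_distrib_left mult.assoc)
  qed
  have c2: "(\<Sum>i\<in>UNIV. contr A y z $ i * x $ i) = (\<Sum>l\<in>UNIV. z $ l * (\<Sum>i\<in>UNIV. s l $ i * x $ i))"
  proof -
    have "(\<Sum>i\<in>UNIV. contr A y z $ i * x $ i) = (\<Sum>i\<in>UNIV. \<Sum>l\<in>UNIV. z $ l * s l $ i * x $ i)"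
      by (simp add: contr_expand2 s_def sum_distrib_right)
    also have "\<dots> = (\<Sum>l\<in>UNIV. \<Sum>i\<in>UNIV. z $ l * s l $ i * x $ i)" by (rule sum.swap)
    finally show ?thesis by (simp add: sum_distrib_left mult.assoc)
  qed
  have r0: "(\<Sum>i\<in>UNIV. r j $ i * x $ i) = 0" for j
  proof (cases "j = j0")
    case True
    have "(\<Sum>j\<in>UNIV. y $ j * (\<Sum>i\<in>UNIV. r j $ i * x $ i)) = y $ j0 * (\<Sum>i\<in>UNIV. r j0 $ i * x $ i)"
      using x(2) by (subst sum.remove[of _ j0]) auto
    then show ?thesis using c0 c1 j0 True by simp
  qed (use x(2) in blast)
  have s0: "(\<Sum>i\<in>UNIV. s l $ i * x $ i) = 0" for l
  proof (cases "l = l0")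
    case True
    have "(\<Sum>l\<in>UNIV. z $ l * (\<Sum>i\<in>UNIV. s l $ i * x $ i)) = z $ l0 * (\<Sum>i\<in>UNIV. s l0 $ i * x $ i)"
      using x(2) by (subst sum.remove[of _ l0]) auto
    then show ?thesis using c0 c2 l0 True by simp
  qed (use x(2) in blast)
  have p0: "pairing A (tensor3 x' y z) = 0" for x'
  proof -
    have "pairing A (tensor3 x' y z) = (\<Sum>i\<in>UNIV. x' $ i * contr A y z $ i)"
      by (simp add: pairing_def tensor3_def contr_def sum_distrib_left mult_ac)
    then show ?thesis using yz by simp
  qed
  have p1: "pairing A (tensor3 x y' z) = 0" for y'
  proof -
    have "pairing A (tensor3 x y' z) = (\<Sum>i\<in>UNIV. \<Sum>j\<in>UNIV. y' $ j * (r j $ i * x $ i))"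
      by (simp add: pairing_def tensor3_def r_def sum_distrib_left sum_distrib_right mult_ac)
    also have "\<dots> = (\<Sum>j\<in>UNIV. \<Sum>i\<in>UNIV. y' $ j * (r j $ i * x $ i))" by (rule sum.swap)
    finally show ?thesis by (simp add: r0 flip: sum_distrib_left)
  qed
  have p2: "pairing A (tensor3 x y z') = 0" for z'
  proof -
    have "pairing A (tensor3 x y z') = (\<Sum>i\<in>UNIV. \<Sum>l\<in>UNIV. z' $ l * (s l $ i * x $ i))"
      unfolding pairing_def tensor3_def s_def
      by (rule sum.cong[OF refl], subst sum.swap)
        (simp add: sum_distrib_left sum_distrib_right mult_ac)
    also have "\<dots> = (\<Sum>l\<in>UNIV. \<Sum>i\<in>UNIV. z' $ l * (s l $ i * x $ i))" by (rule sum.swap)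
    finally show ?thesis by (simp add: s0 flip: sum_distrib_left)
  qed
  show ?thesis
    unfolding segre_dual_cone_def mem_Collect_eq
    by (intro exI[of _ x] exI[of _ y] exI[of _ z] conjI allI x(1) yz p0 p1 p2)
qed

text \<open>Along a curve with polynomial coordinates, a polynomial function either vanishes or has
  finitely many zeros, and it is differentiable. Both facts are reached through this reduction to
  one variable.\<close>

lemma generated_algebra_poly_comp:
  fixes f :: "complex \<Rightarrow> 'a"
  assumes "q \<in> generated_algebra L" and "\<And>l. l \<in> L \<Longrightarrow> \<exists>p. \<forall>t. l (f t) = poly p t"
  shows "\<exists>p. \<forall>t. q (f t) = poly p t"
  using assms(1)
proof induction
  case (const c)
  then show ?case by (intro exI[of _ "[:c:]"]) simp
next
  case (add p q)
  then obtain p' q' where "\<forall>t. p (f t) = poly p' t" "\<forall>t. q (f t) = poly q' t" by blast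
  then show ?case by (intro exI[of _ "p' + q'"]) simp
next
  case (mult p q)
  then obtain p' q' where "\<forall>t. p (f t) = poly p' t" "\<forall>t. q (f t) = poly q' t" by blast
  then show ?case by (intro exI[of _ "p' * q'"]) simp
qed (use assms(2) in blast)

definition degenerate :: "('n0::finite, 'n1::finite, 'n2::finite) tensor \<Rightarrow> bool" where
  "degenerate A \<longleftrightarrow> (\<exists>y z. y \<noteq> 0 \<and> z \<noteq> 0 \<and> contr A y z = 0)"

text \<open>Vectors \<open>y\<close> supported on \<open>J\<close> and \<open>z\<close> supported on
  \<open>L\<close>, normalized to \<open>1\<close> at \<open>j0\<close> and \<open>l0\<close>, have
  \<open>card J + card L - 2\<close> free coordinates, and the equations indexed by \<open>I\<close>
  hold automatically. By \<open>large\<close> the remaining equations are at most as many as these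
  coordinates. On the segment from \<open>A0\<close> to \<open>B\<close> they take the form
  \<open>u = - t R u\<close>, a fixed point equation that is solvable for small
  \<open>t\<close>.\<close>

lemma degenerate_perturbation:
  fixes B :: "('n0::finite, 'n1::finite, 'n2::finite) tensor"
  assumes jl: "j0 \<in> J" "l0 \<in> L"
    and large: "CARD('n0) + 2 \<le> card I + card J + card L"
    and zero: "\<And>i j l. i \<in> I \<Longrightarrow> j \<in> J \<Longrightarrow> l \<in> L \<Longrightarrow> B $ i $ j $ l = 0"
  shows "\<exists>A0 \<epsilon>::real. \<epsilon> > 0 \<and> (\<forall>t. 0 < t \<and> t < \<epsilon> \<longrightarrow>
    degenerate (A0 + scale3 (complex_of_real t) (B - A0)))"
proof -
  have "card (- I) = CARD('n0) - card I" using card_Diff_subset[of I UNIV] by (simp only: Compl_eq_Diff_UNIV finite top_greatest)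
  moreover have "card ((J - {j0}) <+> (L - {l0})) = card J - 1 + (card L - 1)"
    using jl by (simp add: card_Plus)
  moreover have "card J \<ge> 1" "card L \<ge> 1"
    using jl by (metis One_nat_def Suc_leI card_gt_0_iff empty_iff finite)+
  ultimately have "card (- I) \<le> card ((J - {j0}) <+> (L - {l0}))" using large by linarith
  \<comment> \<open>Each equation outside \<open>I\<close> receives a coordinate of \<open>y\<close>
    or of \<open>z\<close> of its own.\<close>
  then obtain h :: "'n0 \<Rightarrow> 'n1 + 'n2" where h: "inj_on h (- I)" "h ` (- I) \<subseteq> (J - {j0}) <+> (L - {l0})"
    using card_le_inj[of "- I" "(J - {j0}) <+> (L - {l0})"] by auto
  \<comment> \<open>Row \<open>i\<close> pairs the coordinate \<open>h i\<close> with the normalized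
    coordinate of the other vector only. The bilinear equation of index \<open>i\<close> thus
    becomes linear and reads off \<open>u $ i\<close>.\<close>
  define A0 :: "('n0, 'n1, 'n2) tensor" where
    "A0 = (\<chi> i j l. if i \<notin> I \<and> (h i = Inl j \<and> l = l0 \<or> h i = Inr l \<and> j = j0) then 1 else 0)"
  define y :: "complex^'n0 \<Rightarrow> complex^'n1" where
    "y u = (\<chi> j. if j = j0 then 1 else if Inl j \<in> h ` (- I) then u $ inv_into (- I) h (Inl j) else 0)" for u
  define z :: "complex^'n0 \<Rightarrow> complex^'n2" where
    "z u = (\<chi> l. if l = l0 then 1 else if Inr l \<in> h ` (- I) then u $ inv_into (- I) h (Inr l) else 0)" for u
  define R where "R u = contr (B - A0) (y u) (z u)" for u
  have hI: "h i = Inl j \<Longrightarrow> i \<notin> I \<Longrightarrow> j \<in> J - {j0}" "h i = Inr l \<Longrightarrow> i \<notin> I \<Longrightarrow> l \<in> L - {l0}" for i j l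
    using h(2) by (force simp: Plus_def)+
  have yj: "y u $ j = u $ i" if "h i = Inl j" "i \<notin> I" for i j u
  proof -
    have "inv_into (- I) h (Inl j) = i" using h(1) that by (metis ComplI inv_into_f_f)
    moreover have "Inl j \<in> h ` (- I)" using that by (metis ComplI imageI)
    ultimately show ?thesis using hI(1)[OF that] by (simp add: y_def)
  qed
  have zl: "z u $ l = u $ i" if "h i = Inr l" "i \<notin> I" for i l u
  proof -
    have "inv_into (- I) h (Inr l) = i" using h(1) that by (metis ComplI inv_into_f_f)
    moreover have "Inr l \<in> h ` (- I)" using that by (metis ComplI imageI)
    ultimately show ?thesis using hI(2)[OF that] by (simp add: z_def)
  qed
  have y0: "y u $ j = 0" if "j \<notin> J" for u j
    using that jl hI(1) by (auto simp: y_def)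
  have z0: "z u $ l = 0" if "l \<notin> L" for u l
    using that jl hI(2) by (auto simp: z_def)
  have A0I: "contr A0 (y u) (z u) $ i = 0" if "i \<in> I" for u i
    using that by (simp add: contr_def A0_def)
  have A0u: "contr A0 (y u) (z u) $ i = u $ i" if i: "i \<notin> I" for u i
  proof (cases "h i")
    case (Inl a)
    have "contr A0 (y u) (z u) $ i = (\<Sum>j\<in>UNIV. \<Sum>l\<in>UNIV. if a = j \<and> l = l0 then y u $ j * z u $ l else 0)"
      using i Inl by (auto simp: contr_def A0_def intro!: sum.cong)
    also have "\<dots> = (\<Sum>j\<in>UNIV. if a = j then y u $ j * z u $ l0 else 0)"
      by (rule sum.cong[OF refl]) auto
    also have "\<dots> = y u $ a * z u $ l0" by simp
    finally show ?thesis using yj[OF Inl i] by (simp add: z_def)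
  next
    case (Inr b)
    have "contr A0 (y u) (z u) $ i = (\<Sum>j\<in>UNIV. \<Sum>l\<in>UNIV. if b = l \<and> j = j0 then y u $ j * z u $ l else 0)"
      using i Inr by (auto simp: contr_def A0_def intro!: sum.cong)
    also have "\<dots> = (\<Sum>j\<in>UNIV. if j = j0 then y u $ j * z u $ b else 0)"
      by (rule sum.cong[OF refl]) auto
    also have "\<dots> = y u $ j0 * z u $ b" by simp
    finally show ?thesis using zl[OF Inr i] by (simp add: y_def)
  qed
  have RI: "R u $ i = 0" if "i \<in> I" for u i
  proof -
    have "(B - A0) $ i $ j $ l * y u $ j * z u $ l = 0" for j l
      using that zero[of i j l] y0[of j u] z0[of l u] by (auto simp: A0_def)
    then show ?thesis unfolding R_def contr_def vec_lambda_beta by (intro sum.neutral ballI)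
  qed
  have "continuous_on S (\<lambda>u. y u $ j)" "continuous_on S (\<lambda>u. z u $ l)" for S j l
    by (cases "j = j0"; cases "Inl j \<in> h ` (- I)"; simp add: y_def continuous_on_component)
      (cases "l = l0"; cases "Inr l \<in> h ` (- I)"; simp add: z_def continuous_on_component)
  then have contR: "continuous_on S R" for S
    unfolding R_def contr_def
    by (intro continuous_on_vec_lambda continuous_on_sum continuous_on_mult continuous_on_const) auto
  have "bounded (R ` cball 0 1)"
    using contR compact_cball compact_continuous_image compact_imp_bounded by blast
  then obtain C where C: "C > 0" "\<And>u. u \<in> cball 0 1 \<Longrightarrow> norm (R u) \<le> C"
    by (auto simp: bounded_pos)
  show ?thesis
  proof (intro exI conjI allI impI)
    \<comment> \<open>The bound \<open>C\<close> of \<open>R\<close> on the unit ball makes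
      \<open>- t R\<close> a self-map of that ball for \<open>t < 1 / C\<close>, as Brouwer's
      theorem requires.\<close>
    show "1 / C > 0" using C by simp
    fix t :: real assume t: "0 < t \<and> t < 1 / C"
    have "(\<lambda>u. - (t *\<^sub>R R u)) \<in> cball 0 1 \<rightarrow> cball 0 1"
    proof
      fix u :: "complex^'n0" assume "u \<in> cball 0 1"
      then have "t * norm (R u) \<le> t * C" using C t by (intro mult_left_mono) auto
      also have "\<dots> \<le> 1" using t C by (simp add: field_simps)
      finally show "- (t *\<^sub>R R u) \<in> cball 0 1" using t by simp
    qed
    moreover have "continuous_on (cball 0 1) (\<lambda>u. - (t *\<^sub>R R u))"
      by (intro continuous_intros contR)
    ultimately obtain u where u: "- (t *\<^sub>R R u) = u"
      using brouwer_ball[of 1 0 "\<lambda>u. - (t *\<^sub>R R u)"] by (auto simp: zero_less_one)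
    have "contr (A0 + scale3 (complex_of_real t) (B - A0)) (y u) (z u) $ i = 0" for i
    proof (cases "i \<in> I")
      case True
      then show ?thesis using RI[OF True, of u] A0I[OF True, of u] by (simp add: contr_add contr_scale3 R_def)
    next
      case False
      have "u $ i = - (complex_of_real t * R u $ i)"
        by (subst u[symmetric], simp only: vector_uminus_component vector_scaleR_component) (simp add: scaleR_conv_of_real)
      then show ?thesis using A0u[OF False, of u] by (simp add: contr_add contr_scale3 R_def)
    qed
    then have "contr (A0 + scale3 (complex_of_real t) (B - A0)) (y u) (z u) = 0" by (simp add: vec_eq_iff)
    moreover have "y u $ j0 = 1" "z u $ l0 = 1" by (simp_all add: y_def z_def)
    then have "y u \<noteq> 0" "z u \<noteq> 0" by auto
    ultimately show "degenerate (A0 + scale3 (complex_of_real t) (B - A0))"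
      unfolding degenerate_def by (intro exI conjI)
  qed
qed

text \<open>The bound that a nondegenerate tensor satisfies in all bases; in terms of the bilinear map
  \<open>contr A\<close> it says that \<open>dim B(S, T) \<ge> dim S + dim T - 1\<close>.\<close>

definition block_bounded :: "('n0::finite, 'n1::finite, 'n2::finite) tensor \<Rightarrow> bool" where
  "block_bounded A \<longleftrightarrow> (\<forall>P0 P1 P2 I J L. invertible P0 \<and> invertible P1 \<and> invertible P2 \<and> J \<noteq> {} \<and> L \<noteq> {} \<and>
     (\<forall>i\<in>I. \<forall>j\<in>J. \<forall>l\<in>L. tensor_act (P0, P1, P2) A $ i $ j $ l = 0) \<longrightarrow>
     card I + card J + card L \<le> CARD('n1) + CARD('n2))"

text \<open>A zero block that violates the bound puts infinitely many points of a line on the zero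
  locus of \<open>D\<close>. So the polynomial \<open>p\<close> that describes \<open>D\<close> on
  this line is zero, and \<open>A\<close> is the point of parameter \<open>1\<close>. The matrices
  \<open>Q0\<close>, \<open>Q1\<close>, \<open>Q2\<close> carry the line back to the coordinates in
  which \<open>D\<close> is given.\<close>

lemma hyperdeterminant_block_bounded:
  fixes A :: "('n0::finite, 'n1::finite, 'n2::finite) tensor"
  assumes card: "CARD('n0) + 1 = CARD('n1) + CARD('n2)"
    and D: "is_hyperdeterminant D" "D A \<noteq> 0"
  shows "block_bounded A"
  unfolding block_bounded_def
proof (intro allI impI, elim conjE)
  fix P0 P1 P2 I J L
  assume inv: "invertible P0" "invertible P1" "invertible P2" and ne: "J \<noteq> {}" "L \<noteq> {}"
    and zero: "\<forall>i\<in>I. \<forall>j\<in>J. \<forall>l\<in>L. tensor_act (P0, P1, P2) A $ i $ j $ l = 0"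
  obtain Q0 where Q0: "P0 ** Q0 = mat 1" "Q0 ** P0 = mat 1" using inv(1) by (rule invertibleE)
  obtain Q1 where Q1: "P1 ** Q1 = mat 1" "Q1 ** P1 = mat 1" using inv(2) by (rule invertibleE)
  obtain Q2 where Q2: "P2 ** Q2 = mat 1" "Q2 ** P2 = mat 1" using inv(3) by (rule invertibleE)
  obtain j0 l0 where jl: "j0 \<in> J" "l0 \<in> L" using ne by blast
  have Dz: "{A. D A = 0} = segre_dual_cone"
    using D(1) unfolding is_hyperdeterminant_def by (elim conjE)
  define B where "B = tensor_act (P0, P1, P2) A"
  show "card I + card J + card L \<le> CARD('n1) + CARD('n2)"
  proof (rule ccontr)
    assume "\<not> ?thesis"
    then have large: "CARD('n0) + 2 \<le> card I + card J + card L" using card by linarith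
    have zeroB: "B $ i $ j $ l = 0" if "i \<in> I" "j \<in> J" "l \<in> L" for i j l
      using zero that unfolding B_def by blast
    obtain A0 \<epsilon> where e: "\<epsilon> > (0::real)" and
      deg: "\<And>t. 0 < t \<Longrightarrow> t < \<epsilon> \<Longrightarrow> degenerate (A0 + scale3 (complex_of_real t) (B - A0))"
      using degenerate_perturbation[OF jl large zeroB] by blast
    define f where "f t = tensor_act (Q0, Q1, Q2) (A0 + scale3 t (B - A0))" for t
    have "\<exists>p. \<forall>t. D (f t) = poly p t"
    proof (rule generated_algebra_poly_comp[where L = "{\<lambda>A. A $ i $ j $ l | i j l. True}"])
      show "D \<in> generated_algebra {\<lambda>A. A $ i $ j $ l | i j l. True}"
        using D(1) unfolding is_hyperdeterminant_def tensor_polynomials_def by (elim conjE)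
      fix c :: "('n0, 'n1, 'n2) tensor \<Rightarrow> complex"
      assume "c \<in> {\<lambda>A. A $ i $ j $ l | i j l. True}"
      then obtain i j l where c: "c = (\<lambda>A. A $ i $ j $ l)" by blast
      define a b where "a = tensor_act (Q0, Q1, Q2) A0" and "b = tensor_act (Q0, Q1, Q2) (B - A0)"
      have "f t = a + scale3 t b" for t
        by (rule contr_ext)
          (simp add: f_def a_def b_def contr_tensor_act contr_add contr_scale3 vec.add vec.scale del: tensor_act.simps)
      then show "\<exists>p. \<forall>t. c (f t) = poly p t"
        by (intro exI[of _ "[:a $ i $ j $ l, b $ i $ j $ l:]"]) (simp add: c scale3_def)
    qed
    then obtain p where p: "\<And>t. D (f t) = poly p t" by blast

    have "poly p (complex_of_real t) = 0" if t: "0 < t" "t < \<epsilon>" for t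
    proof -
      obtain y z where yz: "y \<noteq> 0" "z \<noteq> 0" "contr (A0 + scale3 (complex_of_real t) (B - A0)) y z = 0"
        using deg[OF t] unfolding degenerate_def by blast
      have tr: "transpose Q1 *v (transpose P1 *v y) = y" "transpose Q2 *v (transpose P2 *v z) = z"
        using Q1 Q2 by (simp_all add: matrix_vector_mul_assoc transpose_mat flip: matrix_transpose_mul)
      then have nz: "transpose P1 *v y \<noteq> 0" "transpose P2 *v z \<noteq> 0" using yz by auto
      have "contr (f (complex_of_real t)) (transpose P1 *v y) (transpose P2 *v z) = 0"
        by (simp add: f_def contr_tensor_act tr yz del: tensor_act.simps)
      from degenerate_in_segre_dual_cone[OF card this nz] have "D (f (complex_of_real t)) = 0"
        unfolding Dz[symmetric] by simp
      then show ?thesis using p by simp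
    qed
    then have "complex_of_real ` {0<..<\<epsilon>} \<subseteq> {t. poly p t = 0}" by auto
    moreover have "infinite (complex_of_real ` {0<..<\<epsilon>})"
      using e by (subst finite_image_iff) (auto simp: inj_on_def)
    ultimately have "p = 0" using poly_roots_finite finite_subset by blast
    then have "D (f 1) = 0" using p by simp
    moreover have "f 1 = A"
    proof -
      have "A0 + scale3 1 (B - A0) = B" by (simp add: vec_eq_iff scale3_def)
      then have "f 1 = tensor_act (Q0 ** P0, Q1 ** P1, Q2 ** P2) A"
        by (simp only: f_def B_def tensor_act_mult)
      then show ?thesis by (simp only: Q0 Q1 Q2 tensor_act_one)
    qed
    ultimately show False using D by simp
  qed
qed

section \<open>Linear algebra of nilpotent maps\<close>

abbreviation lin :: "(complex^'m \<Rightarrow> complex^'n) \<Rightarrow> bool" where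
  "lin \<equiv> Vector_Spaces.linear (*s) (*s)"

lemma lin_iff: "lin f \<longleftrightarrow> (\<forall>x y. f (x + y) = f x + f y) \<and> (\<forall>c x. f (c *s x) = c *s f x)"
  by (auto simp: Vector_Spaces.linear_iff intro: vec.vector_space_axioms)

lemma lin_funpow:
  fixes f :: "complex^'m \<Rightarrow> complex^'m"
  shows "lin f \<Longrightarrow> lin (f ^^ m)"
  by (induction m) (auto simp: lin_iff)

lemma lin_0: "lin f \<Longrightarrow> f 0 = 0"
  by (rule vec.linear_0)

lemma dim_pos: "v \<in> S \<Longrightarrow> v \<noteq> 0 \<Longrightarrow> 0 < vec.dim S"
  by (metis gr0I singletonD subsetD vec.dim_eq_0)

text \<open>Rank and nullity relative to a subspace: a basis \<open>B\<close> of the kernel is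
  extended by \<open>E\<close> to a basis of \<open>S\<close>, and \<open>f\<close> is injective on
  the span of \<open>E\<close>.\<close>

lemma dim_ker_im:
  fixes f :: "complex^'m \<Rightarrow> complex^'n"
  assumes f: "lin f" and S: "vec.subspace S"
  shows "vec.dim (f ` S) + vec.dim {x \<in> S. f x = 0} = vec.dim S"
proof -
  define K where "K = {x \<in> S. f x = 0}"
  have subK: "vec.subspace K"
    using f S by (auto simp: K_def vec.subspace_def lin_iff lin_0[OF f])
  obtain B where B: "B \<subseteq> K" "vec.independent B" "K \<subseteq> vec.span B" "card B = vec.dim K"
    using vec.basis_exists[of K] by blast
  have "B \<subseteq> S" using B by (auto simp: K_def)
  then obtain C where C: "B \<subseteq> C" "C \<subseteq> S" "vec.independent C" "S \<subseteq> vec.span C"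
    using vec.maximal_independent_subset_extend[of B S] B by blast
  have finC: "finite C" using C vec.finiteI_independent by blast
  have dimS: "vec.dim S = card C" using vec.basis_card_eq_dim[OF C(2,4,3)] by simp
  define E where "E = C - B"
  have indE: "vec.independent E" using C vec.independent_mono unfolding E_def by blast
  have cardE: "card E + card B = card C"
    using finC C(1) card_mono[OF finC C(1)] unfolding E_def
    by (subst card_Diff_subset) (auto intro: finite_subset)
  have spanE: "vec.span E \<subseteq> S" using C S unfolding E_def
    by (meson Diff_subset order_trans vec.span_minimal)
  have SC: "vec.span C = S" using C S by (simp add: subset_antisym vec.span_minimal)
  have KB: "vec.span B = K" using B subK by (simp add: subset_antisym vec.span_minimal)
  have sums: "{x + y |x y. x \<in> K \<and> y \<in> vec.span E} = S"
  proof -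
    have "C = B \<union> E" using C(1) by (auto simp: E_def)
    then show ?thesis using vec.span_Un[of B E] SC KB by simp
  qed
  have "vec.dim (K \<inter> vec.span E) = 0"
    using vec.dim_sums_Int[OF subK vec.subspace_span[of E]] dimS cardE B(4) vec.dim_span_eq_card_independent[OF indE]
    unfolding sums by linarith
  then have K0: "K \<inter> vec.span E \<subseteq> {0}" by simp
  have inj: "inj_on f (vec.span E)"
  proof (subst vec.linear_inj_on_iff_eq_0[OF f vec.subspace_span], intro ballI impI)
    fix x assume "x \<in> vec.span E" "f x = 0"
    then show "x = 0" using K0 spanE by (auto simp: K_def)
  qed
  have "f ` S = f ` vec.span E"
  proof
    show "f ` S \<subseteq> f ` vec.span E"
    proof
      fix w assume "w \<in> f ` S"
      then obtain x y where "x \<in> K" "y \<in> vec.span E" "w = f (x + y)"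
        unfolding sums[symmetric] by blast
      then show "w \<in> f ` vec.span E" using f by (auto simp: K_def lin_iff)
    qed
  qed (use spanE in auto)
  moreover have "vec.dim (f ` vec.span E) = vec.dim E"
    using vec.dim_image_eq[OF f, of "vec.span E"] inj by (simp add: vec.span_span)
  ultimately have "vec.dim (f ` S) = card E"
    using vec.dim_eq_card_independent[OF indE] by simp
  then show ?thesis using B(4) cardE dimS by (simp add: K_def)
qed

lemma funpow_eq_0_mono:
  fixes f :: "complex^'m \<Rightarrow> complex^'m"
  assumes "lin f" "(f ^^ m) v = 0" "m \<le> n"
  shows "(f ^^ n) v = 0"
proof -
  have "(f ^^ n) v = (f ^^ (n - m)) ((f ^^ m) v)"
    using assms(3) by (metis comp_apply funpow_add le_add_diff_inverse2)
  then show ?thesis using assms lin_0[OF lin_funpow] by metis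
qed

text \<open>The vectors are added from the end of the chain: \<open>f ^^ Suc r\<close> kills those
  already present but not the new one, which it sends to \<open>(f ^^ m) v\<close>.\<close>

lemma chain_independent:
  fixes f :: "complex^'m \<Rightarrow> complex^'m"
  assumes f: "lin f" and top: "(f ^^ m) v \<noteq> 0" "(f ^^ Suc m) v = 0"
  shows "vec.independent ((\<lambda>i. (f ^^ i) v) ` {..m}) \<and> card ((\<lambda>i. (f ^^ i) v) ` {..m}) = Suc m"
proof -
  define S where "S r = (\<lambda>i. (f ^^ i) v) ` {m - r..m}" for r
  have "vec.independent (S r) \<and> card (S r) = Suc r" if "r \<le> m" for r
    using that
  proof (induction r)
    case 0
    then show ?case using top by (simp add: S_def)
  next
    case (Suc r)
    define g where "g = f ^^ Suc r"
    have g: "lin g" unfolding g_def by (rule lin_funpow[OF f])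
    have "{m - Suc r..m} = insert (m - Suc r) {m - r..m}" using Suc.prems by auto
    then have S: "S (Suc r) = insert ((f ^^ (m - Suc r)) v) (S r)" by (simp add: S_def)
    have ker: "x \<in> vec.span (S r) \<Longrightarrow> g x = 0" for x
    proof (erule vec.linear_eq_0_on_span[OF g, rotated])
      fix x assume "x \<in> S r"
      then obtain i where i: "i \<ge> m - r" "x = (f ^^ i) v" by (auto simp: S_def)
      have "g x = (f ^^ (Suc r + i)) v" by (simp only: g_def i funpow_add o_apply)
      moreover have "Suc m \<le> Suc r + i" using i by simp
      ultimately show "g x = 0" using funpow_eq_0_mono[OF f top(2)] by metis
    qed
    have "g ((f ^^ (m - Suc r)) v) = (f ^^ (Suc r + (m - Suc r))) v"
      by (simp only: g_def funpow_add o_apply)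
    then have "g ((f ^^ (m - Suc r)) v) \<noteq> 0" using top Suc.prems by simp
    then have new: "(f ^^ (m - Suc r)) v \<notin> vec.span (S r)" using ker by blast
    then have "(f ^^ (m - Suc r)) v \<notin> S r" using vec.span_base by blast
    then show ?case
      using Suc new S vec.independent_insertI by (auto simp: S_def card_insert_if)
  qed
  from this[of m] show ?thesis by (simp add: S_def atLeast0AtMost)
qed

definition nilp :: "('a::zero \<Rightarrow> 'a) \<Rightarrow> bool" where
  "nilp f \<longleftrightarrow> (\<exists>K. \<forall>v. (f ^^ K) v = 0)"

lemma nilp_top:
  assumes "nilp f" "v \<noteq> 0"
  obtains m where "(f ^^ m) v \<noteq> 0" "(f ^^ Suc m) v = 0"
proof -
  obtain K where K: "(f ^^ K) v = 0" using assms by (auto simp: nilp_def)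
  obtain m where "m < K" "(f ^^ m) v \<noteq> 0" "(f ^^ Suc m) v = 0"
    using ex_least_nat_less[of "\<lambda>k. (f ^^ k) v = 0" K] K assms by auto
  then show ?thesis using that by blast
qed

lemma nilp_CARD:
  fixes f :: "complex^'n::finite \<Rightarrow> complex^'n"
  assumes "lin f" "nilp f"
  shows "(f ^^ CARD('n)) v = 0"
proof (cases "v = 0")
  case False
  obtain m where m: "(f ^^ m) v \<noteq> 0" "(f ^^ Suc m) v = 0" using nilp_top[OF assms(2) False] .
  have "Suc m \<le> CARD('n)"
    using chain_independent[OF assms(1) m] vec.independent_card_le_dim[of _ UNIV] vec_dim_card
    by (metis top_greatest)
  then show ?thesis by (rule funpow_eq_0_mono[OF assms(1) m(2)])
qed (use assms lin_0[OF lin_funpow] in auto)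

lemma nilp_top_set:
  fixes f :: "complex^'m \<Rightarrow> complex^'m"
  assumes "lin f" "nilp f" "\<exists>v\<in>P. f v \<noteq> 0"
  obtains a where "a \<ge> 1" "\<exists>v\<in>P. (f ^^ a) v \<noteq> 0" "\<forall>v\<in>P. (f ^^ Suc a) v = 0"
proof -
  define Q where "Q m \<longleftrightarrow> (\<forall>v\<in>P. (f ^^ Suc m) v = 0)" for m
  obtain K where K: "\<forall>v. (f ^^ K) v = 0" using assms(2) by (auto simp: nilp_def)
  then have QK: "Q K" using funpow_eq_0_mono[OF assms(1), of K _ "Suc K"] by (simp add: Q_def)
  have Q0: "\<not> Q 0" using assms(3) by (auto simp: Q_def)
  obtain a where a: "Q a" "\<forall>m<a. \<not> Q m"
    using QK by (metis LeastI not_less_Least)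
  have "a \<ge> 1" using a(1) Q0 by (cases a) auto
  moreover have "\<exists>v\<in>P. (f ^^ a) v \<noteq> 0"
    using a(2)[rule_format, of "a - 1"] \<open>a \<ge> 1\<close> by (simp add: Q_def)
  ultimately show ?thesis using a(1) that unfolding Q_def by blast
qed

section \<open>Nilpotent derivations of a nondegenerate bilinear map\<close>

text \<open>The coordinate-free form of \<open>block_bounded\<close>, for any bilinear map. Its
  symmetry in the two arguments (\<open>hopf_swap\<close>) halves the case distinctions
  below.\<close>

definition hopf :: "(complex^'a \<Rightarrow> complex^'b \<Rightarrow> complex^'c) \<Rightarrow> bool" where
  "hopf b \<longleftrightarrow> (\<forall>y. lin (b y)) \<and> (\<forall>z. lin (\<lambda>y. b y z)) \<and>
    (\<forall>S T R. vec.subspace S \<and> vec.subspace T \<and> vec.subspace R \<and> vec.dim S > 0 \<and> vec.dim T > 0 \<and>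
       (\<forall>y\<in>S. \<forall>z\<in>T. b y z \<in> R) \<longrightarrow> vec.dim S + vec.dim T \<le> vec.dim R + 1)"

lemma hopf_swap: "hopf b \<Longrightarrow> hopf (\<lambda>z y. b y z)"
  unfolding hopf_def by (metis add.commute)

lemma
  assumes "hopf b"
  shows hopf_lin1: "lin (\<lambda>y. b y z)" and hopf_lin2: "lin (b y)"
    and hopf_dim: "vec.subspace S \<Longrightarrow> vec.subspace T \<Longrightarrow> vec.subspace R \<Longrightarrow> vec.dim S > 0 \<Longrightarrow> vec.dim T > 0 \<Longrightarrow>
       (\<And>y z. y \<in> S \<Longrightarrow> z \<in> T \<Longrightarrow> b y z \<in> R) \<Longrightarrow> vec.dim S + vec.dim T \<le> vec.dim R + 1"
  using assms unfolding hopf_def by blast+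

text \<open>Two lines mapped to the zero space would give \<open>1 + 1 <= 0 + 1\<close> in the
  dimension bound.\<close>

lemma hopf_nonzero:
  assumes "hopf b" "b y z = 0" shows "y = 0 \<or> z = 0"
proof (rule ccontr)
  assume *: "\<not> ?thesis"
  have "vec.dim (vec.span {y}) + vec.dim (vec.span {z}) \<le> vec.dim {0 :: complex^'c} + 1"
  proof (rule hopf_dim[OF assms(1)])
    fix u v assume "u \<in> vec.span {y}" "v \<in> vec.span {z}"
    then obtain c d where "u = c *s y" "v = d *s z" by (auto simp: vec.span_singleton)
    then show "b u v \<in> {0}"
      using hopf_lin1[OF assms(1)] hopf_lin2[OF assms(1)] assms(2) by (simp add: lin_iff)
  qed (use * in \<open>auto simp: vec.subspace_0 vec.subspace_single_0 vec.subspace_span simp del: vec.dim_eq_0\<close>)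
  then show False using * by simp
qed

lemma derivation_power:
  assumes b: "hopf b" and Z: "lin Z" and der: "\<And>y z. Z (b y z) = b (X y) z + b y (Y z)"
  shows "(Z ^^ m) (b y z) = (\<Sum>i\<le>m. of_nat (m choose i) *s b ((X ^^ i) y) ((Y ^^ (m - i)) z))"
proof (induction m)
  case (Suc m)
  let ?t = "\<lambda>i j. b ((X ^^ i) y) ((Y ^^ j) z)"
  have "(Z ^^ Suc m) (b y z) = (\<Sum>i\<le>m. of_nat (m choose i) *s Z (?t i (m - i)))"
    using Suc by (simp add: vec.linear_sum[OF Z] vec.linear_scale[OF Z])
  also have "\<dots> = (\<Sum>i\<le>m. of_nat (m choose i) *s ?t (Suc i) (m - i)) + (\<Sum>i\<le>m. of_nat (m choose i) *s ?t i (Suc m - i))"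
    by (simp add: der vec.scale_right_distrib sum.distrib Suc_diff_le)
  also have "(\<Sum>i\<le>m. of_nat (m choose i) *s ?t i (Suc m - i)) =
      ?t 0 (Suc m) + (\<Sum>i\<le>m. of_nat (m choose Suc i) *s ?t (Suc i) (m - i))"
  proof -
    have "(\<Sum>i\<le>m. of_nat (m choose i) *s ?t i (Suc m - i)) = (\<Sum>i\<le>Suc m. of_nat (m choose i) *s ?t i (Suc m - i))"
      by (simp add: binomial_eq_0)
    then show ?thesis by (simp add: sum.atMost_Suc_shift del: sum.atMost_Suc)
  qed
  also have "(\<Sum>i\<le>m. of_nat (m choose i) *s ?t (Suc i) (m - i)) +
      (?t 0 (Suc m) + (\<Sum>i\<le>m. of_nat (m choose Suc i) *s ?t (Suc i) (m - i))) =
      ?t 0 (Suc m) + (\<Sum>i\<le>m. of_nat (Suc m choose Suc i) *s ?t (Suc i) (m - i))"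
    by (simp add: sum.distrib vec.scale_left_distrib algebra_simps)
  also have "\<dots> = (\<Sum>i\<le>Suc m. of_nat (Suc m choose i) *s ?t i (Suc m - i))"
    by (simp add: sum.atMost_Suc_shift del: sum.atMost_Suc)
  finally show ?case .
qed simp

text \<open>In the Leibniz expansion of degree \<open>a + c\<close>, every term other than
  \<open>i = a\<close> contains too high a power of \<open>X\<close> or of \<open>Y\<close>.\<close>

lemma derivation_top_power:
  assumes b: "hopf b" and Z: "lin Z" and X: "lin X" and Y: "lin Y"
    and der: "\<And>y z. Z (b y z) = b (X y) z + b y (Y z)"
    and y: "(X ^^ Suc a) y = 0" and z: "(Y ^^ Suc c) z = 0"
  shows "(Z ^^ (a + c)) (b y z) = of_nat (a + c choose a) *s b ((X ^^ a) y) ((Y ^^ c) z)"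
proof -
  have "(\<Sum>i\<le>a + c. of_nat (a + c choose i) *s b ((X ^^ i) y) ((Y ^^ (a + c - i)) z)) =
    (\<Sum>i\<in>{a}. of_nat (a + c choose i) *s b ((X ^^ i) y) ((Y ^^ (a + c - i)) z))"
  proof (rule sum.mono_neutral_right)
    show "\<forall>i\<in>{..a + c} - {a}. of_nat (a + c choose i) *s b ((X ^^ i) y) ((Y ^^ (a + c - i)) z) = 0"
    proof
      fix i assume i: "i \<in> {..a + c} - {a}"
      consider "i > a" | "i < a" using i by fastforce
      then show "of_nat (a + c choose i) *s b ((X ^^ i) y) ((Y ^^ (a + c - i)) z) = 0"
      proof cases
        case 1
        then have "(X ^^ i) y = 0" using funpow_eq_0_mono[OF X y] by simp
        then show ?thesis using lin_0[OF hopf_lin1[OF b]] by simp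
      next
        case 2
        then have "(Y ^^ (a + c - i)) z = 0" using funpow_eq_0_mono[OF Y z] by simp
        then show ?thesis using lin_0[OF hopf_lin2[OF b]] by simp
      qed
    qed
  qed auto
  then show ?thesis using derivation_power[where b = b and m = "a + c", OF b Z der] by simp
qed

text \<open>This is the case in which the second component acts as zero on \<open>Q\<close>. The
  dimension bound is applied to the image of \<open>X\<close> with \<open>Q\<close>, landing in the
  image of \<open>Z\<close>, and to the kernel of \<open>X\<close> with \<open>Q\<close>, landing in
  the kernel of \<open>Z\<close>. Adding both and using rank and nullity gives
  \<open>(p + 1) + 2 (q + 1) <= (p + q + 1) + 2\<close>, which contradicts
  \<open>q \<ge> 1\<close>.\<close>

lemma nilp_nonzero_imp_nonzero:
  assumes b: "hopf b" and X: "lin X" and Z: "lin Z"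
    and sub: "vec.subspace P" "vec.subspace Q" "vec.subspace R"
    and PQ: "\<And>y z. y \<in> P \<Longrightarrow> z \<in> Q \<Longrightarrow> b y z \<in> R"
    and dims: "vec.dim P = p + 1" "vec.dim Q = q + 1" "vec.dim R = p + q + 1" "q \<ge> 1"
    and inv: "\<And>y. y \<in> P \<Longrightarrow> X y \<in> P"
    and der: "\<And>y z. y \<in> P \<Longrightarrow> z \<in> Q \<Longrightarrow> Z (b y z) = b (X y) z"
    and nilp: "nilp X" and nz: "\<exists>y\<in>P. X y \<noteq> 0"
  shows False
proof -
  define K where "K = {y \<in> P. X y = 0}"
  define Kr where "Kr = {r \<in> R. Z r = 0}"
  obtain a where a: "a \<ge> 1" "\<exists>v\<in>P. (X ^^ a) v \<noteq> 0" "\<forall>v\<in>P. (X ^^ Suc a) v = 0"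
    using nilp_top_set[OF X nilp nz] .
  then obtain v where v: "v \<in> P" "(X ^^ a) v \<noteq> 0" "X ((X ^^ a) v) = 0" by auto
  have "(X ^^ i) v \<in> P" for i using v(1) inv by (induction i) auto
  then have "(X ^^ a) v \<in> K" using v by (simp add: K_def)
  then have "\<not> K \<subseteq> {0}" using v by blast
  then have K0: "vec.dim K > 0" by (metis gr0I vec.dim_eq_0)
  have "\<not> X ` P \<subseteq> {0}" using nz by auto
  then have X0: "vec.dim (X ` P) > 0" by (metis gr0I vec.dim_eq_0)
  have Q0: "vec.dim Q > 0" using dims by simp
  have subK: "vec.subspace K" "vec.subspace Kr"
    using sub X Z lin_0[OF X] lin_0[OF Z] by (auto simp: K_def Kr_def vec.subspace_def lin_iff)
  have subim: "vec.subspace (X ` P)" "vec.subspace (Z ` R)"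
    using vec.linear_subspace_image X Z sub by blast+
  have "vec.dim (X ` P) + vec.dim Q \<le> vec.dim (Z ` R) + 1"
    by (rule hopf_dim[OF b subim(1) sub(2) subim(2) X0 Q0]) (use der PQ in \<open>force simp: image_iff\<close>)
  moreover have "vec.dim K + vec.dim Q \<le> vec.dim Kr + 1"
    by (rule hopf_dim[OF b subK(1) sub(2) subK(2) K0 Q0])
      (use der PQ lin_0[OF hopf_lin1[OF b]] in \<open>auto simp: K_def Kr_def\<close>)
  moreover have "vec.dim (X ` P) + vec.dim K = p + 1" "vec.dim (Z ` R) + vec.dim Kr = p + q + 1"
    using dim_ker_im[OF X sub(1)] dim_ker_im[OF Z sub(3)] dims by (simp_all add: K_def Kr_def)
  ultimately show False using dims by linarith
qed

text \<open>The induction passes to the kernel of the highest nonvanishing power of \<open>X\<close> (or of \<open>Y\<close>). The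
  dimension bound forces this kernel to be a hyperplane, so that the shape of the dimensions is
  preserved.\<close>

lemma nilp_derivation_regular:
  assumes b: "hopf b" and X: "lin X" and Y: "lin Y" and Z: "lin Z"
    and nX: "nilp X" and nY: "nilp Y"
    and der: "\<And>y z. Z (b y z) = b (X y) z + b y (Y z)"
    and "vec.subspace P" "vec.subspace Q" "vec.subspace R"
    and "\<And>y z. y \<in> P \<Longrightarrow> z \<in> Q \<Longrightarrow> b y z \<in> R"
    and "vec.dim P = p + 1" "vec.dim Q = q + 1" "vec.dim R = p + q + 1" "p \<ge> 1" "q \<ge> 1"
    and "\<And>y. y \<in> P \<Longrightarrow> X y \<in> P" "\<And>z. z \<in> Q \<Longrightarrow> Y z \<in> Q"
    and "(\<exists>y\<in>P. X y \<noteq> 0) \<or> (\<exists>z\<in>Q. Y z \<noteq> 0)"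
  shows "(\<exists>y\<in>P. (X ^^ p) y \<noteq> 0) \<and> (\<exists>z\<in>Q. (Y ^^ q) z \<noteq> 0)"
  using assms(8-)
proof (induction "p + q" arbitrary: p q P Q R rule: less_induct)
  case less
  note sub = less.prems(1-3) and PQ = less.prems(4) and dims = less.prems(5-7) and pq = less.prems(8,9)
    and inv = less.prems(10,11)
  have nzX: "\<exists>y\<in>P. X y \<noteq> 0"
  proof (rule ccontr)
    assume "\<not> ?thesis"
    then have X0: "y \<in> P \<Longrightarrow> X y = 0" for y by blast
    show False
    proof (rule nilp_nonzero_imp_nonzero[where p = q and q = p, OF hopf_swap[OF b] Y Z sub(2,1,3)])
      show "\<exists>z\<in>Q. Y z \<noteq> 0" using X0 less.prems(12) by blast
    qed (use PQ dims pq inv nY X0 der lin_0[OF hopf_lin1[OF b]] in auto)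
  qed
  have nzY: "\<exists>z\<in>Q. Y z \<noteq> 0"
  proof (rule ccontr)
    assume "\<not> ?thesis"
    then have Y0: "z \<in> Q \<Longrightarrow> Y z = 0" for z by blast
    show False
    proof (rule nilp_nonzero_imp_nonzero[where p = p and q = q, OF b X Z sub])
      show "\<exists>y\<in>P. X y \<noteq> 0" using Y0 less.prems(12) by blast
    qed (use PQ dims pq inv nX Y0 der lin_0[OF hopf_lin2[OF b]] in auto)
  qed
  obtain a where a: "a \<ge> 1" "\<exists>v\<in>P. (X ^^ a) v \<noteq> 0" "\<forall>v\<in>P. (X ^^ Suc a) v = 0"
    using nilp_top_set[OF X nX nzX] .
  obtain c where c: "c \<ge> 1" "\<exists>v\<in>Q. (Y ^^ c) v \<noteq> 0" "\<forall>v\<in>Q. (Y ^^ Suc c) v = 0"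
    using nilp_top_set[OF Y nY nzY] .
  have invX: "(X ^^ i) y \<in> P" if "y \<in> P" for i y using that inv by (induction i) auto
  have invY: "(Y ^^ i) y \<in> Q" if "y \<in> Q" for i y using that inv by (induction i) auto
  define P' where "P' = {y \<in> P. (X ^^ a) y = 0}"
  define Q' where "Q' = {z \<in> Q. (Y ^^ c) z = 0}"
  define R' where "R' = {r \<in> R. (Z ^^ (a + c)) r = 0}"
  have linp: "lin (X ^^ a)" "lin (Y ^^ c)" "lin (Z ^^ (a + c))" using X Y Z lin_funpow by blast+
  have sub': "vec.subspace P'" "vec.subspace Q'" "vec.subspace R'"
    using sub linp lin_0[OF linp(1)] lin_0[OF linp(2)] lin_0[OF linp(3)]
    unfolding P'_def Q'_def R'_def vec.subspace_def lin_iff by auto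
  have subim: "vec.subspace ((X ^^ a) ` P)" "vec.subspace ((Y ^^ c) ` Q)" "vec.subspace ((Z ^^ (a + c)) ` R)"
    using vec.linear_subspace_image linp sub by blast+
  have rn: "vec.dim ((X ^^ a) ` P) + vec.dim P' = p + 1" "vec.dim ((Y ^^ c) ` Q) + vec.dim Q' = q + 1"
    "vec.dim ((Z ^^ (a + c)) ` R) + vec.dim R' = p + q + 1"
    using dim_ker_im[OF linp(1) sub(1)] dim_ker_im[OF linp(2) sub(2)] dim_ker_im[OF linp(3) sub(3)] dims
    by (simp_all add: P'_def Q'_def R'_def)
  have top: "(Z ^^ (a + c)) (b y z) = of_nat (a + c choose a) *s b ((X ^^ a) y) ((Y ^^ c) z)"
    if "y \<in> P" "z \<in> Q" for y z
    using that a c by (intro derivation_top_power[OF b Z X Y der]) auto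
  have P'Q: "b y z \<in> R'" if "y \<in> P'" "z \<in> Q" for y z
    using that PQ top lin_0[OF hopf_lin1[OF b]] by (simp add: P'_def R'_def)
  have PQ': "b y z \<in> R'" if "y \<in> P" "z \<in> Q'" for y z
    using that PQ top lin_0[OF hopf_lin2[OF b]] by (simp add: Q'_def R'_def)
  have pos: "vec.dim ((X ^^ a) ` P) > 0" "vec.dim ((Y ^^ c) ` Q) > 0"
  proof -
    obtain u v where "u \<in> P" "(X ^^ a) u \<noteq> 0" "v \<in> Q" "(Y ^^ c) v \<noteq> 0" using a(2) c(2) by blast
    then show "vec.dim ((X ^^ a) ` P) > 0" "vec.dim ((Y ^^ c) ` Q) > 0"
      by (intro dim_pos[of "(X ^^ a) u"] imageI, simp_all)
        (intro dim_pos[of "(Y ^^ c) v"] imageI, simp_all)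
  qed
  have "\<exists>y\<in>P'. y \<noteq> 0"
  proof -
    obtain v where "v \<in> P" "X v \<noteq> 0" using nzX by blast
    then show ?thesis using a(3) inv(1) by (intro bexI[of _ "X v"]) (auto simp: P'_def funpow_swap1)
  qed
  then have posP: "vec.dim P' > 0" by (metis gr0I singletonD subsetD vec.dim_eq_0)
  have "\<exists>y\<in>Q'. y \<noteq> 0"
  proof -
    obtain v where "v \<in> Q" "Y v \<noteq> 0" using nzY by blast
    then show ?thesis using c(3) inv(2) by (intro bexI[of _ "Y v"]) (auto simp: Q'_def funpow_swap1)
  qed
  then have posQ: "vec.dim Q' > 0" by (metis gr0I singletonD subsetD vec.dim_eq_0)
  have "vec.dim ((X ^^ a) ` P) + vec.dim ((Y ^^ c) ` Q) \<le> vec.dim ((Z ^^ (a + c)) ` R) + 1"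
  proof (rule hopf_dim[OF b subim pos])
    fix y z assume "y \<in> (X ^^ a) ` P" "z \<in> (Y ^^ c) ` Q"
    then obtain u v where uv: "u \<in> P" "v \<in> Q" "y = (X ^^ a) u" "z = (Y ^^ c) v" by blast
    have "of_nat (a + c choose a) \<noteq> (0::complex)" by simp
    then have "b y z = inverse (of_nat (a + c choose a)) *s (Z ^^ (a + c)) (b u v)"
      using top[OF uv(1,2)] uv by simp
    then show "b y z \<in> (Z ^^ (a + c)) ` R"
      using PQ[OF uv(1,2)] subim(3) by (auto intro: vec.subspace_scale)
  qed
  moreover have "vec.dim P' + vec.dim Q \<le> vec.dim R' + 1"
    by (rule hopf_dim[OF b sub'(1) sub(2) sub'(3) posP _ P'Q]) (use dims in auto)
  moreover have "vec.dim P + vec.dim Q' \<le> vec.dim R' + 1"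
    by (rule hopf_dim[OF b sub(1) sub'(2,3) _ posQ PQ']) (use dims in auto)
  \<comment> \<open>Write \<open>x\<close>, \<open>y\<close>, \<open>r\<close> for the dimensions of
    the three images. The three bounds read \<open>x + y <= r + 1\<close>, \<open>r <= x\<close> and
    \<open>r <= y\<close>, so positive \<open>x\<close> and \<open>y\<close> are forced to be
    \<open>1\<close>, and then \<open>r = 1\<close>.\<close>
  ultimately have one: "vec.dim ((X ^^ a) ` P) = 1" "vec.dim ((Y ^^ c) ` Q) = 1" "vec.dim ((Z ^^ (a + c)) ` R) = 1"
    using rn pos dims by linarith+
  have inv': "X y \<in> P'" if "y \<in> P'" for y
    using that inv(1) lin_0[OF X] by (auto simp: P'_def funpow_swap1)
      (metis funpow_swap1)
  have inv'': "Y y \<in> Q'" if "y \<in> Q'" for y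
    using that inv(2) lin_0[OF Y] by (auto simp: Q'_def funpow_swap1)
      (metis funpow_swap1)
  \<comment> \<open>The induction hypothesis requires both parameters to stay positive, so the
    hyperplane is taken in a factor whose parameter is at least two.\<close>
  consider "p = 1" "q = 1" | "p \<ge> 2" | "p = 1" "q \<ge> 2" using pq by linarith
  then show ?case
  proof cases
    case 1
    then show ?thesis using nzX nzY by simp
  next
    case 2
    have "(\<exists>y\<in>P'. (X ^^ (p - 1)) y \<noteq> 0) \<and> (\<exists>z\<in>Q. (Y ^^ q) z \<noteq> 0)"
      by (rule less.hyps[of "p - 1" q P' Q R'])
        (use 2 pq sub sub' P'Q rn one dims inv inv' nzY in auto)
    then obtain y where y: "y \<in> P'" "(X ^^ (p - 1)) y \<noteq> 0" and q: "\<exists>z\<in>Q. (Y ^^ q) z \<noteq> 0" by blast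
    \<comment> \<open>On the hyperplane \<open>P'\<close> the power \<open>a\<close> of
      \<open>X\<close> vanishes, whereas the power \<open>p - 1\<close> does not, by induction;
      hence \<open>a >= p\<close>.\<close>
    have "\<not> a \<le> p - 1"
    proof
      assume "a \<le> p - 1"
      then have "(X ^^ (p - 1)) y = 0" using y(1) funpow_eq_0_mono[OF X] unfolding P'_def by blast
      then show False using y(2) by simp
    qed
    then have "p \<le> a" by simp
    obtain v where v: "v \<in> P" "(X ^^ a) v \<noteq> 0" using a by blast
    have "(X ^^ a) v = (X ^^ p) ((X ^^ (a - p)) v)" using \<open>p \<le> a\<close> by (metis comp_apply funpow_add le_add_diff_inverse)
    then show ?thesis using v invX q by metis
  next
    case 3
    have "(\<exists>y\<in>P. (X ^^ p) y \<noteq> 0) \<and> (\<exists>z\<in>Q'. (Y ^^ (q - 1)) z \<noteq> 0)"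
      by (rule less.hyps[of p "q - 1" P Q' R'])
        (use 3 pq sub sub' PQ' rn one dims inv inv'' nzX in auto)
    then obtain y where y: "y \<in> Q'" "(Y ^^ (q - 1)) y \<noteq> 0" and p: "\<exists>z\<in>P. (X ^^ p) z \<noteq> 0" by blast
    have "\<not> c \<le> q - 1"
    proof
      assume "c \<le> q - 1"
      then have "(Y ^^ (q - 1)) y = 0" using y(1) funpow_eq_0_mono[OF Y] unfolding Q'_def by blast
      then show False using y(2) by simp
    qed
    then have "q \<le> c" by simp
    obtain v where v: "v \<in> Q" "(Y ^^ c) v \<noteq> 0" using c by blast
    have "(Y ^^ c) v = (Y ^^ q) ((Y ^^ (c - q)) v)" using \<open>q \<le> c\<close> by (metis comp_apply funpow_add le_add_diff_inverse)
    then show ?thesis using v invY p by metis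
  qed
qed

section \<open>Matrix powers and the normal form of regular nilpotent matrices\<close>

definition mpow :: "complex^'n^'n \<Rightarrow> nat \<Rightarrow> complex^'n^'n" where
  "mpow X m = (((**) X) ^^ m) (mat 1)"

lemma mpow_0 [simp]: "mpow X 0 = mat 1"
  and mpow_Suc: "mpow X (Suc m) = X ** mpow X m"
  by (simp_all add: mpow_def)

lemma mpow_commute: "mpow X m ** X = X ** mpow X m"
  by (induction m) (simp_all add: mpow_Suc flip: matrix_mul_assoc)

lemma funpow_mpow: "((*v) X ^^ m) v = mpow X m *v v"
  by (induction m) (simp_all add: mpow_Suc matrix_vector_mul_assoc)

lemma transpose_0: "transpose (0 :: complex^'n^'n) = 0"
  by (simp add: vec_eq_iff transpose_def)

lemma mult_axis: "(A *v axis j 1) $ i = A $ i $ j"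
  for A :: "complex^'n^'m"
  by (simp add: matrix_vector_mult_def axis_def if_distrib[of "\<lambda>x. _ * x"] cong: if_cong)

lemma invertibleI: "P ** Q = mat 1 \<Longrightarrow> Q ** P = mat 1 \<Longrightarrow> invertible P"
  for P Q :: "complex^'n^'n"
  unfolding invertible_def by blast

lemma invertible_transpose:
  fixes M :: "complex^'n^'n"
  assumes "invertible M"
  shows "invertible (transpose M)"
proof -
  obtain N where "M ** N = mat 1" "N ** M = mat 1" using assms by (rule invertibleE)
  then show ?thesis
    by (intro invertibleI[of _ "transpose N"]) (simp_all only: transpose_mat flip: matrix_transpose_mul)
qed

lemma transpose_mpow: "transpose (mpow X m) = mpow (transpose X) m"
  by (induction m) (simp_all add: mpow_Suc matrix_transpose_mul transpose_mat mpow_commute)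

lemma matrix_mul_uminus:
  fixes X Y :: "complex^'n^'n"
  shows "(- X) ** Y = - (X ** Y)" "X ** (- Y) = - (X ** Y)"
  by (simp_all add: matrix_matrix_mult_def vec_eq_iff sum_negf)

lemma mpow_uminus: "mpow (- X) m = 0 \<longleftrightarrow> mpow X m = 0"
proof -
  have "mpow (- X) m = mpow X m \<or> mpow (- X) m = - mpow X m"
    by (induction m) (auto simp: mpow_Suc matrix_mul_uminus)
  then show ?thesis by auto
qed

lemma lin_mult: "lin ((*v) M)"
  by (rule matrix_vector_mul_linear_gen)

lemma nilp_iff_mpow: "nilp ((*v) M) \<longleftrightarrow> (\<exists>K. mpow M K = 0)"
  for M :: "complex^'n^'n"
  unfolding nilp_def funpow_mpow by (metis matrix_eq matrix_vector_mult_0)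

lemma nilp_transpose: "nilp ((*v) (transpose M)) \<longleftrightarrow> nilp ((*v) M)"
  for M :: "complex^'n^'n"
  unfolding nilp_iff_mpow by (metis transpose_mpow transpose_transpose transpose_0)

lemma nilp_uminus: "nilp ((*v) (- M)) \<longleftrightarrow> nilp ((*v) M)"
  for M :: "complex^'n^'n"
  unfolding nilp_iff_mpow mpow_uminus ..

text \<open>A single Jordan block of full size with eigenvalue zero.\<close>

definition regular_nilp :: "complex^'n::finite^'n \<Rightarrow> bool" where
  "regular_nilp M \<longleftrightarrow> nilp ((*v) M) \<and> mpow M (CARD('n) - 1) \<noteq> 0"

lemma matrix_eq_axis: "(\<And>j. A *v axis j 1 = B *v axis j 1) \<Longrightarrow> A = B"
  for A B :: "complex^'n^'m"
  by (simp add: vec_eq_iff mult_axis)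

text \<open>The raising operator on binary forms in the monomial basis, sending
  \<open>x^(k-m) y^m\<close> to \<open>m x^(k-m+1) y^(m-1)\<close>. These weights, instead of
  entries \<open>1\<close>, make it the differential of \<open>rho\<close> in the upper triangular
  direction.\<close>

definition jmat :: "('n \<Rightarrow> nat) \<Rightarrow> complex^'n::finite^'n" where
  "jmat \<iota> = (\<chi> i j. if \<iota> j = Suc (\<iota> i) then of_nat (\<iota> j) else 0)"

lemma bij_index:
  assumes "bij_betw \<iota> (UNIV :: 'n::finite set) {..k}"
  shows "CARD('n) = Suc k" "\<And>i j. \<iota> i = \<iota> j \<longleftrightarrow> i = j" "\<And>i. \<iota> i \<le> k" "\<And>m. m \<le> k \<Longrightarrow> \<exists>i. \<iota> i = m"
proof -
  show "CARD('n) = Suc k" using bij_betw_same_card[OF assms] by simp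
  show "\<iota> i = \<iota> j \<longleftrightarrow> i = j" for i j using assms by (auto simp: bij_betw_def inj_on_def)
  show "\<iota> i \<le> k" for i using assms by (auto simp: bij_betw_def)
  show "m \<le> k \<Longrightarrow> \<exists>i. \<iota> i = m" for m
    using assms by (auto simp: bij_betw_def image_iff set_eq_iff) metis
qed

lemma regular_normal_form:
  fixes M :: "complex^'n::finite^'n"
  assumes bij: "bij_betw \<iota> (UNIV :: 'n set) {..k}" and reg: "regular_nilp M"
  shows "\<exists>Q. invertible Q \<and> M ** Q = Q ** jmat \<iota>"
proof -
  note idx = bij_index[OF bij]
  let ?M = "(*v) M"
  have "mpow M k \<noteq> 0" using reg idx(1) by (simp add: regular_nilp_def)
  then obtain v where v: "(?M ^^ k) v \<noteq> 0" unfolding funpow_mpow by (metis matrix_eq matrix_vector_mult_0)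
  have v0: "(?M ^^ Suc k) v = 0"
    using nilp_CARD[OF lin_mult, of M v] reg idx(1) by (simp add: regular_nilp_def)
  \<comment> \<open>The factorials turn the chain of powers into the weights of \<open>jmat\<close>:
    \<open>M\<close> maps the vector of index \<open>m + 1\<close> to \<open>m + 1\<close> times the
    vector of index \<open>m\<close>.\<close>
  define f where "f j = (fact (\<iota> j) / fact k) *s (?M ^^ (k - \<iota> j)) v" for j
  define Q where "Q = (\<chi> i j. f j $ i)"
  have Qa: "Q *v axis j 1 = f j" for j
    by (simp add: vec_eq_iff mult_axis) (simp add: Q_def)
  have "(\<lambda>i. (?M ^^ i) v) ` {..k} \<subseteq> vec.span (columns Q)"
  proof
    fix w assume "w \<in> (\<lambda>i. (?M ^^ i) v) ` {..k}"
    then obtain i where i: "i \<le> k" "w = (?M ^^ i) v" by blast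
    obtain j where j: "\<iota> j = k - i" using idx(4)[of "k - i"] by auto
    have "w = (fact k / fact (\<iota> j)) *s f j" using i j by (simp add: f_def)
    moreover have "f j \<in> columns Q"
    proof -
      have "f j = column j Q" by (simp add: column_def Q_def vec_lambda_eta)
      then show ?thesis unfolding columns_def by blast
    qed
    ultimately show "w \<in> vec.span (columns Q)" by (simp add: vec.span_base vec.span_scale)
  qed
  moreover have "UNIV \<subseteq> vec.span ((\<lambda>i. (?M ^^ i) v) ` {..k})"
    using chain_independent[OF lin_mult v v0] idx(1)
    by (intro vec.card_ge_dim_independent) (auto simp: vec_dim_card simp del: vec.dim_UNIV)
  ultimately have "vec.span (columns Q) = UNIV"
    by (meson subset_antisym top_greatest vec.span_minimal vec.subspace_span subset_trans)
  then have inv: "invertible Q"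
    unfolding invertible_right_inverse matrix_right_invertible_span_columns .
  have "M ** Q = Q ** jmat \<iota>"
  proof (rule matrix_eq_axis)
    fix j
    have *: "(Q ** jmat \<iota>) *v axis j 1 = (\<Sum>i\<in>UNIV. jmat \<iota> $ i $ j *s f i)"
    proof -
      show ?thesis
        by (simp add: vec_eq_iff mult_axis) (simp add: matrix_matrix_mult_def Q_def mult.commute)
    qed
    have **: "(M ** Q) *v axis j 1 = M *v f j" by (simp add: Qa flip: matrix_vector_mul_assoc)
    show "(M ** Q) *v axis j 1 = (Q ** jmat \<iota>) *v axis j 1"
    proof (cases "\<iota> j")
      case 0
      have "M *v f j = (fact (\<iota> j) / fact k) *s (?M ^^ Suc k) v"
        using 0 by (simp add: f_def vec.scale)
      then have "M *v f j = 0" by (simp only: v0 vec.scale_zero_right)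
      moreover have "jmat \<iota> $ i $ j *s f i = 0" for i using 0 by (simp add: jmat_def)
      ultimately show ?thesis unfolding * ** by (simp only: sum.neutral_const)
    next
      case (Suc m)
      then obtain i0 where i0: "\<iota> i0 = m" using idx(4)[of m] idx(3)[of j] by auto
      have "(\<Sum>i\<in>UNIV. jmat \<iota> $ i $ j *s f i) = (\<Sum>i\<in>UNIV. if i = i0 then of_nat (Suc m) *s f i0 else 0)"
        using Suc i0 idx(2) by (intro sum.cong) (auto simp: jmat_def)
      also have "\<dots> = of_nat (Suc m) *s f i0" by simp
      also have "\<dots> = M *v f j"
      proof -
        have "k - m = Suc (k - Suc m)" using idx(3)[of j] Suc by simp
        then have "(?M ^^ (k - m)) v = M *v ((?M ^^ (k - Suc m)) v)" by simp
        then show ?thesis unfolding f_def i0 Suc by (simp add: vec.scale field_simps)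
      qed
      finally show ?thesis unfolding * ** by simp
    qed
  qed
  with inv show ?thesis by blast
qed

text \<open>In the coordinates of the normal form, a kernel vector has no coordinate other than the
  one of index \<open>0\<close>.\<close>

lemma regular_kernel_line:
  assumes "regular_nilp M" "M *v x = 0" "M *v y = 0"
  shows "\<exists>a b. (a \<noteq> 0 \<or> b \<noteq> 0) \<and> a *s x + b *s y = 0"
proof -
  obtain \<iota> :: "'a \<Rightarrow> nat" where "bij_betw \<iota> UNIV {0..<CARD('a)}"
    using ex_bij_betw_finite_nat[of "UNIV :: 'a set"] by auto
  moreover have "{0..<CARD('a)} = {..CARD('a) - 1}"
    using zero_less_card_finite[where 'a='a] by (auto simp: Suc_le_eq[symmetric] le_diff_conv2 simp del: zero_less_card_finite)
  ultimately have bij: "bij_betw \<iota> UNIV {..CARD('a) - 1}" by simp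
  note idx = bij_index[OF bij]
  obtain Q where Q: "invertible Q" "M ** Q = Q ** jmat \<iota>" using regular_normal_form[OF bij assms(1)] by blast
  obtain R where R: "Q ** R = mat 1" "R ** Q = mat 1" using Q(1) by (rule invertibleE)
  obtain i0 where i0: "\<iota> i0 = 0" using idx(4)[of 0] by auto
  have ker: "(R *v u) $ j = 0" if u: "M *v u = 0" and j: "j \<noteq> i0" for u j
  proof -
    have "M *v (Q *v (R *v u)) = 0" using R u by simp
    then have "Q *v (jmat \<iota> *v (R *v u)) = 0"
      by (metis Q(2) matrix_vector_mul_assoc)
    then have "R *v (Q *v (jmat \<iota> *v (R *v u))) = 0" by simp
    then have 0: "jmat \<iota> *v (R *v u) = 0" using R by simp
    have "\<iota> j \<noteq> 0" using j i0 idx(2) by metis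
    then obtain m where m: "\<iota> j = Suc m" by (cases "\<iota> j") auto
    then obtain i where i: "\<iota> i = m" using idx(4)[of m] idx(3)[of j] by auto
    have "jmat \<iota> $ i $ l * (R *v u) $ l = (if l = j then of_nat (Suc m) * (R *v u) $ l else 0)" for l
      using i m idx(2)[of l j] by (auto simp: jmat_def)
    then have "(jmat \<iota> *v (R *v u)) $ i = of_nat (Suc m) * (R *v u) $ j"
      unfolding matrix_vector_mult_def[of "jmat \<iota>"] by simp
    then show ?thesis using 0 of_nat_neq_0[of m, where 'a = complex] by (simp del: of_nat_Suc)
  qed
  define a b where "a = (R *v y) $ i0" and "b = - (R *v x) $ i0"
  have comb: "c *s x + d *s y = 0" if "c * (R *v x) $ i0 + d * (R *v y) $ i0 = 0" for c d
  proof -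
    have "R *v (c *s x + d *s y) = 0"
      using that ker[OF assms(2)] ker[OF assms(3)]
      by (simp add: vec.add vec.scale vec_eq_iff) (metis add_cancel_right_right mult_zero_right)
    then have "Q *v (R *v (c *s x + d *s y)) = 0" by simp
    then show ?thesis using R by simp
  qed
  show ?thesis
  proof (cases "a = 0 \<and> b = 0")
    case True
    then have "1 *s x + 0 *s y = 0" by (intro comb) (simp add: b_def)
    then show ?thesis by (metis zero_neq_one)
  next
    case False
    have "a *s x + b *s y = 0" by (rule comb) (simp add: a_def b_def mult.commute)
    then show ?thesis using False by blast
  qed
qed

section \<open>The infinitesimal stabilizer\<close>

text \<open>The differential of \<open>tensor_act\<close> at the identity. The triples with value
  zero form the Lie algebra of the exact stabilizer of \<open>A\<close> in the product of the
  general linear groups; scalar triples of sum zero always belong to it.\<close>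

fun lie_act :: "('n0::finite, 'n1::finite, 'n2::finite) triple \<Rightarrow> ('n0, 'n1, 'n2) tensor \<Rightarrow> ('n0, 'n1, 'n2) tensor" where
  "lie_act (X0, X1, X2) A = mode0 X0 A + mode1 X1 A + mode2 X2 A"

lemma contr_lie_act:
  "contr (lie_act (X0, X1, X2) A) y z =
    X0 *v contr A y z + contr A (transpose X1 *v y) z + contr A y (transpose X2 *v z)"
  by (simp add: contr_add contr_mode0 contr_mode1 contr_mode2)

text \<open>Coordinates adapted to a subspace translate dimensions into sizes of blocks.\<close>

lemma subspace_basis_matrix:
  fixes S :: "(complex^'n::finite) set"
  assumes S: "vec.subspace S"
  shows "\<exists>(Q::complex^'n^'n) (R::complex^'n^'n) J. Q ** R = mat 1 \<and> R ** Q = mat 1 \<and> card J = vec.dim S \<and> (\<forall>j\<in>J. Q *v axis j 1 \<in> S) \<and>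
    (\<forall>r\<in>S. \<forall>i. i \<notin> J \<longrightarrow> (R *v r) $ i = 0)"
proof -
  obtain B where B: "B \<subseteq> S" "vec.independent B" "S \<subseteq> vec.span B" "card B = vec.dim S"
    using vec.basis_exists[of S] by blast
  obtain C where C0: "B \<subseteq> C" "C \<subseteq> UNIV" "vec.independent C" "UNIV \<subseteq> vec.span C"
    by (rule vec.maximal_independent_subset_extend[OF subset_UNIV B(2)])
  note C = C0(1,3,4)
  have finC: "finite C" using C vec.finiteI_independent by blast
  have "card C = CARD('n)"
    using vec.basis_card_eq_dim[OF _ C(3,2)] vec_dim_card by (metis top_greatest)
  then obtain f :: "'n \<Rightarrow> complex^'n" where f: "bij_betw f UNIV C"
    using finC by (metis bij_betw_iff_card finite_class.finite_UNIV)
  define Q where "Q = (\<chi> i j. f j $ i)"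
  have Qa: "Q *v axis j 1 = f j" for j
    by (simp add: vec_eq_iff mult_axis) (simp add: Q_def)
  have "columns Q = C"
  proof -
    have "column j Q = f j" for j by (simp add: column_def Q_def vec_lambda_eta)
    then show ?thesis using f by (auto simp: columns_def bij_betw_def)
  qed
  then have "invertible Q"
    using C(3) unfolding invertible_right_inverse matrix_right_invertible_span_columns by auto
  then obtain R where R: "Q ** R = mat 1" "R ** Q = mat 1" by (rule invertibleE)
  define J where "J = f -` B"
  have "card J = card B"
    using f C(1) unfolding J_def bij_betw_def by (intro card_vimage_inj) auto
  moreover have "Q *v axis j 1 \<in> S" if "j \<in> J" for j using that B(1) by (auto simp: Qa J_def)
  moreover have "(R *v r) $ i = 0" if "r \<in> S" "i \<notin> J" for r i
  proof -
    have "r \<in> vec.span B" using that B by blast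
    then show ?thesis
    proof (induction rule: vec.span_induct_alt)
      case (step c x y)
      obtain j where j: "x = f j" using step f C(1) by (auto simp: bij_betw_def)
      have "R *v x = axis j 1" using R by (simp add: j flip: Qa)
      moreover have "j \<noteq> i" using step j that by (auto simp: J_def)
      ultimately show ?case using step by (simp add: vec.add vec.scale axis_def)
    qed simp
  qed
  ultimately show ?thesis using R B(4) by (intro exI[of _ Q] exI[of _ R] exI[of _ J]) auto
qed

text \<open>In bases adapted to \<open>S\<close>, \<open>T\<close> and \<open>R\<close>, the
  hypothesis on values says that the block of rows outside the index set of \<open>R\<close> is
  zero. The complement turns \<open>card I\<close> into \<open>CARD('n0) - vec.dim R\<close>, which
  explains the \<open>+ 1\<close> in the bound.\<close>

lemma block_bounded_hopf:
  fixes A :: "('n0::finite, 'n1::finite, 'n2::finite) tensor"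
  assumes card: "CARD('n0) + 1 = CARD('n1) + CARD('n2)" and A: "block_bounded A"
  shows "hopf (contr A)"
  unfolding hopf_def
proof (intro conjI allI impI linear_contr1 linear_contr2, elim conjE)
  fix S :: "(complex^'n1) set" and T :: "(complex^'n2) set" and R :: "(complex^'n0) set"
  assume sub: "vec.subspace S" "vec.subspace T" "vec.subspace R" and pos: "vec.dim S > 0" "vec.dim T > 0"
    and STR: "\<forall>y\<in>S. \<forall>z\<in>T. contr A y z \<in> R"
  obtain Q0 R0 :: "complex^'n0^'n0" and I where 0: "Q0 ** R0 = mat 1" "R0 ** Q0 = mat 1" "card I = vec.dim R"
    "\<forall>r\<in>R. \<forall>i. i \<notin> I \<longrightarrow> (R0 *v r) $ i = 0" using subspace_basis_matrix[OF sub(3)] by metis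
  obtain Q1 R1 :: "complex^'n1^'n1" and J where 1: "Q1 ** R1 = mat 1" "R1 ** Q1 = mat 1" "card J = vec.dim S"
    "\<forall>j\<in>J. Q1 *v axis j 1 \<in> S" using subspace_basis_matrix[OF sub(1)] by metis
  obtain Q2 R2 :: "complex^'n2^'n2" and L where 2: "Q2 ** R2 = mat 1" "R2 ** Q2 = mat 1" "card L = vec.dim T"
    "\<forall>j\<in>L. Q2 *v axis j 1 \<in> T" using subspace_basis_matrix[OF sub(2)] by metis
  have inv: "invertible R0" "invertible (transpose Q1)" "invertible (transpose Q2)"
    by (rule invertibleI[OF 0(2,1)], rule invertible_transpose[OF invertibleI[OF 1(1,2)]],
        rule invertible_transpose[OF invertibleI[OF 2(1,2)]])
  have zero: "tensor_act (R0, transpose Q1, transpose Q2) A $ i $ j $ l = 0" if "i \<in> - I" "j \<in> J" "l \<in> L" for i j l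
  proof -
    have "tensor_act (R0, transpose Q1, transpose Q2) A $ i $ j $ l =
      (R0 *v contr A (Q1 *v axis j 1) (Q2 *v axis l 1)) $ i"
      by (simp add: contr_tensor_act flip: contr_axis del: tensor_act.simps)
    then show ?thesis using that 0(4) 1(4) 2(4) STR by auto
  qed
  have ne: "J \<noteq> {}" "L \<noteq> {}" using pos unfolding 1(3)[symmetric] 2(3)[symmetric] by auto
  have "card (- I) + card J + card L \<le> CARD('n1) + CARD('n2)"
    by (rule A[unfolded block_bounded_def, rule_format, of R0 "transpose Q1" "transpose Q2" J L "- I"])
      (intro conjI ballI inv ne zero)
  moreover have "card I \<le> CARD('n0)" by (simp add: card_mono)
  moreover have "card (- I) = CARD('n0) - card I"
    using card_Diff_subset[of I UNIV] by (simp only: Compl_eq_Diff_UNIV finite top_greatest)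
  ultimately show "vec.dim S + vec.dim T \<le> vec.dim R + 1" using card 0(3) 1(3) 2(3) by linarith
qed

text \<open>The kernel of \<open>f\<close> contains all values of \<open>b\<close>, and the bound
  for the two full spaces makes it at least as large as the whole target.\<close>

lemma hopf_span:
  fixes b :: "complex^'a::finite \<Rightarrow> complex^'b::finite \<Rightarrow> complex^'c::finite"
  assumes b: "hopf b" and card: "CARD('c) + 1 = CARD('a) + CARD('b)"
    and f: "lin f" "\<And>y z. f (b y z) = 0"
  shows "f r = 0"
proof -
  let ?R = "{r. f r = 0}"
  have "vec.subspace ?R" using vec.linear_subspace_kernel[OF f(1)] .
  have "vec.dim (UNIV :: (complex^'a) set) + vec.dim (UNIV :: (complex^'b) set) \<le> vec.dim ?R + 1"
    by (rule hopf_dim[OF b vec.subspace_UNIV vec.subspace_UNIV \<open>vec.subspace ?R\<close>])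
      (use f in \<open>auto simp: vec_dim_card simp del: vec.dim_UNIV\<close>)
  then have "vec.dim (UNIV :: (complex^'c) set) \<le> vec.dim ?R"
    using card by (simp add: vec_dim_card del: vec.dim_UNIV)
  then have "?R = UNIV"
    using vec.subspace_dim_equal[OF \<open>vec.subspace ?R\<close> vec.subspace_UNIV] by simp
  then show ?thesis by blast
qed

lemma transpose_nonzero_vector:
  fixes M :: "complex^'n^'n"
  assumes "M \<noteq> 0"
  shows "\<exists>v. transpose M *v v \<noteq> 0"
proof (rule ccontr)
  assume "\<not> ?thesis"
  then have "transpose M = 0" by (simp add: matrix_eq)
  then have "transpose (transpose M) = 0" by (simp only: transpose_0)
  with assms show False by (simp add: transpose_transpose)
qed

text \<open>The negated transposes of \<open>X1\<close> and \<open>X2\<close> act on the dual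
  spaces, and \<open>X0\<close> is then a derivation over the bilinear map \<open>contr A\<close>.
  Nilpotency of \<open>X0\<close> is a consequence, since values of \<open>contr A\<close> span. If
  \<open>X1\<close> and \<open>X2\<close> both vanished, spanning would force \<open>X0 = 0\<close>
  too.\<close>

lemma lie_act_regular:
  fixes A :: "('n0::finite, 'n1::finite, 'n2::finite) tensor"
  assumes card: "CARD('n0) + 1 = CARD('n1) + CARD('n2)" "CARD('n1) \<ge> 2" "CARD('n2) \<ge> 2"
    and A: "block_bounded A" and X: "lie_act (X0, X1, X2) A = 0"
    and nilp: "nilp ((*v) X1)" "nilp ((*v) X2)" and nz: "X0 \<noteq> 0 \<or> X1 \<noteq> 0 \<or> X2 \<noteq> 0"
  shows "regular_nilp X0 \<and> regular_nilp X1 \<and> regular_nilp X2"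
proof -
  let ?b = "contr A" and ?X = "(*v) (- transpose X1)" and ?Y = "(*v) (- transpose X2)" and ?Z = "(*v) X0"
  note b = block_bounded_hopf[OF card(1) A]
  define p where "p = CARD('n1) - 1"
  define q where "q = CARD('n2) - 1"
  have pq: "CARD('n1) = p + 1" "CARD('n2) = q + 1" "CARD('n0) = p + q + 1" "p \<ge> 1" "q \<ge> 1"
    using card unfolding p_def q_def by linarith+
  have umin: "(- M) *v v = - (M *v v)" for M :: "complex^'m^'m" and v
    by (simp add: vec_eq_iff matrix_vector_mult_def sum_negf)
  have neg: "contr A (- y) z = - contr A y z" "contr A y (- z) = - contr A y z" for y z
    by (rule vec.linear_neg[OF linear_contr1], rule vec.linear_neg[OF linear_contr2])
  have der: "?Z (?b y z) = ?b (?X y) z + ?b y (?Y z)" for y z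
  proof -
    have "X0 *v ?b y z + (?b (transpose X1 *v y) z + ?b y (transpose X2 *v z)) = 0"
      using contr_lie_act[of X0 X1 X2 A y z] unfolding X contr_0 by (simp only: add.assoc)
    then show ?thesis unfolding umin neg by (simp only: eq_neg_iff_add_eq_0 flip: minus_add_distrib)
  qed
  have nil: "nilp ?X" "nilp ?Y" using nilp by (simp_all only: nilp_uminus nilp_transpose)
  have "X1 \<noteq> 0 \<or> X2 \<noteq> 0"
  proof (rule ccontr)
    assume "\<not> ?thesis"
    then have "X1 = 0" "X2 = 0" by simp_all
    then have "X0 *v r = 0" for r
      using hopf_span[OF b card(1), of "(*v) X0" r] lin_mult der by (simp add: transpose_0)
    then have "X0 = 0" by (metis matrix_eq matrix_vector_mult_0)
    with nz \<open>X1 = 0\<close> \<open>X2 = 0\<close> show False by simp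
  qed
  then have nzv: "(\<exists>y\<in>UNIV. ?X y \<noteq> 0) \<or> (\<exists>z\<in>UNIV. ?Y z \<noteq> 0)"
    using transpose_nonzero_vector[of X1] transpose_nonzero_vector[of X2] by (auto simp: umin)
  have "(\<exists>y\<in>UNIV. (?X ^^ p) y \<noteq> 0) \<and> (\<exists>z\<in>UNIV. (?Y ^^ q) z \<noteq> 0)"
    by (rule nilp_derivation_regular[OF b lin_mult lin_mult lin_mult nil der vec.subspace_UNIV vec.subspace_UNIV
        vec.subspace_UNIV UNIV_I, unfolded vec_dim_card, OF pq UNIV_I UNIV_I nzv])
  then obtain y z where yz: "(?X ^^ p) y \<noteq> 0" "(?Y ^^ q) z \<noteq> 0" by blast
  have top: "(?X ^^ Suc p) v = 0" "(?Y ^^ Suc q) w = 0" for v w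
    using nilp_CARD[OF lin_mult nil(1)] nilp_CARD[OF lin_mult nil(2)] pq by simp_all
  \<comment> \<open>The top Leibniz term is a nonzero binomial coefficient times a value of the map
    at two nonzero vectors, hence nonzero by \<open>hopf_nonzero\<close>.\<close>
  have "(?Z ^^ (p + q)) (?b y z) = of_nat (p + q choose p) *s ?b ((?X ^^ p) y) ((?Y ^^ q) z)"
    by (rule derivation_top_power[OF b lin_mult lin_mult lin_mult der top])
  moreover have "?b ((?X ^^ p) y) ((?Y ^^ q) z) \<noteq> 0" using hopf_nonzero[OF b] yz by blast
  moreover have "of_nat (p + q choose p) \<noteq> (0::complex)" by simp
  ultimately have "(?Z ^^ (p + q)) (?b y z) \<noteq> 0" by (simp only: vec.scale_eq_0_iff simp_thms)
  then have "mpow X0 (p + q) \<noteq> 0" unfolding funpow_mpow by auto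
  moreover have "nilp ?Z"
  proof -
    \<comment> \<open>In degree \<open>p + q + 1\<close> every Leibniz term has exponent above
      \<open>p\<close> in \<open>?X\<close> or above \<open>q\<close> in \<open>?Y\<close>.\<close>
    have "(?Z ^^ (p + q + 1)) (?b y z) = 0" for y z
      unfolding derivation_power[where b = ?b and Z = ?Z, OF b lin_mult der]
    proof (rule sum.neutral, intro ballI)
      fix i assume i: "i \<in> {..p + q + 1}"
      consider "Suc p \<le> i" | "Suc q \<le> p + q + 1 - i" using i by fastforce
      then show "of_nat (p + q + 1 choose i) *s contr A ((?X ^^ i) y) ((?Y ^^ (p + q + 1 - i)) z) = 0"
      proof cases
        case 1
        then show ?thesis using funpow_eq_0_mono[OF lin_mult top(1)] by simp
      next
        case 2
        then show ?thesis using funpow_eq_0_mono[OF lin_mult top(2)] by simp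
      qed
    qed
    then have "(?Z ^^ (p + q + 1)) r = 0" for r
      by (rule hopf_span[OF b card(1) lin_funpow[OF lin_mult]])
    then show ?thesis unfolding nilp_def by blast
  qed
  moreover have "mpow (- transpose X1) p \<noteq> 0" "mpow (- transpose X2) q \<noteq> 0"
    using yz unfolding funpow_mpow by auto
  then have "mpow X1 p \<noteq> 0" "mpow X2 q \<noteq> 0"
    unfolding mpow_uminus transpose_mpow[symmetric] by (auto simp: transpose_0)
  ultimately show ?thesis using nilp pq by (simp add: regular_nilp_def)
qed

section \<open>Weights of nondegenerate tensors\<close>

lemma sorting_index:
  fixes w :: "'n::finite \<Rightarrow> real"
  assumes "CARD('n) = Suc k"
  shows "\<exists>\<iota>. bij_betw \<iota> (UNIV :: 'n set) {..k} \<and> (\<forall>i j. \<iota> i \<le> \<iota> j \<longrightarrow> w i \<le> w j)"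
proof -
  obtain xs where xs: "set xs = (UNIV::'n set)" "distinct xs"
    using finite_distinct_list[of "UNIV::'n set"] by auto
  define ys where "ys = sort_key w xs"
  have ys: "set ys = UNIV" "distinct ys" "sorted (map w ys)" using xs by (simp_all add: ys_def)
  have len: "length ys = Suc k" using ys distinct_card[OF ys(2)] assms by simp
  have bij: "bij_betw (nth ys) {..<length ys} UNIV" using ys by (simp add: bij_betw_nth)
  define \<iota> where "\<iota> = inv_into {..<length ys} (nth ys)"
  have bij': "bij_betw \<iota> UNIV {..<length ys}" unfolding \<iota>_def by (rule bij_betw_inv_into[OF bij])
  have "{..<length ys} = {..k}" by (simp add: len lessThan_Suc_atMost)
  moreover have "w i \<le> w j" if "\<iota> i \<le> \<iota> j" for i j
  proof -
    have "ys ! \<iota> i = i" "ys ! \<iota> j = j"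
      unfolding \<iota>_def using bij_betw_inv_into_right[OF bij UNIV_I] by auto
    moreover have "\<iota> j < length ys" using bij' by (auto simp: bij_betw_def)
    ultimately show ?thesis using sorted_nth_mono[OF ys(3) that] that by simp
  qed
  ultimately show ?thesis using bij' by (intro exI[of _ \<iota>]) simp
qed

text \<open>The orderings of the three index types are parameters because they are chosen only
  later, by sorting eigenvalues, and differ from one tensor to another.\<close>

locale boundary_index =
  fixes \<iota>0 :: "'n0::finite \<Rightarrow> nat" and \<iota>1 :: "'n1::finite \<Rightarrow> nat" and \<iota>2 :: "'n2::finite \<Rightarrow> nat"
    and k0 k1 k2 :: nat
  assumes bij0: "bij_betw \<iota>0 (UNIV :: 'n0 set) {..k0}"
    and bij1: "bij_betw \<iota>1 (UNIV :: 'n1 set) {..k1}"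
    and bij2: "bij_betw \<iota>2 (UNIV :: 'n2 set) {..k2}"
    and k012: "k0 = k1 + k2" "k1 \<ge> 1" "k2 \<ge> 1"

lemma card_index_atMost:
  assumes "bij_betw \<iota> (UNIV :: 'n::finite set) {..k}" "m \<le> k"
  shows "card {i. \<iota> i \<le> m} = Suc m"
proof -
  have "card (\<iota> -` {..m}) = card {..m}"
    using assms by (intro card_vimage_inj) (auto simp: bij_betw_def)
  then show ?thesis by (simp add: vimage_def)
qed

definition coord_bounded :: "('n0::finite, 'n1::finite, 'n2::finite) tensor \<Rightarrow> bool" where
  "coord_bounded A \<longleftrightarrow> (\<forall>I J L. J \<noteq> {} \<longrightarrow> L \<noteq> {} \<longrightarrow> (\<forall>i\<in>I. \<forall>j\<in>J. \<forall>l\<in>L. A $ i $ j $ l = 0) \<longrightarrow>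
     card I + card J + card L \<le> CARD('n1) + CARD('n2))"

lemma block_bounded_coord:
  fixes A :: "('n0::finite, 'n1::finite, 'n2::finite) tensor"
  assumes "block_bounded A" "invertible P0" "invertible P1" "invertible P2"
  shows "coord_bounded (tensor_act (P0, P1, P2) A)"
  unfolding coord_bounded_def
proof (intro allI impI)
  fix I :: "'n0 set" and J :: "'n1 set" and L :: "'n2 set"
  assume "J \<noteq> {}" "L \<noteq> {}" "\<forall>i\<in>I. \<forall>j\<in>J. \<forall>l\<in>L. tensor_act (P0, P1, P2) A $ i $ j $ l = 0"
  then show "card I + card J + card L \<le> CARD('n1) + CARD('n2)"
    by (intro assms(1)[unfolded block_bounded_def, rule_format, of P0 P1 P2 J L I] conjI assms(2-))
qed

context boundary_index
begin

text \<open>The box below the given position has side lengths of sum \<open>k0 + 3\<close>, one more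
  than a zero block may have.\<close>

lemma corner_nonzero:
  fixes A :: "('n0, 'n1, 'n2) tensor"
  assumes A: "coord_bounded A" and s: "\<iota>0 i + \<iota>1 j + \<iota>2 l = k0"
  obtains i' j' l' where "\<iota>0 i' \<le> \<iota>0 i" "\<iota>1 j' \<le> \<iota>1 j" "\<iota>2 l' \<le> \<iota>2 l" "A $ i' $ j' $ l' \<noteq> 0"
proof -
  define I J L where "I = {i'. \<iota>0 i' \<le> \<iota>0 i}" and "J = {j'. \<iota>1 j' \<le> \<iota>1 j}" and "L = {l'. \<iota>2 l' \<le> \<iota>2 l}"
  have "card I + card J + card L = k0 + 3"
    using card_index_atMost[OF bij0, of "\<iota>0 i"] card_index_atMost[OF bij1, of "\<iota>1 j"]
      card_index_atMost[OF bij2, of "\<iota>2 l"] bij_index(3)[OF bij0, of i] bij_index(3)[OF bij1, of j]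
      bij_index(3)[OF bij2, of l] s by (simp add: I_def J_def L_def)
  moreover have "CARD('n1) + CARD('n2) = k0 + 2"
    using bij_index(1)[OF bij1] bij_index(1)[OF bij2] k012 by simp
  ultimately have large: "\<not> card I + card J + card L \<le> CARD('n1) + CARD('n2)" by simp
  have ne: "J \<noteq> {}" "L \<noteq> {}" by (auto simp: J_def L_def)
  have "\<not> (\<forall>i\<in>I. \<forall>j\<in>J. \<forall>l\<in>L. A $ i $ j $ l = 0)"
  proof
    assume "\<forall>i\<in>I. \<forall>j\<in>J. \<forall>l\<in>L. A $ i $ j $ l = 0"
    then have "card I + card J + card L \<le> CARD('n1) + CARD('n2)"
      by (intro A[unfolded coord_bounded_def, rule_format, of J L I] ne) auto
    with large show False ..
  qed
  then obtain i' j' l' where "i' \<in> I" "j' \<in> J" "l' \<in> L" "A $ i' $ j' $ l' \<noteq> 0" by auto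
  then show ?thesis by (intro that[of i' j' l']) (simp_all add: I_def J_def L_def)
qed

lemma weights_ge:
  fixes A :: "('n0, 'n1, 'n2) tensor" and w0 w1 w2 :: "_ \<Rightarrow> real"
  assumes A: "coord_bounded A"
    and w: "\<And>i j l. A $ i $ j $ l \<noteq> 0 \<Longrightarrow> w0 i + w1 j + w2 l \<ge> c"
    and mono: "\<And>i i'. \<iota>0 i \<le> \<iota>0 i' \<Longrightarrow> w0 i \<le> w0 i'" "\<And>i i'. \<iota>1 i \<le> \<iota>1 i' \<Longrightarrow> w1 i \<le> w1 i'"
      "\<And>i i'. \<iota>2 i \<le> \<iota>2 i' \<Longrightarrow> w2 i \<le> w2 i'"
    and s: "\<iota>0 i + \<iota>1 j + \<iota>2 l = k0"
  shows "w0 i + w1 j + w2 l \<ge> c"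
proof -
  obtain i' j' l' where *: "\<iota>0 i' \<le> \<iota>0 i" "\<iota>1 j' \<le> \<iota>1 j" "\<iota>2 l' \<le> \<iota>2 l" "A $ i' $ j' $ l' \<noteq> 0"
    using corner_nonzero[OF A s] .
  show ?thesis using w[OF *(4)] mono(1)[OF *(1)] mono(2)[OF *(2)] mono(3)[OF *(3)] by linarith
qed

lemma reverse_bij:
  fixes \<iota> :: "'n::finite \<Rightarrow> nat"
  assumes "bij_betw \<iota> (UNIV :: 'n::finite set) {..k}"
  shows "bij_betw (\<lambda>i. k - \<iota> i) UNIV {..k}"
proof -
  have "bij_betw (\<lambda>m. k - m) {..k} {..k}" by (rule bij_betwI[of _ _ _ "\<lambda>m. k - m"]) auto
  from bij_betw_trans[OF assms this] show ?thesis by (simp add: o_def)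
qed

lemma reversed: "boundary_index (\<lambda>i. k0 - \<iota>0 i) (\<lambda>j. k1 - \<iota>1 j) (\<lambda>l. k2 - \<iota>2 l) k0 k1 k2"
  using reverse_bij[OF bij0] reverse_bij[OF bij1] reverse_bij[OF bij2] k012 by unfold_locales

lemma reversed_sum:
  "(k0 - \<iota>0 i) + (k1 - \<iota>1 j) + (k2 - \<iota>2 l) = k0 \<longleftrightarrow> \<iota>0 i + \<iota>1 j + \<iota>2 l = k0"
  using bij_index(3)[OF bij0, of i] bij_index(3)[OF bij1, of j] bij_index(3)[OF bij2, of l] k012 by linarith

text \<open>The maxima of the three orderings sum to \<open>2 * k0\<close>, so reversing all of them
  preserves the plane of index sum \<open>k0\<close>. Negated weights are monotone for the reversed
  orders, and \<open>weights_ge\<close> then supplies the upper bound.\<close>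

lemma weights_eq:
  fixes A :: "('n0, 'n1, 'n2) tensor" and w0 w1 w2 :: "_ \<Rightarrow> real"
  assumes A: "coord_bounded A"
    and w: "\<And>i j l. A $ i $ j $ l \<noteq> 0 \<Longrightarrow> w0 i + w1 j + w2 l = c"
    and mono: "\<And>i i'. \<iota>0 i \<le> \<iota>0 i' \<Longrightarrow> w0 i \<le> w0 i'" "\<And>i i'. \<iota>1 i \<le> \<iota>1 i' \<Longrightarrow> w1 i \<le> w1 i'"
      "\<And>i i'. \<iota>2 i \<le> \<iota>2 i' \<Longrightarrow> w2 i \<le> w2 i'"
    and s: "\<iota>0 i + \<iota>1 j + \<iota>2 l = k0"
  shows "w0 i + w1 j + w2 l = c"
proof (rule antisym)
  interpret r: boundary_index "\<lambda>i. k0 - \<iota>0 i" "\<lambda>j. k1 - \<iota>1 j" "\<lambda>l. k2 - \<iota>2 l" k0 k1 k2 by (rule reversed)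
  have le: "a \<le> b" if "k - b \<le> k - a" "b \<le> k" "a \<le> k" for a b k :: nat using that by linarith
  have "(- w0 i) + (- w1 j) + (- w2 l) \<ge> - c"
  proof (rule r.weights_ge[OF A])
    show "(- w0 i) + (- w1 j) + (- w2 l) \<ge> - c" if "A $ i $ j $ l \<noteq> 0" for i j l using w[OF that] by simp
    show "- w0 i \<le> - w0 i'" if "k0 - \<iota>0 i \<le> k0 - \<iota>0 i'" for i i'
      using mono(1)[OF le[OF that]] bij_index(3)[OF bij0] by simp
    show "- w1 i \<le> - w1 i'" if "k1 - \<iota>1 i \<le> k1 - \<iota>1 i'" for i i'
      using mono(2)[OF le[OF that]] bij_index(3)[OF bij1] by simp
    show "- w2 i \<le> - w2 i'" if "k2 - \<iota>2 i \<le> k2 - \<iota>2 i'" for i i'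
      using mono(3)[OF le[OF that]] bij_index(3)[OF bij2] by simp
  qed (simp only: reversed_sum s)
  then show "w0 i + w1 j + w2 l \<le> c" by simp
  show "w0 i + w1 j + w2 l \<ge> c"
    by (rule weights_ge[OF A _ mono s]) (use w in auto)
qed

text \<open>With the first index fixed, one step of the second can be traded for one step of the
  third. So every step of \<open>w1\<close> equals every step of \<open>w2\<close>, and
  \<open>w0\<close> is determined by the constant sum. The field is general because real eigenvalue
  parts, complex logarithms and complex matrix entries all occur as weights.\<close>

lemma weights_arith:
  fixes w0 w1 w2 :: "_ \<Rightarrow> 'a::field_char_0"
  assumes eq: "\<And>i j l. \<iota>0 i + \<iota>1 j + \<iota>2 l = k0 \<Longrightarrow> w0 i + w1 j + w2 l = c"
  shows "\<exists>\<delta> a b g. (\<forall>i. w0 i = a + of_nat (\<iota>0 i) * \<delta>) \<and> (\<forall>j. w1 j = b + of_nat (\<iota>1 j) * \<delta>) \<and>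
    (\<forall>l. w2 l = g + of_nat (\<iota>2 l) * \<delta>) \<and> a + b + g + of_nat k0 * \<delta> = c"
proof -
  obtain e0 where e0: "\<And>m. m \<le> k0 \<Longrightarrow> \<iota>0 (e0 m) = m" using bij_index(4)[OF bij0] by metis
  obtain e1 where e1: "\<And>m. m \<le> k1 \<Longrightarrow> \<iota>1 (e1 m) = m" using bij_index(4)[OF bij1] by metis
  obtain e2 where e2: "\<And>m. m \<le> k2 \<Longrightarrow> \<iota>2 (e2 m) = m" using bij_index(4)[OF bij2] by metis
  have inv1: "e1 (\<iota>1 j) = j" for j using e1[of "\<iota>1 j"] bij_index(2,3)[OF bij1] by simp
  have inv2: "e2 (\<iota>2 j) = j" for j using e2[of "\<iota>2 j"] bij_index(2,3)[OF bij2] by simp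
  define \<delta> where "\<delta> = w1 (e1 1) - w1 (e1 0)"
  have step: "w1 (e1 (Suc p)) - w1 (e1 p) = w2 (e2 (Suc q)) - w2 (e2 q)" if "p < k1" "q < k2" for p q
  proof -
    let ?i = "e0 (k0 - Suc (p + q))"
    have "w0 ?i + w1 (e1 (Suc p)) + w2 (e2 q) = c" "w0 ?i + w1 (e1 p) + w2 (e2 (Suc q)) = c"
      using that k012 by (intro eq; simp add: e0 e1 e2)+
    then have "w1 (e1 (Suc p)) + w2 (e2 q) = w1 (e1 p) + w2 (e2 (Suc q))"
      by (metis add.assoc add_left_cancel)
    then show ?thesis by (simp add: algebra_simps)
  qed
  have d2: "w2 (e2 (Suc q)) - w2 (e2 q) = \<delta>" if "q < k2" for q
    using step[of 0 q] that k012 by (simp add: \<delta>_def)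
  have d1: "w1 (e1 (Suc p)) - w1 (e1 p) = \<delta>" if "p < k1" for p
    using step[of p 0] d2[of 0] that k012 by simp
  have a1: "w1 (e1 p) = w1 (e1 0) + of_nat p * \<delta>" if "p \<le> k1" for p
    using that
  proof (induction p)
    case (Suc p)
    then show ?case using d1[of p] by (simp add: algebra_simps)
  qed simp
  have a2: "w2 (e2 p) = w2 (e2 0) + of_nat p * \<delta>" if "p \<le> k2" for p
    using that
  proof (induction p)
    case (Suc p)
    then show ?case using d2[of p] by (simp add: algebra_simps)
  qed simp
  define a where "a = c - w1 (e1 0) - w2 (e2 0) - of_nat k0 * \<delta>"
  have a0: "w0 i = a + of_nat (\<iota>0 i) * \<delta>" for i
  proof -
    define s where "s = k0 - \<iota>0 i"
    \<comment> \<open>Any split of \<open>k0 - \<iota>0 i\<close> into indices of the other two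
      factors would do; taking as much as possible from the second leaves at most \<open>k2\<close>
      for the third.\<close>
    define p where "p = min s k1"
    define q where "q = s - p"
    have i: "\<iota>0 i \<le> k0" using bij_index(3)[OF bij0] .
    have pq: "p \<le> k1" "q \<le> k2" "p + q = s" "\<iota>0 i + p + q = k0"
      using i k012 by (auto simp: p_def q_def s_def)
    have "w0 i + w1 (e1 p) + w2 (e2 q) = c" using pq by (intro eq) (simp add: e1 e2)
    then have "w0 i = c - w1 (e1 0) - w2 (e2 0) - of_nat (p + q) * \<delta>"
      using a1[OF pq(1)] a2[OF pq(2)] by (simp add: algebra_simps)
    moreover have "of_nat k0 = of_nat (\<iota>0 i) + (of_nat (p + q) :: 'a)" using pq by (metis add.assoc of_nat_add)
    ultimately show ?thesis by (simp add: a_def algebra_simps)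
  qed
  show ?thesis
  proof (intro exI conjI allI)
    show "w0 i = a + of_nat (\<iota>0 i) * \<delta>" for i by (rule a0)
    show "w1 j = w1 (e1 0) + of_nat (\<iota>1 j) * \<delta>" for j
      using a1[of "\<iota>1 j"] bij_index(3)[OF bij1] inv1 by simp
    show "w2 j = w2 (e2 0) + of_nat (\<iota>2 j) * \<delta>" for j
      using a2[of "\<iota>2 j"] bij_index(3)[OF bij2] inv2 by simp
    show "a + w1 (e1 0) + w2 (e2 0) + of_nat k0 * \<delta> = c" by (simp add: a_def)
  qed
qed

definition diag_type :: "('n0, 'n1, 'n2) tensor \<Rightarrow> bool" where
  "diag_type A \<longleftrightarrow> (\<forall>i j l. A $ i $ j $ l \<noteq> 0 \<longleftrightarrow> \<iota>0 i + \<iota>1 j + \<iota>2 l = k0)"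

end

text \<open>Sorting by weight yields arithmetic progressions of common difference
  \<open>\<delta>\<close>. If \<open>\<delta>\<close> is nonzero, the support lies in the plane of
  index sum \<open>k0\<close>. Below a position of this plane no other position of the plane exists,
  so \<open>corner_nonzero\<close> shows that the entry at the position itself is nonzero.\<close>

lemma weights_dichotomy:
  fixes A :: "('n0::finite, 'n1::finite, 'n2::finite) tensor" and w0 w1 w2 :: "_ \<Rightarrow> real"
  assumes card: "CARD('n0) = Suc k0" "CARD('n1) = Suc k1" "CARD('n2) = Suc k2"
    and k: "k0 = k1 + k2" "k1 \<ge> 1" "k2 \<ge> 1"
    and A: "coord_bounded A"
    and w: "\<And>i j l. A $ i $ j $ l \<noteq> 0 \<Longrightarrow> w0 i + w1 j + w2 l = c"
  shows "(\<exists>\<iota>0 \<iota>1 \<iota>2. boundary_index \<iota>0 \<iota>1 \<iota>2 k0 k1 k2 \<and> boundary_index.diag_type \<iota>0 \<iota>1 \<iota>2 k0 A) \<or>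
    (\<forall>i i'. w0 i = w0 i') \<and> (\<forall>i i'. w1 i = w1 i') \<and> (\<forall>i i'. w2 i = w2 i')"
proof -
  obtain \<iota>0 where 0: "bij_betw \<iota>0 (UNIV :: 'n0 set) {..k0}" "\<forall>i j. \<iota>0 i \<le> \<iota>0 j \<longrightarrow> w0 i \<le> w0 j"
    using sorting_index[OF card(1), of w0] by (elim exE conjE)
  obtain \<iota>1 where 1: "bij_betw \<iota>1 (UNIV :: 'n1 set) {..k1}" "\<forall>i j. \<iota>1 i \<le> \<iota>1 j \<longrightarrow> w1 i \<le> w1 j"
    using sorting_index[OF card(2), of w1] by (elim exE conjE)
  obtain \<iota>2 where 2: "bij_betw \<iota>2 (UNIV :: 'n2 set) {..k2}" "\<forall>i j. \<iota>2 i \<le> \<iota>2 j \<longrightarrow> w2 i \<le> w2 j"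
    using sorting_index[OF card(3), of w2] by (elim exE conjE)
  interpret boundary_index \<iota>0 \<iota>1 \<iota>2 k0 k1 k2 using 0 1 2 k by unfold_locales auto
  have eq: "w0 i + w1 j + w2 l = c" if "\<iota>0 i + \<iota>1 j + \<iota>2 l = k0" for i j l
    using weights_eq[OF A w 0(2)[rule_format] 1(2)[rule_format] 2(2)[rule_format] that] .
  obtain \<delta> a b g where "(\<forall>i. w0 i = a + real (\<iota>0 i) * \<delta>) \<and> (\<forall>j. w1 j = b + real (\<iota>1 j) * \<delta>) \<and>
    (\<forall>l. w2 l = g + real (\<iota>2 l) * \<delta>) \<and> a + b + g + real k0 * \<delta> = c"
  proof -
    have "\<exists>\<delta> a b g. (\<forall>i. w0 i = a + real (\<iota>0 i) * \<delta>) \<and> (\<forall>j. w1 j = b + real (\<iota>1 j) * \<delta>) \<and>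
      (\<forall>l. w2 l = g + real (\<iota>2 l) * \<delta>) \<and> a + b + g + real k0 * \<delta> = c"
      by (rule weights_arith) (rule eq)
    then show thesis by (elim exE) (rule that)
  qed
  then have arith: "w0 i = a + real (\<iota>0 i) * \<delta>" "w1 j = b + real (\<iota>1 j) * \<delta>"
    "w2 l = g + real (\<iota>2 l) * \<delta>" "a + b + g + real k0 * \<delta> = c" for i j l by auto
  show ?thesis
  proof (cases "\<delta> = 0")
    case True
    then show ?thesis using arith by simp
  next
    case False
    have supp: "\<iota>0 i + \<iota>1 j + \<iota>2 l = k0" if "A $ i $ j $ l \<noteq> 0" for i j l
    proof -
      have "(real (\<iota>0 i + \<iota>1 j + \<iota>2 l) - real k0) * \<delta> = 0"
        using w[OF that] arith by (simp add: algebra_simps)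
      then have "real (\<iota>0 i + \<iota>1 j + \<iota>2 l) = real k0" using False by simp
      then show ?thesis by (simp only: of_nat_eq_iff)
    qed
    have "A $ i $ j $ l \<noteq> 0" if s: "\<iota>0 i + \<iota>1 j + \<iota>2 l = k0" for i j l
    proof -
      obtain i' j' l' where *: "\<iota>0 i' \<le> \<iota>0 i" "\<iota>1 j' \<le> \<iota>1 j" "\<iota>2 l' \<le> \<iota>2 l" "A $ i' $ j' $ l' \<noteq> 0"
        using corner_nonzero[OF A s] .
      then have "\<iota>0 i' = \<iota>0 i" "\<iota>1 j' = \<iota>1 j" "\<iota>2 l' = \<iota>2 l" using supp[OF *(4)] s by linarith+
      then have "i' = i" "j' = j" "l' = l" using bij_index(2)[OF bij0] bij_index(2)[OF bij1] bij_index(2)[OF bij2] by simp_all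
      then show ?thesis using * by simp
    qed
    with supp have "diag_type A" unfolding diag_type_def by (intro allI iffI)
    then show ?thesis
      by (intro disjI1 exI[of _ \<iota>0] exI[of _ \<iota>1] exI[of _ \<iota>2] conjI boundary_index_axioms)
  qed
qed

declare tensor_act.simps [simp del]

section \<open>Generalized eigenvectors\<close>

definition gen_eigen :: "(complex^'n \<Rightarrow> complex^'n) \<Rightarrow> complex \<Rightarrow> complex^'n \<Rightarrow> bool" where
  "gen_eigen f \<mu> v \<longleftrightarrow> (\<exists>m. ((\<lambda>v. f v - \<mu> *s v) ^^ m) v = 0)"

lemma lin_shift: "lin f \<Longrightarrow> lin (\<lambda>v. f v - \<mu> *s v)"
  for f :: "complex^'n \<Rightarrow> complex^'n"
  by (auto simp: lin_iff vec_eq_iff algebra_simps)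

lemma gen_eigen_subspace:
  fixes f :: "complex^'n \<Rightarrow> complex^'n"
  assumes f: "lin f"
  shows "vec.subspace {v. gen_eigen f \<mu> v}"
proof -
  let ?g = "\<lambda>v. f v - \<mu> *s v"
  note g = lin_shift[OF f, of \<mu>]
  have "gen_eigen f \<mu> 0" unfolding gen_eigen_def by (intro exI[of _ 0]) simp
  moreover have "gen_eigen f \<mu> (x + y)" if x: "gen_eigen f \<mu> x" and y: "gen_eigen f \<mu> y" for x y
  proof -
    obtain m where m: "(?g ^^ m) x = 0" using x unfolding gen_eigen_def by blast
    obtain n where n: "(?g ^^ n) y = 0" using y unfolding gen_eigen_def by blast
    have "(?g ^^ (m + n)) x = 0" "(?g ^^ (m + n)) y = 0"
      using funpow_eq_0_mono[OF g m, of "m + n"] funpow_eq_0_mono[OF g n, of "m + n"] by auto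
    then have "(?g ^^ (m + n)) (x + y) = 0" using lin_funpow[OF g, of "m + n"] by (simp add: lin_iff)
    then show ?thesis unfolding gen_eigen_def by (rule exI)
  qed
  moreover have "gen_eigen f \<mu> (c *s x)" if x: "gen_eigen f \<mu> x" for c x
  proof -
    obtain m where "(?g ^^ m) x = 0" using x unfolding gen_eigen_def by auto
    then have "(?g ^^ m) (c *s x) = 0" using lin_funpow[OF g, of m] by (simp add: lin_iff)
    then show ?thesis unfolding gen_eigen_def by (rule exI)
  qed
  ultimately show ?thesis unfolding vec.subspace_def by simp
qed

lemma gen_eigen_step: "gen_eigen f \<mu> (f v - \<mu> *s v) \<Longrightarrow> gen_eigen f \<mu> v"
proof -
  assume "gen_eigen f \<mu> (f v - \<mu> *s v)"
  then obtain m where "((\<lambda>v. f v - \<mu> *s v) ^^ m) (f v - \<mu> *s v) = 0" unfolding gen_eigen_def by auto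
  then have "((\<lambda>v. f v - \<mu> *s v) ^^ Suc m) v = 0" unfolding funpow_Suc_right by simp
  then show ?thesis unfolding gen_eigen_def by (rule exI)
qed

text \<open>On the generalized eigenspace of \<open>\<mu>\<close> the map \<open>f - \<nu>\<close>
  is invertible. If \<open>w\<close> solves \<open>(f - \<nu>) w = (f - \<mu>) v\<close>, by
  induction on the order of \<open>v\<close>, then \<open>(w - v) / (\<nu> - \<mu>)\<close> is the
  required preimage.\<close>

lemma gen_eigen_preimage:
  fixes f :: "complex^'n \<Rightarrow> complex^'n"
  assumes f: "lin f" and "\<nu> \<noteq> \<mu>" and "((\<lambda>v. f v - \<mu> *s v) ^^ m) v = 0"
  shows "\<exists>w. gen_eigen f \<mu> w \<and> f w - \<nu> *s w = v"
  using assms(3)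
proof (induction m arbitrary: v)
  case 0
  then show ?case using vec.subspace_0[OF gen_eigen_subspace[OF f, of \<mu>]] lin_0[OF f] by (intro exI[of _ 0]) simp
next
  case (Suc m)
  have "((\<lambda>v. f v - \<mu> *s v) ^^ m) (f v - \<mu> *s v) = 0" using Suc.prems unfolding funpow_Suc_right by simp
  from Suc.IH[OF this] obtain w where w: "gen_eigen f \<mu> w" "f w - \<nu> *s w = f v - \<mu> *s v" by auto
  have v: "gen_eigen f \<mu> v" unfolding gen_eigen_def using Suc.prems by (rule exI)
  define u where "u = inverse (\<nu> - \<mu>) *s (w - v)"
  have "gen_eigen f \<mu> u"
    using gen_eigen_subspace[OF f, of \<mu>] w(1) v vec.subspace_diff vec.subspace_scale
    unfolding u_def by blast
  moreover have "f u - \<nu> *s u = v"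
  proof -
    have "f u - \<nu> *s u = inverse (\<nu> - \<mu>) *s ((f w - \<nu> *s w) - (f v - \<nu> *s v))"
      unfolding u_def vec.linear_scale[OF f] vec.linear_diff[OF f] by (simp add: vec_eq_iff algebra_simps)
    also have "\<dots> = inverse (\<nu> - \<mu>) *s ((\<nu> - \<mu>) *s v)"
      unfolding w(2) by (simp add: vec_eq_iff algebra_simps)
    also have "\<dots> = v"
    proof -
      have "inverse (\<nu> - \<mu>) * (\<nu> - \<mu>) = 1" using assms(2) by simp
      then show ?thesis by (simp only: vec.scale_scale vec.scale_one)
    qed
    finally show ?thesis .
  qed
  ultimately show ?case by blast
qed

definition gen_span :: "(complex^'n \<Rightarrow> complex^'n) \<Rightarrow> (complex^'n) set" where
  "gen_span f = vec.span {v. \<exists>\<mu>. gen_eigen f \<mu> v}"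

text \<open>Modulo the image of \<open>f - \<nu>\<close>, an element of \<open>gen_span f\<close>
  can be represented by a generalized eigenvector \<open>g\<close> of eigenvalue
  \<open>\<nu>\<close>. Subtracting the preimage \<open>w\<close> from \<open>v\<close> leaves a
  vector that \<open>f - \<nu>\<close> sends to \<open>g\<close>, and such a vector is again a
  generalized eigenvector.\<close>

lemma gen_span_preimage:
  fixes f :: "complex^'n \<Rightarrow> complex^'n"
  assumes f: "lin f" and v: "f v - \<nu> *s v \<in> gen_span f"
  shows "v \<in> gen_span f"
proof -
  have base: "x \<in> gen_span f" if "gen_eigen f \<mu> x" for x \<mu>
    unfolding gen_span_def using that by (intro vec.span_base) auto
  have sub: "vec.subspace (gen_span f)" unfolding gen_span_def by simp
  have "\<exists>w g. w \<in> gen_span f \<and> gen_eigen f \<nu> g \<and> u = (f w - \<nu> *s w) + g" if "u \<in> gen_span f" for u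
    using that unfolding gen_span_def
  proof (induction rule: vec.span_induct_alt)
    case base
    show ?case
      using vec.subspace_0[OF gen_eigen_subspace[OF f, of \<nu>]] lin_0[OF f]
      by (intro exI[of _ 0]) (simp add: vec.span_zero)
  next
    case (step c x y)
    then obtain w g where w: "w \<in> gen_span f" "gen_eigen f \<nu> g" "y = (f w - \<nu> *s w) + g"
      unfolding gen_span_def by auto
    obtain \<mu> where x: "gen_eigen f \<mu> x" using step by auto
    show ?case
    proof (cases "\<mu> = \<nu>")
      case True
      have "gen_eigen f \<nu> (c *s x + g)"
        using vec.subspace_add[OF gen_eigen_subspace[OF f, of \<nu>]] vec.subspace_scale[OF gen_eigen_subspace[OF f, of \<nu>]]
          x w(2) True by simp
      then show ?thesis using w
        by (intro exI[of _ w] exI[of _ "c *s x + g"]) (simp add: gen_span_def)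
    next
      case False
      obtain m where "((\<lambda>v. f v - \<mu> *s v) ^^ m) x = 0" using x unfolding gen_eigen_def by auto
      then obtain u where u: "gen_eigen f \<mu> u" "f u - \<nu> *s u = x"
        using gen_eigen_preimage[OF f] False by metis
      have "c *s u + w \<in> gen_span f"
        using base[OF u(1)] w(1) sub vec.subspace_add vec.subspace_scale by metis
      moreover have "c *s x + y = (f (c *s u + w) - \<nu> *s (c *s u + w)) + g"
        unfolding w(3) u(2)[symmetric] vec.linear_add[OF f] vec.linear_scale[OF f]
        by (simp add: vec_eq_iff algebra_simps)
      ultimately show ?thesis using w(2) unfolding gen_span_def by blast
    qed
  qed
  from this[OF v] obtain w g where w: "w \<in> gen_span f" "gen_eigen f \<nu> g" "f v - \<nu> *s v = (f w - \<nu> *s w) + g"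
    by auto
  have "f (v - w) - \<nu> *s (v - w) = g"
    using w(3) unfolding vec.linear_diff[OF f] by (simp add: vec_eq_iff algebra_simps)
  then have "gen_eigen f \<nu> (v - w)" using w(2) gen_eigen_step by metis
  then have "(v - w) + w \<in> gen_span f" using base w(1) sub vec.subspace_add by metis
  then show ?thesis by simp
qed

definition poly_act :: "complex poly \<Rightarrow> (complex^'n \<Rightarrow> complex^'n) \<Rightarrow> complex^'n \<Rightarrow> complex^'n" where
  "poly_act p f v = (\<Sum>i\<le>degree p. coeff p i *s (f ^^ i) v)"

lemma poly_act_bound: "degree p \<le> N \<Longrightarrow> poly_act p f v = (\<Sum>i\<le>N. coeff p i *s (f ^^ i) v)"
  unfolding poly_act_def by (rule sum.mono_neutral_left) (auto simp: coeff_eq_0)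

lemma poly_act_root:
  fixes f :: "complex^'n \<Rightarrow> complex^'n"
  assumes f: "lin f"
  shows "poly_act ([:- z, 1:] * q) f v = f (poly_act q f v) - z *s poly_act q f v"
proof -
  let ?N = "degree q"
  have "degree ([:- z, 1:] * q) \<le> degree [:- z, 1:] + ?N" by (rule degree_mult_le)
  then have deg: "degree ([:- z, 1:] * q) \<le> Suc ?N" by simp
  have c: "coeff ([:- z, 1:] * q) i = (if i = 0 then 0 else coeff q (i - 1)) - z * coeff q i" for i
    by (simp add: coeff_pCons split: nat.split)
  have "poly_act ([:- z, 1:] * q) f v =
    (\<Sum>i\<le>Suc ?N. ((if i = 0 then 0 else coeff q (i - 1)) *s (f ^^ i) v) - (z * coeff q i) *s (f ^^ i) v)"
    unfolding poly_act_bound[OF deg] c by (simp only: vec.scale_left_diff_distrib)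
  also have "\<dots> = (\<Sum>i\<le>Suc ?N. (if i = 0 then 0 else coeff q (i - 1)) *s (f ^^ i) v) - (\<Sum>i\<le>Suc ?N. (z * coeff q i) *s (f ^^ i) v)"
    by (simp only: sum_subtractf)
  also have "(\<Sum>i\<le>Suc ?N. (if i = 0 then 0 else coeff q (i - 1)) *s (f ^^ i) v) = f (poly_act q f v)"
    by (simp add: sum.atMost_Suc_shift poly_act_def vec.linear_sum[OF f] vec.linear_scale[OF f] del: sum.atMost_Suc)
  also have "(\<Sum>i\<le>Suc ?N. (z * coeff q i) *s (f ^^ i) v) = z *s poly_act q f v"
    by (simp add: poly_act_bound[of q "Suc ?N"] vec.scale_sum_right del: sum.atMost_Suc)
  finally show ?thesis .
qed

text \<open>Roots are stripped off one at a time by the fundamental theorem of algebra, each handled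
  by \<open>gen_span_preimage\<close>.\<close>

lemma poly_act_gen_span:
  fixes f :: "complex^'n \<Rightarrow> complex^'n"
  assumes f: "lin f" and "p \<noteq> 0" "poly_act p f v \<in> gen_span f"
  shows "v \<in> gen_span f"
  using assms(2,3)
proof (induction "degree p" arbitrary: p)
  case 0
  then obtain a where a: "p = [:a:]" by (metis degree_eq_zeroE)
  with 0 have "a \<noteq> 0" by auto
  have "a *s v \<in> gen_span f" using 0 a by (simp add: poly_act_def)
  then have "inverse a *s (a *s v) \<in> gen_span f" unfolding gen_span_def by (rule vec.span_scale)
  then show ?case using \<open>a \<noteq> 0\<close> by simp
next
  case (Suc d)
  have "\<not> constant (poly p)" using Suc.hyps(2) by (simp add: constant_degree)
  then obtain z where "poly p z = 0" using fundamental_theorem_of_algebra by auto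
  then obtain q where q: "p = [:- z, 1:] * q" by (auto simp: poly_eq_0_iff_dvd)
  then have q0: "q \<noteq> 0" using Suc.prems by auto
  then have "degree p = Suc (degree q)" unfolding q by (subst degree_mult_eq) auto
  then have d: "d = degree q" using Suc.hyps(2) by simp
  have "f (poly_act q f v) - z *s poly_act q f v \<in> gen_span f"
    using Suc.prems(2) unfolding q poly_act_root[OF f] .
  then have "poly_act q f v \<in> gen_span f" by (rule gen_span_preimage[OF f])
  then show ?case by (rule Suc.hyps(1)[OF d q0])
qed

text \<open>The vectors \<open>(f ^^ i) v\<close> for \<open>i\<close> up to the dimension are one
  too many to be independent. The type \<open>'n option\<close> has exactly that many elements and
  serves as index set of the unknown coefficients.\<close>

lemma annihilating_poly:
  fixes f :: "complex^'n::finite \<Rightarrow> complex^'n"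
  shows "\<exists>p. p \<noteq> 0 \<and> poly_act p f v = 0"
proof -
  let ?n = "CARD('n)"
  obtain e where e: "bij_betw e {..?n} (UNIV :: 'n option set)"
  proof -
    have "card {..?n} = card (UNIV :: 'n option set)" by (simp add: card_UNIV_option)
    then show ?thesis using that finite_same_card_bij[of "{..?n}" "UNIV :: 'n option set"] by auto
  qed
  define d where "d = inv_into {..?n} e"
  have de: "d (e i) = i" if "i \<le> ?n" for i
    using e that unfolding d_def by (simp add: bij_betw_def inv_into_f_f)
  define r :: "'n \<Rightarrow> complex^'n option" where "r i = (\<chi> o'. ((f ^^ d o') v) $ i)" for i
  have "card (range r) \<le> ?n" by (rule card_image_le) simp
  then have "card (range r) < CARD('n option)" by (simp add: card_UNIV_option)
  then obtain x where x: "x \<noteq> 0" "\<And>i. (\<Sum>o'\<in>UNIV. r i $ o' * x $ o') = 0"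
    using exists_orthogonal[of "range r"] by auto
  define p where "p = Poly (map (\<lambda>i. x $ e i) [0..<Suc ?n])"
  have cp: "coeff p i = (if i \<le> ?n then x $ e i else 0)" for i
    unfolding p_def coeff_Poly_eq by (simp add: nth_default_def del: upt_Suc)
  have "\<exists>o'. x $ o' \<noteq> 0" using x(1) by (simp add: vec_eq_iff)
  then obtain i where "i \<le> ?n" "x $ e i \<noteq> 0" using e by (auto simp: bij_betw_def) (metis UNIV_I atMost_iff imageE)
  then have "p \<noteq> 0" using cp[of i] by auto
  moreover have "poly_act p f v = 0"
  proof -
    have "degree p \<le> ?n" by (rule degree_le) (simp add: cp)
    then have "poly_act p f v = (\<Sum>i\<le>?n. x $ e i *s (f ^^ d (e i)) v)"
      by (simp add: poly_act_bound cp de)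
    also have "\<dots> = (\<Sum>o'\<in>UNIV. x $ o' *s (f ^^ d o') v)"
      by (rule sum.reindex_bij_betw[OF e])
    also have "\<dots> = 0" using x(2) by (simp add: vec_eq_iff r_def mult.commute)
    finally show ?thesis .
  qed
  ultimately show ?thesis by blast
qed

lemma gen_eigen_basis:
  fixes f :: "complex^'n::finite \<Rightarrow> complex^'n"
  assumes f: "lin f"
  shows "\<exists>(Q::complex^'n^'n) \<beta>. invertible Q \<and> (\<forall>j. gen_eigen f (\<beta> j) (Q *v axis j 1))"
proof -
  let ?G = "{v. \<exists>\<mu>. gen_eigen f \<mu> v}"
  have "v \<in> vec.span ?G" for v
  proof -
    obtain p where "p \<noteq> 0" "poly_act p f v = 0" using annihilating_poly by metis
    then show ?thesis
      using poly_act_gen_span[OF f, of p v] unfolding gen_span_def by (simp add: vec.span_zero)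
  qed
  then have span: "vec.span ?G = UNIV" by auto
  obtain C where C: "C \<subseteq> ?G" "vec.independent C" "?G \<subseteq> vec.span C" "card C = vec.dim ?G"
    by (rule vec.basis_exists[of ?G])
  have spanC: "vec.span C = UNIV"
    using vec.span_minimal[OF C(3) vec.subspace_span] span by auto
  have finC: "finite C" using C vec.finiteI_independent by blast
  have "card C = CARD('n)"
    using vec.dim_span_eq_card_independent[OF C(2)] unfolding spanC vec_dim_card by simp
  then obtain h :: "'n \<Rightarrow> complex^'n" where h: "bij_betw h UNIV C"
    using finC by (metis bij_betw_iff_card finite_class.finite_UNIV)
  define Q where "Q = (\<chi> i j. h j $ i)"
  have Qa: "Q *v axis j 1 = h j" for j
    by (simp add: vec_eq_iff mult_axis) (simp add: Q_def)
  have "columns Q = C"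
  proof -
    have "column j Q = h j" for j by (simp add: column_def Q_def vec_lambda_eta)
    then show ?thesis using h by (auto simp: columns_def bij_betw_def)
  qed
  then have "invertible Q"
    using spanC unfolding invertible_right_inverse matrix_right_invertible_span_columns by auto
  moreover have "\<forall>j. \<exists>\<mu>. gen_eigen f \<mu> (Q *v axis j 1)"
    using C(1) h unfolding Qa by (auto simp: bij_betw_def)
  ultimately show ?thesis using choice[of "\<lambda>j \<mu>. gen_eigen f \<mu> (Q *v axis j 1)"] by blast
qed

section \<open>The trilinear form of a tensor and the weights on its support\<close>

definition tri :: "('n0::finite, 'n1::finite, 'n2::finite) tensor \<Rightarrow> complex^'n0 \<Rightarrow> complex^'n1 \<Rightarrow> complex^'n2 \<Rightarrow> complex" where
  "tri A x y z = (\<Sum>i\<in>UNIV. x $ i * contr A y z $ i)"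

lemma tri_linear:
  "tri A (x + x') y z = tri A x y z + tri A x' y z" "tri A (a *s x) y z = a * tri A x y z"
  "tri A x (y + y') z = tri A x y z + tri A x y' z" "tri A x (a *s y) z = a * tri A x y z"
  "tri A x y (z + z') = tri A x y z + tri A x y z'" "tri A x y (a *s z) = a * tri A x y z"
  by (simp_all add: tri_def contr_add1 contr_add2 contr_scale1 contr_scale2 sum.distrib sum_distrib_left algebra_simps)

lemma tri_zero [simp]: "tri A 0 y z = 0" "tri A x 0 z = 0" "tri A x y 0 = 0"
  by (simp_all add: tri_def)

lemma tri_axis: "tri A (axis i 1) (axis j 1) (axis l 1) = A $ i $ j $ l"
proof -
  have "tri A (axis i 1) (axis j 1) (axis l 1) = (\<Sum>i'\<in>UNIV. if i = i' then contr A (axis j 1) (axis l 1) $ i' else 0)"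
    unfolding tri_def by (rule sum.cong) (auto simp: axis_def)
  then show ?thesis by (simp add: contr_axis)
qed

lemma dot_matrix: "(\<Sum>i\<in>UNIV. x $ i * (g *v w) $ i) = (\<Sum>i\<in>UNIV. (transpose g *v x) $ i * w $ i)"
  for g :: "complex^'n^'n"
proof -
  have "(\<Sum>i\<in>UNIV. x $ i * (g *v w) $ i) = (\<Sum>i\<in>UNIV. \<Sum>j\<in>UNIV. x $ i * g $ i $ j * w $ j)"
    by (simp add: matrix_vector_mult_def sum_distrib_left mult.assoc)
  also have "\<dots> = (\<Sum>j\<in>UNIV. \<Sum>i\<in>UNIV. x $ i * g $ i $ j * w $ j)" by (rule sum.swap)
  finally show ?thesis
    by (simp add: matrix_vector_mult_def transpose_def sum_distrib_left sum_distrib_right mult_ac)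
qed

lemma tri_tensor_act:
  "tri (tensor_act (g0, g1, g2) A) x y z = tri A (transpose g0 *v x) (transpose g1 *v y) (transpose g2 *v z)"
  unfolding tri_def contr_tensor_act dot_matrix ..

lemma tri_lie_act:
  "tri (lie_act (X0, X1, X2) A) x y z = tri A (transpose X0 *v x) y z + tri A x (transpose X1 *v y) z
    + tri A x y (transpose X2 *v z)"
  unfolding tri_def contr_lie_act vector_add_component distrib_left sum.distrib dot_matrix ..

lemma tri_scale3: "tri (scale3 c A) x y z = c * tri A x y z"
  by (simp add: tri_def contr_scale3 sum_distrib_left mult_ac)

text \<open>Induction on the total nilpotency order. Writing \<open>f0 x\<close> as
  \<open>\<alpha> *s x + x'\<close> and likewise for the other two, every term with a primed vector
  vanishes by induction, and the value \<open>T\<close> at \<open>x\<close>, \<open>y\<close>,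
  \<open>z\<close> satisfies \<open>c * T = \<alpha> * \<beta> * \<gamma> * T\<close>.\<close>

lemma tri_gen_vanish_mult:
  assumes eqv: "\<And>x y z. tri A (f0 x) (f1 y) (f2 z) = c * tri A x y z" and ne: "\<alpha> * \<beta> * \<gamma> \<noteq> c"
    and "((\<lambda>v. f0 v - \<alpha> *s v) ^^ a) x = 0" "((\<lambda>v. f1 v - \<beta> *s v) ^^ b) y = 0" "((\<lambda>v. f2 v - \<gamma> *s v) ^^ e) z = 0"
  shows "tri A x y z = 0"
  using assms(3-)
proof (induction "a + b + e" arbitrary: a b e x y z rule: less_induct)
  case less
  show ?case
  proof (cases "a = 0 \<or> b = 0 \<or> e = 0")
    case True
    then show ?thesis using less.prems by auto
  next
    case False
    then obtain a' b' e' where s: "a = Suc a'" "b = Suc b'" "e = Suc e'" by (metis not0_implies_Suc)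
    define x' y' z' where "x' = f0 x - \<alpha> *s x" and "y' = f1 y - \<beta> *s y" and "z' = f2 z - \<gamma> *s z"
    have p: "((\<lambda>v. f0 v - \<alpha> *s v) ^^ a') x' = 0" "((\<lambda>v. f1 v - \<beta> *s v) ^^ b') y' = 0"
      "((\<lambda>v. f2 v - \<gamma> *s v) ^^ e') z' = 0"
      using less.prems unfolding s funpow_Suc_right by (simp_all add: x'_def y'_def z'_def)
    note q = less.prems
    have v: "tri A x' y z = 0" "tri A x y' z = 0" "tri A x y z' = 0" "tri A x' y' z = 0"
        "tri A x' y z' = 0" "tri A x y' z' = 0" "tri A x' y' z' = 0"
      using less.hyps[OF _ p(1) q(2) q(3)] less.hyps[OF _ q(1) p(2) q(3)] less.hyps[OF _ q(1) q(2) p(3)]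
        less.hyps[OF _ p(1) p(2) q(3)] less.hyps[OF _ p(1) q(2) p(3)] less.hyps[OF _ q(1) p(2) p(3)]
        less.hyps[OF _ p] by (simp_all add: s)
    have "c * tri A x y z = tri A (\<alpha> *s x + x') (\<beta> *s y + y') (\<gamma> *s z + z')"
      using eqv[of x y z] by (simp add: x'_def y'_def z'_def)
    also have "\<dots> = \<alpha> * \<beta> * \<gamma> * tri A x y z" by (simp add: tri_linear v)
    finally show ?thesis using ne by simp
  qed
qed

text \<open>The same induction for elements of the Lie algebra in place of group elements, with the
  sum of the eigenvalues in place of their product.\<close>

lemma tri_gen_vanish_add:
  assumes eqv: "\<And>x y z. tri A (f0 x) y z + tri A x (f1 y) z + tri A x y (f2 z) = 0" and ne: "\<alpha> + \<beta> + \<gamma> \<noteq> 0"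
    and "((\<lambda>v. f0 v - \<alpha> *s v) ^^ a) x = 0" "((\<lambda>v. f1 v - \<beta> *s v) ^^ b) y = 0" "((\<lambda>v. f2 v - \<gamma> *s v) ^^ e) z = 0"
  shows "tri A x y z = 0"
  using assms(3-)
proof (induction "a + b + e" arbitrary: a b e x y z rule: less_induct)
  case less
  show ?case
  proof (cases "a = 0 \<or> b = 0 \<or> e = 0")
    case True
    then show ?thesis using less.prems by auto
  next
    case False
    then obtain a' b' e' where s: "a = Suc a'" "b = Suc b'" "e = Suc e'" by (metis not0_implies_Suc)
    define x' y' z' where "x' = f0 x - \<alpha> *s x" and "y' = f1 y - \<beta> *s y" and "z' = f2 z - \<gamma> *s z"
    have p: "((\<lambda>v. f0 v - \<alpha> *s v) ^^ a') x' = 0" "((\<lambda>v. f1 v - \<beta> *s v) ^^ b') y' = 0"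
      "((\<lambda>v. f2 v - \<gamma> *s v) ^^ e') z' = 0"
      using less.prems unfolding s funpow_Suc_right by (simp_all add: x'_def y'_def z'_def)
    note q = less.prems
    have v: "tri A x' y z = 0" "tri A x y' z = 0" "tri A x y z' = 0"
      using less.hyps[OF _ p(1) q(2) q(3)] less.hyps[OF _ q(1) p(2) q(3)] less.hyps[OF _ q(1) q(2) p(3)]
      by (simp_all add: s)
    have "0 = tri A (\<alpha> *s x + x') y z + tri A x (\<beta> *s y + y') z + tri A x y (\<gamma> *s z + z')"
      using eqv[of x y z] by (simp add: x'_def y'_def z'_def)
    also have "\<dots> = (\<alpha> + \<beta> + \<gamma>) * tri A x y z" by (simp add: tri_linear v algebra_simps)
    finally show ?thesis using ne by simp
  qed
qed

lemma mat_mult_vec: "mat c *v v = c *s v" for v :: "complex^'n"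
  by (simp add: vec_eq_iff matrix_vector_mult_def mat_def if_distrib[of "\<lambda>x. x * _"] cong: if_cong)

lemma matrix_zero_mult: "0 ** M = 0" for M :: "complex^'n^'m"
  by (simp add: vec_eq_iff matrix_matrix_mult_def)

lemma gen_eigen_const_nilp:
  fixes M Q :: "complex^'n::finite^'n"
  assumes Q: "invertible Q" and e: "\<And>j. gen_eigen ((*v) M) \<mu> (Q *v axis j 1)"
  shows "nilp ((*v) (M - mat \<mu>))"
proof -
  have shift: "(\<lambda>v. M *v v - \<mu> *s v) = (*v) (M - mat \<mu>)"
    by (rule ext) (simp add: matrix_vector_mult_diff_rdistrib mat_mult_vec)
  have "\<exists>m. mpow (M - mat \<mu>) m *v (Q *v axis j 1) = 0" for j
    using e[of j] unfolding gen_eigen_def shift funpow_mpow .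
  then obtain m where m: "\<And>j. mpow (M - mat \<mu>) (m j) *v (Q *v axis j 1) = 0" by metis
  define K where "K = Max (range m)"
  have "mpow (M - mat \<mu>) K ** Q = 0"
  proof (rule matrix_eq_axis)
    fix j
    have "m j \<le> K" unfolding K_def by (rule Max_ge) auto
    then have "((*v) (M - mat \<mu>) ^^ K) (Q *v axis j 1) = 0"
      using funpow_eq_0_mono[OF lin_mult, of "m j" "M - mat \<mu>" "Q *v axis j 1" K] m[of j] unfolding funpow_mpow by simp
    then show "(mpow (M - mat \<mu>) K ** Q) *v axis j 1 = 0 *v axis j 1"
      unfolding funpow_mpow by (simp flip: matrix_vector_mul_assoc)
  qed
  moreover obtain R where "Q ** R = mat 1" using Q by (rule invertibleE)
  ultimately have "mpow (M - mat \<mu>) K = 0"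
    by (metis matrix_mul_assoc matrix_mul_rid matrix_zero_mult)
  then show ?thesis unfolding nilp_iff_mpow by (rule exI)
qed

lemma coord_bounded_nonzero:
  fixes A :: "('n0::finite, 'n1::finite, 'n2::finite) tensor"
  assumes "coord_bounded A"
  shows "\<exists>i j l. A $ i $ j $ l \<noteq> 0"
proof (rule ccontr)
  assume "\<not> ?thesis"
  then have z: "A $ i $ j $ l = 0" for i j l by simp
  have "card (UNIV :: 'n0 set) + card (UNIV :: 'n1 set) + card (UNIV :: 'n2 set) \<le> CARD('n1) + CARD('n2)"
    by (intro assms[unfolded coord_bounded_def, rule_format]) (simp_all add: z)
  then show False by simp
qed

text \<open>This singles out the tensors stabilized by a torus of \<open>SL(2)\<close>. The
  orderings are part of the data since sorting eigenvalues produces them.\<close>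

definition diagonalizable :: "nat \<Rightarrow> nat \<Rightarrow> nat \<Rightarrow> ('n0::finite, 'n1::finite, 'n2::finite) tensor \<Rightarrow> bool" where
  "diagonalizable k0 k1 k2 A \<longleftrightarrow> (\<exists>P0 P1 P2 \<iota>0 \<iota>1 \<iota>2. invertible P0 \<and> invertible P1 \<and> invertible P2 \<and>
     boundary_index \<iota>0 \<iota>1 \<iota>2 k0 k1 k2 \<and> boundary_index.diag_type \<iota>0 \<iota>1 \<iota>2 k0 (tensor_act (P0, P1, P2) A))"

lemma disj_notD: "P \<or> Q \<Longrightarrow> \<not> P \<Longrightarrow> Q"
  by blast

text \<open>Complex weights cannot be sorted, but their real and imaginary parts can, each giving a
  real weight system to which the dichotomy applies.\<close>

lemma weights_const:
  fixes A :: "('n0::finite, 'n1::finite, 'n2::finite) tensor" and w0 w1 w2 :: "_ \<Rightarrow> complex"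
  assumes card: "CARD('n0) = Suc k0" "CARD('n1) = Suc k1" "CARD('n2) = Suc k2"
    and k: "k0 = k1 + k2" "k1 \<ge> 1" "k2 \<ge> 1"
    and A: "block_bounded A" and nd: "\<not> diagonalizable k0 k1 k2 A"
    and inv: "invertible P0" "invertible P1" "invertible P2"
    and w: "\<And>i j l. tensor_act (P0, P1, P2) A $ i $ j $ l \<noteq> 0 \<Longrightarrow> w0 i + w1 j + w2 l = c"
  shows "w0 i = w0 i' \<and> w1 j = w1 j' \<and> w2 l = w2 l'"
proof -
  let ?A = "tensor_act (P0, P1, P2) A"
  note cb = block_bounded_coord[OF A inv]
  have nd': "\<not> (\<exists>\<iota>0 \<iota>1 \<iota>2. boundary_index \<iota>0 \<iota>1 \<iota>2 k0 k1 k2 \<and> boundary_index.diag_type \<iota>0 \<iota>1 \<iota>2 k0 ?A)"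
  proof
    assume "\<exists>\<iota>0 \<iota>1 \<iota>2. boundary_index \<iota>0 \<iota>1 \<iota>2 k0 k1 k2 \<and> boundary_index.diag_type \<iota>0 \<iota>1 \<iota>2 k0 ?A"
    then have "diagonalizable k0 k1 k2 A" unfolding diagonalizable_def
      using inv by (elim exE) (intro exI conjI, assumption+, erule conjunct1, erule conjunct2)
    with nd show False ..
  qed
  have wR: "Re (w0 i) + Re (w1 j) + Re (w2 l) = Re c" and wI: "Im (w0 i) + Im (w1 j) + Im (w2 l) = Im c"
    if "?A $ i $ j $ l \<noteq> 0" for i j l using w[OF that] by auto
  have "(\<forall>i i'. Re (w0 i) = Re (w0 i')) \<and> (\<forall>i i'. Re (w1 i) = Re (w1 i')) \<and> (\<forall>i i'. Re (w2 i) = Re (w2 i'))"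
    by (rule disj_notD[OF weights_dichotomy[OF card k cb] nd']) (rule wR)
  moreover have "(\<forall>i i'. Im (w0 i) = Im (w0 i')) \<and> (\<forall>i i'. Im (w1 i) = Im (w1 i')) \<and> (\<forall>i i'. Im (w2 i) = Im (w2 i'))"
    by (rule disj_notD[OF weights_dichotomy[OF card k cb] nd']) (rule wI)
  ultimately show ?thesis by (simp add: complex_eq_iff)
qed

lemma transpose_diff_mat: "transpose (M - mat c) = transpose M - mat c" for M :: "complex^'n^'n"
  by (simp add: vec_eq_iff transpose_def mat_def eq_commute)

lemma tensor_act_transpose_entry:
  "tensor_act (transpose Q0, transpose Q1, transpose Q2) A $ i $ j $ l =
    tri A (Q0 *v axis i 1) (Q1 *v axis j 1) (Q2 *v axis l 1)"
  by (simp add: tri_tensor_act transpose_transpose flip: tri_axis del: tensor_act.simps)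

text \<open>In bases of generalized eigenvectors of the transposes, the eigenvalues sum to zero on
  the support of \<open>A\<close>. Outside the diagonalizable case they are constant on each factor,
  so that each component is a scalar plus a nilpotent matrix.\<close>

lemma lie_act_nondiag:
  fixes A :: "('n0::finite, 'n1::finite, 'n2::finite) tensor"
  assumes card: "CARD('n0) = Suc k0" "CARD('n1) = Suc k1" "CARD('n2) = Suc k2"
    and k: "k0 = k1 + k2" "k1 \<ge> 1" "k2 \<ge> 1"
    and A: "block_bounded A" and nd: "\<not> diagonalizable k0 k1 k2 A"
    and X: "lie_act (X0, X1, X2) A = 0"
  shows "\<exists>a0 a1 a2. a0 + a1 + a2 = 0 \<and> nilp ((*v) (X0 - mat a0)) \<and> nilp ((*v) (X1 - mat a1)) \<and> nilp ((*v) (X2 - mat a2))"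
proof -
  obtain Q0 :: "complex^'n0^'n0" and \<alpha> where "invertible Q0 \<and> (\<forall>j. gen_eigen ((*v) (transpose X0)) (\<alpha> j) (Q0 *v axis j 1))"
    using gen_eigen_basis[OF lin_mult, of "transpose X0"] by (elim exE) (rule that)
  then have 0: "invertible Q0" "gen_eigen ((*v) (transpose X0)) (\<alpha> j) (Q0 *v axis j 1)" for j by auto
  obtain Q1 :: "complex^'n1^'n1" and \<beta> where "invertible Q1 \<and> (\<forall>j. gen_eigen ((*v) (transpose X1)) (\<beta> j) (Q1 *v axis j 1))"
    using gen_eigen_basis[OF lin_mult, of "transpose X1"] by (elim exE) (rule that)
  then have 1: "invertible Q1" "gen_eigen ((*v) (transpose X1)) (\<beta> j) (Q1 *v axis j 1)" for j by auto
  obtain Q2 :: "complex^'n2^'n2" and \<gamma> where "invertible Q2 \<and> (\<forall>j. gen_eigen ((*v) (transpose X2)) (\<gamma> j) (Q2 *v axis j 1))"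
    using gen_eigen_basis[OF lin_mult, of "transpose X2"] by (elim exE) (rule that)
  then have 2: "invertible Q2" "gen_eigen ((*v) (transpose X2)) (\<gamma> j) (Q2 *v axis j 1)" for j by auto
  have eqv: "tri A (transpose X0 *v x) y z + tri A x (transpose X1 *v y) z + tri A x y (transpose X2 *v z) = 0" for x y z
    using tri_lie_act[of X0 X1 X2 A x y z] X by (simp add: tri_def contr_0)
  have w: "\<alpha> i + \<beta> j + \<gamma> l = 0" if "tensor_act (transpose Q0, transpose Q1, transpose Q2) A $ i $ j $ l \<noteq> 0" for i j l
  proof (rule ccontr)
    assume ne: "\<alpha> i + \<beta> j + \<gamma> l \<noteq> 0"
    obtain a where a: "((\<lambda>v. transpose X0 *v v - \<alpha> i *s v) ^^ a) (Q0 *v axis i 1) = 0" using 0(2)[of i] unfolding gen_eigen_def by blast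
    obtain b where b: "((\<lambda>v. transpose X1 *v v - \<beta> j *s v) ^^ b) (Q1 *v axis j 1) = 0" using 1(2)[of j] unfolding gen_eigen_def by blast
    obtain e where e: "((\<lambda>v. transpose X2 *v v - \<gamma> l *s v) ^^ e) (Q2 *v axis l 1) = 0" using 2(2)[of l] unfolding gen_eigen_def by blast
    from tri_gen_vanish_add[OF eqv ne a b e] that show False by (simp add: tensor_act_transpose_entry del: tensor_act.simps)
  qed
  note inv = invertible_transpose[OF 0(1)] invertible_transpose[OF 1(1)] invertible_transpose[OF 2(1)]
  obtain i j l where nz: "tensor_act (transpose Q0, transpose Q1, transpose Q2) A $ i $ j $ l \<noteq> 0"
    using coord_bounded_nonzero[OF block_bounded_coord[OF A inv]] by blast
  have const: "\<alpha> i' = \<alpha> i" "\<beta> j' = \<beta> j" "\<gamma> l' = \<gamma> l" for i' j' l'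
  proof -
    have "\<alpha> i' = \<alpha> i \<and> \<beta> j' = \<beta> j \<and> \<gamma> l' = \<gamma> l"
      by (rule weights_const[OF card k A nd inv]) (rule w)
    then show "\<alpha> i' = \<alpha> i" "\<beta> j' = \<beta> j" "\<gamma> l' = \<gamma> l" by auto
  qed
  have n0: "nilp ((*v) (X0 - mat (\<alpha> i)))"
  proof -
    have "gen_eigen ((*v) (transpose X0)) (\<alpha> i) (Q0 *v axis j' 1)" for j'
      using 0(2)[of j'] by (subst (asm) const(1)[of j'])
    from gen_eigen_const_nilp[OF 0(1) this] show ?thesis
      unfolding transpose_diff_mat[symmetric] nilp_transpose .
  qed
  have n1: "nilp ((*v) (X1 - mat (\<beta> j)))"
  proof -
    have "gen_eigen ((*v) (transpose X1)) (\<beta> j) (Q1 *v axis j' 1)" for j'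
      using 1(2)[of j'] by (subst (asm) const(2)[of j'])
    from gen_eigen_const_nilp[OF 1(1) this] show ?thesis
      unfolding transpose_diff_mat[symmetric] nilp_transpose .
  qed
  have n2: "nilp ((*v) (X2 - mat (\<gamma> l)))"
  proof -
    have "gen_eigen ((*v) (transpose X2)) (\<gamma> l) (Q2 *v axis j' 1)" for j'
      using 2(2)[of j'] by (subst (asm) const(3)[of j'])
    from gen_eigen_const_nilp[OF 2(1) this] show ?thesis
      unfolding transpose_diff_mat[symmetric] nilp_transpose .
  qed
  show ?thesis by (intro exI[of _ "\<alpha> i"] exI[of _ "\<beta> j"] exI[of _ "\<gamma> l"] conjI w[OF nz] n0 n1 n2)
qed

section \<open>Eigenvalues of stabilizer elements close to the identity\<close>

lemma Ln_small:
  assumes "e > 0"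
  shows "\<exists>d>0. \<forall>z. cmod (z - 1) < d \<longrightarrow> z \<noteq> 0 \<and> cmod (Ln z) < e"
proof -
  have "isCont Ln (1::complex)" by (rule continuous_at_Ln) simp
  then obtain d where d: "d > 0" "\<And>z. dist z 1 < d \<Longrightarrow> dist (Ln z) (Ln 1) < e"
    using assms unfolding continuous_at_eps_delta by blast
  show ?thesis
  proof (intro exI[of _ "min d 1"] conjI allI impI)
    fix z :: complex assume z: "cmod (z - 1) < min d 1"
    then show "z \<noteq> 0" by auto
    show "cmod (Ln z) < e" using d(2)[of z] z by (simp add: dist_norm)
  qed (use d in auto)
qed

text \<open>Compare both sides of the eigenvector equation at the coordinate of largest
  modulus.\<close>

lemma eigenvalue_near_one:
  fixes M :: "complex^'n::finite^'n"
  assumes ev: "M *v v = \<mu> *s v" "v \<noteq> 0" and e: "\<And>i j. cmod ((M - mat 1) $ i $ j) \<le> e"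
  shows "cmod (\<mu> - 1) \<le> real CARD('n) * e"
proof -
  obtain i where i: "\<And>j. cmod (v $ j) \<le> cmod (v $ i)"
  proof -
    have "Max (range (\<lambda>j. cmod (v $ j))) \<in> range (\<lambda>j. cmod (v $ j))" by (rule Max_in) auto
    then obtain i where "Max (range (\<lambda>j. cmod (v $ j))) = cmod (v $ i)" by (rule rangeE)
    then show ?thesis using that[of i] Max_ge[of "range (\<lambda>j. cmod (v $ j))"] by auto
  qed
  have vi: "v $ i \<noteq> 0" using ev(2) i by (metis norm_le_zero_iff norm_zero vec_eq_iff zero_index)
  have "(\<mu> - 1) * v $ i = ((M - mat 1) *v v) $ i"
    by (simp add: matrix_vector_mult_diff_rdistrib mat_mult_vec ev(1) algebra_simps)
  then have "cmod ((\<mu> - 1) * v $ i) \<le> (\<Sum>j\<in>UNIV. cmod ((M - mat 1) $ i $ j * v $ j))"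
    unfolding matrix_vector_mult_def by (simp add: norm_sum)
  also have "\<dots> \<le> (\<Sum>j\<in>(UNIV::'n set). e * cmod (v $ i))"
    by (intro sum_mono) (simp only: norm_mult, intro mult_mono e i, auto intro: order_trans[OF norm_ge_zero e])
  finally have "cmod (\<mu> - 1) * cmod (v $ i) \<le> real CARD('n) * e * cmod (v $ i)" by (simp add: norm_mult)
  then show ?thesis using vi by simp
qed

lemma gen_eigen_eigenvector:
  fixes f :: "complex^'n \<Rightarrow> complex^'n"
  assumes "gen_eigen f \<mu> v" "v \<noteq> 0"
  shows "\<exists>u. u \<noteq> 0 \<and> f u = \<mu> *s u"
proof -
  let ?g = "\<lambda>v. f v - \<mu> *s v"
  obtain m where m: "(?g ^^ m) v = 0" using assms(1) unfolding gen_eigen_def by blast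
  then obtain k where k: "(?g ^^ k) v \<noteq> 0" "(?g ^^ Suc k) v = 0"
    using ex_least_nat_less[of "\<lambda>k. (?g ^^ k) v = 0" m] assms(2) by auto
  then show ?thesis by (intro exI[of _ "(?g ^^ k) v"]) simp
qed

text \<open>On the support the product of the three eigenvalues is \<open>c\<close>. Closeness to
  one keeps each logarithm below \<open>pi / 3\<close>, so a sum of three has imaginary part below
  \<open>pi\<close>; two such sums differ by less than \<open>2 * pi\<close> and agree as soon as
  their exponentials do. The logarithms are then additive weights, to which
  \<open>weights_const\<close> applies.\<close>

lemma stab_nondiag_near_one:
  fixes A :: "('n0::finite, 'n1::finite, 'n2::finite) tensor"
  assumes card: "CARD('n0) = Suc k0" "CARD('n1) = Suc k1" "CARD('n2) = Suc k2"
    and k: "k0 = k1 + k2" "k1 \<ge> 1" "k2 \<ge> 1"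
    and A: "block_bounded A" and nd: "\<not> diagonalizable k0 k1 k2 A"
    and g: "tensor_act (g0, g1, g2) A = scale3 c A"
    and d: "\<And>z. cmod (z - 1) < d \<Longrightarrow> z \<noteq> 0 \<and> cmod (Ln z) < pi / 3"
    and near: "\<And>i j. cmod ((g0 - mat 1) $ i $ j) \<le> e" "\<And>i j. cmod ((g1 - mat 1) $ i $ j) \<le> e"
      "\<And>i j. cmod ((g2 - mat 1) $ i $ j) \<le> e"
    and e: "real CARD('n0) * e < d" "real CARD('n1) * e < d" "real CARD('n2) * e < d"
  shows "\<exists>a0 a1 a2. a0 * a1 * a2 = c \<and> cmod (a0 - 1) < d \<and> cmod (a1 - 1) < d \<and> cmod (a2 - 1) < d \<and>
    nilp ((*v) (g0 - mat a0)) \<and> nilp ((*v) (g1 - mat a1)) \<and> nilp ((*v) (g2 - mat a2))"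
proof -
  obtain Q0 :: "complex^'n0^'n0" and \<alpha> where "invertible Q0 \<and> (\<forall>j. gen_eigen ((*v) (transpose g0)) (\<alpha> j) (Q0 *v axis j 1))"
    using gen_eigen_basis[OF lin_mult, of "transpose g0"] by (elim exE) (rule that)
  then have 0: "invertible Q0" "gen_eigen ((*v) (transpose g0)) (\<alpha> j) (Q0 *v axis j 1)" for j by auto
  obtain Q1 :: "complex^'n1^'n1" and \<beta> where "invertible Q1 \<and> (\<forall>j. gen_eigen ((*v) (transpose g1)) (\<beta> j) (Q1 *v axis j 1))"
    using gen_eigen_basis[OF lin_mult, of "transpose g1"] by (elim exE) (rule that)
  then have 1: "invertible Q1" "gen_eigen ((*v) (transpose g1)) (\<beta> j) (Q1 *v axis j 1)" for j by auto
  obtain Q2 :: "complex^'n2^'n2" and \<gamma> where "invertible Q2 \<and> (\<forall>j. gen_eigen ((*v) (transpose g2)) (\<gamma> j) (Q2 *v axis j 1))"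
    using gen_eigen_basis[OF lin_mult, of "transpose g2"] by (elim exE) (rule that)
  then have 2: "invertible Q2" "gen_eigen ((*v) (transpose g2)) (\<gamma> j) (Q2 *v axis j 1)" for j by auto
  have ev: "cmod (\<mu> - 1) < d"
    if Q: "invertible Q" and ge: "gen_eigen ((*v) (transpose M)) \<mu> (Q *v axis j 1)"
      and le: "\<And>i j. cmod ((M - mat 1) $ i $ j) \<le> e" and ed: "real CARD('m) * e < d"
    for M Q :: "complex^'m::finite^'m" and \<mu> j
  proof -
    obtain R where R: "R ** Q = mat 1" using Q by (rule invertibleE)
    have "Q *v axis j 1 \<noteq> 0"
    proof
      assume "Q *v axis j 1 = 0"
      then have "R *v (Q *v axis j 1) = 0" by simp
      then have "axis j (1::complex) = 0" using R by simp
      then show False by (simp add: axis_eq_0_iff)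
    qed
    then obtain u where u: "u \<noteq> 0" "transpose M *v u = \<mu> *s u" using gen_eigen_eigenvector[OF ge] by blast
    have "cmod ((transpose M - mat 1) $ i $ j) \<le> e" for i j
      using le[of j i] by (simp add: transpose_def mat_def eq_commute)
    from eigenvalue_near_one[OF u(2,1) this] ed show ?thesis by simp
  qed
  have near': "cmod (\<alpha> i - 1) < d" "cmod (\<beta> j - 1) < d" "cmod (\<gamma> l - 1) < d" for i j l
    using ev[OF 0(1) 0(2) near(1) e(1)] ev[OF 1(1) 1(2) near(2) e(2)] ev[OF 2(1) 2(2) near(3) e(3)] by auto
  have eqv: "tri A (transpose g0 *v x) (transpose g1 *v y) (transpose g2 *v z) = c * tri A x y z" for x y z
    using tri_tensor_act[of g0 g1 g2 A x y z] unfolding g tri_scale3 by simp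
  have w: "\<alpha> i * \<beta> j * \<gamma> l = c" if "tensor_act (transpose Q0, transpose Q1, transpose Q2) A $ i $ j $ l \<noteq> 0" for i j l
  proof (rule ccontr)
    assume ne: "\<alpha> i * \<beta> j * \<gamma> l \<noteq> c"
    obtain a where a: "((\<lambda>v. transpose g0 *v v - \<alpha> i *s v) ^^ a) (Q0 *v axis i 1) = 0" using 0(2)[of i] unfolding gen_eigen_def by blast
    obtain b where b: "((\<lambda>v. transpose g1 *v v - \<beta> j *s v) ^^ b) (Q1 *v axis j 1) = 0" using 1(2)[of j] unfolding gen_eigen_def by blast
    obtain e where e: "((\<lambda>v. transpose g2 *v v - \<gamma> l *s v) ^^ e) (Q2 *v axis l 1) = 0" using 2(2)[of l] unfolding gen_eigen_def by blast
    from tri_gen_vanish_mult[OF eqv ne a b e] that show False by (simp add: tensor_act_transpose_entry del: tensor_act.simps)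
  qed
  note inv = invertible_transpose[OF 0(1)] invertible_transpose[OF 1(1)] invertible_transpose[OF 2(1)]
  obtain i j l where nz: "tensor_act (transpose Q0, transpose Q1, transpose Q2) A $ i $ j $ l \<noteq> 0"
    using coord_bounded_nonzero[OF block_bounded_coord[OF A inv]] by blast
  define S where "S i j l = Ln (\<alpha> i) + Ln (\<beta> j) + Ln (\<gamma> l)" for i j l
  have expS: "exp (S i j l) = \<alpha> i * \<beta> j * \<gamma> l" for i j l
    using d[OF near'(1)] d[OF near'(2)] d[OF near'(3)] by (simp add: S_def exp_add)
  have ImS: "\<bar>Im (S i j l)\<bar> < pi" for i j l
  proof -
    have "cmod (S i j l) \<le> cmod (Ln (\<alpha> i)) + cmod (Ln (\<beta> j)) + cmod (Ln (\<gamma> l))"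
      using norm_triangle_ineq[of "Ln (\<alpha> i) + Ln (\<beta> j)" "Ln (\<gamma> l)"] norm_triangle_ineq[of "Ln (\<alpha> i)" "Ln (\<beta> j)"]
      unfolding S_def by linarith
    also have "\<dots> < pi / 3 + pi / 3 + pi / 3"
      using d[OF near'(1)[of i]] d[OF near'(2)[of j]] d[OF near'(3)[of l]] by linarith
    finally show ?thesis using abs_Im_le_cmod[of "S i j l"] by simp
  qed
  have wS: "Ln (\<alpha> i') + Ln (\<beta> j') + Ln (\<gamma> l') = S i j l"
    if "tensor_act (transpose Q0, transpose Q1, transpose Q2) A $ i' $ j' $ l' \<noteq> 0" for i' j' l'
  proof -
    have "S i' j' l' = S i j l"
    proof (rule exp_complex_eqI)
      show "\<bar>Im (S i' j' l') - Im (S i j l)\<bar> < 2 * pi" using ImS[of i' j' l'] ImS[of i j l] by linarith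
      show "exp (S i' j' l') = exp (S i j l)" by (simp only: expS w[OF that] w[OF nz])
    qed
    then show ?thesis by (simp only: S_def)
  qed
  have const: "\<alpha> i' = \<alpha> i" "\<beta> j' = \<beta> j" "\<gamma> l' = \<gamma> l" for i' j' l'
  proof -
    have "Ln (\<alpha> i') = Ln (\<alpha> i) \<and> Ln (\<beta> j') = Ln (\<beta> j) \<and> Ln (\<gamma> l') = Ln (\<gamma> l)"
      by (rule weights_const[OF card k A nd inv]) (rule wS)
    moreover have "exp (Ln (\<alpha> i)) = \<alpha> i" "exp (Ln (\<beta> j)) = \<beta> j" "exp (Ln (\<gamma> l)) = \<gamma> l" for i j l
      using d[OF near'(1)] d[OF near'(2)] d[OF near'(3)] by simp_all
    ultimately show "\<alpha> i' = \<alpha> i" "\<beta> j' = \<beta> j" "\<gamma> l' = \<gamma> l" by metis+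
  qed
  have n0: "nilp ((*v) (g0 - mat (\<alpha> i)))"
  proof -
    have "gen_eigen ((*v) (transpose g0)) (\<alpha> i) (Q0 *v axis j' 1)" for j'
      using 0(2)[of j'] by (subst (asm) const(1)[of j'])
    from gen_eigen_const_nilp[OF 0(1) this] show ?thesis
      unfolding transpose_diff_mat[symmetric] nilp_transpose .
  qed
  have n1: "nilp ((*v) (g1 - mat (\<beta> j)))"
  proof -
    have "gen_eigen ((*v) (transpose g1)) (\<beta> j) (Q1 *v axis j' 1)" for j'
      using 1(2)[of j'] by (subst (asm) const(2)[of j'])
    from gen_eigen_const_nilp[OF 1(1) this] show ?thesis
      unfolding transpose_diff_mat[symmetric] nilp_transpose .
  qed
  have n2: "nilp ((*v) (g2 - mat (\<gamma> l)))"
  proof -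
    have "gen_eigen ((*v) (transpose g2)) (\<gamma> l) (Q2 *v axis j' 1)" for j'
      using 2(2)[of j'] by (subst (asm) const(3)[of j'])
    from gen_eigen_const_nilp[OF 2(1) this] show ?thesis
      unfolding transpose_diff_mat[symmetric] nilp_transpose .
  qed
  show ?thesis by (intro exI[of _ "\<alpha> i"] exI[of _ "\<beta> j"] exI[of _ "\<gamma> l"] conjI w[OF nz] near' n0 n1 n2)
qed

declare lie_act.simps [simp del]

section \<open>Binary forms\<close>

text \<open>Homogenization of \<open>p\<close> in degree \<open>n\<close>. It lets products of
  binary linear forms be computed as products of polynomials in one variable.\<close>

definition hom_eval :: "nat \<Rightarrow> complex poly \<Rightarrow> complex \<Rightarrow> complex \<Rightarrow> complex" where
  "hom_eval n p X Y = (\<Sum>i\<le>n. coeff p i * X ^ (n - i) * Y ^ i)"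

lemma hom_eval_linear_factor:
  assumes "degree p \<le> n"
  shows "hom_eval (Suc n) ([:a, c:] * p) X Y = (a * X + c * Y) * hom_eval n p X Y"
proof -
  have co: "coeff ([:a, c:] * p) i = a * coeff p i + (if i = 0 then 0 else c * coeff p (i - 1))" for i
    by (simp add: coeff_pCons split: nat.split)
  have z: "coeff p (Suc n) = 0" using assms by (simp add: coeff_eq_0)
  have "hom_eval (Suc n) ([:a, c:] * p) X Y =
      (\<Sum>i\<le>Suc n. a * coeff p i * X ^ (Suc n - i) * Y ^ i) +
      (\<Sum>i\<le>Suc n. (if i = 0 then 0 else c * coeff p (i - 1)) * X ^ (Suc n - i) * Y ^ i)"
    unfolding hom_eval_def co by (simp only: distrib_right sum.distrib)
  also have "(\<Sum>i\<le>Suc n. a * coeff p i * X ^ (Suc n - i) * Y ^ i) = a * X * hom_eval n p X Y"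
    unfolding hom_eval_def sum_distrib_left by (simp add: z Suc_diff_le algebra_simps)
  also have "(\<Sum>i\<le>Suc n. (if i = 0 then 0 else c * coeff p (i - 1)) * X ^ (Suc n - i) * Y ^ i) =
      c * Y * hom_eval n p X Y"
    unfolding hom_eval_def sum_distrib_left sum.atMost_Suc_shift by (simp add: algebra_simps)
  finally show ?thesis by (simp add: algebra_simps)
qed

lemma hom_eval_power_factor:
  assumes "degree p \<le> n"
  shows "hom_eval (m + n) ([:a, c:] ^ m * p) X Y = (a * X + c * Y) ^ m * hom_eval n p X Y \<and>
    degree ([:a, c:] ^ m * p) \<le> m + n"
proof (induction m)
  case (Suc m)
  have "[:a, c:] ^ Suc m * p = [:a, c:] * ([:a, c:] ^ m * p)" by (simp only: power_Suc mult.assoc)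
  moreover have "degree ([:a, c:] * ([:a, c:] ^ m * p)) \<le> Suc (m + n)"
  proof -
    have "degree [:a, c:] \<le> 1" by simp
    then show ?thesis using degree_mult_le[of "[:a, c:]" "[:a, c:] ^ m * p"] Suc by linarith
  qed
  ultimately show ?case
    using Suc hom_eval_linear_factor[of "[:a, c:] ^ m * p" "m + n" a c X Y] by (simp only: add_Suc power_Suc mult.assoc)
qed (use assms in simp)

lemma hom_eval_product:
  assumes "j \<le> k"
  shows "hom_eval k ([:a, c:] ^ (k - j) * [:b, d:] ^ j) X Y = (a * X + c * Y) ^ (k - j) * (b * X + d * Y) ^ j"
proof -
  have 1: "hom_eval 0 1 X Y = 1" by (simp add: hom_eval_def)
  have "hom_eval (j + 0) ([:b, d:] ^ j * 1) X Y = (b * X + d * Y) ^ j * hom_eval 0 1 X Y \<and>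
    degree ([:b, d:] ^ j * 1) \<le> j + 0"
    by (rule hom_eval_power_factor) simp
  then have j: "hom_eval j ([:b, d:] ^ j) X Y = (b * X + d * Y) ^ j" "degree ([:b, d:] ^ j) \<le> j"
    using 1 by simp_all
  show ?thesis
    using hom_eval_power_factor[OF j(2), of "k - j" a c X Y] assms j(1) by simp
qed

text \<open>The matrix of \<open>g\<close> on the symmetric power in the monomial basis: column
  \<open>j\<close> lists the coefficients of the image of \<open>x^(k-m) y^m\<close>,
  \<open>m\<close> being \<open>\<iota> j\<close>, written as a polynomial in \<open>y\<close> with
  \<open>x = 1\<close>.\<close>

definition rho :: "('n::finite \<Rightarrow> nat) \<Rightarrow> nat \<Rightarrow> complex^2^2 \<Rightarrow> complex^'n^'n" where
  "rho \<iota> k g = (\<chi> i j. coeff ([:g $ 1 $ 1, g $ 2 $ 1:] ^ (k - \<iota> j) * [:g $ 1 $ 2, g $ 2 $ 2:] ^ \<iota> j) (\<iota> i))"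

text \<open>The point over \<open>\<xi>\<close> on the affine cone of the rational normal curve.
  Matrix and tensor identities are tested on these vectors.\<close>

definition mvec :: "('n::finite \<Rightarrow> nat) \<Rightarrow> nat \<Rightarrow> complex^2 \<Rightarrow> complex^'n" where
  "mvec \<iota> k \<xi> = (\<chi> i. (\<xi> $ 1) ^ (k - \<iota> i) * (\<xi> $ 2) ^ \<iota> i)"

definition form :: "('n::finite \<Rightarrow> nat) \<Rightarrow> nat \<Rightarrow> complex^'n \<Rightarrow> complex^2 \<Rightarrow> complex" where
  "form \<iota> k u \<xi> = (\<Sum>i\<in>UNIV. u $ i * mvec \<iota> k \<xi> $ i)"

locale index =
  fixes \<iota> :: "'n::finite \<Rightarrow> nat" and k :: nat
  assumes bij: "bij_betw \<iota> (UNIV :: 'n set) {..k}"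
begin

lemma index_le: "\<iota> i \<le> k" and index_inj: "\<iota> i = \<iota> j \<longleftrightarrow> i = j"
  and index_surj: "m \<le> k \<Longrightarrow> \<exists>i. \<iota> i = m" and index_card: "CARD('n) = Suc k"
  using bij_index[OF bij] by auto

lemma sum_index: "(\<Sum>i\<in>UNIV. f (\<iota> i)) = (\<Sum>m\<le>k. f m)"
  by (rule sum.reindex_bij_betw[OF bij])

lemma transpose2: "(transpose g *v \<xi>) $ 1 = g $ 1 $ 1 * \<xi> $ 1 + g $ 2 $ 1 * \<xi> $ 2"
  "(transpose g *v \<xi>) $ 2 = g $ 1 $ 2 * \<xi> $ 1 + g $ 2 $ 2 * \<xi> $ 2"
  for g :: "complex^2^2"
  by (simp_all add: matrix_vector_mult_def transpose_def sum_2)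

text \<open>Since the vectors \<open>mvec\<close> separate, this identity characterizes
  \<open>rho\<close>. Multiplicativity and the other properties follow from it without any
  manipulation of binomial sums.\<close>

lemma rho_mvec: "transpose (rho \<iota> k g) *v mvec \<iota> k \<xi> = mvec \<iota> k (transpose g *v \<xi>)"
proof -
  have "(\<Sum>i\<in>UNIV. rho \<iota> k g $ i $ j * mvec \<iota> k \<xi> $ i) = mvec \<iota> k (transpose g *v \<xi>) $ j" for j
  proof -
    let ?p = "[:g $ 1 $ 1, g $ 2 $ 1:] ^ (k - \<iota> j) * [:g $ 1 $ 2, g $ 2 $ 2:] ^ \<iota> j"
    have "(\<Sum>i\<in>UNIV. rho \<iota> k g $ i $ j * mvec \<iota> k \<xi> $ i) =
      (\<Sum>i\<in>UNIV. coeff ?p (\<iota> i) * (\<xi> $ 1) ^ (k - \<iota> i) * (\<xi> $ 2) ^ \<iota> i)"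
      by (simp add: rho_def mvec_def mult.assoc)
    also have "\<dots> = hom_eval k ?p (\<xi> $ 1) (\<xi> $ 2)"
      unfolding hom_eval_def by (rule sum_index)
    also have "\<dots> = mvec \<iota> k (transpose g *v \<xi>) $ j"
      unfolding hom_eval_product[OF index_le] by (simp add: mvec_def transpose2)
    finally show ?thesis .
  qed
  then show ?thesis by (simp add: vec_eq_iff matrix_vector_mult_def transpose_def)
qed

lemma form_rho: "form \<iota> k (rho \<iota> k g *v u) \<xi> = form \<iota> k u (transpose g *v \<xi>)"
proof -
  have "form \<iota> k (rho \<iota> k g *v u) \<xi> = (\<Sum>i\<in>UNIV. mvec \<iota> k \<xi> $ i * (rho \<iota> k g *v u) $ i)"
    by (simp add: form_def mult.commute)
  then show ?thesis unfolding dot_matrix rho_mvec by (simp add: form_def mult.commute)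
qed

text \<open>At \<open>\<xi> = (1, x)\<close> the hypothesis is a polynomial identity in
  \<open>x\<close> with coefficients \<open>u i\<close>.\<close>

lemma mvec_separates:
  assumes "\<And>\<xi>. (\<Sum>i\<in>UNIV. u i * mvec \<iota> k \<xi> $ i) = (0::complex)"
  shows "u i = 0"
proof -
  obtain e where e: "\<And>m. m \<le> k \<Longrightarrow> \<iota> (e m) = m" using index_surj by metis
  have ei: "e (\<iota> i) = i" for i using e[OF index_le[of i]] index_inj by simp
  have "(\<Sum>m\<le>k. u (e m) * x ^ m) = 0" for x
  proof -
    have "(\<Sum>m\<le>k. u (e m) * x ^ m) = (\<Sum>i\<in>UNIV. u (e (\<iota> i)) * x ^ \<iota> i)" by (rule sum_index[symmetric])
    also have "\<dots> = (\<Sum>i\<in>UNIV. u i * mvec \<iota> k (vector [1, x]) $ i)" by (simp add: ei mvec_def)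
    finally show ?thesis using assms by simp
  qed
  then have "\<forall>m\<le>k. u (e m) = 0"
    using polyfun_eq_0[of "\<lambda>m. u (e m)" k] by simp
  then show ?thesis using index_le ei by metis
qed

lemma form_inj: "(\<And>\<xi>. form \<iota> k u \<xi> = form \<iota> k v \<xi>) \<Longrightarrow> u = v"
  using mvec_separates[of "\<lambda>i. u $ i - v $ i"]
  by (simp add: form_def vec_eq_iff left_diff_distrib sum_subtractf)

lemma rho_mult: "rho \<iota> k (g ** h) = rho \<iota> k g ** rho \<iota> k h"
proof -
  have "rho \<iota> k (g ** h) *v u = (rho \<iota> k g ** rho \<iota> k h) *v u" for u
    by (rule form_inj)
      (simp only: form_rho matrix_transpose_mul matrix_vector_mul_assoc[symmetric])
  then show ?thesis by (simp add: matrix_eq)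
qed

lemma rho_one: "rho \<iota> k (mat 1) = mat 1"
proof -
  have "rho \<iota> k (mat 1) *v u = mat 1 *v u" for u
    by (rule form_inj) (simp only: form_rho transpose_mat matrix_vector_mul_lid)
  then show ?thesis by (simp add: matrix_eq)
qed

end

text \<open>Polynomial dependence on \<open>g\<close> is the source of continuity, of derivatives
  along polynomial curves and of regularity in the sense of algebraic groups. The predicate
  \<open>reg\<close> carries it through products and powers of polynomials.\<close>

lemma rho_regular: "(\<lambda>g. rho \<iota> k g $ i $ j) \<in> generated_algebra {\<lambda>g. g $ i $ j | i j. True}"
proof -
  let ?R = "generated_algebra {\<lambda>g::complex^2^2. g $ i $ j | i j. True}"
  define reg where "reg p \<longleftrightarrow> (\<forall>m. (\<lambda>g. coeff (p g) m) \<in> ?R)" for p :: "complex^2^2 \<Rightarrow> complex poly"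
  have sum: "(\<lambda>g. \<Sum>x\<in>S. f x g) \<in> ?R" if "finite S" "\<And>x. x \<in> S \<Longrightarrow> f x \<in> ?R" for S :: "nat set" and f
    using that
  proof (induction S)
    case empty
    then show ?case using generated_algebra.const[of 0] by simp
  next
    case (insert x S)
    then show ?case using generated_algebra.add[of "f x" _ "\<lambda>g. \<Sum>x\<in>S. f x g"] by simp
  qed
  have mult: "reg (\<lambda>g. p g * q g)" if "reg p" "reg q" for p q
    using that unfolding reg_def coeff_mult by (intro allI sum generated_algebra.mult) auto
  have power: "reg (\<lambda>g. p g ^ n)" if "reg p" for p n
  proof (induction n)
    case 0
    show ?case unfolding reg_def by (simp add: generated_algebra.const)
  next
    case (Suc n)
    then show ?case using mult[OF that] by simp
  qed
  have lin: "reg (\<lambda>g. [:g $ a $ b, g $ c $ d:])" for a b c d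
    unfolding reg_def
  proof
    fix m
    have "(\<lambda>g. g $ a $ b) \<in> ?R" "(\<lambda>g. g $ c $ d) \<in> ?R" by (auto intro!: generated_algebra.gen)
    then show "(\<lambda>g. coeff [:g $ a $ b, g $ c $ d:] m) \<in> ?R"
      by (cases m; cases "m - 1") (auto simp: coeff_pCons generated_algebra.const)
  qed
  show ?thesis
    using mult[OF power[OF lin] power[OF lin]] unfolding reg_def rho_def by simp
qed

section \<open>One-parameter groups\<close>

lemma matrix_mult_zero: "M ** 0 = 0" for M :: "complex^'n^'m"
  by (simp add: vec_eq_iff matrix_matrix_mult_def)

definition mderiv :: "(complex \<Rightarrow> complex^'n^'m) \<Rightarrow> complex^'n^'m \<Rightarrow> complex \<Rightarrow> bool" where
  "mderiv F D t \<longleftrightarrow> (\<forall>i j. ((\<lambda>s. F s $ i $ j) has_field_derivative D $ i $ j) (at t))"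

lemma mderiv_const: "mderiv (\<lambda>_. C) 0 t"
  by (simp add: mderiv_def)

lemma mderiv_mult:
  fixes F :: "complex \<Rightarrow> complex^'n^'m" and G :: "complex \<Rightarrow> complex^'l^'n"
  assumes "mderiv F D t" "mderiv G E t"
  shows "mderiv (\<lambda>s. F s ** G s) (D ** G t + F t ** E) t"
  using assms unfolding mderiv_def matrix_matrix_mult_def
  by (auto intro!: derivative_eq_intros simp: sum.distrib mult.commute)

lemma mderiv_unique: "mderiv F D t \<Longrightarrow> mderiv F E t \<Longrightarrow> D = E"
  unfolding mderiv_def vec_eq_iff using DERIV_unique by blast

text \<open>Stands for \<open>exp (t N)\<close>. The exponential series is never formed: all groups
  considered have polynomial entries.\<close>

definition one_param :: "(complex \<Rightarrow> complex^'n^'n) \<Rightarrow> complex^'n^'n \<Rightarrow> bool" where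
  "one_param F N \<longleftrightarrow> F 0 = mat 1 \<and> (\<forall>s t. F (s + t) = F s ** F t) \<and> mderiv F N 0"

lemma one_param_deriv:
  assumes "one_param F N"
  shows "mderiv F (F t ** N) t"
proof -
  have "mderiv (\<lambda>s. F t ** F s) (0 ** F 0 + F t ** N) 0"
    using assms by (intro mderiv_mult mderiv_const) (simp add: one_param_def)
  moreover have "F t ** F s = F (s + t)" for s using assms by (simp add: one_param_def add.commute[of s])
  ultimately have "mderiv (\<lambda>s. F (s + t)) (F t ** N) 0" by (simp add: matrix_zero_mult)
  then show ?thesis unfolding mderiv_def using DERIV_at_within_shift[of _ _ t 0 UNIV] by (simp add: add.commute)
qed

lemma mderiv_zero_const:
  assumes "\<And>t. mderiv F 0 t"
  shows "F s = F t"
proof -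
  have "F s $ i $ j = F t $ i $ j" for i j
  proof -
    have "((\<lambda>s. F s $ i $ j) has_field_derivative 0) (at x within UNIV)" for x
      using assms unfolding mderiv_def by simp
    then obtain c where "\<And>x. F x $ i $ j = c"
      using has_field_derivative_zero_constant[of UNIV "\<lambda>s. F s $ i $ j"] by auto
    then show ?thesis by simp
  qed
  then show ?thesis by (simp add: vec_eq_iff)
qed

text \<open>The product of \<open>F t\<close> and \<open>G (- t)\<close> has derivative zero,
  because \<open>N\<close> commutes with both groups; hence it is constantly the identity.\<close>

lemma one_param_unique:
  assumes F: "one_param F N" and G: "one_param G N"
  shows "F t = G t"
proof -
  have comm: "F t ** N = N ** F t" if F: "one_param F N" for F t
  proof -
    have "mderiv (\<lambda>s. F s ** F t) (N ** F t + F 0 ** 0) 0"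
      using that by (intro mderiv_mult mderiv_const) (simp add: one_param_def)
    moreover have "F s ** F t = F (s + t)" for s using F by (simp add: one_param_def)
    ultimately have 1: "mderiv (\<lambda>s. F (s + t)) (N ** F t) 0" by (simp add: matrix_mult_zero)
    have "mderiv (\<lambda>s. F (s + t)) (F t ** N) 0"
      using one_param_deriv[OF F, of t] unfolding mderiv_def using DERIV_at_within_shift[of _ _ t 0 UNIV]
      by (simp add: add.commute)
    then show ?thesis using 1 mderiv_unique by blast
  qed
  have neg: "mderiv (\<lambda>s. G (- s)) (- (N ** G (- t))) t" for t
  proof -
    have "((\<lambda>s. G (- s) $ i $ j) has_field_derivative ((N ** G (- t)) $ i $ j * (- 1))) (at t)" for i j
      using one_param_deriv[OF G, of "- t"] comm[OF G, of "- t"] unfolding mderiv_def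
      by (intro DERIV_chain2[of "\<lambda>s. G s $ i $ j"]) (auto intro!: derivative_eq_intros)
    then show ?thesis unfolding mderiv_def by simp
  qed
  have "mderiv (\<lambda>s. F s ** G (- s)) ((F t ** N) ** G (- t) + F t ** (- (N ** G (- t)))) t" for t
    by (rule mderiv_mult[OF one_param_deriv[OF F] neg])
  then have "mderiv (\<lambda>s. F s ** G (- s)) 0 t" for t
    by (simp add: matrix_mul_uminus matrix_mul_assoc)
  then have "F t ** G (- t) = F 0 ** G (- 0)" by (rule mderiv_zero_const)
  then have "F t ** G (- t) = mat 1" using F G by (simp add: one_param_def)
  moreover have "G (- t) ** G t = mat 1"
    using G unfolding one_param_def by (metis add.left_inverse)
  ultimately show ?thesis by (metis matrix_mul_assoc matrix_mul_lid matrix_mul_rid)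
qed

section \<open>Polynomial one-parameter groups through unipotent matrices\<close>

abbreviation pf :: "(complex \<Rightarrow> complex) set" where
  "pf \<equiv> generated_algebra {\<lambda>t. t}"

lemma generated_algebra_sum:
  "finite S \<Longrightarrow> (\<And>x. x \<in> S \<Longrightarrow> f x \<in> generated_algebra L) \<Longrightarrow> (\<lambda>g. \<Sum>x\<in>S. f x g) \<in> generated_algebra L"
proof (induction S rule: finite_induct)
  case empty
  then show ?case using generated_algebra.const[of 0] by simp
next
  case (insert x S)
  then show ?case using generated_algebra.add[of "f x" _ "\<lambda>g. \<Sum>x\<in>S. f x g"] by simp
qed

lemma pf_iff_poly: "f \<in> pf \<Longrightarrow> \<exists>p. \<forall>t. f t = poly p t"
  by (erule generated_algebra_poly_comp[where f = "\<lambda>t. t"]) (auto intro!: exI[of _ "[:0, 1:]"])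

lemma poly_pf: "poly p \<in> pf"
proof (induction p)
  case 0
  then show ?case using generated_algebra.const[of 0] by simp
next
  case (pCons a p)
  have "(\<lambda>t. a + t * poly p t) \<in> pf"
    by (intro generated_algebra.add generated_algebra.mult generated_algebra.const pCons generated_algebra.gen) simp
  then show ?case by (simp add: fun_eq_iff)
qed

lemma pf_shift: "f \<in> pf \<Longrightarrow> (\<lambda>t. f (t + c)) \<in> pf"
proof (induction rule: generated_algebra.induct)
  case (gen l)
  have "(\<lambda>t. t + c) \<in> pf"
    by (rule generated_algebra.add[OF generated_algebra.gen generated_algebra.const]) simp
  then show ?case using gen by simp
qed (auto intro: generated_algebra.intros)

text \<open>The device that extends identities between powers of a unipotent matrix, known for
  natural exponents, to complex exponents.\<close>

lemma pf_zero:
  assumes "f \<in> pf" "\<And>n::nat. f (of_nat n) = 0"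
  shows "f t = 0"
proof -
  obtain p where p: "\<And>t. f t = poly p t" using pf_iff_poly[OF assms(1)] by auto
  have "range (of_nat :: nat \<Rightarrow> complex) \<subseteq> {t. poly p t = 0}" using assms(2) p by auto
  moreover have "infinite (range (of_nat :: nat \<Rightarrow> complex))" by (simp add: finite_image_iff inj_of_nat)
  ultimately have "p = 0" using poly_roots_finite finite_subset by blast
  then show ?thesis by (simp add: p)
qed

lemma pf_mderiv:
  assumes "\<And>i j. (\<lambda>t. F t $ i $ j) \<in> pf"
  shows "\<exists>D. mderiv F D t"
proof -
  have "\<exists>d. ((\<lambda>t. F t $ i $ j) has_field_derivative d) (at t)" for i j
  proof -
    obtain p where "\<forall>t. F t $ i $ j = poly p t" using pf_iff_poly[OF assms] by blast
    then have "(\<lambda>t. F t $ i $ j) = poly p" by (simp add: fun_eq_iff)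
    then show ?thesis by (simp only:) (rule exI, rule poly_DERIV)
  qed
  then obtain d where "\<And>i j. ((\<lambda>t. F t $ i $ j) has_field_derivative d i j) (at t)" by metis
  then show ?thesis by (intro exI[of _ "\<chi> i j. d i j"]) (simp add: mderiv_def)
qed

lemma mpow_add: "mpow g (m + n) = mpow g m ** mpow g n"
  by (induction m) (simp_all add: mpow_Suc matrix_mul_assoc)

text \<open>The entries of \<open>F t ** mpow N m\<close> are the \<open>m\<close>-th derivatives of
  the entries of \<open>F\<close>, so they vanish once \<open>m\<close> exceeds all degrees.
  Evaluation at \<open>t = 0\<close> leaves the power of \<open>N\<close> alone.\<close>

lemma poly_one_param_nilp:
  fixes F :: "complex \<Rightarrow> complex^'n::finite^'n"
  assumes F: "one_param F N" and pf: "\<And>i j. (\<lambda>t. F t $ i $ j) \<in> pf"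
  shows "nilp ((*v) N)"
proof -
  have "\<forall>i j. \<exists>p. \<forall>t. F t $ i $ j = poly p t" using pf_iff_poly[OF pf] by blast
  then obtain p where p: "\<And>i j t. F t $ i $ j = poly (p i j) t" by metis
  have "(F t ** mpow N m) $ i $ j = poly ((pderiv ^^ m) (p i j)) t" for m t i j
  proof (induction m arbitrary: t)
    case 0
    then show ?case by (simp add: p)
  next
    case (Suc m)
    have "mderiv (\<lambda>s. F s ** mpow N m) ((F t ** N) ** mpow N m + F t ** 0) t"
      by (rule mderiv_mult[OF one_param_deriv[OF F] mderiv_const])
    then have "((\<lambda>s. (F s ** mpow N m) $ i $ j) has_field_derivative (F t ** mpow N (Suc m)) $ i $ j) (at t)"
      unfolding mderiv_def by (simp add: matrix_mult_zero mpow_Suc matrix_mul_assoc)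
    then have "((\<lambda>s. poly ((pderiv ^^ m) (p i j)) s) has_field_derivative (F t ** mpow N (Suc m)) $ i $ j) (at t)"
      by (simp only: Suc)
    moreover have "((\<lambda>s. poly ((pderiv ^^ m) (p i j)) s) has_field_derivative poly (pderiv ((pderiv ^^ m) (p i j))) t) (at t)"
      by (rule poly_DERIV)
    ultimately show ?case by (simp add: DERIV_unique)
  qed
  from this[of 0] have e: "mpow N m $ i $ j = poly ((pderiv ^^ m) (p i j)) 0" for m i j
    using F by (simp add: one_param_def)
  define m where "m = Suc (Max (range (\<lambda>(i, j). degree (p i j))))"
  have "mpow N m $ i $ j = 0" for i j
  proof -
    have "degree (p i j) \<le> Max (range (\<lambda>(i, j). degree (p i j)))" by (rule Max_ge) auto
    then have "degree (p i j) < m" by (simp add: m_def)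
    moreover have "degree q < n \<Longrightarrow> (pderiv ^^ n) q = 0" for q :: "complex poly" and n
    proof (induction n arbitrary: q)
      case (Suc n)
      show ?case
      proof (cases "degree q = 0")
        case True
        then have "pderiv q = 0" by (simp add: pderiv_eq_0_iff)
        moreover have "(pderiv ^^ n) 0 = (0 :: complex poly)" by (induction n) (simp_all)
        ultimately show ?thesis by (simp add: funpow_swap1)
      next
        case False
        then have "degree (pderiv q) < n" using Suc.prems by (simp add: degree_pderiv)
        then show ?thesis using Suc.IH by (simp add: funpow_swap1)
      qed
    qed simp
    ultimately show ?thesis by (simp add: e)
  qed
  then have "mpow N m = 0" by (simp add: vec_eq_iff)
  then show ?thesis unfolding nilp_iff_mpow by (rule exI)
qed

lemma gchoose_pf: "(\<lambda>t::complex. t gchoose s) \<in> pf"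
proof -
  have "(\<lambda>t::complex. t gchoose s) = poly (smult (1 / fact s) (\<Prod>i = 0..<s. [:- of_nat i, 1:]))"
    by (simp add: fun_eq_iff gbinomial_prod_rev poly_prod field_simps)
  then show ?thesis by (simp only: poly_pf)
qed

lemma matrix_diff_mult: "(A - B) ** C = A ** C - B ** C" for A B :: "complex^'n^'m"
  by (simp add: vec_eq_iff matrix_matrix_mult_def left_diff_distrib sum_subtractf)

text \<open>The binomial series of \<open>(1 + \<nu>)^t\<close> with
  \<open>\<nu> = g - mat 1\<close> terminates, and its entries are polynomials in \<open>t\<close>.
  Pascal's rule identifies its values at natural numbers with the powers of
  \<open>g\<close>.\<close>

lemma unipotent_one_param:
  fixes g :: "complex^'n::finite^'n"
  assumes "nilp ((*v) (g - mat 1))"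
  shows "\<exists>F N. one_param F N \<and> (\<forall>i j. (\<lambda>t. F t $ i $ j) \<in> pf) \<and> (\<forall>n::nat. F (of_nat n) = mpow g n) \<and> nilp ((*v) N)"
proof -
  let ?\<nu> = "g - mat 1"
  obtain K where K0: "mpow ?\<nu> K = 0" using assms unfolding nilp_iff_mpow by blast
  then have K: "mpow ?\<nu> (Suc K) = 0" by (simp add: mpow_Suc matrix_mult_zero)
  define F where "F t = (\<chi> i j. \<Sum>s\<le>K. (t gchoose s) * mpow ?\<nu> s $ i $ j)" for t
  have pfF: "(\<lambda>t. F t $ i $ j) \<in> pf" for i j
    by (simp add: F_def, intro generated_algebra_sum generated_algebra.mult gchoose_pf generated_algebra.const) simp
  have nat: "F (of_nat n) = mpow g n" for n :: nat
  proof (induction n)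
    case 0
    have "F 0 $ i $ j = (mat 1) $ i $ j" for i j
    proof -
      have "F 0 $ i $ j = (\<Sum>s\<le>K. if s = 0 then (mat 1 :: complex^'n^'n) $ i $ j else 0)"
        unfolding F_def vec_lambda_beta
      proof (rule sum.cong[OF refl])
        fix s show "(0 gchoose s) * mpow ?\<nu> s $ i $ j = (if s = 0 then (mat 1 :: complex^'n^'n) $ i $ j else 0)"
          by (cases s) simp_all
      qed
      then show ?thesis by simp
    qed
    then show ?case by (simp add: vec_eq_iff)
  next
    case (Suc n)
    have step: "(of_nat (Suc n) gchoose s :: complex) = (of_nat n gchoose s) + (if s = 0 then 0 else of_nat n gchoose (s - 1))" for s
      using gbinomial_Suc_Suc[of "of_nat n :: complex"] by (cases s) (simp_all add: add.commute)
    have "(?\<nu> ** F (of_nat n)) $ i $ j = (\<Sum>s\<le>K. (of_nat n gchoose s) * mpow ?\<nu> (Suc s) $ i $ j)" for i j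
    proof -
      have "(?\<nu> ** F (of_nat n)) $ i $ j = (\<Sum>l\<in>UNIV. \<Sum>s\<le>K. (of_nat n gchoose s) * (?\<nu> $ i $ l * mpow ?\<nu> s $ l $ j))"
        unfolding matrix_matrix_mult_def F_def by (simp add: sum_distrib_left mult_ac)
      also have "\<dots> = (\<Sum>s\<le>K. \<Sum>l\<in>UNIV. (of_nat n gchoose s) * (?\<nu> $ i $ l * mpow ?\<nu> s $ l $ j))"
        by (rule sum.swap)
      also have "\<dots> = (\<Sum>s\<le>K. (of_nat n gchoose s) * mpow ?\<nu> (Suc s) $ i $ j)"
        unfolding mpow_Suc matrix_matrix_mult_def by (simp add: sum_distrib_left)
      finally show ?thesis .
    qed
    moreover have "(\<Sum>s\<le>K. (of_nat n gchoose s) * mpow ?\<nu> (Suc s) $ i $ j) =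
        (\<Sum>s\<le>K. (if s = 0 then 0 else of_nat n gchoose (s - 1)) * mpow ?\<nu> s $ i $ j)" for i j
    proof -
      have "(\<Sum>s\<le>Suc K. (if s = 0 then 0 else of_nat n gchoose (s - 1)) * mpow ?\<nu> s $ i $ j) =
        (\<Sum>s\<le>K. (of_nat n gchoose s) * mpow ?\<nu> (Suc s) $ i $ j)"
        unfolding sum.atMost_Suc_shift by simp
      then show ?thesis using K by simp
    qed
    ultimately have "F (of_nat (Suc n)) = F (of_nat n) + ?\<nu> ** F (of_nat n)"
      by (simp add: vec_eq_iff, simp add: F_def step[simplified] distrib_right sum.distrib)
    also have "\<dots> = g ** F (of_nat n)"
      by (simp add: matrix_diff_mult)
    finally show ?case using Suc by (simp add: mpow_Suc)
  qed
  have F0: "F 0 = mat 1" using nat[of 0] by simp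
  \<comment> \<open>Additivity is extended one variable at a time: first with a natural second
    argument, then with an arbitrary one.\<close>
  have add1: "F (t + of_nat n) = F t ** F (of_nat n)" for t and n :: nat
  proof -
    have "F (t + of_nat n) $ i $ j - (F t ** F (of_nat n)) $ i $ j = 0" for i j
    proof (rule pf_zero[where f = "\<lambda>t. F (t + of_nat n) $ i $ j - (F t ** F (of_nat n)) $ i $ j" and t = t])
      show "(\<lambda>t. F (t + of_nat n) $ i $ j - (F t ** F (of_nat n)) $ i $ j) \<in> pf"
      proof -
        have "(\<lambda>t. F (t + of_nat n) $ i $ j + (- 1) * (\<Sum>l\<in>UNIV. F t $ i $ l * F (of_nat n) $ l $ j)) \<in> pf"
          by (intro generated_algebra.add generated_algebra.mult generated_algebra.const generated_algebra_sum pfF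
              pf_shift[where f = "\<lambda>t. F t $ i $ j"]) simp
        then show ?thesis by (simp add: matrix_matrix_mult_def)
      qed
      show "F (of_nat m + of_nat n) $ i $ j - (F (of_nat m) ** F (of_nat n)) $ i $ j = 0" for m
        using nat[of "m + n"] nat[of m] nat[of n] by (simp add: mpow_add)
    qed
    then show ?thesis by (simp add: vec_eq_iff)
  qed
  have add2: "F (s + t) = F s ** F t" for s t
  proof -
    have "F (s + t) $ i $ j - (F s ** F t) $ i $ j = 0" for i j
    proof (rule pf_zero[where f = "\<lambda>t. F (s + t) $ i $ j - (F s ** F t) $ i $ j" and t = t])
      show "(\<lambda>t. F (s + t) $ i $ j - (F s ** F t) $ i $ j) \<in> pf"
      proof -
        have "(\<lambda>t. F (t + s) $ i $ j + (- 1) * (\<Sum>l\<in>UNIV. F s $ i $ l * F t $ l $ j)) \<in> pf"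
          by (intro generated_algebra.add generated_algebra.mult generated_algebra.const generated_algebra_sum pfF
              pf_shift[where f = "\<lambda>t. F t $ i $ j"]) simp
        then show ?thesis by (simp add: matrix_matrix_mult_def add.commute)
      qed
      show "F (s + of_nat m) $ i $ j - (F s ** F (of_nat m)) $ i $ j = 0" for m
        by (simp add: add1)
    qed
    then show ?thesis by (simp add: vec_eq_iff)
  qed
  obtain N where "mderiv F N 0" using pf_mderiv[OF pfF] by blast
  then have "one_param F N" using F0 add2 by (simp add: one_param_def)
  then show ?thesis using pfF nat poly_one_param_nilp by blast
qed

lemma tensor_act_deriv:
  assumes "mderiv F0 D0 t" "mderiv F1 D1 t" "mderiv F2 D2 t"
  shows "((\<lambda>s. tensor_act (F0 s, F1 s, F2 s) A $ i $ j $ l) has_field_derivative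
    (tensor_act (D0, F1 t, F2 t) A + tensor_act (F0 t, D1, F2 t) A + tensor_act (F0 t, F1 t, D2) A) $ i $ j $ l) (at t)"
  using assms unfolding mderiv_def
  by (auto intro!: derivative_eq_intros simp: tensor_act.simps sum.distrib algebra_simps)

lemma tensor_act_add: "tensor_act g (A + B) = tensor_act g A + tensor_act g B"
  by (cases g, rule contr_ext) (simp add: contr_tensor_act contr_add vec.add)

lemma lie_act_tensor_act:
  "lie_act (X0, X1, X2) A = tensor_act (X0, mat 1, mat 1) A + tensor_act (mat 1, X1, mat 1) A + tensor_act (mat 1, mat 1, X2) A"
  by (rule contr_ext) (simp add: lie_act.simps contr_add contr_tensor_act contr_mode0 contr_mode1 contr_mode2 transpose_mat)

lemma one_param_tensor_deriv:
  assumes F: "one_param F0 N0" "one_param F1 N1" "one_param F2 N2"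
  shows "((\<lambda>s. tensor_act (F0 s, F1 s, F2 s) A $ i $ j $ l) has_field_derivative
    tensor_act (F0 t, F1 t, F2 t) (lie_act (N0, N1, N2) A) $ i $ j $ l) (at t)"
proof -
  have *: "tensor_act (F0 t, F1 t, F2 t) (lie_act (N0, N1, N2) A) =
    tensor_act (F0 t ** N0, F1 t, F2 t) A + tensor_act (F0 t, F1 t ** N1, F2 t) A + tensor_act (F0 t, F1 t, F2 t ** N2) A"
    unfolding lie_act_tensor_act tensor_act_add tensor_act_mult[symmetric] by simp
  show ?thesis
    unfolding * by (rule tensor_act_deriv[OF one_param_deriv[OF F(1)] one_param_deriv[OF F(2)] one_param_deriv[OF F(3)]])
qed

lemma one_param_stabilizes:
  assumes F: "one_param F0 N0" "one_param F1 N1" "one_param F2 N2" and N: "lie_act (N0, N1, N2) A = 0"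
  shows "tensor_act (F0 t, F1 t, F2 t) A = A"
proof -
  have 0: "tensor_act g 0 = 0" for g :: "('a, 'b, 'c) triple"
    by (cases g, rule contr_ext) (simp add: contr_tensor_act contr_0)
  have "tensor_act (F0 t, F1 t, F2 t) A $ i $ j $ l = A $ i $ j $ l" for i j l
  proof -
    have "((\<lambda>s. tensor_act (F0 s, F1 s, F2 s) A $ i $ j $ l) has_field_derivative 0) (at s within UNIV)" for s
      using one_param_tensor_deriv[OF F, where A = A and i = i and j = j and l = l and t = s] by (simp add: N 0)
    then obtain c where c: "\<And>s. tensor_act (F0 s, F1 s, F2 s) A $ i $ j $ l = c"
      using has_field_derivative_zero_constant[of UNIV "\<lambda>s. tensor_act (F0 s, F1 s, F2 s) A $ i $ j $ l"] by auto
    from c[of 0] have "A $ i $ j $ l = c" using F by (simp add: one_param_def tensor_act_one)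
    then show ?thesis using c by simp
  qed
  then show ?thesis by (simp add: vec_eq_iff)
qed

lemma one_param_lie_act:
  assumes F: "one_param F0 N0" "one_param F1 N1" "one_param F2 N2"
    and s: "\<And>t. tensor_act (F0 t, F1 t, F2 t) A = A"
  shows "lie_act (N0, N1, N2) A = 0"
proof -
  have "lie_act (N0, N1, N2) A $ i $ j $ l = 0" for i j l
  proof -
    have "((\<lambda>s. A $ i $ j $ l) has_field_derivative lie_act (N0, N1, N2) A $ i $ j $ l) (at 0)"
      using one_param_tensor_deriv[OF F, where A = A and i = i and j = j and l = l and t = 0] F unfolding s
      by (simp add: one_param_def tensor_act_one)
    then show ?thesis using DERIV_unique[OF _ DERIV_const] by blast
  qed
  then show ?thesis by (simp add: vec_eq_iff)
qed

section \<open>The representation on binary forms\<close>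

definition mk :: "complex \<Rightarrow> complex \<Rightarrow> complex \<Rightarrow> complex \<Rightarrow> complex^2^2" where
  "mk a b c d = vector [vector [a, b], vector [c, d]]"

lemma mk_sel [simp]: "mk a b c d $ 1 $ 1 = a" "mk a b c d $ 1 $ 2 = b" "mk a b c d $ 2 $ 1 = c" "mk a b c d $ 2 $ 2 = d"
  by (simp_all add: mk_def)

lemma mk_eq: "g = mk (g $ 1 $ 1) (g $ 1 $ 2) (g $ 2 $ 1) (g $ 2 $ 2)"
  by (simp add: vec_eq_iff forall_2)

lemma mk_mult: "mk a b c d ** mk a' b' c' d' = mk (a * a' + b * c') (a * b' + b * d') (c * a' + d * c') (c * b' + d * d')"
  by (simp add: vec_eq_iff forall_2 matrix_matrix_mult_def sum_2)

lemma mk_one: "mat 1 = mk 1 0 0 1"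
  by (simp add: vec_eq_iff forall_2 mat_def)

lemma mk_inject: "mk a b c d = mk a' b' c' d' \<longleftrightarrow> a = a' \<and> b = b' \<and> c = c' \<and> d = d'"
  by (metis mk_sel)

lemma mk_in_SL: "mk a b c d \<in> SL \<longleftrightarrow> a * d - b * c = 1"
  by (simp add: SL_def det_2)

text \<open>The value at \<open>mk u v w (- u)\<close>, a general element of \<open>sl(2)\<close>,
  of the differential of \<open>rho\<close>; \<open>rho_mderiv\<close> justifies the
  formula.\<close>

definition drho :: "('n::finite \<Rightarrow> nat) \<Rightarrow> nat \<Rightarrow> complex \<Rightarrow> complex \<Rightarrow> complex \<Rightarrow> complex^'n^'n" where
  "drho \<iota> k u v w = (\<chi> i j. (if \<iota> i = \<iota> j then u * (of_nat k - 2 * of_nat (\<iota> j)) else 0) +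
     (if \<iota> j = Suc (\<iota> i) then v * of_nat (\<iota> j) else 0) + (if \<iota> i = Suc (\<iota> j) then w * (of_nat k - of_nat (\<iota> j)) else 0))"

lemma drho_jmat: "drho \<iota> k 0 1 0 = jmat \<iota>"
  by (simp add: drho_def jmat_def vec_eq_iff)

context index
begin

text \<open>The right-hand side is the derivative at zero, by the product rule, of the two powers of
  linear forms that \<open>rho\<close> produces along \<open>1 + s X\<close>;
  \<open>rho_mderiv\<close> compares it with the actual derivative.\<close>

lemma drho_mvec:
  "(\<Sum>i\<in>UNIV. drho \<iota> k u v w $ i $ j * mvec \<iota> k \<xi> $ i) =
    of_nat (k - \<iota> j) * (\<xi> $ 1) ^ (k - \<iota> j - 1) * (u * \<xi> $ 1 + w * \<xi> $ 2) * (\<xi> $ 2) ^ \<iota> j +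
    (\<xi> $ 1) ^ (k - \<iota> j) * (of_nat (\<iota> j) * (\<xi> $ 2) ^ (\<iota> j - 1) * (v * \<xi> $ 1 - u * \<xi> $ 2))"
proof -
  let ?x = "\<xi> $ 1" and ?y = "\<xi> $ 2"
  define J where "J = \<iota> j"
  have J: "J \<le> k" using index_le by (simp add: J_def)
  define f where "f m = ?x ^ (k - m) * ?y ^ m" for m
  have "(\<Sum>i\<in>UNIV. drho \<iota> k u v w $ i $ j * mvec \<iota> k \<xi> $ i) =
    (\<Sum>i\<in>UNIV. (if \<iota> i = J then u * (of_nat k - 2 * of_nat J) * f J else 0) +
      (if J = Suc (\<iota> i) then v * of_nat J * f (J - 1) else 0) +
      (if \<iota> i = Suc J then w * (of_nat k - of_nat J) * f (Suc J) else 0))"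
    by (rule sum.cong) (auto simp: drho_def mvec_def f_def J_def algebra_simps)
  also have "\<dots> = (\<Sum>m\<le>k. (if m = J then u * (of_nat k - 2 * of_nat J) * f J else 0) +
      (if J = Suc m then v * of_nat J * f (J - 1) else 0) +
      (if m = Suc J then w * (of_nat k - of_nat J) * f (Suc J) else 0))"
    by (rule sum_index)
  also have "\<dots> = u * (of_nat k - 2 * of_nat J) * f J + (if J = 0 then 0 else v * of_nat J * f (J - 1)) +
      (if J = k then 0 else w * (of_nat k - of_nat J) * f (Suc J))"
  proof -
    have "(\<Sum>m\<le>k. if J = Suc m then v * of_nat J * f (J - 1) else 0) = (if J = 0 then 0 else v * of_nat J * f (J - 1))"
    proof (cases J)
      case (Suc n)
      have "(\<Sum>m\<le>k. if J = Suc m then v * of_nat J * f (J - 1) else 0) = (\<Sum>m\<le>k. if m = n then v * of_nat J * f (J - 1) else 0)"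
        by (rule sum.cong) (auto simp: Suc)
      then show ?thesis using Suc J by simp
    qed simp
    moreover have "(\<Sum>m\<le>k. if m = Suc J then w * (of_nat k - of_nat J) * f (Suc J) else 0) =
      (if J = k then 0 else w * (of_nat k - of_nat J) * f (Suc J))"
      using J by simp
    moreover have "(\<Sum>m\<le>k. if m = J then u * (of_nat k - 2 * of_nat J) * f J else 0) = u * (of_nat k - 2 * of_nat J) * f J"
      using J by simp
    ultimately show ?thesis by (simp only: sum.distrib)
  qed
  also have "\<dots> = of_nat (k - J) * ?x ^ (k - J - 1) * (u * ?x + w * ?y) * ?y ^ J +
    ?x ^ (k - J) * (of_nat J * ?y ^ (J - 1) * (v * ?x - u * ?y))"
  proof -
    obtain a where a: "k = J + a" using J by (metis le_iff_add)
    show ?thesis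
      by (cases a; cases J) (simp_all add: a f_def algebra_simps)
  qed
  finally show ?thesis by (simp add: J_def)
qed

text \<open>The line \<open>1 + s X\<close> need not stay inside \<open>SL\<close>, but it has the
  right tangent, and \<open>rho\<close> is polynomial and multiplicative on all matrices. The
  derivative therefore exists, and \<open>mvec_separates\<close> identifies it.\<close>

lemma rho_mderiv: "mderiv (\<lambda>s. rho \<iota> k (mk (1 + s * u) (s * v) (s * w) (1 - s * u))) (drho \<iota> k u v w) 0"
proof -
  let ?G = "\<lambda>s. mk (1 + s * u) (s * v) (s * w) (1 - s * u)"
  have "(\<lambda>s. rho \<iota> k (?G s) $ i $ j) \<in> pf" for i j
  proof -
    have "\<exists>p. \<forall>t. (\<lambda>g. rho \<iota> k g $ i $ j) (?G t) = poly p t"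
    proof (rule generated_algebra_poly_comp[OF rho_regular])
      fix l :: "complex^2^2 \<Rightarrow> complex" assume "l \<in> {\<lambda>g. g $ i $ j | i j. True}"
      then obtain a b where l: "l = (\<lambda>g. g $ a $ b)" by blast
      have "\<forall>a b. \<exists>p. \<forall>t. ?G t $ a $ b = poly p t"
        unfolding forall_2
      proof (intro conjI)
        show "\<exists>p. \<forall>t. ?G t $ 1 $ 1 = poly p t" by (intro exI[of _ "[:1, u:]"]) simp
        show "\<exists>p. \<forall>t. ?G t $ 1 $ 2 = poly p t" by (intro exI[of _ "[:0, v:]"]) simp
        show "\<exists>p. \<forall>t. ?G t $ 2 $ 1 = poly p t" by (intro exI[of _ "[:0, w:]"]) simp
        show "\<exists>p. \<forall>t. ?G t $ 2 $ 2 = poly p t" by (intro exI[of _ "[:1, - u:]"]) simp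
      qed
      then show "\<exists>p. \<forall>t. l (?G t) = poly p t" unfolding l by blast
    qed
    then obtain p where "(\<lambda>s. rho \<iota> k (?G s) $ i $ j) = poly p" by (auto simp: fun_eq_iff)
    then show ?thesis by (simp only: poly_pf)
  qed
  then obtain D where D: "mderiv (\<lambda>s. rho \<iota> k (?G s)) D 0"
    using pf_mderiv[of "\<lambda>s. rho \<iota> k (?G s)" 0] by blast
  have "D $ i $ j = drho \<iota> k u v w $ i $ j" for i j
  proof -
    have "(\<Sum>i\<in>UNIV. (D $ i $ j - drho \<iota> k u v w $ i $ j) * mvec \<iota> k \<xi> $ i) = 0" for \<xi>
    proof -
      have "((\<lambda>s. \<Sum>i\<in>UNIV. rho \<iota> k (?G s) $ i $ j * mvec \<iota> k \<xi> $ i) has_field_derivative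
          (\<Sum>i\<in>UNIV. D $ i $ j * mvec \<iota> k \<xi> $ i)) (at 0)"
        using D unfolding mderiv_def by (intro DERIV_sum DERIV_cmult_right) auto
      moreover have "(\<Sum>i\<in>UNIV. rho \<iota> k (?G s) $ i $ j * mvec \<iota> k \<xi> $ i) =
        (\<xi> $ 1 + s * (u * \<xi> $ 1 + w * \<xi> $ 2)) ^ (k - \<iota> j) * (\<xi> $ 2 + s * (v * \<xi> $ 1 - u * \<xi> $ 2)) ^ \<iota> j" for s
      proof -
        have "(\<Sum>i\<in>UNIV. rho \<iota> k (?G s) $ i $ j * mvec \<iota> k \<xi> $ i) = (transpose (rho \<iota> k (?G s)) *v mvec \<iota> k \<xi>) $ j"
          by (simp add: matrix_vector_mult_def transpose_def)
        then show ?thesis unfolding rho_mvec by (simp add: mvec_def transpose2 algebra_simps)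
      qed
      ultimately have "((\<lambda>s. (\<xi> $ 1 + s * (u * \<xi> $ 1 + w * \<xi> $ 2)) ^ (k - \<iota> j) * (\<xi> $ 2 + s * (v * \<xi> $ 1 - u * \<xi> $ 2)) ^ \<iota> j)
          has_field_derivative (\<Sum>i\<in>UNIV. D $ i $ j * mvec \<iota> k \<xi> $ i)) (at 0)" by simp
      moreover have "((\<lambda>s. (\<xi> $ 1 + s * (u * \<xi> $ 1 + w * \<xi> $ 2)) ^ (k - \<iota> j) * (\<xi> $ 2 + s * (v * \<xi> $ 1 - u * \<xi> $ 2)) ^ \<iota> j)
          has_field_derivative (\<Sum>i\<in>UNIV. drho \<iota> k u v w $ i $ j * mvec \<iota> k \<xi> $ i)) (at 0)"
        unfolding drho_mvec by (auto intro!: derivative_eq_intros)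
      ultimately have "(\<Sum>i\<in>UNIV. D $ i $ j * mvec \<iota> k \<xi> $ i) = (\<Sum>i\<in>UNIV. drho \<iota> k u v w $ i $ j * mvec \<iota> k \<xi> $ i)"
        by (rule DERIV_unique)
      then show ?thesis by (simp add: left_diff_distrib sum_subtractf)
    qed
    from mvec_separates[OF this, of i] show ?thesis by simp
  qed
  then have "D = drho \<iota> k u v w" by (simp add: vec_eq_iff)
  with D show ?thesis by simp
qed

text \<open>The hypothesis \<open>p X = X' p\<close> gives \<open>p (1 + s X) = (1 + s X') p\<close>
  for all \<open>s\<close>. Apply \<open>rho\<close> and differentiate at
  \<open>s = 0\<close>.\<close>

lemma rho_drho_conj:
  assumes "p ** mk u v w (- u) = mk u' v' w' (- u') ** p"
  shows "rho \<iota> k p ** drho \<iota> k u v w = drho \<iota> k u' v' w' ** rho \<iota> k p"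
proof -
  let ?G = "\<lambda>u v w s. mk (1 + s * u) (s * v) (s * w) (1 - s * u)"
  have "p ** ?G u v w s = ?G u' v' w' s ** p" for s
  proof -
    obtain a b c d where p: "p = mk a b c d" using mk_eq by blast
    have e: "a * u + b * w = u' * a + v' * c" "a * v + b * (- u) = u' * b + v' * d"
      "c * u + d * w = w' * a + (- u') * c" "c * v + d * (- u) = w' * b + (- u') * d"
      using assms unfolding p mk_mult mk_inject by auto
    have "a * (1 + s * u) + b * (s * w) = (1 + s * u') * a + s * v' * c"
      "a * (s * v) + b * (1 - s * u) = (1 + s * u') * b + s * v' * d"
      "c * (1 + s * u) + d * (s * w) = s * w' * a + (1 - s * u') * c"
      "c * (s * v) + d * (1 - s * u) = s * w' * b + (1 - s * u') * d"
      using arg_cong[OF e(1), of "\<lambda>x. s * x"] arg_cong[OF e(2), of "\<lambda>x. s * x"]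
        arg_cong[OF e(3), of "\<lambda>x. s * x"] arg_cong[OF e(4), of "\<lambda>x. s * x"] by (simp_all add: algebra_simps)
    then show ?thesis unfolding p mk_mult mk_inject by simp
  qed
  then have e: "rho \<iota> k p ** rho \<iota> k (?G u v w s) = rho \<iota> k (?G u' v' w' s) ** rho \<iota> k p" for s
    by (simp only: rho_mult[symmetric])
  have 1: "mderiv (\<lambda>s. rho \<iota> k p ** rho \<iota> k (?G u v w s)) (0 ** rho \<iota> k (?G u v w 0) + rho \<iota> k p ** drho \<iota> k u v w) 0"
    by (rule mderiv_mult[OF mderiv_const rho_mderiv])
  have 2: "mderiv (\<lambda>s. rho \<iota> k (?G u' v' w' s) ** rho \<iota> k p) (drho \<iota> k u' v' w' ** rho \<iota> k p + rho \<iota> k (?G u' v' w' 0) ** 0) 0"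
    by (rule mderiv_mult[OF rho_mderiv mderiv_const])
  show ?thesis
    using mderiv_unique[OF 1[unfolded e] 2] by (simp add: matrix_zero_mult matrix_mult_zero)
qed

lemma rho_upper_one_param: "one_param (\<lambda>t. rho \<iota> k (mk 1 t 0 1)) (drho \<iota> k 0 1 0)"
  and rho_lower_one_param: "one_param (\<lambda>t. rho \<iota> k (mk 1 0 t 1)) (drho \<iota> k 0 0 1)"
  using rho_mderiv[of 0 1 0] rho_mderiv[of 0 0 1] rho_one
  by (auto simp: one_param_def mk_one mk_mult add.commute simp flip: rho_mult)

end

section \<open>The standard tensor\<close>

sublocale boundary_index \<subseteq> i0: index \<iota>0 k0 by unfold_locales (rule bij0)
sublocale boundary_index \<subseteq> i1: index \<iota>1 k1 by unfold_locales (rule bij1)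
sublocale boundary_index \<subseteq> i2: index \<iota>2 k2 by unfold_locales (rule bij2)

context boundary_index
begin

text \<open>The three factors are peeled off one after another by
  \<open>mvec_separates\<close>.\<close>

lemma tri_mvec_ext:
  assumes "\<And>\<xi> \<eta> \<zeta>. tri A (mvec \<iota>0 k0 \<xi>) (mvec \<iota>1 k1 \<eta>) (mvec \<iota>2 k2 \<zeta>) =
    tri B (mvec \<iota>0 k0 \<xi>) (mvec \<iota>1 k1 \<eta>) (mvec \<iota>2 k2 \<zeta>)"
  shows "A = B"
proof -
  have 1: "contr A (mvec \<iota>1 k1 \<eta>) (mvec \<iota>2 k2 \<zeta>) $ i - contr B (mvec \<iota>1 k1 \<eta>) (mvec \<iota>2 k2 \<zeta>) $ i = 0" for i \<eta> \<zeta>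
    using assms[of _ \<eta> \<zeta>]
    by (intro i0.mvec_separates[of "\<lambda>i. contr A (mvec \<iota>1 k1 \<eta>) (mvec \<iota>2 k2 \<zeta>) $ i - contr B (mvec \<iota>1 k1 \<eta>) (mvec \<iota>2 k2 \<zeta>) $ i"])
      (simp add: tri_def left_diff_distrib right_diff_distrib sum_subtractf mult.commute)
  have 2: "(\<Sum>l\<in>UNIV. A $ i $ j $ l * mvec \<iota>2 k2 \<zeta> $ l) - (\<Sum>l\<in>UNIV. B $ i $ j $ l * mvec \<iota>2 k2 \<zeta> $ l) = 0" for i j \<zeta>
    using 1[of _ \<zeta> i]
    by (intro i1.mvec_separates[of "\<lambda>j. (\<Sum>l\<in>UNIV. A $ i $ j $ l * mvec \<iota>2 k2 \<zeta> $ l) - (\<Sum>l\<in>UNIV. B $ i $ j $ l * mvec \<iota>2 k2 \<zeta> $ l)"])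
      (simp add: contr_expand1 left_diff_distrib right_diff_distrib sum_subtractf mult.commute)
  have "A $ i $ j $ l - B $ i $ j $ l = 0" for i j l
    using 2[of i j]
    by (intro i2.mvec_separates[of "\<lambda>l. A $ i $ j $ l - B $ i $ j $ l"]) (simp add: left_diff_distrib right_diff_distrib sum_subtractf)
  then show ?thesis by (simp add: vec_eq_iff)
qed

text \<open>The coefficients of \<open>[\<xi>, \<eta>]\<^bsup>k\<^sub>1\<^esup> [\<xi>, \<zeta>]\<^bsup>k\<^sub>2\<^esup>\<close>, where \<open>[\<xi>, \<eta>] = \<xi>\<^sub>1 \<eta>\<^sub>2 - \<xi>\<^sub>2 \<eta>\<^sub>1\<close>.\<close>

definition std :: "('n0, 'n1, 'n2) tensor" where
  "std = (\<chi> i j l. if \<iota>0 i + \<iota>1 j + \<iota>2 l = k0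
     then (- 1) ^ \<iota>0 i * of_nat (k1 choose \<iota>1 j) * of_nat (k2 choose \<iota>2 l) else 0)"

text \<open>Binomial expansion of both brackets. For given \<open>j\<close> and \<open>l\<close> the
  plane condition leaves only \<open>i = (k1 - j) + (k2 - l)\<close>, and the sign
  \<open>(- 1) ^ i\<close> collects the signs from both brackets.\<close>

lemma tri_std:
  "tri std (mvec \<iota>0 k0 \<xi>) (mvec \<iota>1 k1 \<eta>) (mvec \<iota>2 k2 \<zeta>) =
    (\<xi> $ 1 * \<eta> $ 2 - \<xi> $ 2 * \<eta> $ 1) ^ k1 * (\<xi> $ 1 * \<zeta> $ 2 - \<xi> $ 2 * \<zeta> $ 1) ^ k2"
proof -
  let ?x = "\<xi> $ 1" and ?y = "\<xi> $ 2"
  define t where "t i j l = (if i + j + l = k0 then (- 1) ^ i * of_nat (k1 choose j) * of_nat (k2 choose l) else 0)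
    * (?x ^ (k0 - i) * ?y ^ i) * (\<eta> $ 1 ^ (k1 - j) * \<eta> $ 2 ^ j) * (\<zeta> $ 1 ^ (k2 - l) * \<zeta> $ 2 ^ l)" for i j l
  have "tri std (mvec \<iota>0 k0 \<xi>) (mvec \<iota>1 k1 \<eta>) (mvec \<iota>2 k2 \<zeta>) = (\<Sum>i\<in>UNIV. \<Sum>j\<in>UNIV. \<Sum>l\<in>UNIV. t (\<iota>0 i) (\<iota>1 j) (\<iota>2 l))"
    unfolding tri_def contr_def vec_lambda_beta sum_distrib_left
    by (intro sum.cong refl) (simp add: std_def t_def mvec_def)
  also have "\<dots> = (\<Sum>i\<le>k0. \<Sum>j\<le>k1. \<Sum>l\<le>k2. t i j l)"
    unfolding i2.sum_index[of "t _ _"] i1.sum_index[of "\<lambda>j. \<Sum>l\<le>k2. t _ j l"]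
      i0.sum_index[of "\<lambda>i. \<Sum>j\<le>k1. \<Sum>l\<le>k2. t i j l"] ..
  also have "\<dots> = (\<Sum>j\<le>k1. \<Sum>i\<le>k0. \<Sum>l\<le>k2. t i j l)" by (rule sum.swap)
  also have "\<dots> = (\<Sum>j\<le>k1. \<Sum>l\<le>k2. \<Sum>i\<le>k0. t i j l)" by (intro sum.cong refl sum.swap)
  also have "\<dots> = (\<Sum>j\<le>k1. \<Sum>l\<le>k2. (of_nat (k1 choose j) * (?x * \<eta> $ 2) ^ j * (- (?y * \<eta> $ 1)) ^ (k1 - j)) *
      (of_nat (k2 choose l) * (?x * \<zeta> $ 2) ^ l * (- (?y * \<zeta> $ 1)) ^ (k2 - l)))"
  proof (intro sum.cong refl)
    fix j l assume "j \<in> {..k1}" "l \<in> {..k2}"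
    then obtain a b where ab: "k1 = j + a" "k2 = l + b" by (metis atMost_iff le_iff_add)
    have "(\<Sum>i\<le>k0. t i j l) = (\<Sum>i\<le>k0. if i = a + b then t (a + b) j l else 0)"
      by (rule sum.cong) (auto simp: t_def k012 ab)
    also have "\<dots> = t (a + b) j l" by (simp add: k012 ab)
    also have "\<dots> = (of_nat (k1 choose j) * (?x * \<eta> $ 2) ^ j * (- (?y * \<eta> $ 1)) ^ (k1 - j)) *
      (of_nat (k2 choose l) * (?x * \<zeta> $ 2) ^ l * (- (?y * \<zeta> $ 1)) ^ (k2 - l))"
    proof -
      have m: "(- (?y * \<eta> $ 1)) ^ a = (- 1) ^ a * ?y ^ a * \<eta> $ 1 ^ a"
        "(- (?y * \<zeta> $ 1)) ^ b = (- 1) ^ b * ?y ^ b * \<zeta> $ 1 ^ b"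
        by (simp_all only: power_mult_distrib power_minus[of "_ * _"] mult.assoc)
      have teq: "t (a + b) j l = (- 1) ^ (a + b) * of_nat (k1 choose j) * of_nat (k2 choose l)
        * (?x ^ (j + l) * ?y ^ (a + b)) * (\<eta> $ 1 ^ a * \<eta> $ 2 ^ j) * (\<zeta> $ 1 ^ b * \<zeta> $ 2 ^ l)"
        by (simp add: t_def k012 ab)
      show ?thesis
        unfolding teq unfolding ab diff_add_inverse m power_mult_distrib power_add by (simp only: mult_ac)
    qed
    finally show "(\<Sum>i\<le>k0. t i j l) = (of_nat (k1 choose j) * (?x * \<eta> $ 2) ^ j * (- (?y * \<eta> $ 1)) ^ (k1 - j)) *
      (of_nat (k2 choose l) * (?x * \<zeta> $ 2) ^ l * (- (?y * \<zeta> $ 1)) ^ (k2 - l))" .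
  qed
  also have "\<dots> = (?x * \<eta> $ 2 + - (?y * \<eta> $ 1)) ^ k1 * (?x * \<zeta> $ 2 + - (?y * \<zeta> $ 1)) ^ k2"
    unfolding binomial_ring by (simp only: sum_product)
  finally show ?thesis by simp
qed

definition rho3 :: "complex^2^2 \<Rightarrow> ('n0, 'n1, 'n2) triple" where
  "rho3 g = (rho \<iota>0 k0 g, rho \<iota>1 k1 g, rho \<iota>2 k2 g)"

definition drho3 :: "complex \<Rightarrow> complex \<Rightarrow> complex \<Rightarrow> ('n0, 'n1, 'n2) triple" where
  "drho3 u v w = (drho \<iota>0 k0 u v w, drho \<iota>1 k1 u v w, drho \<iota>2 k2 u v w)"

text \<open>Each bracket is multiplied by the determinant of \<open>g\<close>.\<close>

lemma std_invariant:
  assumes "g \<in> SL"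
  shows "tensor_act (rho3 g) std = std"
proof (rule tri_mvec_ext)
  fix \<xi> \<eta> \<zeta> :: "complex^2"
  have d: "g $ 1 $ 1 * g $ 2 $ 2 - g $ 1 $ 2 * g $ 2 $ 1 = 1" using assms by (simp add: SL_def det_2)
  have br: "(transpose g *v x) $ 1 * (transpose g *v y) $ 2 - (transpose g *v x) $ 2 * (transpose g *v y) $ 1 =
    x $ 1 * y $ 2 - x $ 2 * y $ 1" for x y :: "complex^2"
  proof -
    have "(transpose g *v x) $ 1 * (transpose g *v y) $ 2 - (transpose g *v x) $ 2 * (transpose g *v y) $ 1 =
      (g $ 1 $ 1 * g $ 2 $ 2 - g $ 1 $ 2 * g $ 2 $ 1) * (x $ 1 * y $ 2 - x $ 2 * y $ 1)"
      unfolding i0.transpose2 by algebra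
    then show ?thesis using d by simp
  qed
  show "tri (tensor_act (rho3 g) std) (mvec \<iota>0 k0 \<xi>) (mvec \<iota>1 k1 \<eta>) (mvec \<iota>2 k2 \<zeta>) =
    tri std (mvec \<iota>0 k0 \<xi>) (mvec \<iota>1 k1 \<eta>) (mvec \<iota>2 k2 \<zeta>)"
    unfolding rho3_def tri_tensor_act i0.rho_mvec i1.rho_mvec i2.rho_mvec tri_std br ..
qed

lemma std_diag: "diag_type std"
  by (auto simp: diag_type_def std_def i1.index_le[THEN leD] i2.index_le[THEN leD])

lemma lie_act_entry:
  "lie_act (X0, X1, X2) A $ i $ j $ l = (\<Sum>i'\<in>UNIV. X0 $ i $ i' * A $ i' $ j $ l) +
    (\<Sum>j'\<in>UNIV. X1 $ j $ j' * A $ i $ j' $ l) + (\<Sum>l'\<in>UNIV. X2 $ l $ l' * A $ i $ j $ l')"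
  by (simp add: lie_act.simps mode0_def mode1_def mode2_def)

text \<open>The two off-diagonal directions come from differentiating invariance along the unipotent
  groups. The diagonal direction is a computation with weights, and linearity gives the
  rest.\<close>

lemma drho3_std: "lie_act (drho3 u v w) std = 0"
proof -
  have E: "lie_act (drho3 0 1 0) std = 0"
    unfolding drho3_def
    by (rule one_param_lie_act[OF i0.rho_upper_one_param i1.rho_upper_one_param i2.rho_upper_one_param])
      (rule std_invariant[unfolded rho3_def], simp add: mk_in_SL)
  have F: "lie_act (drho3 0 0 1) std = 0"
    unfolding drho3_def
    by (rule one_param_lie_act[OF i0.rho_lower_one_param i1.rho_lower_one_param i2.rho_lower_one_param])
      (rule std_invariant[unfolded rho3_def], simp add: mk_in_SL)
  have d: "drho \<iota> k u 0 0 $ i $ j = (if i = j then u * (of_nat k - 2 * of_nat (\<iota> j)) else 0)"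
    if "\<And>i j. \<iota> i = \<iota> j \<longleftrightarrow> i = j" for \<iota> :: "'x::finite \<Rightarrow> nat" and k u i j
    using that by (simp add: drho_def)
  have H: "lie_act (drho3 u 0 0) std = 0"
  proof -
    have "lie_act (drho3 u 0 0) std $ i $ j $ l = (u * (of_nat k0 - 2 * of_nat (\<iota>0 i)) + u * (of_nat k1 - 2 * of_nat (\<iota>1 j))
      + u * (of_nat k2 - 2 * of_nat (\<iota>2 l))) * std $ i $ j $ l" for i j l
      unfolding drho3_def lie_act_entry d[OF i0.index_inj] d[OF i1.index_inj] d[OF i2.index_inj]
      by (simp add: if_distrib[of "\<lambda>x. x * _"] distrib_right cong: if_cong)
    moreover have "(u * (of_nat k0 - 2 * of_nat (\<iota>0 i)) + u * (of_nat k1 - 2 * of_nat (\<iota>1 j))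
      + u * (of_nat k2 - 2 * of_nat (\<iota>2 l))) * std $ i $ j $ l = 0" for i j l
    proof (cases "\<iota>0 i + \<iota>1 j + \<iota>2 l = k0")
      case True
      then have "(of_nat k0 :: complex) = of_nat (\<iota>0 i) + of_nat (\<iota>1 j) + of_nat (\<iota>2 l)" by (metis of_nat_add)
      moreover have "(of_nat k0 :: complex) = of_nat k1 + of_nat k2" by (simp add: k012)
      ultimately have "of_nat k0 - 2 * of_nat (\<iota>0 i) + (of_nat k1 - 2 * of_nat (\<iota>1 j)) + (of_nat k2 - 2 * of_nat (\<iota>2 l)) = (0::complex)"
        by algebra
      then show ?thesis by (metis distrib_left mult_zero_left mult_zero_right)
    qed (simp add: std_def)
    ultimately show ?thesis by (simp add: vec_eq_iff)
  qed
  have s: "drho \<iota> k u v w = drho \<iota> k u 0 0 + mat v ** drho \<iota> k 0 1 0 + mat w ** drho \<iota> k 0 0 1"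
    for \<iota> :: "'x::finite \<Rightarrow> nat" and k
  proof -
    have "(mat c ** M) $ i $ j = c * M $ i $ j" for c and M :: "complex^'x^'x" and i j
      by (simp add: matrix_matrix_mult_def mat_def if_distrib[of "\<lambda>x. x * _"] cong: if_cong)
    then show ?thesis by (simp add: vec_eq_iff drho_def algebra_simps)
  qed
  have lin: "lie_act (X0 + mat v ** Y0 + mat w ** Z0, X1 + mat v ** Y1 + mat w ** Z1, X2 + mat v ** Y2 + mat w ** Z2) A =
    lie_act (X0, X1, X2) A + scale3 v (lie_act (Y0, Y1, Y2) A) + scale3 w (lie_act (Z0, Z1, Z2) A)"
    for X0 Y0 Z0 X1 Y1 Z1 X2 Y2 Z2 and A :: "('n0, 'n1, 'n2) tensor"
  proof -
    have "(mat c ** M) $ i $ j = c * M $ i $ j" for c and M :: "complex^'x::finite^'x" and i j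
      by (simp add: matrix_matrix_mult_def mat_def if_distrib[of "\<lambda>x. x * _"] cong: if_cong)
    moreover have "(mat c ** M) $ i $ j = c * M $ i $ j" for c and M :: "complex^'n0^'n0" and i j
      by (simp add: matrix_matrix_mult_def mat_def if_distrib[of "\<lambda>x. x * _"] cong: if_cong)
    moreover have "(mat c ** M) $ i $ j = c * M $ i $ j" for c and M :: "complex^'n1^'n1" and i j
      by (simp add: matrix_matrix_mult_def mat_def if_distrib[of "\<lambda>x. x * _"] cong: if_cong)
    moreover have "(mat c ** M) $ i $ j = c * M $ i $ j" for c and M :: "complex^'n2^'n2" and i j
      by (simp add: matrix_matrix_mult_def mat_def if_distrib[of "\<lambda>x. x * _"] cong: if_cong)
    ultimately show ?thesis
      by (simp add: vec_eq_iff lie_act_entry scale3_def algebra_simps sum.distrib sum_distrib_left)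
  qed
  have "lie_act (drho3 u v w) std = lie_act (drho3 u 0 0) std + scale3 v (lie_act (drho3 0 1 0) std) + scale3 w (lie_act (drho3 0 0 1) std)"
    unfolding drho3_def s[of \<iota>0 k0] s[of \<iota>1 k1] s[of \<iota>2 k2] by (rule lin)
  then show ?thesis by (simp add: E F H vec_eq_iff scale3_def)
qed

section \<open>The Lie algebra of a diagonal tensor\<close>

text \<open>The component of degree \<open>m\<close> for the grading by index, that is, a weight
  component under conjugation by the torus.\<close>

definition (in -) part :: "('n::finite \<Rightarrow> nat) \<Rightarrow> int \<Rightarrow> complex^'n^'n \<Rightarrow> complex^'n^'n" where
  "part \<iota> m X = (\<chi> i j. if int (\<iota> i) = int (\<iota> j) + m then X $ i $ j else 0)"

text \<open>A tensor of diagonal type is homogeneous of degree \<open>k0\<close>, so the components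
  of different degree contribute to disjoint sets of entries and must vanish separately.\<close>

lemma lie_act_part:
  assumes A: "diag_type A" and X: "lie_act (X0, X1, X2) A = 0"
  shows "lie_act (part \<iota>0 m X0, part \<iota>1 m X1, part \<iota>2 m X2) A = 0"
proof -
  have z: "A $ i $ j $ l = 0" if "\<iota>0 i + \<iota>1 j + \<iota>2 l \<noteq> k0" for i j l
    using A that unfolding diag_type_def by blast
  have "lie_act (part \<iota>0 m X0, part \<iota>1 m X1, part \<iota>2 m X2) A $ i $ j $ l =
    (if int (\<iota>0 i + \<iota>1 j + \<iota>2 l) = int k0 + m then lie_act (X0, X1, X2) A $ i $ j $ l else 0)" for i j l
  proof -
    have "part \<iota>0 m X0 $ i $ i' * A $ i' $ j $ l = (if int (\<iota>0 i + \<iota>1 j + \<iota>2 l) = int k0 + m then X0 $ i $ i' * A $ i' $ j $ l else 0)" for i'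
      using z[of i' j l] by (cases "\<iota>0 i' + \<iota>1 j + \<iota>2 l = k0") (auto simp: part_def)
    moreover have "part \<iota>1 m X1 $ j $ j' * A $ i $ j' $ l = (if int (\<iota>0 i + \<iota>1 j + \<iota>2 l) = int k0 + m then X1 $ j $ j' * A $ i $ j' $ l else 0)" for j'
      using z[of i j' l] by (cases "\<iota>0 i + \<iota>1 j' + \<iota>2 l = k0") (auto simp: part_def)
    moreover have "part \<iota>2 m X2 $ l $ l' * A $ i $ j $ l' = (if int (\<iota>0 i + \<iota>1 j + \<iota>2 l) = int k0 + m then X2 $ l $ l' * A $ i $ j $ l' else 0)" for l'
      using z[of i j l'] by (cases "\<iota>0 i + \<iota>1 j + \<iota>2 l' = k0") (auto simp: part_def)
    ultimately show ?thesis unfolding lie_act_entry by simp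
  qed
  then show ?thesis by (simp add: vec_eq_iff X)
qed

end

context index
begin

text \<open>Each factor shifts the index by \<open>m\<close>, so \<open>k + 1\<close> factors leave
  the range \<open>{..k}\<close>.\<close>

lemma part_nilp:
  assumes "m \<noteq> 0"
  shows "nilp ((*v) (part \<iota> m X))"
proof -
  let ?M = "part \<iota> m X"
  have supp: "int (\<iota> i) = int (\<iota> j) + int s * m" if "mpow ?M s $ i $ j \<noteq> 0" for i j s
    using that
  proof (induction s arbitrary: i)
    case 0
    then show ?case by (simp add: mat_def split: if_splits)
  next
    case (Suc s)
    have "(\<Sum>l\<in>UNIV. ?M $ i $ l * mpow ?M s $ l $ j) \<noteq> 0" using Suc.prems by (simp add: mpow_Suc matrix_matrix_mult_def)
    then obtain l where l: "?M $ i $ l * mpow ?M s $ l $ j \<noteq> 0" by (metis (mono_tags, lifting) sum.neutral)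
    then have "int (\<iota> i) = int (\<iota> l) + m" by (auto simp: part_def split: if_splits)
    moreover have "int (\<iota> l) = int (\<iota> j) + int s * m" using Suc.IH[of l] l by simp
    ultimately show ?case by (simp add: algebra_simps)
  qed
  have "mpow ?M (Suc k) $ i $ j = 0" for i j
  proof (rule ccontr)
    assume "mpow ?M (Suc k) $ i $ j \<noteq> 0"
    from supp[OF this] have "\<bar>int (Suc k) * m\<bar> = \<bar>int (\<iota> i) - int (\<iota> j)\<bar>" by simp
    also have "\<dots> \<le> int k" using index_le[of i] index_le[of j] by linarith
    finally have "int (Suc k) * \<bar>m\<bar> \<le> int k" by (simp add: abs_mult)
    moreover have "int (Suc k) * 1 \<le> int (Suc k) * \<bar>m\<bar>" using assms by (intro mult_left_mono) auto
    ultimately have "int (Suc k) \<le> int k" by (metis mult.right_neutral order_trans)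
    then show False by simp
  qed
  then have "mpow ?M (Suc k) = 0" by (simp add: vec_eq_iff)
  then show ?thesis unfolding nilp_iff_mpow by (rule exI)
qed

lemma regular_axis_kernel:
  fixes M :: "complex^'n^'n"
  assumes "regular_nilp M" "M *v axis i 1 = 0" "M *v axis j 1 = 0"
  shows "i = j"
proof (rule ccontr)
  assume ij: "i \<noteq> j"
  obtain a b where ab: "a \<noteq> 0 \<or> b \<noteq> 0" "a *s axis i 1 + b *s axis j 1 = (0 :: complex^'n)"
    using regular_kernel_line[OF assms] by blast
  have "(a *s axis i 1 + b *s axis j 1 :: complex^'n) $ i = a" "(a *s axis i 1 + b *s axis j 1 :: complex^'n) $ j = b"
    using ij by (auto simp: axis_def)
  then show False using ab by simp
qed

lemma part_axis_0:
  assumes "int (\<iota> j) + m < 0 \<or> int k < int (\<iota> j) + m"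
  shows "part \<iota> m X *v axis j 1 = 0"
proof -
  have "int (\<iota> i) \<noteq> int (\<iota> j) + m" for i using assms index_le[of i] by linarith
  then show ?thesis by (simp add: vec_eq_iff mult_axis) (simp add: part_def)
qed

text \<open>A shift by two or more kills two basis vectors, whereas the kernel of a regular
  nilpotent matrix is a line. A shift by one already kills the last basis vector, so no other column
  may vanish.\<close>

lemma regular_part:
  assumes reg: "regular_nilp (part \<iota> m X)" and m: "m \<noteq> 0" and k: "k \<ge> 1"
  shows "m = 1 \<or> m = - 1" and "m = 1 \<Longrightarrow> \<iota> i = Suc (\<iota> j) \<Longrightarrow> X $ i $ j \<noteq> 0"
proof -
  obtain a0 where a0: "\<iota> a0 = 0" using index_surj[of 0] by auto
  obtain a1 where a1: "\<iota> a1 = 1" using index_surj[of 1] k by auto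
  obtain b0 where b0: "\<iota> b0 = k" using index_surj[of k] by auto
  obtain b1 where b1: "\<iota> b1 = k - 1" using index_surj[of "k - 1"] by auto
  have "a0 \<noteq> a1" "b0 \<noteq> b1" using a0 a1 b0 b1 k by auto
  then have "\<not> m \<ge> 2" "\<not> m \<le> - 2"
    using regular_axis_kernel[OF reg part_axis_0[of b0 m X] part_axis_0[of b1 m X]]
      regular_axis_kernel[OF reg part_axis_0[of a0 m X] part_axis_0[of a1 m X]] a0 a1 b0 b1 k by auto
  then show "m = 1 \<or> m = - 1" using m by linarith
  assume 1: "m = 1" and ij: "\<iota> i = Suc (\<iota> j)"
  show "X $ i $ j \<noteq> 0"
  proof
    assume X: "X $ i $ j = 0"
    have "part \<iota> 1 X $ i' $ j = 0" for i'
      using X ij index_inj[of i' i] by (auto simp: part_def)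
    then have "part \<iota> m X *v axis j 1 = 0" by (simp add: vec_eq_iff mult_axis 1)
    moreover have "part \<iota> m X *v axis b0 1 = 0" by (rule part_axis_0) (simp add: 1 b0)
    ultimately have "j = b0" using regular_axis_kernel[OF reg] by blast
    then show False using ij b0 index_le[of i] by simp
  qed
qed

end

context boundary_index
begin

text \<open>The vanishing of the degree-one part of the Lie algebra action is the Pascal recursion, up to
  rescaling the bases.\<close>

lemma shift_product_form:
  assumes A: "diag_type A" and X: "lie_act (X0, X1, X2) A = 0"
    and p: "part \<iota>0 1 X0 = X0" "part \<iota>1 1 X1 = X1" "part \<iota>2 1 X2 = X2"
    and nz: "\<And>i j. \<iota>0 i = Suc (\<iota>0 j) \<Longrightarrow> X0 $ i $ j \<noteq> 0" "\<And>i j. \<iota>1 i = Suc (\<iota>1 j) \<Longrightarrow> X1 $ i $ j \<noteq> 0"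
      "\<And>i j. \<iota>2 i = Suc (\<iota>2 j) \<Longrightarrow> X2 $ i $ j \<noteq> 0"
  shows "\<exists>P Q R. (\<forall>m\<le>k0. P m \<noteq> 0) \<and> (\<forall>m\<le>k1. Q m \<noteq> 0) \<and> (\<forall>m\<le>k2. R m \<noteq> 0) \<and>
    (\<forall>i j l. A $ i $ j $ l = (if \<iota>0 i + \<iota>1 j + \<iota>2 l = k0 then P (\<iota>0 i) * Q (\<iota>1 j) * R (\<iota>2 l) else 0))"
proof -
  obtain e0 where e0: "\<And>m. m \<le> k0 \<Longrightarrow> \<iota>0 (e0 m) = m" using i0.index_surj by metis
  obtain e1 where e1: "\<And>m. m \<le> k1 \<Longrightarrow> \<iota>1 (e1 m) = m" using i1.index_surj by metis
  obtain e2 where e2: "\<And>m. m \<le> k2 \<Longrightarrow> \<iota>2 (e2 m) = m" using i2.index_surj by metis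
  have inv0: "e0 (\<iota>0 j) = j" for j using e0[OF i0.index_le[of j]] i0.index_inj by simp
  have inv1: "e1 (\<iota>1 j) = j" for j using e1[OF i1.index_le[of j]] i1.index_inj by simp
  have inv2: "e2 (\<iota>2 j) = j" for j using e2[OF i2.index_le[of j]] i2.index_inj by simp
  define x where "x m = X0 $ e0 (Suc m) $ e0 m" for m
  define y where "y m = X1 $ e1 (Suc m) $ e1 m" for m
  define z where "z m = X2 $ e2 (Suc m) $ e2 m" for m
  define a where "a p q = A $ e0 (k0 - (p + q)) $ e1 p $ e2 q" for p q
  have x0: "x m \<noteq> 0" if "m < k0" for m using that by (auto simp: x_def e0 intro!: nz)
  have y0: "y m \<noteq> 0" if "m < k1" for m using that by (auto simp: y_def e1 intro!: nz)
  have z0: "z m \<noteq> 0" if "m < k2" for m using that by (auto simp: z_def e2 intro!: nz)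
  have X0z: "X0 $ i $ i' = 0" if "\<iota>0 i \<noteq> Suc (\<iota>0 i')" for i i'
    using that by (subst p(1)[symmetric]) (simp add: part_def)
  have X1z: "X1 $ i $ i' = 0" if "\<iota>1 i \<noteq> Suc (\<iota>1 i')" for i i'
    using that by (subst p(2)[symmetric]) (simp add: part_def)
  have X2z: "X2 $ i $ i' = 0" if "\<iota>2 i \<noteq> Suc (\<iota>2 i')" for i i'
    using that by (subst p(3)[symmetric]) (simp add: part_def)
  have rec: "x (k0 - Suc n) * a p q + (if p = 0 then 0 else y (p - 1) * a (p - 1) q) + (if q = 0 then 0 else z (q - 1) * a p (q - 1)) = 0"
    if pq: "p \<le> k1" "q \<le> k2" "p + q = Suc n" for p q n
  proof -
    define i where "i = e0 (k0 - n)"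
    have n: "n < k0" using pq k012 by simp
    have "Suc (k0 - Suc n) = k0 - n" using n by simp
    then have i: "\<iota>0 i = Suc (k0 - Suc n)" "i = e0 (Suc (k0 - Suc n))" by (simp_all add: i_def e0)
    have s0: "(\<Sum>i'\<in>UNIV. X0 $ i $ i' * A $ i' $ e1 p $ e2 q) = x (k0 - Suc n) * a p q"
    proof -
      have "X0 $ i $ i' * A $ i' $ e1 p $ e2 q = (if i' = e0 (k0 - Suc n) then x (k0 - Suc n) * a p q else 0)" for i'
      proof (cases "i' = e0 (k0 - Suc n)")
        case False
        then have "\<iota>0 i' \<noteq> k0 - Suc n" using inv0[of i'] by auto
        then show ?thesis using False X0z[of i i'] i by simp
      qed (simp add: x_def a_def pq i(2))
      then show ?thesis by simp
    qed
    have s1: "(\<Sum>j'\<in>UNIV. X1 $ e1 p $ j' * A $ i $ j' $ e2 q) = (if p = 0 then 0 else y (p - 1) * a (p - 1) q)"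
    proof (cases p)
      case 0
      then show ?thesis using X1z[of "e1 p"] e1[of p] by simp
    next
      case (Suc p')
      have "X1 $ e1 p $ j' * A $ i $ j' $ e2 q = (if j' = e1 p' then y p' * a p' q else 0)" for j'
      proof (cases "j' = e1 p'")
        case False
        then have "\<iota>1 j' \<noteq> p'" using inv1[of j'] by auto
        then show ?thesis using False X1z[of "e1 p" j'] e1[of p] pq Suc by simp
      next
        case True
        have "p' + q = n" using pq Suc by simp
        then show ?thesis using True Suc by (simp add: y_def a_def i_def)
      qed
      then show ?thesis using Suc by simp
    qed
    have s2: "(\<Sum>l'\<in>UNIV. X2 $ e2 q $ l' * A $ i $ e1 p $ l') = (if q = 0 then 0 else z (q - 1) * a p (q - 1))"
    proof (cases q)
      case 0
      then show ?thesis using X2z[of "e2 q"] e2[of q] by simp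
    next
      case (Suc q')
      have "X2 $ e2 q $ l' * A $ i $ e1 p $ l' = (if l' = e2 q' then z q' * a p q' else 0)" for l'
      proof (cases "l' = e2 q'")
        case False
        then have "\<iota>2 l' \<noteq> q'" using inv2[of l'] by auto
        then show ?thesis using False X2z[of "e2 q" l'] e2[of q] pq Suc by simp
      next
        case True
        have "p + q' = n" using pq Suc by simp
        then show ?thesis using True Suc by (simp add: z_def a_def i_def)
      qed
      then show ?thesis using Suc by simp
    qed
    have "lie_act (X0, X1, X2) A $ i $ e1 p $ e2 q = 0" by (simp add: X)
    then show ?thesis unfolding lie_act_entry s0 s1 s2 .
  qed
  \<comment> \<open>These products of successive entries of \<open>X0\<close>, \<open>X1\<close>,
    \<open>X2\<close> are the rescalings after which \<open>rec\<close> becomes Pascal's recursion;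
    the sign of the recursion goes into \<open>P\<close>.\<close>
  define P where "P n = (\<Prod>s<n. - (1 / x (k0 - Suc s)))" for n
  define Y where "Y n = (\<Prod>s<n. y s)" for n
  define Z where "Z n = (\<Prod>s<n. z s)" for n
  \<comment> \<open>The solution of the recursion carries the binomial coefficient
    \<open>n! / (p! q!)\<close> with \<open>n = p + q\<close>. Since the first index is
    \<open>k0 - n\<close>, this is a product of functions of the three indices taken singly, which
    is what allows it to be absorbed into bases.\<close>
  have closed: "a p q = a 0 0 * (fact n * P n) * (Y p / fact p) * (Z q / fact q)"
    if "p \<le> k1" "q \<le> k2" "p + q = n" for p q n
    using that
  proof (induction n arbitrary: p q)
    case 0
    then show ?case by (simp add: P_def Y_def Z_def)
  next
    case (Suc n)
    have "n < k0" using Suc.prems k012 by simp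
    then have xn: "x (k0 - Suc n) \<noteq> 0" by (intro x0) simp
    let ?c = "a 0 0 * (fact n * P n)"
    have 1: "(if p = 0 then 0 else y (p - 1) * a (p - 1) q) = ?c * (of_nat p * (Y p / fact p)) * (Z q / fact q)"
    proof (cases p)
      case (Suc p')
      have "a p' q = ?c * (Y p' / fact p') * (Z q / fact q)" using Suc.prems Suc by (intro Suc.IH) auto
      moreover have "of_nat p * (Y p / fact p) = y p' * (Y p' / fact p')"
        unfolding Suc by (simp add: Y_def fact_Suc del: of_nat_Suc)
      ultimately show ?thesis using Suc by simp
    qed simp
    have 2: "(if q = 0 then 0 else z (q - 1) * a p (q - 1)) = ?c * (Y p / fact p) * (of_nat q * (Z q / fact q))"
    proof (cases q)
      case (Suc q')
      have "a p q' = ?c * (Y p / fact p) * (Z q' / fact q')" using Suc.prems Suc by (intro Suc.IH) auto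
      moreover have "of_nat q * (Z q / fact q) = z q' * (Z q' / fact q')"
        unfolding Suc by (simp add: Z_def fact_Suc del: of_nat_Suc)
      ultimately show ?thesis using Suc by simp
    qed simp
    have "x (k0 - Suc n) * a p q = - (?c * (Y p / fact p) * (Z q / fact q) * (of_nat p + of_nat q))"
      using rec[OF Suc.prems] unfolding 1 2 by (simp add: eq_neg_iff_add_eq_0 algebra_simps add_divide_distrib)
    also have "of_nat p + of_nat q = (of_nat (Suc n) :: complex)" using Suc.prems(3) by (metis of_nat_add)
    finally have "a p q = - (?c * (Y p / fact p) * (Z q / fact q) * of_nat (Suc n)) / x (k0 - Suc n)"
      using xn by (simp add: field_simps)
    moreover have "fact (Suc n) * P (Suc n) = - (of_nat (Suc n) * (fact n * P n)) / x (k0 - Suc n)"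
      by (simp add: P_def fact_Suc del: of_nat_Suc)
    ultimately show ?case by (simp add: mult_ac del: of_nat_Suc fact_Suc)
  qed
  have supp: "A $ i $ j $ l \<noteq> 0 \<longleftrightarrow> \<iota>0 i + \<iota>1 j + \<iota>2 l = k0" for i j l
    using A unfolding diag_type_def by blast
  have a00: "a 0 0 \<noteq> 0" unfolding a_def supp by (simp add: e0 e1 e2)
  define P' where "P' m = a 0 0 * (fact (k0 - m) * P (k0 - m))" for m
  define Q' where "Q' m = Y m / fact m" for m
  define R' where "R' m = Z m / fact m" for m
  have "A $ i $ j $ l = P' (\<iota>0 i) * Q' (\<iota>1 j) * R' (\<iota>2 l)" if s: "\<iota>0 i + \<iota>1 j + \<iota>2 l = k0" for i j l
  proof -
    have s': "k0 - (\<iota>1 j + \<iota>2 l) = \<iota>0 i" "\<iota>1 j + \<iota>2 l = k0 - \<iota>0 i" using s by auto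
    have "A $ i $ j $ l = a (\<iota>1 j) (\<iota>2 l)" by (simp add: a_def s' inv0 inv1 inv2 del: s'(2))
    also have "\<dots> = P' (\<iota>0 i) * Q' (\<iota>1 j) * R' (\<iota>2 l)"
      using closed[OF i1.index_le i2.index_le s'(2)] by (simp add: P'_def Q'_def R'_def)
    finally show ?thesis .
  qed
  moreover have "P' m \<noteq> 0" if "m \<le> k0" for m
    unfolding P'_def P_def using a00 x0 k012 by (auto simp: prod_zero_iff)
  moreover have "Q' m \<noteq> 0" if "m \<le> k1" for m
    unfolding Q'_def Y_def using y0 that by (auto simp: prod_zero_iff)
  moreover have "R' m \<noteq> 0" if "m \<le> k2" for m
    unfolding R'_def Z_def using z0 that by (auto simp: prod_zero_iff)
  moreover have "A $ i $ j $ l = 0" if "\<iota>0 i + \<iota>1 j + \<iota>2 l \<noteq> k0" for i j l using that supp by blast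
  ultimately show ?thesis by (intro exI[of _ P'] exI[of _ Q'] exI[of _ R']) simp
qed

end

section \<open>Identities\<close>

lemma is_basis_span:
  fixes b :: "nat \<Rightarrow> complex^'n::finite"
  assumes card: "CARD('n) = Suc k" and span: "vec.span (b ` {..k}) = UNIV"
  shows "is_basis k b"
proof -
  have dim: "vec.dim (b ` {..k}) = Suc k"
    using vec.dim_span[of "b ` {..k}"] unfolding span vec_dim_card card by simp
  have "vec.dim (b ` {..k}) \<le> card (b ` {..k})" by (rule vec.dim_le_card) (auto intro: vec.span_base)
  moreover have "card (b ` {..k}) \<le> card {..k}" by (rule card_image_le) simp
  ultimately have c: "card (b ` {..k}) = card {..k}" using dim by simp
  have "inj_on b {..k}" by (rule eq_card_imp_inj_on[OF _ c]) simp
  moreover have "vec.independent (b ` {..k})"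
    by (rule vec.card_le_dim_spanning[of _ UNIV]) (use span card c in \<open>auto simp: vec_dim_card simp del: vec.dim_UNIV\<close>)
  ultimately show ?thesis using span by (simp add: is_basis_def)
qed

context index
begin

text \<open>The reindexing \<open>\<pi>\<close> will be the identity or the reversal
  \<open>k - m\<close>: identities are supported on \<open>i0 = i1 + i2\<close>, tensors of diagonal
  type on the plane of index sum \<open>k0\<close>.\<close>

lemma invertible_of_basis:
  fixes Q :: "complex^'n^'n"
  assumes span: "vec.span (b ` {..k}) = (UNIV :: (complex^'n) set)" and c: "\<And>m. m \<le> k \<Longrightarrow> c m \<noteq> 0"
    and Q: "\<And>i. Q *v axis i 1 = c (\<iota> i) *s b (\<pi> (\<iota> i))" and \<pi>: "\<pi> ` {..k} = {..k}"
  shows "invertible Q"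
proof -
  have "b ` {..k} \<subseteq> vec.span (columns Q)"
  proof
    fix v assume "v \<in> b ` {..k}"
    then obtain m where m: "m \<le> k" "v = b (\<pi> m)" using \<pi> by (metis atMost_iff imageE)
    obtain i where i: "\<iota> i = m" using index_surj m by blast
    have "column i Q = Q *v axis i 1" by (simp add: column_def vec_eq_iff mult_axis)
    then have "v = inverse (c m) *s column i Q" using Q[of i] i m c by simp
    moreover have "column i Q \<in> columns Q" unfolding columns_def by blast
    ultimately show "v \<in> vec.span (columns Q)" by (simp add: vec.span_base vec.span_scale)
  qed
  then have "vec.span (columns Q) = UNIV"
    using span vec.span_minimal[of _ "vec.span (columns Q)"] by auto
  then show ?thesis unfolding invertible_right_inverse matrix_right_invertible_span_columns .
qed

lemma basis_of_invertible:
  fixes Q :: "complex^'n^'n"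
  assumes Q: "invertible Q" and c: "\<And>m. m \<le> k \<Longrightarrow> c m \<noteq> 0"
    and b: "\<And>i. Q *v axis i 1 = c (\<iota> i) *s b (\<pi> (\<iota> i))" and \<pi>: "\<pi> ` {..k} = {..k}"
  shows "is_basis k b"
proof (rule is_basis_span[OF index_card])
  have "columns Q \<subseteq> vec.span (b ` {..k})"
  proof
    fix v assume "v \<in> columns Q"
    then obtain i where v: "v = column i Q" unfolding columns_def by blast
    have "v = c (\<iota> i) *s b (\<pi> (\<iota> i))" unfolding b[symmetric] v by (simp add: column_def vec_eq_iff mult_axis)
    moreover have "\<pi> (\<iota> i) \<in> {..k}" using \<pi> index_le[of i] by (metis atMost_iff imageI)
    ultimately show "v \<in> vec.span (b ` {..k})" by (simp add: vec.span_base vec.span_scale)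
  qed
  moreover have "vec.span (columns Q) = UNIV"
    using Q unfolding invertible_right_inverse matrix_right_invertible_span_columns .
  ultimately show "vec.span (b ` {..k}) = UNIV"
    using vec.span_minimal[of "columns Q" "vec.span (b ` {..k})"] by auto
qed

end

context boundary_index
begin

lemma reversed_image: "(\<lambda>m. k - m) ` {..k} = {..k}" for k :: nat
proof
  show "{..k} \<subseteq> (\<lambda>m. k - m) ` {..k}"
  proof
    fix m assume "m \<in> {..k}"
    then show "m \<in> (\<lambda>m. k - m) ` {..k}" by (intro image_eqI[of _ _ "k - m"]) auto
  qed
qed auto

text \<open>Reversing the bases of the second and third factor turns the condition of index sum
  \<open>k0\<close> into \<open>i0 = i1 + i2\<close>, because \<open>k0 = k1 + k2\<close>. The
  factors \<open>\<alpha>\<close>, \<open>\<beta>\<close>, \<open>\<gamma>\<close> rescale all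
  nonzero entries to \<open>1\<close>.\<close>

lemma identity_expansion:
  assumes Q0: "\<And>i. Q0 *v axis i 1 = \<alpha> (\<iota>0 i) *s b0 (\<iota>0 i)"
    and Q1: "\<And>j. Q1 *v axis j 1 = \<beta> (\<iota>1 j) *s b1 (k1 - \<iota>1 j)"
    and Q2: "\<And>l. Q2 *v axis l 1 = \<gamma> (\<iota>2 l) *s b2 (k2 - \<iota>2 l)"
    and A: "\<And>i j l. \<alpha> (\<iota>0 i) * \<beta> (\<iota>1 j) * \<gamma> (\<iota>2 l) * A $ i $ j $ l = (if \<iota>0 i + \<iota>1 j + \<iota>2 l = k0 then 1 else 0)"
  shows "tensor_act (Q0, Q1, Q2) A = (\<Sum>i0\<le>k0. \<Sum>i1\<le>k1. \<Sum>i2\<le>k2.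
    scale3 (if i0 = i1 + i2 then 1 else 0) (tensor3 (b0 i0) (b1 i1) (b2 i2)))"
proof -
  interpret r: boundary_index "\<lambda>i. k0 - \<iota>0 i" "\<lambda>j. k1 - \<iota>1 j" "\<lambda>l. k2 - \<iota>2 l" k0 k1 k2 by (rule reversed)
  have q: "Q0 $ a $ i = \<alpha> (\<iota>0 i) * b0 (\<iota>0 i) $ a" "Q1 $ b $ j = \<beta> (\<iota>1 j) * b1 (k1 - \<iota>1 j) $ b"
    "Q2 $ c $ l = \<gamma> (\<iota>2 l) * b2 (k2 - \<iota>2 l) $ c" for a b c i j l
    using Q0[of i] Q1[of j] Q2[of l] by (simp_all flip: mult_axis)
  define f where "f a b c i0 i1 i2 = (if i0 = i1 + i2 then 1 else 0) * (b0 i0 $ a * b1 i1 $ b * b2 i2 $ c)" for a b c i0 i1 i2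
  have "tensor_act (Q0, Q1, Q2) A $ a $ b $ c = (\<Sum>i0\<le>k0. \<Sum>i1\<le>k1. \<Sum>i2\<le>k2. f a b c i0 i1 i2)" for a b c
  proof -
    have "tensor_act (Q0, Q1, Q2) A $ a $ b $ c = (\<Sum>i\<in>UNIV. \<Sum>j\<in>UNIV. \<Sum>l\<in>UNIV. f a b c (\<iota>0 i) (k1 - \<iota>1 j) (k2 - \<iota>2 l))"
      unfolding tensor_act.simps vec_lambda_beta
    proof (intro sum.cong refl)
      fix i j l
      have e: "\<iota>0 i = k1 - \<iota>1 j + (k2 - \<iota>2 l) \<longleftrightarrow> \<iota>0 i + \<iota>1 j + \<iota>2 l = k0"
        using i1.index_le[of j] i2.index_le[of l] k012 by linarith
      have "Q0 $ a $ i * Q1 $ b $ j * Q2 $ c $ l * A $ i $ j $ l =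
        (\<alpha> (\<iota>0 i) * \<beta> (\<iota>1 j) * \<gamma> (\<iota>2 l) * A $ i $ j $ l) * (b0 (\<iota>0 i) $ a * b1 (k1 - \<iota>1 j) $ b * b2 (k2 - \<iota>2 l) $ c)"
        by (simp add: q mult_ac)
      then show "Q0 $ a $ i * Q1 $ b $ j * Q2 $ c $ l * A $ i $ j $ l = f a b c (\<iota>0 i) (k1 - \<iota>1 j) (k2 - \<iota>2 l)"
        unfolding A f_def e .
    qed
    also have "\<dots> = (\<Sum>i0\<le>k0. \<Sum>i1\<le>k1. \<Sum>i2\<le>k2. f a b c i0 i1 i2)"
      unfolding r.i2.sum_index[of "f a b c _ _"] r.i1.sum_index[of "\<lambda>j. \<Sum>l\<le>k2. f a b c _ j l"]
        i0.sum_index[of "\<lambda>i. \<Sum>j\<le>k1. \<Sum>l\<le>k2. f a b c i j l"] ..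
    finally show ?thesis .
  qed
  then show ?thesis by (simp add: vec_eq_iff sum_component scale3_def tensor3_def f_def)
qed

lemma product_form_identity:
  assumes inv: "invertible P0" "invertible P1" "invertible P2"
    and nz: "\<And>m. m \<le> k0 \<Longrightarrow> p m \<noteq> 0" "\<And>m. m \<le> k1 \<Longrightarrow> q m \<noteq> 0" "\<And>m. m \<le> k2 \<Longrightarrow> r m \<noteq> 0"
    and A: "\<And>i j l. tensor_act (P0, P1, P2) A $ i $ j $ l =
      (if \<iota>0 i + \<iota>1 j + \<iota>2 l = k0 then p (\<iota>0 i) * q (\<iota>1 j) * r (\<iota>2 l) else 0)"
  shows "is_identity k0 k1 k2 A"
proof -
  obtain Q0 where Q0: "P0 ** Q0 = mat 1" "Q0 ** P0 = mat 1" "invertible Q0" using inv(1) by (rule invertibleE)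
  obtain Q1 where Q1: "P1 ** Q1 = mat 1" "Q1 ** P1 = mat 1" "invertible Q1" using inv(2) by (rule invertibleE)
  obtain Q2 where Q2: "P2 ** Q2 = mat 1" "Q2 ** P2 = mat 1" "invertible Q2" using inv(3) by (rule invertibleE)
  obtain e0 where "\<And>m. m \<le> k0 \<Longrightarrow> \<iota>0 (e0 m) = m" using i0.index_surj by metis
  then have e0: "e0 (\<iota>0 i) = i" for i using i0.index_le i0.index_inj by metis
  obtain e1 where "\<And>m. m \<le> k1 \<Longrightarrow> \<iota>1 (e1 m) = m" using i1.index_surj by metis
  then have e1: "e1 (\<iota>1 i) = i" for i using i1.index_le i1.index_inj by metis
  obtain e2 where "\<And>m. m \<le> k2 \<Longrightarrow> \<iota>2 (e2 m) = m" using i2.index_surj by metis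
  then have e2: "e2 (\<iota>2 i) = i" for i using i2.index_le i2.index_inj by metis
  define b0 where "b0 m = p m *s (Q0 *v axis (e0 m) 1)" for m
  define b1 where "b1 m = q (k1 - m) *s (Q1 *v axis (e1 (k1 - m)) 1)" for m
  define b2 where "b2 m = r (k2 - m) *s (Q2 *v axis (e2 (k2 - m)) 1)" for m
  have b: "Q0 *v axis i 1 = inverse (p (\<iota>0 i)) *s b0 (\<iota>0 i)"
    "Q1 *v axis j 1 = inverse (q (\<iota>1 j)) *s b1 (k1 - \<iota>1 j)"
    "Q2 *v axis l 1 = inverse (r (\<iota>2 l)) *s b2 (k2 - \<iota>2 l)" for i j l
    using nz(1)[OF i0.index_le, of i] nz(2)[OF i1.index_le, of j] nz(3)[OF i2.index_le, of l]
    by (simp_all add: b0_def b1_def b2_def e0 e1 e2 i1.index_le i2.index_le)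
  have "tensor_act (Q0, Q1, Q2) (tensor_act (P0, P1, P2) A) = (\<Sum>i0\<le>k0. \<Sum>i1\<le>k1. \<Sum>i2\<le>k2.
    scale3 (if i0 = i1 + i2 then 1 else 0) (tensor3 (b0 i0) (b1 i1) (b2 i2)))"
    by (rule identity_expansion[OF b])
      (use nz(1)[OF i0.index_le] nz(2)[OF i1.index_le] nz(3)[OF i2.index_le] in \<open>simp add: A field_simps\<close>)
  moreover have "tensor_act (Q0, Q1, Q2) (tensor_act (P0, P1, P2) A) = scale3 1 A"
    unfolding tensor_act_mult[symmetric] Q0 Q1 Q2 tensor_act_one by (simp add: vec_eq_iff scale3_def)
  moreover have "is_basis k0 b0" by (rule i0.basis_of_invertible[where c = "\<lambda>m. inverse (p m)" and b = b0 and \<pi> = "\<lambda>m. m", OF Q0(3) _ b(1)]) (use nz in auto)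
  moreover have "is_basis k1 b1"
    by (rule i1.basis_of_invertible[where c = "\<lambda>m. inverse (q m)" and b = b1 and \<pi> = "\<lambda>m. k1 - m", OF Q1(3) _ b(2)]) (use nz reversed_image in auto)
  moreover have "is_basis k2 b2"
    by (rule i2.basis_of_invertible[where c = "\<lambda>m. inverse (r m)" and b = b2 and \<pi> = "\<lambda>m. k2 - m", OF Q2(3) _ b(3)]) (use nz reversed_image in auto)
  ultimately show ?thesis unfolding is_identity_def
    by (intro exI[of _ 1] exI[of _ b0] exI[of _ b1] exI[of _ b2]) simp
qed

text \<open>The signs and binomial coefficients of \<open>std\<close> are absorbed by rescaling the
  basis vectors, and the projective factor \<open>c\<close> by a scalar matrix in the first
  component.\<close>

lemma identity_std:
  assumes "is_identity k0 k1 k2 A"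
  shows "\<exists>P0 P1 P2. invertible P0 \<and> invertible P1 \<and> invertible P2 \<and> tensor_act (P0, P1, P2) A = std"
proof -
  obtain c b0 b1 b2 where c: "c \<noteq> 0" and b: "is_basis k0 b0" "is_basis k1 b1" "is_basis k2 b2"
    and A: "scale3 c A = (\<Sum>i0\<le>k0. \<Sum>i1\<le>k1. \<Sum>i2\<le>k2.
        scale3 (if i0 = i1 + i2 then 1 else 0) (tensor3 (b0 i0) (b1 i1) (b2 i2)))"
    using assms unfolding is_identity_def by blast
  define Q0 where "Q0 = (\<chi> a i. (- 1) ^ \<iota>0 i * b0 (\<iota>0 i) $ a)"
  define Q1 where "Q1 = (\<chi> a i. inverse (of_nat (k1 choose \<iota>1 i)) * b1 (k1 - \<iota>1 i) $ a)"
  define Q2 where "Q2 = (\<chi> a i. inverse (of_nat (k2 choose \<iota>2 i)) * b2 (k2 - \<iota>2 i) $ a)"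
  have Q: "Q0 *v axis i 1 = (- 1) ^ \<iota>0 i *s b0 (\<iota>0 i)"
    "Q1 *v axis j 1 = inverse (of_nat (k1 choose \<iota>1 j)) *s b1 (k1 - \<iota>1 j)"
    "Q2 *v axis l 1 = inverse (of_nat (k2 choose \<iota>2 l)) *s b2 (k2 - \<iota>2 l)" for i j l
    by (simp_all add: vec_eq_iff mult_axis) (simp_all add: Q0_def Q1_def Q2_def)
  have e: "tensor_act (Q0, Q1, Q2) std = scale3 c A"
    unfolding A
  proof (rule identity_expansion[OF Q])
    fix i j l
    have nz: "of_nat (k1 choose \<iota>1 j) \<noteq> (0::complex)" "of_nat (k2 choose \<iota>2 l) \<noteq> (0::complex)"
      using i1.index_le[of j] i2.index_le[of l] by simp_all
    have sg: "(- 1) ^ n * (- 1) ^ n = (1::complex)" for n by (simp flip: power_mult_distrib)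
    have "(- 1) ^ \<iota>0 i * inverse B * inverse C * ((- 1) ^ \<iota>0 i * B * C) = 1" if "B \<noteq> 0" "C \<noteq> 0" for B C :: complex
    proof -
      have "(- 1) ^ \<iota>0 i * inverse B * inverse C * ((- 1) ^ \<iota>0 i * B * C) =
        ((- 1) ^ \<iota>0 i * (- 1) ^ \<iota>0 i) * (inverse B * B) * (inverse C * C)" by (simp only: mult_ac)
      then show ?thesis using that by (simp add: sg)
    qed
    from this[OF nz] show "(- 1) ^ \<iota>0 i * inverse (of_nat (k1 choose \<iota>1 j)) * inverse (of_nat (k2 choose \<iota>2 l)) * std $ i $ j $ l =
      (if \<iota>0 i + \<iota>1 j + \<iota>2 l = k0 then 1 else 0)" by (simp add: std_def)
  qed
  have "invertible Q0"
    by (rule i0.invertible_of_basis[where c = "\<lambda>m. (- 1) ^ m" and b = b0 and \<pi> = "\<lambda>m. m", OF _ _ Q(1)]) (use b in \<open>auto simp: is_basis_def\<close>)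
  then obtain R0 where R0: "Q0 ** R0 = mat 1" "R0 ** Q0 = mat 1" "invertible R0" by (rule invertibleE)
  have "invertible Q1"
    by (rule i1.invertible_of_basis[where c = "\<lambda>m. inverse (of_nat (k1 choose m))" and b = b1 and \<pi> = "\<lambda>m. k1 - m", OF _ _ Q(2)]) (use b reversed_image in \<open>auto simp: is_basis_def\<close>)
  then obtain R1 where R1: "Q1 ** R1 = mat 1" "R1 ** Q1 = mat 1" "invertible R1" by (rule invertibleE)
  have "invertible Q2"
    by (rule i2.invertible_of_basis[where c = "\<lambda>m. inverse (of_nat (k2 choose m))" and b = b2 and \<pi> = "\<lambda>m. k2 - m", OF _ _ Q(3)]) (use b reversed_image in \<open>auto simp: is_basis_def\<close>)
  then obtain R2 where R2: "Q2 ** R2 = mat 1" "R2 ** Q2 = mat 1" "invertible R2" by (rule invertibleE)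
  have sc: "tensor_act (mat c ** g0, g1, g2) B = scale3 c (tensor_act (g0, g1, g2) B)" for c g0 g1 g2 and B :: "('n0, 'n1, 'n2) tensor"
    by (rule contr_ext) (simp add: contr_tensor_act contr_scale3 mat_mult_vec flip: matrix_vector_mul_assoc)
  have "tensor_act (R0, R1, R2) (scale3 c A) = std"
    unfolding e[symmetric] tensor_act_mult[symmetric] R0 R1 R2 tensor_act_one ..
  then have "tensor_act (mat c ** R0, R1, R2) A = std" by (simp add: sc tensor_act_scale3)
  moreover have "invertible (mat c :: complex^'n0^'n0)"
  proof (rule invertibleI)
    have "mat a ** (mat b :: complex^'n0^'n0) = mat (a * b)" for a b
      by (simp add: matrix_eq mat_mult_vec flip: matrix_vector_mul_assoc)
    then show "mat c ** (mat (inverse c) :: complex^'n0^'n0) = mat 1" "mat (inverse c) ** (mat c :: complex^'n0^'n0) = mat 1"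
      using c by simp_all
  qed
  ultimately show ?thesis using R0(3) R1(3) R2(3) invertible_mult by blast
qed

end

section \<open>Identity components\<close>

lemma continuous_on_matrixI:
  fixes F :: "'x::topological_space \<Rightarrow> complex^'n^'m"
  assumes "\<And>i j. continuous_on S (\<lambda>x. F x $ i $ j)"
  shows "continuous_on S F"
proof -
  have "continuous_on S (\<lambda>x. \<chi> i. \<chi> j. F x $ i $ j)"
    by (intro continuous_on_vec_lambda assms)
  then show ?thesis by (simp only: vec_lambda_eta)
qed

lemma continuous_on_matrix_mult [continuous_intros]:
  fixes F :: "'x::topological_space \<Rightarrow> complex^'n^'m" and G :: "'x::topological_space \<Rightarrow> complex^'l^'n"
  assumes "continuous_on S F" "continuous_on S G"
  shows "continuous_on S (\<lambda>x. F x ** G x)"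
  by (rule continuous_on_matrixI)
    (auto simp: matrix_matrix_mult_def intro!: continuous_intros assms)

lemma tendsto_matrixI:
  fixes F :: "'x \<Rightarrow> complex^'n^'m"
  assumes "\<And>i j. ((\<lambda>x. F x $ i $ j) \<longlongrightarrow> M $ i $ j) L"
  shows "(F \<longlongrightarrow> M) L"
  by (intro vec_tendstoI assms)

lemma tendsto_matrix_mult [tendsto_intros]:
  fixes F :: "'x \<Rightarrow> complex^'n^'m" and G :: "'x \<Rightarrow> complex^'l^'n"
  assumes "(F \<longlongrightarrow> M) L" "(G \<longlongrightarrow> N) L"
  shows "((\<lambda>x. F x ** G x) \<longlongrightarrow> M ** N) L"
  by (rule tendsto_matrixI)
    (auto simp: matrix_matrix_mult_def intro!: tendsto_intros tendsto_vec_nth assms)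

lemma generated_algebra_continuous:
  assumes "f \<in> generated_algebra L" and "\<And>l. l \<in> L \<Longrightarrow> continuous_on S l"
  shows "continuous_on S f"
  using assms(1)
  by (induction rule: generated_algebra.induct) (auto intro: assms(2) continuous_on_add continuous_on_mult)

fun tmul :: "('n0::finite, 'n1::finite, 'n2::finite) triple \<Rightarrow> ('n0, 'n1, 'n2) triple \<Rightarrow> ('n0, 'n1, 'n2) triple" where
  "tmul (g0, g1, g2) (h0, h1, h2) = (g0 ** h0, g1 ** h1, g2 ** h2)"

abbreviation tone :: "('n0::finite, 'n1::finite, 'n2::finite) triple" where
  "tone \<equiv> (mat 1, mat 1, mat 1)"

lemma tmul_assoc: "tmul (tmul g h) k = tmul g (tmul h k)"
  by (cases g; cases h; cases k) (simp add: matrix_mul_assoc)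

lemma tmul_one [simp]: "tmul tone g = g" "tmul g tone = g"
  by (cases g; simp)+

lemma tensor_act_tmul: "tensor_act (tmul g h) A = tensor_act g (tensor_act h A)"
  by (cases g; cases h) (simp add: tensor_act_mult)

lemma continuous_on_tmul [continuous_intros]:
  assumes "continuous_on S f" "continuous_on S g"
  shows "continuous_on S (\<lambda>x. tmul (f x) (g x))"
proof -
  have "tmul (f x) (g x) = (fst (f x) ** fst (g x), fst (snd (f x)) ** fst (snd (g x)), snd (snd (f x)) ** snd (snd (g x)))" for x
    by (cases "f x"; cases "g x") simp
  then show ?thesis
    by (simp only:) (intro continuous_intros assms)
qed

lemma scale3_scale3: "scale3 a (scale3 b A) = scale3 (a * b) A"
  by (simp add: scale3_def vec_eq_iff mult.assoc)

lemma scale3_one: "scale3 1 A = A"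
  by (simp add: scale3_def vec_eq_iff)

lemma Stab_one: "tone \<in> Stab A"
  by (auto simp: Stab_def SL_def tensor_act_one scale3_one intro!: exI[of _ 1])

lemma Stab_mult:
  assumes "g \<in> Stab A" "h \<in> Stab A"
  shows "tmul g h \<in> Stab A"
proof -
  obtain c d where c: "c \<noteq> 0" "tensor_act g A = scale3 c A" and d: "d \<noteq> 0" "tensor_act h A = scale3 d A"
    using assms by (auto simp: Stab_def)
  have "tensor_act (tmul g h) A = scale3 (d * c) A"
    by (simp add: tensor_act_tmul c d tensor_act_scale3 scale3_scale3)
  moreover have "tmul g h \<in> SL \<times> SL \<times> SL"
    using assms by (cases g; cases h) (auto simp: Stab_def SL_def det_mul)
  ultimately show ?thesis using c(1) d(1) by (auto simp: Stab_def intro!: exI[of _ "d * c"])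
qed

lemma Stab_inverse:
  assumes "g \<in> Stab A"
  shows "\<exists>h\<in>Stab A. tmul g h = tone \<and> tmul h g = tone"
proof -
  obtain g0 g1 g2 where g: "g = (g0, g1, g2)" by (cases g)
  have inv: "\<exists>h. M ** h = mat 1 \<and> h ** M = mat 1 \<and> det h = 1" if "det M = 1" for M :: "complex^'x::finite^'x"
  proof -
    have "invertible M" using that by (simp add: invertible_det_nz)
    then obtain h where h: "M ** h = mat 1" "h ** M = mat 1" by (rule invertibleE)
    then have "det h = 1" using that det_mul[of M h] by simp
    then show ?thesis using h by blast
  qed
  obtain c where c: "c \<noteq> 0" "tensor_act g A = scale3 c A" and d: "det g0 = 1" "det g1 = 1" "det g2 = 1"
    using assms by (auto simp: Stab_def SL_def g)
  obtain h0 h1 h2 where h: "g0 ** h0 = mat 1" "h0 ** g0 = mat 1" "det h0 = 1"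
    "g1 ** h1 = mat 1" "h1 ** g1 = mat 1" "det h1 = 1"
    "g2 ** h2 = mat 1" "h2 ** g2 = mat 1" "det h2 = 1"
    using inv[OF d(1)] inv[OF d(2)] inv[OF d(3)] by blast
  have e: "tmul (h0, h1, h2) g = tone" "tmul g (h0, h1, h2) = tone" by (simp_all add: g h)
  have "tensor_act (h0, h1, h2) A = scale3 (inverse c) (tensor_act (h0, h1, h2) (scale3 c A))"
    using c(1) by (simp add: tensor_act_scale3 scale3_scale3 scale3_one)
  also have "\<dots> = scale3 (inverse c) A"
    using tensor_act_tmul[of "(h0, h1, h2)" g A] by (simp add: e c(2) tensor_act_one)
  finally have "(h0, h1, h2) \<in> Stab A" using c(1) h by (auto simp: Stab_def SL_def intro!: exI[of _ "inverse c"])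
  then show ?thesis using e by blast
qed

text \<open>Let \<open>O1\<close> be a neighbourhood of one in which \<open>Stab A\<close> stays
  inside \<open>K\<close>. Its translates by elements of \<open>K\<close>, and by elements outside
  \<open>K\<close>, are open sets that separate \<open>K\<close> from the rest of
  \<open>Stab A\<close>. So \<open>K\<close> is open and closed in \<open>Stab A\<close>, and a
  connected set containing one cannot leave it.\<close>

lemma Stab0_eqI:
  fixes A :: "('n0::finite, 'n1::finite, 'n2::finite) tensor"
  assumes K: "K \<subseteq> Stab A" "connected K" "tone \<in> K"
    and mult: "\<And>g h. g \<in> K \<Longrightarrow> h \<in> K \<Longrightarrow> tmul g h \<in> K"
    and inv: "\<And>g. g \<in> K \<Longrightarrow> \<exists>h\<in>K. tmul g h = tone \<and> tmul h g = tone"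
    and near: "\<forall>\<^sub>F g in nhds tone. g \<in> Stab A \<longrightarrow> g \<in> K"
  shows "Stab0 A = K"
proof
  show "K \<subseteq> Stab0 A" unfolding Stab0_def
    using K by (intro connected_component_maximal)
  obtain O1 where O1: "open O1" "tone \<in> O1" "\<And>g. g \<in> O1 \<Longrightarrow> g \<in> Stab A \<Longrightarrow> g \<in> K"
    using near unfolding eventually_nhds by blast
  define U V where "U = (\<Union>y\<in>K. {g. tmul y g \<in> O1})" and "V = (\<Union>y\<in>Stab A - K. {g. tmul y g \<in> O1})"
  have op: "open {g. tmul y g \<in> O1}" for y :: "('n0, 'n1, 'n2) triple"
    using O1(1) continuous_on_tmul[OF continuous_on_const continuous_on_id, of UNIV y]
    by (simp add: continuous_on_open_vimage vimage_def)
  have U: "g \<in> K" if "g \<in> U" "g \<in> Stab A" for g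
  proof -
    from that(1) obtain y where y: "y \<in> K" "tmul y g \<in> O1" unfolding U_def by blast
    obtain h where h: "h \<in> K" "tmul h y = tone" using inv[OF y(1)] by blast
    have "tmul y g \<in> K" using O1(3) y K that by (intro O1(3) Stab_mult) auto
    then have "tmul h (tmul y g) \<in> K" by (rule mult[OF h(1)])
    then show ?thesis by (simp flip: tmul_assoc add: h)
  qed
  have V: "g \<notin> K" if "g \<in> V" "g \<in> Stab A" for g
  proof
    assume g: "g \<in> K"
    from that(1) obtain y where y: "y \<in> Stab A" "y \<notin> K" "tmul y g \<in> O1" unfolding V_def by blast
    obtain h where h: "h \<in> K" "tmul g h = tone" using inv[OF g] by blast
    have "tmul y g \<in> K" using O1(3) y that by (intro O1(3) Stab_mult) auto
    then have "tmul (tmul y g) h \<in> K" by (rule mult[OF _ h(1)])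
    then show False using y by (simp add: tmul_assoc h)
  qed
  have cover: "Stab A \<subseteq> U \<union> V"
  proof
    fix g assume "g \<in> Stab A"
    then obtain h where h: "h \<in> Stab A" "tmul h g = tone" using Stab_inverse by blast
    then have "tmul h g \<in> O1" using O1(2) by simp
    then show "g \<in> U \<union> V" unfolding U_def V_def using h(1) by blast
  qed
  have sub: "Stab0 A \<subseteq> Stab A" unfolding Stab0_def by (rule connected_component_subset)
  have con: "connected (Stab0 A)" unfolding Stab0_def by (rule connected_connected_component)
  have one: "tone \<in> Stab0 A" unfolding Stab0_def
    by (simp add: connected_component_refl Stab_one)
  have "tone \<in> U" using O1(2) K(3) by (auto simp: U_def intro!: bexI[of _ tone])
  moreover have "open U" "open V" unfolding U_def V_def using op by auto
  moreover have "U \<inter> V \<inter> Stab0 A = {}" using U V sub by blast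
  ultimately have "V \<inter> Stab0 A = {}"
    using connectedD[OF con, of U V] one cover sub by blast
  then show "Stab0 A \<subseteq> K" using cover sub U by blast
qed

lemma Stab_conj:
  assumes PQ: "tmul P Q = tone" "tmul Q P = tone" and g: "g \<in> Stab (tensor_act P A)"
  shows "tmul Q (tmul g P) \<in> Stab A"
proof -
  obtain c where c: "c \<noteq> 0" "tensor_act g (tensor_act P A) = scale3 c (tensor_act P A)" and d: "g \<in> SL \<times> SL \<times> SL"
    using g by (auto simp: Stab_def)
  have "tensor_act (tmul Q (tmul g P)) A = scale3 c (tensor_act (tmul Q P) A)"
    by (simp add: tensor_act_tmul c tensor_act_scale3)
  moreover have "tmul Q (tmul g P) \<in> SL \<times> SL \<times> SL"
  proof -
    have 1: "det (q ** (x ** p)) = det x" if "q ** p = mat 1" for q x p :: "complex^'x::finite^'x"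
      using det_mul[of q p] that by (simp add: det_mul algebra_simps)
    show ?thesis using d PQ by (cases P; cases Q; cases g) (simp add: SL_def 1)
  qed
  ultimately show ?thesis using c(1) by (auto simp: Stab_def PQ tensor_act_one)
qed

lemma Stab0_conj_subset:
  assumes PQ: "tmul P Q = tone" "tmul Q P = tone"
  shows "(\<lambda>g. tmul Q (tmul g P)) ` Stab0 (tensor_act P A) \<subseteq> Stab0 A"
  unfolding Stab0_def[of A]
proof (rule connected_component_maximal)
  let ?S = "Stab0 (tensor_act P A)"
  have "tone \<in> ?S" unfolding Stab0_def by (simp add: connected_component_refl Stab_one)
  then show "tone \<in> (\<lambda>g. tmul Q (tmul g P)) ` ?S" by (rule rev_image_eqI) (simp add: PQ)
  have "connected ?S" unfolding Stab0_def by (rule connected_connected_component)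
  then show "connected ((\<lambda>g. tmul Q (tmul g P)) ` ?S)"
    by (intro connected_continuous_image continuous_intros)
  have "?S \<subseteq> Stab (tensor_act P A)" unfolding Stab0_def by (rule connected_component_subset)
  then show "(\<lambda>g. tmul Q (tmul g P)) ` ?S \<subseteq> Stab A" using Stab_conj[OF PQ] by blast
qed

text \<open>Conjugation by \<open>P\<close> is a homeomorphism between the two stabilizers; it
  preserves determinants, whatever the determinants of \<open>P\<close> are. Normal forms under
  arbitrary changes of bases are therefore allowed.\<close>

lemma Stab0_conj:
  assumes PQ: "tmul P Q = tone" "tmul Q P = tone"
  shows "Stab0 A = (\<lambda>g. tmul Q (tmul g P)) ` Stab0 (tensor_act P A)"
proof
  have A: "tensor_act Q (tensor_act P A) = A" by (simp flip: tensor_act_tmul add: PQ tensor_act_one)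
  show "Stab0 A \<subseteq> (\<lambda>g. tmul Q (tmul g P)) ` Stab0 (tensor_act P A)"
  proof
    fix g assume "g \<in> Stab0 A"
    then have "tmul P (tmul g Q) \<in> Stab0 (tensor_act P A)"
      using Stab0_conj_subset[OF PQ(2,1), of "tensor_act P A"] by (auto simp: A)
    moreover have "g = tmul Q (tmul (tmul P (tmul g Q)) P)"
      by (simp add: tmul_assoc PQ) (simp flip: tmul_assoc add: PQ)
    ultimately show "g \<in> (\<lambda>g. tmul Q (tmul g P)) ` Stab0 (tensor_act P A)" by blast
  qed
qed (rule Stab0_conj_subset[OF PQ])

section \<open>The image of the special linear group\<close>

lemma continuous_on_rho:
  fixes \<iota> :: "'n::finite \<Rightarrow> nat"
  shows "continuous_on S (rho \<iota> k)"
proof (rule continuous_on_matrixI)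
  fix i j
  show "continuous_on S (\<lambda>g. rho \<iota> k g $ i $ j)"
    by (rule generated_algebra_continuous[OF rho_regular]) (auto intro!: continuous_intros)
qed

lemma continuous_on_mk [continuous_intros]:
  assumes "continuous_on S a" "continuous_on S b" "continuous_on S c" "continuous_on S d"
  shows "continuous_on S (\<lambda>x. mk (a x) (b x) (c x) (d x))"
proof (rule continuous_on_matrixI)
  fix i j :: 2
  show "continuous_on S (\<lambda>x. mk (a x) (b x) (c x) (d x) $ i $ j)"
    using exhaust_2[of i] exhaust_2[of j] assms by auto
qed

definition elem4 :: "complex \<times> complex \<times> complex \<times> complex \<Rightarrow> complex^2^2" where
  "elem4 p = (case p of (x, y, z, w) \<Rightarrow> mk 1 x 0 1 ** (mk 1 0 y 1 ** (mk 1 z 0 1 ** mk 1 0 w 1)))"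

text \<open>As a continuous image of affine four-space the group is connected, and statements about
  multiplicative functions reduce to elementary matrices.\<close>

lemma SL_elementary: "(SL :: (complex^2^2) set) = range elem4"
proof
  have 1: "elem4 (x, y, z, w) = mk ((1 + x * y) * (1 + z * w) + x * w) ((1 + x * y) * z + x) (y * (1 + z * w) + w) (y * z + 1)" for x y z w
    unfolding elem4_def split by (simp add: mk_mult mk_inject algebra_simps)
  show "range elem4 \<subseteq> SL"
    by (auto simp: 1 mk_in_SL) (simp add: algebra_simps)
  show "SL \<subseteq> range elem4"
  proof
    fix g :: "complex^2^2" assume "g \<in> SL"
    then obtain a b c d where g: "g = mk a b c d" and det: "a * d - b * c = 1"
      using mk_eq[of g] mk_in_SL by metis
    show "g \<in> range elem4"
    proof (cases "c = 0")
      case False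
      have "g = elem4 ((a - 1) / c, c, (d - 1) / c, 0)"
        unfolding g 1 mk_inject using False det by (simp add: field_simps)
      then show ?thesis by blast
    next
      case True
      then have d: "d \<noteq> 0" "a = 1 / d" using det by (auto simp: eq_divide_eq)
      \<comment> \<open>Right multiplication by \<open>mk 1 0 1 1\<close> moves \<open>d\<close>
        into the lower left corner, where it makes the previous case applicable; the last factor
        \<open>- 1\<close> undoes this.\<close>
      have "g = elem4 ((a + b - 1) / d, d, (d - 1) / d, - 1)"
        unfolding g 1 mk_inject using d True by (simp add: field_simps)
      then show ?thesis by blast
    qed
  qed
qed

lemma connected_SL2: "connected (SL :: (complex^2^2) set)"
  unfolding SL_elementary elem4_def split_beta
  by (intro connected_continuous_image continuous_intros connected_UNIV)

context index
begin

text \<open>Elementary matrices are commutators: conjugating by \<open>mk 2 0 0 (1/2)\<close>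
  multiplies the parameter by four, so the commutator has parameter \<open>3 * x\<close>. A
  multiplicative function with commutative values is \<open>1\<close> on commutators.\<close>

lemma det_rho_one:
  assumes "g \<in> SL"
  shows "det (rho \<iota> k g) = 1"
proof -
  have m: "det (rho \<iota> k (g ** h)) = det (rho \<iota> k g) * det (rho \<iota> k h)" for g h
    by (simp add: rho_mult det_mul)
  have c: "det (rho \<iota> k (g ** (h ** (g' ** h')))) = 1" if "g ** g' = mat 1" "h ** h' = mat 1" for g h g' h'
    using m[of g g'] m[of h h'] by (simp add: m that rho_one algebra_simps)
  have "det (rho \<iota> k (mk 1 (3 * x) 0 1)) = 1" for x
    using c[of "mk 2 0 0 (1/2)" "mk (1/2) 0 0 2" "mk 1 x 0 1" "mk 1 (-x) 0 1"] by (simp add: mk_mult mk_one)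
  from this[of "_ / 3"] have u: "det (rho \<iota> k (mk 1 x 0 1)) = 1" for x by simp
  have "det (rho \<iota> k (mk 1 0 (3 * x) 1)) = 1" for x
    using c[of "mk (1/2) 0 0 2" "mk 2 0 0 (1/2)" "mk 1 0 x 1" "mk 1 0 (-x) 1"] by (simp add: mk_mult mk_one)
  from this[of "_ / 3"] have l: "det (rho \<iota> k (mk 1 0 x 1)) = 1" for x by simp
  obtain p where "g = elem4 p" using assms unfolding SL_elementary by blast
  then show ?thesis by (cases p) (simp add: elem4_def m u l)
qed

lemma rho_diag: "rho \<iota> k (mk s 0 0 t) $ i $ j = (if i = j then s ^ (k - \<iota> j) * t ^ \<iota> j else 0)"
proof -
  have "[:s:] ^ n = [:s ^ n:]" for n
    by (induction n) (auto simp: one_pCons)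
  moreover have "[:0, t:] ^ n = monom (t ^ n) n" for n
    by (induction n) (simp_all add: one_pCons monom_Suc monom_0 smult_monom)
  ultimately show ?thesis
    by (simp add: rho_def index_inj smult_monom)
qed

end

lemma SL_group: "g \<in> SL \<Longrightarrow> h \<in> SL \<Longrightarrow> g ** h \<in> SL"
  "g \<in> SL \<Longrightarrow> \<exists>h\<in>SL. g ** h = mat 1 \<and> h ** g = mat 1"
  for g h :: "complex^2^2"
proof -
  show "g ** h \<in> SL" if "g \<in> SL" "h \<in> SL" using that by (simp add: SL_def det_mul)
  assume "g \<in> SL"
  then obtain a b c d where g: "g = mk a b c d" and det: "a * d - b * c = 1"
    using mk_eq[of g] mk_in_SL by metis
  show "\<exists>h\<in>SL. g ** h = mat 1 \<and> h ** g = mat 1"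
    using det by (intro bexI[of _ "mk d (-b) (-c) a"]) (auto simp: g mk_mult mk_one mk_inject mk_in_SL algebra_simps)
qed

context boundary_index
begin

lemma rho3_mult: "tmul (rho3 g) (rho3 h) = rho3 (g ** h)"
  by (simp add: rho3_def i0.rho_mult i1.rho_mult i2.rho_mult)

lemma rho3_one: "rho3 (mat 1) = tone"
  by (simp add: rho3_def i0.rho_one i1.rho_one i2.rho_one)

lemma rho3_SL: "g \<in> SL \<Longrightarrow> rho3 g \<in> SL \<times> SL \<times> SL"
  by (simp add: rho3_def SL_def[where 'n='n0] SL_def[where 'n='n1] SL_def[where 'n='n2] i0.det_rho_one i1.det_rho_one i2.det_rho_one)

lemma continuous_on_rho3: "continuous_on S rho3"
  unfolding rho3_def by (intro continuous_intros continuous_on_rho)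

lemma Stab0_rho3I:
  assumes H: "H \<subseteq> SL" "connected H" "mat 1 \<in> H" "\<And>g h. g \<in> H \<Longrightarrow> h \<in> H \<Longrightarrow> g ** h \<in> H"
      "\<And>g. g \<in> H \<Longrightarrow> \<exists>h\<in>H. g ** h = mat 1 \<and> h ** g = mat 1"
    and act: "\<And>g. g \<in> H \<Longrightarrow> \<exists>c. c \<noteq> 0 \<and> tensor_act (rho3 g) A = scale3 c A"
    and near: "\<forall>\<^sub>F g in nhds tone. g \<in> Stab A \<longrightarrow> g \<in> rho3 ` H"
  shows "Stab0 A = rho3 ` H"
proof (rule Stab0_eqI)
  show "rho3 ` H \<subseteq> Stab A" unfolding Stab_def using H(1) act rho3_SL by blast
  show "connected (rho3 ` H)" by (intro connected_continuous_image continuous_on_rho3 H)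
  show "tone \<in> rho3 ` H" using H(3) rho3_one by (metis imageI)
  show "tmul g h \<in> rho3 ` H" if "g \<in> rho3 ` H" "h \<in> rho3 ` H" for g h
    using that H(4) by (auto simp: rho3_mult)
  show "\<exists>h\<in>rho3 ` H. tmul g h = tone \<and> tmul h g = tone" if "g \<in> rho3 ` H" for g
  proof -
    from that obtain x where x: "x \<in> H" "g = rho3 x" by blast
    obtain y where "y \<in> H" "x ** y = mat 1" "y ** x = mat 1" using H(5)[OF x(1)] by blast
    then show ?thesis by (intro bexI[of _ "rho3 y"]) (auto simp: x rho3_mult rho3_one)
  qed
qed (rule near)

end

section \<open>Stabilizers of tensors of diagonal type\<close>

lemma tensor_eq_tri: "(\<And>x y z. tri A x y z = tri B x y z) \<Longrightarrow> A = B"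
  unfolding vec_eq_iff by (metis tri_axis)

lemma lie_act_conj:
  fixes A :: "('n0::finite, 'n1::finite, 'n2::finite) tensor"
  assumes "Y0 ** g0 = g0 ** X0" "Y1 ** g1 = g1 ** X1" "Y2 ** g2 = g2 ** X2"
  shows "lie_act (Y0, Y1, Y2) (tensor_act (g0, g1, g2) A) = tensor_act (g0, g1, g2) (lie_act (X0, X1, X2) A)"
proof (rule tensor_eq_tri)
  fix x y z
  have 1: "transpose g *v (transpose Y *v v) = transpose X *v (transpose g *v v)"
    if "Y ** g = g ** X" for X Y g :: "complex^'x::finite^'x" and v
    using that by (metis matrix_transpose_mul matrix_vector_mul_assoc)
  show "tri (lie_act (Y0, Y1, Y2) (tensor_act (g0, g1, g2) A)) x y z =
      tri (tensor_act (g0, g1, g2) (lie_act (X0, X1, X2) A)) x y z"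
    by (simp add: tri_lie_act tri_tensor_act 1[OF assms(1)] 1[OF assms(2)] 1[OF assms(3)])
qed

lemma lie_act_scale3: "lie_act (X0, X1, X2) (scale3 c A) = scale3 c (lie_act (X0, X1, X2) A)"
  by (rule tensor_eq_tri) (simp add: tri_lie_act tri_scale3 algebra_simps)

lemma scale3_eq_0: "scale3 c A = 0 \<longleftrightarrow> c = 0 \<or> A = 0"
  by (auto simp: scale3_def vec_eq_iff)

text \<open>The stabilizer acts on the Lie algebra by conjugation. In the form
  \<open>Y ** g = g ** X\<close> this can be stated without inverses.\<close>

lemma Stab_lie_act:
  assumes g: "(g0, g1, g2) \<in> Stab A" and X: "lie_act (X0, X1, X2) A = 0"
    and Y: "Y0 ** g0 = g0 ** X0" "Y1 ** g1 = g1 ** X1" "Y2 ** g2 = g2 ** X2"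
  shows "lie_act (Y0, Y1, Y2) A = 0"
proof -
  obtain c where c: "c \<noteq> 0" "tensor_act (g0, g1, g2) A = scale3 c A" using g by (auto simp: Stab_def)
  have "scale3 c (lie_act (Y0, Y1, Y2) A) = tensor_act (g0, g1, g2) 0"
    using lie_act_conj[OF Y, of A] by (simp add: c lie_act_scale3 X)
  also have "\<dots> = 0" by (rule tensor_eq_tri) (simp add: tri_tensor_act, simp add: tri_def contr_0)
  finally show ?thesis using c(1) by (simp add: scale3_eq_0)
qed

lemma eventually_near_one:
  assumes "(F \<longlongrightarrow> (mat 1 :: complex^'n::finite^'n)) L" "d > 0"
  shows "\<forall>\<^sub>F x in L. \<forall>i j. cmod ((F x - mat 1) $ i $ j) < d"
proof -
  have "\<forall>\<^sub>F x in L. cmod ((F x - mat 1) $ i $ j) < d" for i j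
  proof -
    have "((\<lambda>x. F x $ i $ j) \<longlongrightarrow> mat 1 $ i $ j) L"
      by (intro tendsto_vec_nth assms)
    from tendstoD[OF this assms(2)] show ?thesis by (simp add: dist_norm)
  qed
  then show ?thesis by (intro eventually_all_finite)
qed

context index
begin

lemma drho_diag: "drho \<iota> k u 0 0 $ i $ j = (if i = j then u * (of_nat k - 2 * of_nat (\<iota> j)) else 0)"
  by (simp add: drho_def index_inj)

text \<open>Comparing diagonal entries, which are nonzero for \<open>g\<close> near one, identifies
  the eigenvalues of \<open>Y\<close> with those of \<open>drho\<close>. The latter are pairwise
  distinct, so the entries of \<open>g\<close> off the diagonal vanish.\<close>

lemma diagonal_of_conj:
  fixes g Y :: "complex^'n^'n"
  assumes Y: "\<And>i j. i \<noteq> j \<Longrightarrow> Y $ i $ j = 0" and g: "Y ** g = g ** drho \<iota> k 1 0 0" "\<And>i. g $ i $ i \<noteq> 0"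
    and "i \<noteq> j"
  shows "g $ i $ j = 0"
proof -
  have "(Y ** g) $ i $ j = Y $ i $ i * g $ i $ j" for i j
  proof -
    have "(Y ** g) $ i $ j = (\<Sum>l\<in>UNIV. if l = i then Y $ i $ i * g $ i $ j else 0)"
      unfolding matrix_matrix_mult_def vec_lambda_beta using Y by (intro sum.cong) auto
    then show ?thesis by simp
  qed
  moreover have "(g ** drho \<iota> k 1 0 0) $ i $ j = g $ i $ j * (of_nat k - 2 * of_nat (\<iota> j))" for i j
    by (simp add: matrix_matrix_mult_def drho_diag if_distrib cong: if_cong)
  ultimately have e: "Y $ i $ i * g $ i $ j = g $ i $ j * (of_nat k - 2 * of_nat (\<iota> j))" for i j
    using g(1) by metis
  have "Y $ i $ i = of_nat k - 2 * of_nat (\<iota> i)" using e[of i i] g(2)[of i] by simp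
  then have "g $ i $ j * (of_nat (\<iota> i) - of_nat (\<iota> j)) = 0" using e[of i j] by algebra
  then show ?thesis using \<open>i \<noteq> j\<close> by (simp add: index_inj)
qed

text \<open>Determinant one makes the sum of the weights a multiple of \<open>2 pi i\<close>, and
  smallness makes it zero. The progression is then symmetric, \<open>a = - k \<delta> / 2\<close>,
  which is the weight pattern of a diagonal element of \<open>SL(2)\<close>. The bound involves
  \<open>n\<close> rather than \<open>k\<close> so that a single neighbourhood serves all three
  factors.\<close>

lemma exp_weights_rho:
  fixes G :: "complex^'n^'n"
  assumes G: "\<And>i j. i \<noteq> j \<Longrightarrow> G $ i $ j = 0" "\<And>i. G $ i $ i = exp (w i)" and det: "det G = 1"
    and w: "\<And>i. w i = a + of_nat (\<iota> i) * \<delta>" and small: "\<And>i. cmod (w i) < pi / (3 * (real n + 1))" and "k \<le> n"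
  shows "G = rho \<iota> k (mk (exp (- \<delta> / 2)) 0 0 (inverse (exp (- \<delta> / 2))))"
proof -
  have "exp (\<Sum>i\<in>UNIV. w i) = 1"
    using det det_diagonal[of G] G by (simp add: exp_sum)
  moreover have "cmod (\<Sum>i\<in>UNIV. w i) < 2 * pi"
  proof -
    have "cmod (\<Sum>i\<in>UNIV. w i) \<le> (\<Sum>i\<in>(UNIV :: 'n set). pi / (3 * (real n + 1)))"
      by (intro order.trans[OF norm_sum] sum_mono less_imp_le small)
    also have "\<dots> = (real k + 1) * pi / (3 * (real n + 1))" by (simp add: index_card add.commute)
    also have "\<dots> \<le> (real n + 1) * pi / (3 * (real n + 1))"
      using \<open>k \<le> n\<close> by (intro divide_right_mono mult_right_mono) auto
    also have "\<dots> = pi / 3" by (simp add: divide_simps del: of_nat_Suc)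
    finally show ?thesis using pi_gt_zero by linarith
  qed
  ultimately have "(\<Sum>i\<in>UNIV. w i) = 0"
    using abs_Im_le_cmod[of "\<Sum>i\<in>UNIV. w i"] by (intro exp_complex_eqI[of _ 0]) auto
  then have "2 * (\<Sum>m\<le>k. a + of_nat m * \<delta>) = 0" by (simp add: w sum_index[of "\<lambda>m. a + of_nat m * \<delta>"])
  then have "2 * (of_nat k + 1) * a + (2 * (\<Sum>m\<le>k. of_nat m)) * \<delta> = 0"
    by (simp only: sum.distrib flip: sum_distrib_right) (simp add: algebra_simps)
  then have "(of_nat k + 1) * (2 * a + of_nat k * \<delta>) = 0"
    using double_gauss_sum[of k, where 'a=complex] by (simp add: atMost_atLeast0 algebra_simps)
  moreover have "of_nat k + 1 \<noteq> (0::complex)" by (metis of_nat_Suc of_nat_eq_0_iff nat.distinct(1) add.commute)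
  ultimately have "2 * a + of_nat k * \<delta> = 0" by (metis mult_eq_0_iff)
  then have "2 * a = - (of_nat k * \<delta>)" by (simp only: eq_neg_iff_add_eq_0)
  moreover have "a = 2 * a / 2" by simp
  ultimately have a: "a = - of_nat k * \<delta> / 2" by (metis mult_minus_left)
  have "exp (w i) = exp (- \<delta> / 2) ^ (k - \<iota> i) * inverse (exp (- \<delta> / 2)) ^ \<iota> i" for i
  proof -
    have "inverse (exp (- \<delta> / 2)) = exp (\<delta> / 2)" by (simp add: exp_minus)
    then have "exp (- \<delta> / 2) ^ (k - \<iota> i) * inverse (exp (- \<delta> / 2)) ^ \<iota> i =
      exp (of_nat (k - \<iota> i) * (- \<delta> / 2) + of_nat (\<iota> i) * (\<delta> / 2))"
      unfolding exp_add exp_of_nat_mult by simp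
    also have "of_nat (k - \<iota> i) * (- \<delta> / 2) + of_nat (\<iota> i) * (\<delta> / 2) = w i"
      using index_le[of i] by (simp add: w a of_nat_diff field_simps)
    finally show ?thesis ..
  qed
  then show ?thesis using G by (auto simp: vec_eq_iff rho_diag)
qed

end

context boundary_index
begin

text \<open>Logarithms of the diagonal entries have constant sum on the support, hence form
  arithmetic progressions with a common difference. The same \<open>\<delta>\<close> in all three
  factors is what yields one element \<open>mk s 0 0 (inverse s)\<close>.\<close>

lemma diag_stab_rho3:
  assumes A: "diag_type A" and g: "(g0, g1, g2) \<in> Stab A"
    and diag: "\<And>i j. i \<noteq> j \<Longrightarrow> g0 $ i $ j = 0" "\<And>i j. i \<noteq> j \<Longrightarrow> g1 $ i $ j = 0" "\<And>i j. i \<noteq> j \<Longrightarrow> g2 $ i $ j = 0"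
    and d: "\<And>z. cmod (z - 1) < d \<Longrightarrow> z \<noteq> 0 \<and> cmod (Ln z) < pi / (3 * (real k0 + 1))"
    and near: "\<And>i. cmod (g0 $ i $ i - 1) < d" "\<And>i. cmod (g1 $ i $ i - 1) < d" "\<And>i. cmod (g2 $ i $ i - 1) < d"
  shows "\<exists>s. s \<noteq> 0 \<and> (g0, g1, g2) = rho3 (mk s 0 0 (inverse s))"
proof -
  obtain c where c: "c \<noteq> 0" "tensor_act (g0, g1, g2) A = scale3 c A" and det: "det g0 = 1" "det g1 = 1" "det g2 = 1"
    using g by (auto simp: Stab_def SL_def)
  have delta: "(\<Sum>i'\<in>UNIV. G $ i $ i' * f i') = G $ i $ i * f i" if "\<And>i j. i \<noteq> j \<Longrightarrow> G $ i $ j = 0"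
    for G :: "complex^'x::finite^'x" and f :: "'x \<Rightarrow> complex" and i
  proof -
    have "(\<Sum>i'\<in>UNIV. G $ i $ i' * f i') = (\<Sum>i'\<in>UNIV. if i' = i then G $ i $ i * f i else 0)"
      using that by (intro sum.cong) auto
    then show ?thesis by simp
  qed
  have entry: "tensor_act (g0, g1, g2) A $ i $ j $ l = g0 $ i $ i * (g1 $ j $ j * (g2 $ l $ l * A $ i $ j $ l))" for i j l
    by (simp add: tensor_act_modes mode0_def mode1_def mode2_def delta[OF diag(1)] delta[OF diag(2)] delta[OF diag(3)])
  have prod: "g0 $ i $ i * g1 $ j $ j * g2 $ l $ l = c" if "\<iota>0 i + \<iota>1 j + \<iota>2 l = k0" for i j l
  proof -
    have "A $ i $ j $ l \<noteq> 0" using A that by (simp add: diag_type_def)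
    then show ?thesis using entry[of i j l] by (simp add: c scale3_def)
  qed
  define w0 w1 w2 where "w0 i = Ln (g0 $ i $ i)" and "w1 j = Ln (g1 $ j $ j)" and "w2 l = Ln (g2 $ l $ l)" for i j l
  have small: "cmod (w0 i) < pi / (3 * (real k0 + 1))" "cmod (w1 j) < pi / (3 * (real k0 + 1))"
    "cmod (w2 l) < pi / (3 * (real k0 + 1))" for i j l
    unfolding w0_def w1_def w2_def using d near by blast+
  have ex: "g0 $ i $ i = exp (w0 i)" "g1 $ j $ j = exp (w1 j)" "g2 $ l $ l = exp (w2 l)" for i j l
    unfolding w0_def w1_def w2_def using d near by (metis exp_Ln)+
  obtain a b e where abe: "\<iota>0 a = k0" "\<iota>1 b = 0" "\<iota>2 e = 0"
    using i0.index_surj[of k0] i1.index_surj[of 0] i2.index_surj[of 0] by auto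
  have C: "w0 i + w1 j + w2 l = w0 a + w1 b + w2 e" if s: "\<iota>0 i + \<iota>1 j + \<iota>2 l = k0" for i j l
  proof (rule exp_complex_eqI)
    have "pi / (3 * (real k0 + 1)) \<le> pi / 3" by (intro divide_left_mono) auto
    then have "cmod (w0 i) < pi / 3" "cmod (w1 j) < pi / 3" "cmod (w2 l) < pi / 3"
      "cmod (w0 a) < pi / 3" "cmod (w1 b) < pi / 3" "cmod (w2 e) < pi / 3"
      using small by (meson order.strict_trans2)+
    then have "\<bar>Im (w0 i)\<bar> < pi / 3" "\<bar>Im (w1 j)\<bar> < pi / 3" "\<bar>Im (w2 l)\<bar> < pi / 3"
      "\<bar>Im (w0 a)\<bar> < pi / 3" "\<bar>Im (w1 b)\<bar> < pi / 3" "\<bar>Im (w2 e)\<bar> < pi / 3"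
      by (meson abs_Im_le_cmod order.strict_trans1)+
    then show "\<bar>Im (w0 i + w1 j + w2 l) - Im (w0 a + w1 b + w2 e)\<bar> < 2 * pi" by simp
    show "exp (w0 i + w1 j + w2 l) = exp (w0 a + w1 b + w2 e)"
      using prod[OF s] prod[of a b e] abe by (simp add: exp_add ex)
  qed
  obtain \<delta> a0 a1 a2 where w: "\<forall>i. w0 i = a0 + of_nat (\<iota>0 i) * \<delta>" "\<forall>j. w1 j = a1 + of_nat (\<iota>1 j) * \<delta>"
    "\<forall>l. w2 l = a2 + of_nat (\<iota>2 l) * \<delta>"
    using weights_arith[of w0 w1 w2 "w0 a + w1 b + w2 e", OF C] by blast
  have kk: "k1 \<le> k0" "k2 \<le> k0" using k012 by simp_all
  show ?thesis
    using i0.exp_weights_rho[of g0 w0, OF diag(1) ex(1) det(1) w(1)[rule_format] small(1)]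
      i1.exp_weights_rho[of g1 w1, OF diag(2) ex(2) det(2) w(2)[rule_format] small(2)]
      i2.exp_weights_rho[of g2 w2, OF diag(3) ex(3) det(3) w(3)[rule_format] small(3)] kk
    by (intro exI[of _ "exp (- \<delta> / 2)"]) (simp add: rho3_def)
qed

lemma lie_act_diag:
  assumes "diag_type A"
  shows "lie_act (drho3 u 0 0) A = 0"
proof -
  have "lie_act (drho3 u 0 0) A $ i $ j $ l = 0" for i j l
  proof -
    have "lie_act (drho3 u 0 0) A $ i $ j $ l = u * (of_nat k0 - 2 * of_nat (\<iota>0 i) + (of_nat k1 - 2 * of_nat (\<iota>1 j))
        + (of_nat k2 - 2 * of_nat (\<iota>2 l))) * A $ i $ j $ l"
      by (simp add: drho3_def lie_act_entry i0.drho_diag i1.drho_diag i2.drho_diag if_distrib if_distribR cong: if_cong)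
        (simp add: algebra_simps)
    also have "\<dots> = u * (2 * (of_nat k0 - of_nat (\<iota>0 i + \<iota>1 j + \<iota>2 l))) * A $ i $ j $ l"
      using k012 by (simp add: algebra_simps)
    also have "\<dots> = 0"
      using assms by (cases "\<iota>0 i + \<iota>1 j + \<iota>2 l = k0") (auto simp: diag_type_def simp del: of_nat_add)
    finally show ?thesis .
  qed
  then show ?thesis by (simp add: vec_eq_iff)
qed

lemma cards: "CARD('n0) + 1 = CARD('n1) + CARD('n2)" "CARD('n1) \<ge> 2" "CARD('n2) \<ge> 2"
  using k012 by (simp_all add: i0.index_card i1.index_card i2.index_card)

text \<open>By homogeneity the degree-one component kills \<open>A\<close> on its own. It is
  nilpotent and nonzero, hence regular in all factors, and so none of its subdiagonal entries
  vanishes.\<close>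

lemma lie_shift_identity:
  assumes A: "block_bounded A" "diag_type A" and X: "lie_act (X0, X1, X2) A = 0"
    and nz: "part \<iota>0 1 X0 \<noteq> 0 \<or> part \<iota>1 1 X1 \<noteq> 0 \<or> part \<iota>2 1 X2 \<noteq> 0"
  shows "is_identity k0 k1 k2 A"
proof -
  let ?Y0 = "part \<iota>0 1 X0" and ?Y1 = "part \<iota>1 1 X1" and ?Y2 = "part \<iota>2 1 X2"
  have Y: "lie_act (?Y0, ?Y1, ?Y2) A = 0" by (rule lie_act_part[OF A(2) X])
  have reg: "regular_nilp ?Y0 \<and> regular_nilp ?Y1 \<and> regular_nilp ?Y2"
    by (rule lie_act_regular[OF cards A(1) Y i1.part_nilp i2.part_nilp nz]) simp_all
  have nz0: "?Y0 $ i $ j \<noteq> 0" if "\<iota>0 i = Suc (\<iota>0 j)" for i j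
    using i0.regular_part(2)[of 1 X0 i j] reg k012 that by (simp add: part_def)
  have nz1: "?Y1 $ i $ j \<noteq> 0" if "\<iota>1 i = Suc (\<iota>1 j)" for i j
    using i1.regular_part(2)[of 1 X1 i j] reg k012 that by (simp add: part_def)
  have nz2: "?Y2 $ i $ j \<noteq> 0" if "\<iota>2 i = Suc (\<iota>2 j)" for i j
    using i2.regular_part(2)[of 1 X2 i j] reg k012 that by (simp add: part_def)
  have idem: "part \<iota> 1 (part \<iota> 1 X) = part \<iota> 1 X" for \<iota> and X :: "complex^'x::finite^'x"
    by (simp add: part_def vec_eq_iff)
  obtain P Q R where PQR: "\<forall>m\<le>k0. P m \<noteq> 0" "\<forall>m\<le>k1. Q m \<noteq> 0" "\<forall>m\<le>k2. R m \<noteq> 0"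
    and PF: "\<forall>i j l. A $ i $ j $ l = (if \<iota>0 i + \<iota>1 j + \<iota>2 l = k0 then P (\<iota>0 i) * Q (\<iota>1 j) * R (\<iota>2 l) else 0)"
    using shift_product_form[OF A(2) Y idem idem idem nz0 nz1 nz2] by blast
  show ?thesis
    by (rule product_form_identity[where ?P0.0 = "mat 1" and ?P1.0 = "mat 1" and ?P2.0 = "mat 1" and p = P and q = Q and r = R])
      (use PQR PF in \<open>simp_all add: tensor_act_one invertibleI[of "mat 1" "mat 1"]\<close>)
qed

text \<open>Regularity excludes degrees other than one and minus one, and reversing all orderings
  exchanges these two.\<close>

lemma lie_offdiag_identity:
  assumes A: "block_bounded A" "diag_type A" and X: "lie_act (X0, X1, X2) A = 0"
    and nz: "part \<iota>0 m X0 \<noteq> 0 \<or> part \<iota>1 m X1 \<noteq> 0 \<or> part \<iota>2 m X2 \<noteq> 0" and m: "m \<noteq> 0"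
  shows "is_identity k0 k1 k2 A \<and> (m = 1 \<or> m = - 1)"
proof -
  have "regular_nilp (part \<iota>0 m X0) \<and> regular_nilp (part \<iota>1 m X1) \<and> regular_nilp (part \<iota>2 m X2)"
    by (rule lie_act_regular[OF cards A(1) lie_act_part[OF A(2) X] i1.part_nilp[OF m] i2.part_nilp[OF m] nz])
  then have m1: "m = 1 \<or> m = - 1" using i1.regular_part(1)[of m X1] m k012 by blast
  interpret r: boundary_index "\<lambda>i. k0 - \<iota>0 i" "\<lambda>j. k1 - \<iota>1 j" "\<lambda>l. k2 - \<iota>2 l" k0 k1 k2 by (rule reversed)
  have rev: "part (\<lambda>i. k - \<iota> i) 1 X = part \<iota> (- 1) X" if "\<And>i. \<iota> i \<le> k"
    for \<iota> k and X :: "complex^'x::finite^'x"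
    using that by (auto simp: part_def vec_eq_iff of_nat_diff)
  have rA: "r.diag_type A" using A(2) by (simp add: diag_type_def r.diag_type_def reversed_sum)
  show ?thesis
    using m1 lie_shift_identity[OF A X] r.lie_shift_identity[OF A(1) rA X] nz
    by (auto simp: rev[OF i0.index_le] rev[OF i1.index_le] rev[OF i2.index_le])
qed

lemma nonidentity_lie_diagonal:
  assumes A: "block_bounded A" "diag_type A" "\<not> is_identity k0 k1 k2 A" and X: "lie_act (X0, X1, X2) A = 0"
  shows "\<And>i j. i \<noteq> j \<Longrightarrow> X0 $ i $ j = 0" "\<And>i j. i \<noteq> j \<Longrightarrow> X1 $ i $ j = 0" "\<And>i j. i \<noteq> j \<Longrightarrow> X2 $ i $ j = 0"
proof -
  have z: "part \<iota>0 m X0 = 0" "part \<iota>1 m X1 = 0" "part \<iota>2 m X2 = 0" if "m \<noteq> 0" for m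
    using lie_offdiag_identity[OF A(1,2) X _ that] A(3) by blast+
  have part_entry: "X $ i $ j = part \<iota> (int (\<iota> i) - int (\<iota> j)) X $ i $ j" for \<iota> i j and X :: "complex^'x::finite^'x"
    by (simp add: part_def)
  show "X0 $ i $ j = 0" if "i \<noteq> j" for i j
    using that part_entry[of X0 i j \<iota>0] z(1)[of "int (\<iota>0 i) - int (\<iota>0 j)"] by (simp add: i0.index_inj)
  show "X1 $ i $ j = 0" if "i \<noteq> j" for i j
    using that part_entry[of X1 i j \<iota>1] z(2)[of "int (\<iota>1 i) - int (\<iota>1 j)"] by (simp add: i1.index_inj)
  show "X2 $ i $ j = 0" if "i \<noteq> j" for i j
    using that part_entry[of X2 i j \<iota>2] z(3)[of "int (\<iota>2 i) - int (\<iota>2 j)"] by (simp add: i2.index_inj)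
qed

lemma Stab_inverseE:
  assumes "(g0, g1, g2) \<in> Stab A"
  obtains h0 h1 h2 where "g0 ** h0 = mat 1" "h0 ** g0 = mat 1" "g1 ** h1 = mat 1" "h1 ** g1 = mat 1"
    "g2 ** h2 = mat 1" "h2 ** g2 = mat 1"
proof -
  obtain h where "tmul (g0, g1, g2) h = tone" "tmul h (g0, g1, g2) = tone"
    using Stab_inverse[OF assms] by blast
  then show ?thesis by (cases h) (auto intro: that)
qed

definition (in -) torus :: "(complex^2^2) set" where
  "torus = {mk s 0 0 (inverse s) | s. s \<noteq> 0}"

lemma eventually_tone_near_one:
  assumes "d > 0"
  shows "\<forall>\<^sub>F g in nhds (tone :: ('n0, 'n1, 'n2) triple). (\<forall>i j. cmod ((fst g - mat 1) $ i $ j) < d) \<and>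
    (\<forall>i j. cmod ((fst (snd g) - mat 1) $ i $ j) < d) \<and> (\<forall>i j. cmod ((snd (snd g) - mat 1) $ i $ j) < d)"
proof -
  have t: "((\<lambda>g. g) \<longlongrightarrow> (tone :: ('n0, 'n1, 'n2) triple)) (nhds tone)" by (rule filterlim_ident)
  have "(fst \<longlongrightarrow> (mat 1 :: complex^'n0^'n0)) (nhds (tone :: ('n0, 'n1, 'n2) triple))"
    "((\<lambda>g. fst (snd g)) \<longlongrightarrow> (mat 1 :: complex^'n1^'n1)) (nhds (tone :: ('n0, 'n1, 'n2) triple))"
    "((\<lambda>g. snd (snd g)) \<longlongrightarrow> (mat 1 :: complex^'n2^'n2)) (nhds (tone :: ('n0, 'n1, 'n2) triple))"
    using tendsto_fst[OF t] tendsto_fst[OF tendsto_snd[OF t]] tendsto_snd[OF tendsto_snd[OF t]] by simp_all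
  then show ?thesis by (intro eventually_conj eventually_near_one assms)
qed

lemma torus_Stab:
  assumes A: "diag_type A" and s: "s \<noteq> 0"
  shows "\<exists>c. c \<noteq> 0 \<and> tensor_act (rho3 (mk s 0 0 (inverse s))) A = scale3 c A"
proof (intro exI[of _ 1] conjI)
  have eq: "s ^ (k - m) * inverse s ^ m * s ^ m * s ^ m = s ^ k" if "m \<le> k" for k m
    using s that by (simp add: power_diff field_simps)
  have "tensor_act (rho3 (mk s 0 0 (inverse s))) A $ i $ j $ l = A $ i $ j $ l" for i j l
  proof (cases "\<iota>0 i + \<iota>1 j + \<iota>2 l = k0")
    case True
    \<comment> \<open>The total exponent of \<open>s\<close> is
      \<open>k0 + k1 + k2 - 2 * k0\<close>, that is, zero. Multiplying by \<open>s\<close> to the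
      power \<open>2 * k0\<close> clears the inverses.\<close>
    have "s ^ (k0 - \<iota>0 i) * inverse s ^ \<iota>0 i * (s ^ (k1 - \<iota>1 j) * inverse s ^ \<iota>1 j) * (s ^ (k2 - \<iota>2 l) * inverse s ^ \<iota>2 l) *
       (s ^ k0 * s ^ k0) = (s ^ (k0 - \<iota>0 i) * inverse s ^ \<iota>0 i * s ^ \<iota>0 i * s ^ \<iota>0 i) *
        (s ^ (k1 - \<iota>1 j) * inverse s ^ \<iota>1 j * s ^ \<iota>1 j * s ^ \<iota>1 j) * (s ^ (k2 - \<iota>2 l) * inverse s ^ \<iota>2 l * s ^ \<iota>2 l * s ^ \<iota>2 l)"
      by (simp flip: True add: power_add)
    also have "\<dots> = s ^ k0 * s ^ k0"
      unfolding eq[OF i0.index_le] eq[OF i1.index_le] eq[OF i2.index_le] using k012 by (simp add: power_add)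
    finally have "s ^ (k0 - \<iota>0 i) * inverse s ^ \<iota>0 i * (s ^ (k1 - \<iota>1 j) * inverse s ^ \<iota>1 j) * (s ^ (k2 - \<iota>2 l) * inverse s ^ \<iota>2 l) = 1"
      using s by simp
    then show ?thesis
      by (simp add: rho3_def tensor_act_modes mode0_def mode1_def mode2_def i0.rho_diag i1.rho_diag i2.rho_diag
        if_distrib if_distribR cong: if_cong) (simp add: mult.assoc)
  next
    case False
    then have "A $ i $ j $ l = 0" using A by (auto simp: diag_type_def)
    then show ?thesis
      by (simp add: rho3_def tensor_act_modes mode0_def mode1_def mode2_def i0.rho_diag i1.rho_diag i2.rho_diag
        if_distrib if_distribR cong: if_cong)
  qed
  then show "tensor_act (rho3 (mk s 0 0 (inverse s))) A = scale3 1 A"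
    by (simp add: vec_eq_iff scale3_one)
qed simp

lemma torus_group: "torus \<subseteq> SL" "connected torus" "mat 1 \<in> torus" "\<And>g h. g \<in> torus \<Longrightarrow> h \<in> torus \<Longrightarrow> g ** h \<in> torus"
  "\<And>g. g \<in> torus \<Longrightarrow> \<exists>h\<in>torus. g ** h = mat 1 \<and> h ** g = mat 1"
proof -
  show "torus \<subseteq> SL" by (auto simp: torus_def mk_in_SL)
  have "torus = (\<lambda>s. mk s 0 0 (inverse s)) ` (- {0})" by (auto simp: torus_def)
  moreover have "connected \<dots>"
    by (intro connected_continuous_image continuous_intros connected_punctured_universe) auto
  ultimately show "connected torus" by simp
  show "mat 1 \<in> torus" by (auto simp: torus_def mk_one mk_inject intro!: exI[of _ 1])
  show "g ** h \<in> torus" if gh: "g \<in> torus" "h \<in> torus" for g h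
  proof -
    obtain s t where "g = mk s 0 0 (inverse s)" "h = mk t 0 0 (inverse t)" "s \<noteq> 0" "t \<noteq> 0"
      using gh by (auto simp: torus_def)
    then show ?thesis by (auto simp: torus_def mk_mult mk_inject intro!: exI[of _ "s * t"])
  qed
  show "\<exists>h\<in>torus. g ** h = mat 1 \<and> h ** g = mat 1" if g: "g \<in> torus" for g
  proof -
    obtain s where "g = mk s 0 0 (inverse s)" "s \<noteq> 0" using g by (auto simp: torus_def)
    then show ?thesis
      by (intro bexI[of _ "mk (inverse s) 0 0 s"]) (auto simp: torus_def mk_mult mk_one mk_inject intro!: exI[of _ "inverse s"])
  qed
qed

text \<open>An element \<open>g\<close> near one conjugates the torus generator into the Lie
  algebra, which consists of diagonal matrices because \<open>A\<close> is not an identity. So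
  \<open>g\<close> is itself diagonal and \<open>diag_stab_rho3\<close> applies.\<close>

lemma Stab0_diag:
  assumes A: "block_bounded A" "diag_type A" "\<not> is_identity k0 k1 k2 A"
  shows "Stab0 A = rho3 ` torus"
proof (rule Stab0_rho3I[OF torus_group])
  show "\<exists>c. c \<noteq> 0 \<and> tensor_act (rho3 g) A = scale3 c A" if "g \<in> torus" for g
    using that torus_Stab[OF A(2)] by (auto simp: torus_def)
  obtain d where d: "d > 0" "\<And>z. cmod (z - 1) < d \<Longrightarrow> z \<noteq> 0 \<and> cmod (Ln z) < pi / (3 * (real k0 + 1))"
    using Ln_small[of "pi / (3 * (real k0 + 1))"] by auto
  show "\<forall>\<^sub>F g in nhds tone. g \<in> Stab A \<longrightarrow> g \<in> rho3 ` torus"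
    using eventually_tone_near_one[OF d(1)]
  proof (rule eventually_mono)
    fix g :: "('n0, 'n1, 'n2) triple"
    assume n: "(\<forall>i j. cmod ((fst g - mat 1) $ i $ j) < d) \<and>
      (\<forall>i j. cmod ((fst (snd g) - mat 1) $ i $ j) < d) \<and> (\<forall>i j. cmod ((snd (snd g) - mat 1) $ i $ j) < d)"
    obtain g0 g1 g2 where g: "g = (g0, g1, g2)" by (cases g)
    have near: "cmod (g0 $ i $ i - 1) < d" "cmod (g1 $ j $ j - 1) < d" "cmod (g2 $ l $ l - 1) < d" for i j l
      using n[unfolded g fst_conv snd_conv, THEN conjunct1, rule_format, of i i]
        n[unfolded g fst_conv snd_conv, THEN conjunct2, THEN conjunct1, rule_format, of j j]
        n[unfolded g fst_conv snd_conv, THEN conjunct2, THEN conjunct2, rule_format, of l l] by (simp_all add: mat_def)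
    show "g \<in> Stab A \<longrightarrow> g \<in> rho3 ` torus"
    proof
      assume S: "g \<in> Stab A"
      obtain h0 h1 h2 where h: "g0 ** h0 = mat 1" "h0 ** g0 = mat 1" "g1 ** h1 = mat 1" "h1 ** g1 = mat 1"
        "g2 ** h2 = mat 1" "h2 ** g2 = mat 1" using Stab_inverseE[OF S[unfolded g]] by blast
      define Y0 where "Y0 = g0 ** drho \<iota>0 k0 1 0 0 ** h0"
      define Y1 where "Y1 = g1 ** drho \<iota>1 k1 1 0 0 ** h1"
      define Y2 where "Y2 = g2 ** drho \<iota>2 k2 1 0 0 ** h2"
      have Y: "Y0 ** g0 = g0 ** drho \<iota>0 k0 1 0 0" "Y1 ** g1 = g1 ** drho \<iota>1 k1 1 0 0" "Y2 ** g2 = g2 ** drho \<iota>2 k2 1 0 0"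
        by (simp_all add: Y0_def Y1_def Y2_def h flip: matrix_mul_assoc)
      have L: "lie_act (Y0, Y1, Y2) A = 0"
        using Stab_lie_act[OF S[unfolded g] lie_act_diag[OF A(2), unfolded drho3_def] Y] .
      note D = nonidentity_lie_diagonal[OF A L]
      have dg: "g0 $ i $ i \<noteq> 0" "g1 $ j $ j \<noteq> 0" "g2 $ l $ l \<noteq> 0" for i j l
        using d(2) near by blast+
      have "\<exists>s. s \<noteq> 0 \<and> (g0, g1, g2) = rho3 (mk s 0 0 (inverse s))"
        by (rule diag_stab_rho3[OF A(2) S[unfolded g] i0.diagonal_of_conj[OF D(1) Y(1) dg(1)]
          i1.diagonal_of_conj[OF D(2) Y(2) dg(2)] i2.diagonal_of_conj[OF D(3) Y(3) dg(3)] d(2) near])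
      then show "g \<in> rho3 ` torus" unfolding g torus_def by blast
    qed
  qed
qed

end

section \<open>The stabilizer of the standard tensor\<close>

lemma tendsto_det:
  fixes F :: "'x \<Rightarrow> complex^'n::finite^'n"
  assumes "\<And>i j. ((\<lambda>x. F x $ i $ j) \<longlongrightarrow> M $ i $ j) L"
  shows "((\<lambda>x. det (F x)) \<longlongrightarrow> det M) L"
  unfolding det_def by (intro tendsto_intros assms)

text \<open>Cramer's rule gives a formula that is polynomial, hence continuous, on all matrices and
  equals the inverse wherever the determinant is one.\<close>

lemma tendsto_inverse_matrix:
  "\<exists>J :: complex^'n^'n \<Rightarrow> complex^'n::finite^'n. (J \<longlongrightarrow> mat 1) (nhds (mat 1)) \<and> (\<forall>g h. det g = 1 \<longrightarrow> g ** h = mat 1 \<longrightarrow> J g = h)"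
proof -
  define J :: "complex^'n^'n \<Rightarrow> complex^'n^'n" where
    "J g = (\<chi> i j. det (\<chi> a b. if b = i then mat 1 $ a $ j else g $ a $ b))" for g
  have J: "J g = h" if g: "det g = 1" "g ** h = mat 1" for g h
  proof -
    have "h $ i $ j = J g $ i $ j" for i j
    proof -
      have "g *v (h *v axis j 1) = axis j 1" using g(2) by (simp add: matrix_vector_mul_assoc)
      then have "h *v axis j 1 = (\<chi> k. det (\<chi> a b. if b = k then axis j 1 $ a else g $ a $ b) / det g)"
        using cramer[of g "h *v axis j 1" "axis j 1"] g(1) by simp
      then have "(h *v axis j 1) $ i = det (\<chi> a b. if b = i then axis j 1 $ a else g $ a $ b)"
        using g(1) by simp
      moreover have "(axis j 1 :: complex^'n) $ a = mat 1 $ a $ j" for a by (simp add: axis_def mat_def)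
      ultimately show ?thesis by (simp only: J_def mult_axis vec_lambda_beta)
    qed
    then show ?thesis by (simp add: vec_eq_iff)
  qed
  have "((\<lambda>g. J g $ i $ j) \<longlongrightarrow> J (mat 1) $ i $ j) (nhds (mat 1))" for i j
    unfolding J_def vec_lambda_beta
    by (rule tendsto_det) (auto intro!: tendsto_vec_nth filterlim_ident)
  then have "(J \<longlongrightarrow> J (mat 1)) (nhds (mat 1))" by (rule tendsto_matrixI)
  moreover have "J (mat 1) = mat 1" by (rule J) simp_all
  ultimately show ?thesis using J by (intro exI[of _ J]) auto
qed

lemma tendsto_mk:
  assumes "(a \<longlongrightarrow> a') L" "(b \<longlongrightarrow> b') L" "(c \<longlongrightarrow> c') L" "(d \<longlongrightarrow> d') L"
  shows "((\<lambda>x. mk (a x) (b x) (c x) (d x)) \<longlongrightarrow> mk a' b' c' d') L"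
proof (rule tendsto_matrixI)
  fix i j :: 2
  show "((\<lambda>x. mk (a x) (b x) (c x) (d x) $ i $ j) \<longlongrightarrow> mk a' b' c' d' $ i $ j) L"
    using exhaust_2[of i] exhaust_2[of j] assms by auto
qed

lemma lie_act_diff:
  "lie_act (X0 - Y0, X1 - Y1, X2 - Y2) A = lie_act (X0, X1, X2) A - lie_act (Y0, Y1, Y2) A"
  by (simp add: vec_eq_iff lie_act.simps mode0_def mode1_def mode2_def left_diff_distrib sum_subtractf)

context boundary_index
begin

text \<open>Subtract an element of \<open>sl(2)\<close> so that one entry of degree one and one of
  degree minus one vanish in the second factor. A nonzero component of nonzero degree would be
  regular, which these zeros exclude. The remainder is diagonal, and its weights are arithmetic
  progressions.\<close>

lemma std_lie_algebra:
  assumes std: "block_bounded std" and X: "lie_act (X0, X1, X2) std = 0"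
  shows "\<exists>u v w a0 a1 a2. X0 = drho \<iota>0 k0 u v w + mat a0 \<and> X1 = drho \<iota>1 k1 u v w + mat a1 \<and> X2 = drho \<iota>2 k2 u v w + mat a2"
proof -
  obtain e0 e1 where e: "\<iota>1 e0 = 0" "\<iota>1 e1 = 1" using i1.index_surj[of 0] i1.index_surj[of 1] k012 by auto
  \<comment> \<open>At these two positions \<open>drho \<iota>1 k1 0 v w\<close> has entries
    \<open>v\<close> and \<open>of_nat k1 * w\<close>.\<close>
  define v w where "v = X1 $ e0 $ e1" and "w = X1 $ e1 $ e0 / of_nat k1"
  define Y0 where "Y0 = X0 - drho \<iota>0 k0 0 v w"
  define Y1 where "Y1 = X1 - drho \<iota>1 k1 0 v w"
  define Y2 where "Y2 = X2 - drho \<iota>2 k2 0 v w"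
  have Y: "lie_act (Y0, Y1, Y2) std = 0"
    unfolding Y0_def Y1_def Y2_def lie_act_diff X using drho3_std[of 0 v w] by (simp add: drho3_def)
  have Y1: "Y1 $ e0 $ e1 = 0" "Y1 $ e1 $ e0 = 0"
    using k012 e by (simp_all add: Y1_def v_def w_def drho_def)
  interpret r: boundary_index "\<lambda>i. k0 - \<iota>0 i" "\<lambda>j. k1 - \<iota>1 j" "\<lambda>l. k2 - \<iota>2 l" k0 k1 k2 by (rule reversed)
  have rev: "part (\<lambda>j. k1 - \<iota>1 j) 1 Y1 = part \<iota>1 (- 1) Y1"
    using i1.index_le by (auto simp: part_def vec_eq_iff of_nat_diff)
  have z: "part \<iota>0 m Y0 = 0 \<and> part \<iota>1 m Y1 = 0 \<and> part \<iota>2 m Y2 = 0" if m: "m \<noteq> 0" for m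
  proof (rule ccontr)
    assume "\<not> ?thesis"
    then have nz: "part \<iota>0 m Y0 \<noteq> 0 \<or> part \<iota>1 m Y1 \<noteq> 0 \<or> part \<iota>2 m Y2 \<noteq> 0" by blast
    have reg: "regular_nilp (part \<iota>1 m Y1)"
      using lie_act_regular[OF cards std lie_act_part[OF std_diag Y] i1.part_nilp[OF m] i2.part_nilp[OF m] nz] by blast
    have "m = 1 \<or> m = - 1" using i1.regular_part(1)[OF reg m] k012 by blast
    then show False
    proof
      assume "m = 1"
      then show False using i1.regular_part(2)[of 1 Y1 e1 e0] reg Y1 e k012 by simp
    next
      assume "m = - 1"
      then show False using r.i1.regular_part(2)[of 1 Y1 e0 e1] reg Y1 e k012 by (simp add: rev)
    qed
  qed
  have part_entry: "Z $ i $ j = part \<iota> (int (\<iota> i) - int (\<iota> j)) Z $ i $ j" for \<iota> i j and Z :: "complex^'x::finite^'x"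
    by (simp add: part_def)
  have D: "\<And>i j. i \<noteq> j \<Longrightarrow> Y0 $ i $ j = 0" "\<And>i j. i \<noteq> j \<Longrightarrow> Y1 $ i $ j = 0" "\<And>i j. i \<noteq> j \<Longrightarrow> Y2 $ i $ j = 0"
    subgoal for i j using part_entry[of Y0 i j \<iota>0] z[of "int (\<iota>0 i) - int (\<iota>0 j)"] by (simp add: i0.index_inj)
    subgoal for i j using part_entry[of Y1 i j \<iota>1] z[of "int (\<iota>1 i) - int (\<iota>1 j)"] by (simp add: i1.index_inj)
    subgoal for i j using part_entry[of Y2 i j \<iota>2] z[of "int (\<iota>2 i) - int (\<iota>2 j)"] by (simp add: i2.index_inj)
    done
  have delta: "(\<Sum>i'\<in>UNIV. G $ i $ i' * f i') = G $ i $ i * f i" if "\<And>i j. i \<noteq> j \<Longrightarrow> G $ i $ j = 0"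
    for G :: "complex^'x::finite^'x" and f :: "'x \<Rightarrow> complex" and i
  proof -
    have "(\<Sum>i'\<in>UNIV. G $ i $ i' * f i') = (\<Sum>i'\<in>UNIV. if i' = i then G $ i $ i * f i else 0)"
      using that by (intro sum.cong) auto
    then show ?thesis by simp
  qed
  have "Y0 $ i $ i + Y1 $ j $ j + Y2 $ l $ l = 0" if "\<iota>0 i + \<iota>1 j + \<iota>2 l = k0" for i j l
  proof -
    have "(Y0 $ i $ i + Y1 $ j $ j + Y2 $ l $ l) * std $ i $ j $ l = lie_act (Y0, Y1, Y2) std $ i $ j $ l"
      by (simp add: lie_act_entry delta[OF D(1)] delta[OF D(2)] delta[OF D(3)] distrib_right)
    moreover have "std $ i $ j $ l \<noteq> 0" using std_diag that unfolding diag_type_def by blast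
    ultimately show ?thesis by (simp add: Y)
  qed
  then obtain \<delta> b0 b1 b2 where W: "\<forall>i. Y0 $ i $ i = b0 + of_nat (\<iota>0 i) * \<delta>" "\<forall>j. Y1 $ j $ j = b1 + of_nat (\<iota>1 j) * \<delta>"
    "\<forall>l. Y2 $ l $ l = b2 + of_nat (\<iota>2 l) * \<delta>"
    using weights_arith[of "\<lambda>i. Y0 $ i $ i" "\<lambda>i. Y1 $ i $ i" "\<lambda>i. Y2 $ i $ i" 0] by blast
  \<comment> \<open>The diagonal of \<open>drho\<close> decreases by \<open>2 * u\<close> per index
    step; its constant term goes into the scalar matrices.\<close>
  define u where "u = - \<delta> / 2"
  have "X0 = drho \<iota>0 k0 u v w + mat (b0 + \<delta> * of_nat k0 / 2)"
  proof -
    have "X0 $ i $ j = (drho \<iota>0 k0 u v w + mat (b0 + \<delta> * of_nat k0 / 2)) $ i $ j" for i j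
      using D(1)[of i j] W(1)[rule_format, of i]
      by (cases "i = j") (simp_all add: Y0_def drho_def mat_def u_def i0.index_inj field_simps)
    then show ?thesis by (simp add: vec_eq_iff)
  qed
  moreover have "X1 = drho \<iota>1 k1 u v w + mat (b1 + \<delta> * of_nat k1 / 2)"
  proof -
    have "X1 $ i $ j = (drho \<iota>1 k1 u v w + mat (b1 + \<delta> * of_nat k1 / 2)) $ i $ j" for i j
      using D(2)[of i j] W(2)[rule_format, of i]
      by (cases "i = j") (simp_all add: Y1_def drho_def mat_def u_def i1.index_inj field_simps)
    then show ?thesis by (simp add: vec_eq_iff)
  qed
  moreover have "X2 = drho \<iota>2 k2 u v w + mat (b2 + \<delta> * of_nat k2 / 2)"
  proof -
    have "X2 $ i $ j = (drho \<iota>2 k2 u v w + mat (b2 + \<delta> * of_nat k2 / 2)) $ i $ j" for i j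
      using D(3)[of i j] W(3)[rule_format, of i]
      by (cases "i = j") (simp_all add: Y2_def drho_def mat_def u_def i2.index_inj field_simps)
    then show ?thesis by (simp add: vec_eq_iff)
  qed
  ultimately show ?thesis by blast
qed

lemma tendsto_rho:
  fixes \<iota> :: "'n::finite \<Rightarrow> nat"
  assumes "(q \<longlongrightarrow> p) L"
  shows "((\<lambda>x. rho \<iota> k (q x)) \<longlongrightarrow> rho \<iota> k p) L"
  by (rule continuous_on_tendsto_compose[OF continuous_on_rho[of UNIV] assms]) auto

text \<open>If \<open>g\<close> is close to \<open>1\<close> then \<open>g H g\<^sup>-\<^sup>1\<close> is a matrix \<open>M\<close> in \<open>sl(2)\<close> close to \<open>H\<close>; an explicit
  \<open>q\<close> close to \<open>1\<close> diagonalizes \<open>M\<close>, so that \<open>q g\<close> is diagonal.\<close>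

lemma Stab0_std:
  assumes std: "block_bounded std"
  shows "Stab0 std = rho3 ` SL"
proof (rule Stab0_rho3I[OF order.refl connected_SL2 _ SL_group])
  show "mat 1 \<in> (SL :: (complex^2^2) set)" by (simp add: SL_def)
  show "\<exists>c. c \<noteq> 0 \<and> tensor_act (rho3 g) std = scale3 c std" if "g \<in> SL" for g
    using std_invariant[OF that] by (intro exI[of _ 1]) (simp add: scale3_one)
  let ?L = "nhds (tone :: ('n0, 'n1, 'n2) triple)"
  obtain J where J: "(J \<longlongrightarrow> (mat 1 :: complex^'n1^'n1)) (nhds (mat 1))"
    "\<And>g h. det g = 1 \<Longrightarrow> g ** h = mat 1 \<Longrightarrow> J g = h"
    using tendsto_inverse_matrix by blast
  obtain e0 e1 em where e: "\<iota>1 e0 = 0" "\<iota>1 e1 = 1" "\<iota>1 em = k1"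
    using i1.index_surj[of 0] i1.index_surj[of 1] i1.index_surj[of k1] k012 by auto
  define M where "M g = fst (snd g) ** drho \<iota>1 k1 1 0 0 ** J (fst (snd g))" for g :: "('n0, 'n1, 'n2) triple"
  \<comment> \<open>The extreme diagonal entries of \<open>drho \<iota>1 k1 u v w\<close> are
    \<open>k1 u\<close> and \<open>- k1 u\<close>. Taking their difference also eliminates an added
    scalar matrix.\<close>
  define u where "u g = (M g $ e0 $ e0 - M g $ em $ em) / (2 * of_nat k1)" for g
  define v where "v g = M g $ e0 $ e1" for g
  define w where "w g = M g $ e1 $ e0 / of_nat k1" for g
  \<comment> \<open>An eigenvalue of \<open>mk u v w (- u)\<close>; the principal root is continuous
    near \<open>1\<close> and singles out the eigenvalue close to \<open>1\<close>.\<close>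
  define \<mu> where "\<mu> g = csqrt (u g * u g + v g * w g)" for g
  \<comment> \<open>The rows are left eigenvectors of the matrix divided by \<open>\<mu>\<close>,
    for the eigenvalues \<open>1\<close> and \<open>- 1\<close>, scaled so that the determinant is
    one and \<open>q\<close> tends to the identity.\<close>
  define q where "q g = mk ((1 + u g / \<mu> g) / 2) (v g / \<mu> g / 2) (- (w g / \<mu> g) / (1 + u g / \<mu> g)) 1" for g
  have t: "((\<lambda>g. g) \<longlongrightarrow> (tone :: ('n0, 'n1, 'n2) triple)) ?L" by (rule filterlim_ident)
  have pr: "(fst \<longlongrightarrow> (mat 1 :: complex^'n0^'n0)) ?L"
    "((\<lambda>g. fst (snd g)) \<longlongrightarrow> (mat 1 :: complex^'n1^'n1)) ?L"
    "((\<lambda>g. snd (snd g)) \<longlongrightarrow> (mat 1 :: complex^'n2^'n2)) ?L"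
    using tendsto_fst[OF t] tendsto_fst[OF tendsto_snd[OF t]] tendsto_snd[OF tendsto_snd[OF t]] by simp_all
  have k1: "of_nat k1 \<noteq> (0::complex)" using k012 by simp
  have Mt: "(M \<longlongrightarrow> drho \<iota>1 k1 1 0 0) ?L"
  proof -
    have "(M \<longlongrightarrow> mat 1 ** drho \<iota>1 k1 1 0 0 ** mat 1) ?L"
      unfolding M_def by (intro tendsto_intros pr filterlim_compose[OF J(1) pr(2)])
    then show ?thesis by simp
  qed
  have ent: "((\<lambda>g. M g $ i $ j) \<longlongrightarrow> drho \<iota>1 k1 1 0 0 $ i $ j) ?L" for i j
    by (intro tendsto_vec_nth Mt)
  have ne: "e0 \<noteq> e1" "e1 \<noteq> e0" using e by auto
  have ut: "(u \<longlongrightarrow> 1) ?L"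
  proof -
    have "(u \<longlongrightarrow> (drho \<iota>1 k1 1 0 0 $ e0 $ e0 - drho \<iota>1 k1 1 0 0 $ em $ em) / (2 * of_nat k1)) ?L"
      unfolding u_def by (intro tendsto_intros ent) (use k1 in auto)
    then show ?thesis using k1 by (simp add: i1.drho_diag e)
  qed
  have vt: "(v \<longlongrightarrow> 0) ?L" using ent[of e0 e1] ne unfolding v_def by (simp add: i1.drho_diag)
  have wt: "(w \<longlongrightarrow> 0) ?L"
  proof -
    have "(w \<longlongrightarrow> drho \<iota>1 k1 1 0 0 $ e1 $ e0 / of_nat k1) ?L"
      unfolding w_def by (intro tendsto_intros ent k1)
    then show ?thesis using ne by (simp add: i1.drho_diag)
  qed
  have \<mu>t: "(\<mu> \<longlongrightarrow> 1) ?L"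
  proof -
    have "isCont csqrt 1" by (rule continuous_at_csqrt) (auto simp: complex_nonpos_Reals_iff)
    moreover have "((\<lambda>g. u g * u g + v g * w g) \<longlongrightarrow> 1 * 1 + 0 * 0) ?L" by (intro tendsto_intros ut vt wt)
    ultimately have "(\<mu> \<longlongrightarrow> csqrt 1) ?L" unfolding \<mu>_def by (intro isCont_tendsto_compose[of _ csqrt]) auto
    then show ?thesis by simp
  qed
  have qt: "(q \<longlongrightarrow> mat 1) ?L"
  proof -
    have "(q \<longlongrightarrow> mk ((1 + 1 / 1) / 2) (0 / 1 / 2) (- (0 / 1) / (1 + 1 / 1)) 1) ?L"
      unfolding q_def by (intro tendsto_mk tendsto_intros ut vt wt \<mu>t) auto
    then show ?thesis by (simp add: mk_one)
  qed
  have \<mu>0: "\<forall>\<^sub>F g in ?L. \<mu> g \<noteq> 0" by (rule tendsto_imp_eventually_ne[OF \<mu>t]) simp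
  have u0: "\<forall>\<^sub>F g in ?L. 1 + u g / \<mu> g \<noteq> 0"
  proof (rule tendsto_imp_eventually_ne)
    show "((\<lambda>g. 1 + u g / \<mu> g) \<longlongrightarrow> 1 + 1 / 1) ?L" by (intro tendsto_intros ut \<mu>t) simp
  qed simp
  obtain d where d: "d > 0" "\<And>z. cmod (z - 1) < d \<Longrightarrow> z \<noteq> 0 \<and> cmod (Ln z) < pi / (3 * (real k0 + 1))"
    using Ln_small[of "pi / (3 * (real k0 + 1))"] by auto
  define G0 where "G0 g = rho \<iota>0 k0 (q g) ** fst g" for g
  define G1 where "G1 g = rho \<iota>1 k1 (q g) ** fst (snd g)" for g
  define G2 where "G2 g = rho \<iota>2 k2 (q g) ** snd (snd g)" for g
  have Gt: "(G0 \<longlongrightarrow> mat 1) ?L" "(G1 \<longlongrightarrow> mat 1) ?L" "(G2 \<longlongrightarrow> mat 1) ?L"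
    unfolding G0_def G1_def G2_def
    using tendsto_matrix_mult[OF tendsto_rho[OF qt] pr(1), of \<iota>0 k0] tendsto_matrix_mult[OF tendsto_rho[OF qt] pr(2), of \<iota>1 k1]
      tendsto_matrix_mult[OF tendsto_rho[OF qt] pr(3), of \<iota>2 k2]
    by (simp_all add: i0.rho_one i1.rho_one i2.rho_one)
  have "\<forall>\<^sub>F g in ?L. (\<mu> g \<noteq> 0 \<and> 1 + u g / \<mu> g \<noteq> 0) \<and> (\<forall>i j. cmod ((G0 g - mat 1) $ i $ j) < d) \<and>
    (\<forall>i j. cmod ((G1 g - mat 1) $ i $ j) < d) \<and> (\<forall>i j. cmod ((G2 g - mat 1) $ i $ j) < d)"
    by (intro eventually_conj \<mu>0 u0 eventually_near_one Gt d(1))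
  then show "\<forall>\<^sub>F g in ?L. g \<in> Stab std \<longrightarrow> g \<in> rho3 ` SL"
  proof (rule eventually_mono)
    fix g :: "('n0, 'n1, 'n2) triple"
    assume n: "(\<mu> g \<noteq> 0 \<and> 1 + u g / \<mu> g \<noteq> 0) \<and> (\<forall>i j. cmod ((G0 g - mat 1) $ i $ j) < d) \<and>
      (\<forall>i j. cmod ((G1 g - mat 1) $ i $ j) < d) \<and> (\<forall>i j. cmod ((G2 g - mat 1) $ i $ j) < d)"
    obtain g0 g1 g2 where g: "g = (g0, g1, g2)" by (cases g)
    have near: "cmod (G0 g $ i $ i - 1) < d" "cmod (G1 g $ j $ j - 1) < d" "cmod (G2 g $ l $ l - 1) < d" for i j l
      using n[THEN conjunct2, THEN conjunct1, rule_format, of i i]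
        n[THEN conjunct2, THEN conjunct2, THEN conjunct1, rule_format, of j j]
        n[THEN conjunct2, THEN conjunct2, THEN conjunct2, rule_format, of l l] by (simp_all add: mat_def)
    define u1 v1 w1 where "u1 = u g / \<mu> g" and "v1 = v g / \<mu> g" and "w1 = w g / \<mu> g"
    have mu: "\<mu> g \<noteq> 0" and u1: "1 + u1 \<noteq> 0" using n by (simp_all add: u1_def)
    have uvw: "u g = \<mu> g * u1" "v g = \<mu> g * v1" "w g = \<mu> g * w1" using mu by (simp_all add: u1_def v1_def w1_def)
    have q: "q g = mk ((1 + u1) / 2) (v1 / 2) (- w1 / (1 + u1)) 1" by (simp add: q_def u1_def v1_def w1_def)
    have sq: "u1 * u1 + v1 * w1 = 1"
    proof -
      have "\<mu> g * \<mu> g = u g * u g + v g * w g"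
        using power2_csqrt[of "u g * u g + v g * w g"] by (simp add: \<mu>_def power2_eq_square)
      then have "\<mu> g * \<mu> g * (u1 * u1 + v1 * w1) = \<mu> g * \<mu> g * 1" unfolding uvw by (simp add: algebra_simps)
      then show ?thesis using mu by simp
    qed
    have vw: "v1 * w1 = (1 + u1) * (1 - u1)" using sq by (simp add: algebra_simps)
    have qSL: "q g \<in> SL"
    proof -
      have "(1 + u1) / 2 * 1 - v1 / 2 * (- w1 / (1 + u1)) = (1 + u1) / 2 + v1 * w1 / ((1 + u1) * 2)"
        using u1 by (simp add: field_simps)
      also have "\<dots> = (1 + u1) / 2 + (1 - u1) / 2" unfolding vw nonzero_mult_divide_mult_cancel_left[OF u1] ..
      also have "\<dots> = 1" by (simp flip: add_divide_distrib)
      finally show ?thesis unfolding q mk_in_SL .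
    qed
    have qM: "q g ** mk (u g) (v g) (w g) (- u g) = mk (\<mu> g) 0 0 (- \<mu> g) ** q g"
    proof -
      define a b c where "a = (1 + u1) / 2" and "b = v1 / 2" and "c = - w1 / (1 + u1)"
      have "a * u1 + b * w1 = ((1 + u1) * u1 + v1 * w1) / 2" by (simp add: a_def b_def add_divide_distrib)
      also have "\<dots> = a" unfolding vw a_def by (simp add: algebra_simps)
      finally have 1: "a * u1 + b * w1 = a" .
      have 2: "a * v1 - b * u1 = b" by (simp add: a_def b_def field_simps)
      have 3: "c * u1 + w1 = - c" using u1 by (simp add: c_def field_simps)
      have "c * v1 = - (v1 * w1) / (1 + u1)" by (simp add: c_def)
      also have "\<dots> = - (1 - u1)" unfolding vw using u1 by simp
      finally have 4: "c * v1 - u1 = - 1" by simp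
      have "a * (\<mu> g * u1) + b * (\<mu> g * w1) = \<mu> g * (a * u1 + b * w1)"
        "a * (\<mu> g * v1) + b * (- (\<mu> g * u1)) = \<mu> g * (a * v1 - b * u1)"
        "c * (\<mu> g * u1) + 1 * (\<mu> g * w1) = \<mu> g * (c * u1 + w1)"
        "c * (\<mu> g * v1) + 1 * (- (\<mu> g * u1)) = \<mu> g * (c * v1 - u1)" by (simp_all add: algebra_simps)
      then show ?thesis
        unfolding q uvw mk_mult mk_inject a_def[symmetric] b_def[symmetric] c_def[symmetric] 1 2 3 4 by simp
    qed
    show "g \<in> Stab std \<longrightarrow> g \<in> rho3 ` SL"
    proof
      assume S: "g \<in> Stab std"
      obtain h0 h1 h2 where h: "g0 ** h0 = mat 1" "h0 ** g0 = mat 1" "g1 ** h1 = mat 1" "h1 ** g1 = mat 1"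
        "g2 ** h2 = mat 1" "h2 ** g2 = mat 1" using Stab_inverseE[OF S[unfolded g]] by blast
      define Y0 where "Y0 = g0 ** drho \<iota>0 k0 1 0 0 ** h0"
      define Y1 where "Y1 = g1 ** drho \<iota>1 k1 1 0 0 ** h1"
      define Y2 where "Y2 = g2 ** drho \<iota>2 k2 1 0 0 ** h2"
      have Y: "Y0 ** g0 = g0 ** drho \<iota>0 k0 1 0 0" "Y1 ** g1 = g1 ** drho \<iota>1 k1 1 0 0" "Y2 ** g2 = g2 ** drho \<iota>2 k2 1 0 0"
        by (simp_all add: Y0_def Y1_def Y2_def h flip: matrix_mul_assoc)
      have "lie_act (Y0, Y1, Y2) std = 0"
        using Stab_lie_act[OF S[unfolded g] drho3_std[of 1 0 0, unfolded drho3_def] Y] .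
      then obtain u' v' w' a0 a1 a2 where X: "Y0 = drho \<iota>0 k0 u' v' w' + mat a0"
        "Y1 = drho \<iota>1 k1 u' v' w' + mat a1" "Y2 = drho \<iota>2 k2 u' v' w' + mat a2"
        using std_lie_algebra[OF std] by blast
      have "det g1 = 1" using S by (simp add: g Stab_def SL_def)
      then have MY: "M g = Y1" using J(2)[OF _ h(3)] by (simp add: M_def g Y1_def)
      have k2: "of_nat k1 * 2 \<noteq> (0::complex)" using k1 by simp
      have uvw': "u g = u'" "v g = v'" "w g = w'"
        unfolding u_def v_def w_def MY X(2) using e ne k1 k2
        by (simp_all add: drho_def mat_def field_simps)
      have mc: "(drho \<iota> k (\<mu> g) 0 0 + mat a) ** (R ** x) = (R ** x) ** H"
        if "R ** drho \<iota> k u' v' w' = drho \<iota> k (\<mu> g) 0 0 ** R" "(drho \<iota> k u' v' w' + mat a) ** x = x ** H"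
        for \<iota> k a and R x H :: "complex^'x::finite^'x"
      proof -
        have c: "mat a ** Z = Z ** mat a" for Z :: "complex^'x^'x"
          by (simp add: vec_eq_iff matrix_matrix_mult_def mat_def if_distrib if_distribR cong: if_cong)
        have ad: "(P + Q) ** Z = P ** Z + Q ** Z" for P Q Z :: "complex^'x^'x"
          by (simp add: matrix_matrix_mult_def vec_eq_iff distrib_right sum.distrib)
        have "(drho \<iota> k (\<mu> g) 0 0 + mat a) ** (R ** x) = (drho \<iota> k (\<mu> g) 0 0 ** R + R ** mat a) ** x"
          by (simp add: matrix_mul_assoc ad c)
        also have "\<dots> = R ** ((drho \<iota> k u' v' w' + mat a) ** x)"
          by (simp flip: that(1) add: matrix_mul_assoc matrix_add_ldistrib)
        finally show ?thesis by (simp add: that(2) matrix_mul_assoc)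
      qed
      note conj = qM[unfolded uvw']
      have GY: "(drho \<iota>0 k0 (\<mu> g) 0 0 + mat a0) ** G0 g = G0 g ** drho \<iota>0 k0 1 0 0"
        "(drho \<iota>1 k1 (\<mu> g) 0 0 + mat a1) ** G1 g = G1 g ** drho \<iota>1 k1 1 0 0"
        "(drho \<iota>2 k2 (\<mu> g) 0 0 + mat a2) ** G2 g = G2 g ** drho \<iota>2 k2 1 0 0"
        unfolding G0_def G1_def G2_def g fst_conv snd_conv
        using mc[OF i0.rho_drho_conj[of "q g" u' v' w' "\<mu> g" 0 0] Y(1)[unfolded X]]
          mc[OF i1.rho_drho_conj[of "q g" u' v' w' "\<mu> g" 0 0] Y(2)[unfolded X]]
          mc[OF i2.rho_drho_conj[of "q g" u' v' w' "\<mu> g" 0 0] Y(3)[unfolded X]] conj by (simp_all add: g)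
      have D: "i \<noteq> j \<Longrightarrow> (drho \<iota> k (\<mu> g) 0 0 + mat a) $ i $ j = 0"
        if "index \<iota> k" for \<iota> k a and i j :: "'x::finite"
        by (simp add: index.drho_diag[OF that] mat_def)
      have dg: "G0 g $ i $ i \<noteq> 0" "G1 g $ j $ j \<noteq> 0" "G2 g $ l $ l \<noteq> 0" for i j l
        using d(2) near by blast+
      have rq: "rho3 (q g) \<in> Stab std"
        using rho3_SL[OF qSL] std_invariant[OF qSL] by (auto simp: Stab_def scale3_one intro!: exI[of _ 1])
      have GS: "(G0 g, G1 g, G2 g) \<in> Stab std"
        using Stab_mult[OF rq S] by (simp add: G0_def G1_def G2_def rho3_def g)
      have "\<exists>s. s \<noteq> 0 \<and> (G0 g, G1 g, G2 g) = rho3 (mk s 0 0 (inverse s))"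
        by (rule diag_stab_rho3[OF std_diag GS i0.diagonal_of_conj[OF D[OF i0.index_axioms] GY(1) dg(1)]
          i1.diagonal_of_conj[OF D[OF i1.index_axioms] GY(2) dg(2)] i2.diagonal_of_conj[OF D[OF i2.index_axioms] GY(3) dg(3)] d(2) near])
      then obtain s where s: "s \<noteq> 0" "tmul (rho3 (q g)) g = rho3 (mk s 0 0 (inverse s))"
        by (auto simp: G0_def G1_def G2_def rho3_def g)
      obtain p where p: "p \<in> SL" "p ** q g = mat 1" using SL_group(2)[OF qSL] by blast
      have "tmul (rho3 p) (tmul (rho3 (q g)) g) = g"
        by (simp flip: tmul_assoc add: rho3_mult p rho3_one)
      then have "g = rho3 (p ** mk s 0 0 (inverse s))" using s(2) by (simp add: rho3_mult)
      moreover have "p ** mk s 0 0 (inverse s) \<in> SL" using s(1) by (intro SL_group p) (simp add: mk_in_SL)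
      ultimately show "g \<in> rho3 ` SL" by blast
    qed
  qed
qed

end

section \<open>Tensors without a torus of symmetries\<close>

lemma tensor_act_mat: "tensor_act (mat a0, mat a1, mat a2) A = scale3 (a0 * a1 * a2) A"
  by (rule tensor_eq_tri) (simp add: tri_tensor_act tri_scale3 mat_mult_vec tri_linear mult_ac)

lemma lie_act_mat: "lie_act (mat a0, mat a1, mat a2) A = scale3 (a0 + a1 + a2) A"
  by (rule tensor_eq_tri) (simp add: tri_lie_act tri_scale3 mat_mult_vec tri_linear distrib_right)

lemma scale3_zero: "scale3 0 A = 0"
  by (simp add: scale3_eq_0)

text \<open>The annihilator of a tensor is closed under commutators, which later permits descent
  along brackets with the raising operator.\<close>

lemma lie_act_bracket:
  fixes A :: "('n0::finite, 'n1::finite, 'n2::finite) tensor"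
  shows "lie_act (X0 ** Y0 - Y0 ** X0, X1 ** Y1 - Y1 ** X1, X2 ** Y2 - Y2 ** X2) A =
    lie_act (X0, X1, X2) (lie_act (Y0, Y1, Y2) A) - lie_act (Y0, Y1, Y2) (lie_act (X0, X1, X2) A)"
proof (rule tensor_eq_tri)
  fix x y z
  have t: "transpose (X ** Y - Y ** X) *v v = transpose Y *v (transpose X *v v) - transpose X *v (transpose Y *v v)"
    for X Y :: "complex^'x::finite^'x" and v
  proof -
    have "transpose (X ** Y - Y ** X) = transpose (X ** Y) - transpose (Y ** X)"
      by (simp add: transpose_def vec_eq_iff)
    then show ?thesis
      by (simp add: matrix_transpose_mul matrix_vector_mult_diff_rdistrib flip: matrix_vector_mul_assoc)
  qed
  have d0: "tri A (x - x') y z = tri A x y z - tri A x' y z" for x x' y z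
    using tri_linear(1)[of A "x - x'" x' y z] by simp
  have d1: "tri A x (y - y') z = tri A x y z - tri A x y' z" for x y y' z
    using tri_linear(3)[of A x "y - y'" y' z] by simp
  have d2: "tri A x y (z - z') = tri A x y z - tri A x y z'" for x y z z'
    using tri_linear(5)[of A x y "z - z'" z'] by simp
  have s: "tri (A' - B') x y z = tri A' x y z - tri B' x y z" for A' B' :: "('n0, 'n1, 'n2) tensor"
    unfolding tri_def contr_def by (simp add: left_diff_distrib right_diff_distrib sum_subtractf)
  show "tri (lie_act (X0 ** Y0 - Y0 ** X0, X1 ** Y1 - Y1 ** X1, X2 ** Y2 - Y2 ** X2) A) x y z =
    tri (lie_act (X0, X1, X2) (lie_act (Y0, Y1, Y2) A) - lie_act (Y0, Y1, Y2) (lie_act (X0, X1, X2) A)) x y z"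
    by (simp add: tri_lie_act t d0 d1 d2 s)
qed

lemma lie_act_zero: "lie_act (X0, X1, X2) 0 = 0"
  by (simp add: vec_eq_iff lie_act.simps mode0_def mode1_def mode2_def)

lemma nilp_eigenvalue:
  fixes M :: "complex^'n^'n"
  assumes "nilp ((*v) M)" "M *v x = \<mu> *s x" "x \<noteq> 0"
  shows "\<mu> = 0"
proof -
  have "((*v) M ^^ K) x = \<mu> ^ K *s x" for K
    by (induction K) (simp_all add: assms(2) matrix_vector_mult_scaleR vec.scale mult.commute vector_scalar_commute)
  moreover obtain K where "((*v) M ^^ K) x = 0" using assms(1) by (auto simp: nilp_def)
  ultimately have "\<mu> ^ K = 0" using assms(3) by (metis vec.scale_eq_0_iff)
  then show ?thesis by simp
qed

lemma nilp_scaled: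
  fixes M :: "complex^'n^'n"
  assumes "nilp ((*v) M)"
  shows "nilp ((*v) (mat s ** M))"
proof -
  have "((*v) (mat s ** M) ^^ K) v = s ^ K *s ((*v) M ^^ K) v" for K v
    by (induction K) (simp_all add: mat_mult_vec vector_scalar_commute flip: matrix_vector_mul_assoc)
  then show ?thesis using assms by (auto simp: nilp_def)
qed

lemma mat_mult_mat: "mat a ** mat b = (mat (a * b) :: complex^'n^'n)"
  by (simp add: matrix_eq mat_mult_vec flip: matrix_vector_mul_assoc)

lemma mat_mult_entry: "(mat c ** M) $ i $ j = c * M $ i $ j" for M :: "complex^'n^'m"
proof -
  have "(mat c ** M) *v axis j 1 = c *s (M *v axis j 1)"
    by (simp add: mat_mult_vec flip: matrix_vector_mul_assoc)
  from arg_cong[OF this, of "\<lambda>v. v $ i"] show ?thesis by (simp add: mult_axis)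
qed

lemma det_mat: "det (mat a :: complex^'n::finite^'n) = a ^ CARD('n)"
  by (subst det_diagonal) (simp_all add: mat_def)

lemma root_near_one:
  assumes a: "a \<noteq> 0" "cmod (Ln a) < pi / real n" and n: "n > 0" "a ^ n = 1"
  shows "a = 1"
proof -
  have "exp (of_nat n * Ln a) = 1" using a(1) n(2) by (simp add: exp_of_nat_mult)
  moreover have "\<bar>Im (of_nat n * Ln a)\<bar> < 2 * pi"
  proof -
    have "\<bar>Im (of_nat n * Ln a)\<bar> \<le> real n * cmod (Ln a)"
      using abs_Im_le_cmod[of "of_nat n * Ln a"] by (simp add: norm_mult)
    also have "\<dots> < pi" using a(2) n(1) by (simp add: pos_less_divide_eq mult.commute)
    finally show ?thesis using pi_gt_zero by linarith
  qed
  ultimately have "of_nat n * Ln a = 0" by (intro exp_complex_eqI[of _ 0]) auto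
  then show ?thesis using a(1) n(1) by (metis exp_Ln exp_zero mult_eq_0_iff of_nat_0_less_iff of_nat_eq_0_iff less_numeral_extra(3))
qed

text \<open>The powers of the element stabilize \<open>A\<close>, hence so does the whole one-parameter group, because its
  entries are polynomials in the parameter.\<close>

lemma stab_unipotent_one_param:
  fixes A :: "('n0::finite, 'n1::finite, 'n2::finite) tensor"
  assumes act: "tensor_act (u0, u1, u2) A = A"
    and u: "nilp ((*v) (u0 - mat 1))" "nilp ((*v) (u1 - mat 1))" "nilp ((*v) (u2 - mat 1))"
  shows "\<exists>F0 F1 F2 N0 N1 N2. one_param F0 N0 \<and> one_param F1 N1 \<and> one_param F2 N2 \<and>
    F0 1 = u0 \<and> F1 1 = u1 \<and> F2 1 = u2 \<and> nilp ((*v) N0) \<and> nilp ((*v) N1) \<and> nilp ((*v) N2) \<and> lie_act (N0, N1, N2) A = 0"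
proof -
  obtain F0 N0 where F0: "one_param F0 N0" "\<And>i j. (\<lambda>t. F0 t $ i $ j) \<in> pf" "\<And>n::nat. F0 (of_nat n) = mpow u0 n" "nilp ((*v) N0)"
    using unipotent_one_param[OF u(1)] by blast
  obtain F1 N1 where F1: "one_param F1 N1" "\<And>i j. (\<lambda>t. F1 t $ i $ j) \<in> pf" "\<And>n::nat. F1 (of_nat n) = mpow u1 n" "nilp ((*v) N1)"
    using unipotent_one_param[OF u(2)] by blast
  obtain F2 N2 where F2: "one_param F2 N2" "\<And>i j. (\<lambda>t. F2 t $ i $ j) \<in> pf" "\<And>n::nat. F2 (of_nat n) = mpow u2 n" "nilp ((*v) N2)"
    using unipotent_one_param[OF u(3)] by blast
  have nat: "tensor_act (mpow u0 n, mpow u1 n, mpow u2 n) A = A" for n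
    by (induction n) (simp_all add: tensor_act_one mpow_Suc tensor_act_mult act)
  have "tensor_act (F0 t, F1 t, F2 t) A = A" for t
  proof -
    have "tensor_act (F0 t, F1 t, F2 t) A $ i $ j $ l + (- A $ i $ j $ l) = 0" for i j l
    proof (rule pf_zero[where f = "\<lambda>t. tensor_act (F0 t, F1 t, F2 t) A $ i $ j $ l + (- A $ i $ j $ l)"])
      show "(\<lambda>t. tensor_act (F0 t, F1 t, F2 t) A $ i $ j $ l + (- A $ i $ j $ l)) \<in> pf"
        unfolding tensor_act.simps vec_lambda_beta
        by (intro generated_algebra.add generated_algebra_sum generated_algebra.mult generated_algebra.const F0(2) F1(2) F2(2)) simp_all
      show "tensor_act (F0 (of_nat n), F1 (of_nat n), F2 (of_nat n)) A $ i $ j $ l + (- A $ i $ j $ l) = 0" for n :: nat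
        by (simp add: F0(3) F1(3) F2(3) nat)
    qed
    then show ?thesis by (simp add: vec_eq_iff)
  qed
  then have "lie_act (N0, N1, N2) A = 0" by (rule one_param_lie_act[OF F0(1) F1(1) F2(1)])
  moreover have "mpow g 1 = g" for g :: "complex^'x::finite^'x" using mpow_Suc[of g 0] by simp
  then have "F0 1 = u0" "F1 1 = u1" "F2 1 = u2"
    using F0(3)[of 1] F1(3)[of 1] F2(3)[of 1] by simp_all
  ultimately show ?thesis using F0 F1 F2 by blast
qed

context index
begin

text \<open>A filtration by index shift. The matrix \<open>jmat \<iota>\<close> has degree minus
  one, so a bracket with it moves one step down.\<close>

definition degree_le :: "int \<Rightarrow> complex^'n^'n \<Rightarrow> bool" where
  "degree_le m X \<longleftrightarrow> (\<forall>i j. int (\<iota> i) - int (\<iota> j) > m \<longrightarrow> X $ i $ j = 0)"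

lemma degree_le_bracket:
  assumes "degree_le (m + 1) X"
  shows "degree_le m (jmat \<iota> ** X - X ** jmat \<iota>)"
  unfolding degree_le_def
proof (intro allI impI)
  fix i j assume ij: "int (\<iota> i) - int (\<iota> j) > m"
  have "(jmat \<iota> ** X) $ i $ j = 0"
    unfolding matrix_matrix_mult_def vec_lambda_beta
    using assms ij by (intro sum.neutral) (auto simp: jmat_def degree_le_def)
  moreover have "(X ** jmat \<iota>) $ i $ j = 0"
    unfolding matrix_matrix_mult_def vec_lambda_beta
    using assms ij by (intro sum.neutral) (auto simp: jmat_def degree_le_def)
  ultimately show "(jmat \<iota> ** X - X ** jmat \<iota>) $ i $ j = 0" by simp
qed

text \<open>Commutators and \<open>jmat \<iota>\<close> have trace zero.\<close>

lemma bracket_scalar_zero: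
  assumes "jmat \<iota> ** X - X ** jmat \<iota> = mat c ** jmat \<iota> + mat a"
  shows "a = 0"
proof -
  have "trace (jmat \<iota> ** X - X ** jmat \<iota>) = 0" by (simp add: trace_sub trace_mul_sym[of X])
  moreover have "trace (mat c ** jmat \<iota>) = 0"
    by (simp add: trace_def mat_mult_entry jmat_def)
  moreover have "trace (mat a :: complex^'n^'n) = of_nat (CARD('n)) * a"
    by (simp add: trace_def mat_def)
  ultimately have "of_nat (CARD('n)) * a = 0" unfolding assms by (simp add: trace_add)
  then show ?thesis by simp
qed

end

context boundary_index
begin

abbreviation "E0 \<equiv> jmat \<iota>0"
abbreviation "E1 \<equiv> jmat \<iota>1"
abbreviation "E2 \<equiv> jmat \<iota>2"

context
  fixes A :: "('n0, 'n1, 'n2) tensor"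
  assumes bb: "block_bounded A" and nd: "\<not> diagonalizable k0 k1 k2 A" and E: "lie_act (E0, E1, E2) A = 0"
begin

lemma nilp_part:
  assumes "lie_act (X0, X1, X2) A = 0"
  obtains a0 a1 a2 where "a0 + a1 + a2 = 0" "nilp ((*v) (X0 - mat a0))" "nilp ((*v) (X1 - mat a1))" "nilp ((*v) (X2 - mat a2))"
    "lie_act (X0 - mat a0, X1 - mat a1, X2 - mat a2) A = 0"
proof -
  obtain a0 a1 a2 where a: "a0 + a1 + a2 = 0" "nilp ((*v) (X0 - mat a0))" "nilp ((*v) (X1 - mat a1))" "nilp ((*v) (X2 - mat a2))"
    using lie_act_nondiag[OF i0.index_card i1.index_card i2.index_card k012 bb nd assms] by blast
  moreover have "lie_act (X0 - mat a0, X1 - mat a1, X2 - mat a2) A = 0"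
    by (simp add: lie_act_diff assms lie_act_mat a(1) scale3_zero)
  ultimately show ?thesis by (rule that)
qed

text \<open>Let \<open>e0\<close> span the kernel of \<open>E1\<close> and let \<open>E1\<close> map
  \<open>e1\<close> to \<open>e0\<close>. Then \<open>M1\<close> has \<open>e0\<close> as
  eigenvector, hence kills it, and sends \<open>e1\<close> to \<open>c *s e1 + m *s e0\<close>. A
  nonzero \<open>c\<close> would be an eigenvalue of the nilpotent \<open>M1\<close>. After
  subtracting \<open>m\<close> times the raising operator, both vectors are killed, so what remains
  is not regular and must be scalar.\<close>

lemma centralizer_step:
  assumes M: "lie_act (M0, M1, M2) A = 0" "nilp ((*v) M1)"
    and br: "E1 ** M1 - M1 ** E1 = mat c ** E1"
  shows "\<exists>m a0 a1 a2. M0 = mat m ** E0 + mat a0 \<and> M1 = mat m ** E1 + mat a1 \<and> M2 = mat m ** E2 + mat a2"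
proof -
  obtain p0 p1 where p: "\<iota>1 p0 = 0" "\<iota>1 p1 = 1" using i1.index_surj[of 0] i1.index_surj[of 1] k012 by auto
  have p0: "\<iota>1 i = 0 \<longleftrightarrow> i = p0" for i using i1.index_inj[of i p0] p by simp
  define e0 e1 where "e0 = (axis p0 1 :: complex^'n1)" and "e1 = (axis p1 1 :: complex^'n1)"
  have E10: "E1 *v e0 = 0" "E1 *v e1 = e0"
    unfolding vec_eq_iff e0_def e1_def mult_axis using p by (auto simp: jmat_def axis_def simp flip: p0)
  have ker: "\<exists>m. x = m *s e0" if "E1 *v x = 0" for x
  proof -
    have "x $ i = 0" if "i \<noteq> p0" for i
    proof -
      have "\<iota>1 i \<noteq> 0" using that p i1.index_inj by metis
      obtain i' where "\<iota>1 i' = \<iota>1 i - 1"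
        using i1.index_surj[of "\<iota>1 i - 1"] i1.index_le[of i] by fastforce
      then have i': "\<iota>1 i = Suc (\<iota>1 i')" using \<open>\<iota>1 i \<noteq> 0\<close> by simp
      have "(E1 *v x) $ i' = (\<Sum>j\<in>UNIV. if j = i then of_nat (\<iota>1 i) * x $ i else 0)"
        unfolding matrix_vector_mult_def vec_lambda_beta
        using i' i1.index_inj by (intro sum.cong) (auto simp: jmat_def simp flip: i')
      then show ?thesis using \<open>E1 *v x = 0\<close> \<open>\<iota>1 i \<noteq> 0\<close> by simp
    qed
    then have "x = x $ p0 *s e0" by (auto simp: vec_eq_iff e0_def axis_def)
    then show ?thesis by blast
  qed
  have ne: "e0 \<noteq> 0" by (auto simp: e0_def axis_eq_0_iff)
  have EM: "E1 *v (M1 *v x) = c *s (E1 *v x) + M1 *v (E1 *v x)" for x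
  proof -
    have "(E1 ** M1 - M1 ** E1) *v x = (mat c ** E1) *v x" by (simp add: br)
    then show ?thesis
      by (simp add: matrix_vector_mult_diff_rdistrib mat_mult_vec algebra_simps flip: matrix_vector_mul_assoc)
  qed
  obtain a where "M1 *v e0 = a *s e0" using ker[of "M1 *v e0"] EM[of e0] by (auto simp: E10)
  then have M0: "M1 *v e0 = 0" using nilp_eigenvalue[OF M(2) _ ne, of a] by simp
  have "E1 *v (M1 *v e1 - c *s e1) = 0"
    by (simp add: EM E10 M0 matrix_vector_mult_diff_distrib vector_scalar_commute)
  then obtain m where m: "M1 *v e1 - c *s e1 = m *s e0" using ker by blast
  then have m': "M1 *v e1 = c *s e1 + m *s e0" by (simp add: algebra_simps)
  have "c = 0"
  proof (rule ccontr)
    assume c: "c \<noteq> 0"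
    have "M1 *v (e1 + (m / c) *s e0) = c *s (e1 + (m / c) *s e0)"
      using c by (simp add: matrix_vector_right_distrib vector_scalar_commute M0 m' vec.scale_right_distrib vector_smult_assoc)
    moreover have "e1 + (m / c) *s e0 \<noteq> 0"
    proof
      assume "e1 + (m / c) *s e0 = 0"
      then have "E1 *v (e1 + (m / c) *s e0) = 0" by simp
      then show False using ne by (simp add: matrix_vector_right_distrib vector_scalar_commute E10)
    qed
    ultimately show False using nilp_eigenvalue[OF M(2)] c by blast
  qed
  then have m': "M1 *v e1 = m *s e0" using m' by simp
  define W0 W1 W2 where "W0 = M0 - mat m ** E0" and "W1 = M1 - mat m ** E1" and "W2 = M2 - mat m ** E2"
  have W: "lie_act (W0, W1, W2) A = 0"
  proof -
    have "lie_act (mat m ** X0, mat m ** X1, mat m ** X2) A = scale3 m (lie_act (X0, X1, X2) A)" for X0 X1 X2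
    proof (rule tensor_eq_tri)
      fix x y z
      have t: "transpose (mat m ** X) *v v = m *s (transpose X *v v)" for X :: "complex^'x::finite^'x" and v
        by (simp add: matrix_transpose_mul vector_scalar_commute mat_mult_vec flip: matrix_vector_mul_assoc)
      show "tri (lie_act (mat m ** X0, mat m ** X1, mat m ** X2) A) x y z = tri (scale3 m (lie_act (X0, X1, X2) A)) x y z"
        by (simp add: tri_lie_act tri_scale3 tri_linear t algebra_simps)
    qed
    then show ?thesis unfolding W0_def W1_def W2_def lie_act_diff by (simp add: M E scale3_eq_0)
  qed
  obtain a0 a1 a2 where a: "a0 + a1 + a2 = 0" "nilp ((*v) (W0 - mat a0))" "nilp ((*v) (W1 - mat a1))" "nilp ((*v) (W2 - mat a2))"
    "lie_act (W0 - mat a0, W1 - mat a1, W2 - mat a2) A = 0" using nilp_part[OF W] .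
  have We: "W1 *v e0 = 0" "W1 *v e1 = 0"
    by (simp_all add: W1_def matrix_vector_mult_diff_rdistrib E10 M0 m' mat_mult_vec flip: matrix_vector_mul_assoc)
  have "(W1 - mat a1) *v e0 = (- a1) *s e0" by (simp add: matrix_vector_mult_diff_rdistrib We mat_mult_vec)
  then have "a1 = 0" using nilp_eigenvalue[OF a(3) _ ne] by fastforce
  have "W0 - mat a0 = 0 \<and> W1 - mat a1 = 0 \<and> W2 - mat a2 = 0"
  proof (rule ccontr)
    assume "\<not> ?thesis"
    then have "W0 - mat a0 \<noteq> 0 \<or> W1 - mat a1 \<noteq> 0 \<or> W2 - mat a2 \<noteq> 0" by blast
    then have "regular_nilp (W1 - mat a1)" using lie_act_regular[OF cards bb a(5) a(3,4)] by blast
    then have "regular_nilp W1" by (simp add: \<open>a1 = 0\<close>)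
    then have "p0 = p1" using i1.regular_axis_kernel We unfolding e0_def e1_def by blast
    then show False using p by simp
  qed
  then show ?thesis unfolding W0_def W1_def W2_def by (intro exI[of _ m] exI[of _ a0] exI[of _ a1] exI[of _ a2]) (simp add: algebra_simps)
qed

text \<open>Induction along the filtration: the bracket of \<open>E\<close> with \<open>Z\<close>
  lies one step lower, so it is a multiple of \<open>E\<close> plus scalars, and in the second
  factor the trace removes the scalar. Then \<open>centralizer_step\<close> applies to the nilpotent
  part of \<open>Z\<close>.\<close>

lemma nondiag_lie_algebra:
  assumes "lie_act (Z0, Z1, Z2) A = 0"
  shows "\<exists>m a0 a1 a2. Z0 = mat m ** E0 + mat a0 \<and> Z1 = mat m ** E1 + mat a1 \<and> Z2 = mat m ** E2 + mat a2"
proof -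
  have "\<forall>(Z0 :: complex^'n0^'n0) (Z1 :: complex^'n1^'n1) (Z2 :: complex^'n2^'n2). lie_act (Z0, Z1, Z2) A = 0 \<longrightarrow> i0.degree_le (int n - int k0 - 1) Z0 \<longrightarrow>
      i1.degree_le (int n - int k0 - 1) Z1 \<longrightarrow> i2.degree_le (int n - int k0 - 1) Z2 \<longrightarrow>
      (\<exists>m a0 a1 a2. Z0 = mat m ** E0 + mat a0 \<and> Z1 = mat m ** E1 + mat a1 \<and> Z2 = mat m ** E2 + mat a2)" for n
  proof (induction n)
    case 0
    have "int (\<iota>0 i) - int (\<iota>0 j) > int 0 - int k0 - 1" "int (\<iota>1 i') - int (\<iota>1 j') > int 0 - int k0 - 1"
      "int (\<iota>2 i'') - int (\<iota>2 j'') > int 0 - int k0 - 1" for i j i' j' i'' j''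
      using i0.index_le[of j] i1.index_le[of j'] i2.index_le[of j''] k012(1) by linarith+
    then have z: "i0.degree_le (int 0 - int k0 - 1) Z0 \<Longrightarrow> Z0 = 0" "i1.degree_le (int 0 - int k0 - 1) Z1 \<Longrightarrow> Z1 = 0"
      "i2.degree_le (int 0 - int k0 - 1) Z2 \<Longrightarrow> Z2 = 0" for Z0 Z1 Z2
      unfolding i0.degree_le_def i1.degree_le_def i2.degree_le_def vec_eq_iff by simp_all
    have m0: "mat 0 = (0 :: complex^'x^'x)" by (simp add: vec_eq_iff mat_def)
    show ?case
      by (intro allI impI exI[of _ 0]) (simp add: z m0 matrix_zero_mult)
  next
    case (Suc n)
    show ?case
    proof (intro allI impI)
      fix Z0 Z1 Z2 assume Z: "lie_act (Z0, Z1, Z2) A = 0" and d: "i0.degree_le (int (Suc n) - int k0 - 1) Z0"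
        "i1.degree_le (int (Suc n) - int k0 - 1) Z1" "i2.degree_le (int (Suc n) - int k0 - 1) Z2"
      have S: "int (Suc n) - int k0 - 1 = int n - int k0 - 1 + 1" by simp
      have "lie_act (E0 ** Z0 - Z0 ** E0, E1 ** Z1 - Z1 ** E1, E2 ** Z2 - Z2 ** E2) A = 0"
        by (simp add: lie_act_bracket Z E lie_act_zero)
      from Suc.IH[rule_format, OF this i0.degree_le_bracket[OF d(1)[unfolded S]] i1.degree_le_bracket[OF d(2)[unfolded S]]
          i2.degree_le_bracket[OF d(3)[unfolded S]]]
      obtain c a1 where c: "E1 ** Z1 - Z1 ** E1 = mat c ** E1 + mat a1" by blast
      have "a1 = 0" by (rule i1.bracket_scalar_zero[OF c])
      then have c: "E1 ** Z1 - Z1 ** E1 = mat c ** E1" using c by (simp add: vec_eq_iff mat_def)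
      obtain b0 b1 b2 where b: "b0 + b1 + b2 = 0" "nilp ((*v) (Z0 - mat b0))" "nilp ((*v) (Z1 - mat b1))" "nilp ((*v) (Z2 - mat b2))"
        "lie_act (Z0 - mat b0, Z1 - mat b1, Z2 - mat b2) A = 0" using nilp_part[OF Z] .
      have "E1 ** (Z1 - mat b1) - (Z1 - mat b1) ** E1 = mat c ** E1"
      proof -
        have "E1 ** (Z1 - mat b1) - (Z1 - mat b1) ** E1 = E1 ** Z1 - Z1 ** E1"
          unfolding matrix_eq
          by (simp add: matrix_vector_mult_diff_rdistrib matrix_vector_mult_diff_distrib mat_mult_vec vector_scalar_commute
              flip: matrix_vector_mul_assoc)
        then show ?thesis by (simp add: c)
      qed
      from centralizer_step[OF b(5,3) this]
      obtain m d0 d1 d2 where "Z0 - mat b0 = mat m ** E0 + mat d0" "Z1 - mat b1 = mat m ** E1 + mat d1"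
        "Z2 - mat b2 = mat m ** E2 + mat d2" by blast
      then have "Z0 = mat m ** E0 + mat (d0 + b0) \<and> Z1 = mat m ** E1 + mat (d1 + b1) \<and> Z2 = mat m ** E2 + mat (d2 + b2)"
        by (auto simp: vec_eq_iff mat_def algebra_simps)
      then show "\<exists>m a0 a1 a2. Z0 = mat m ** E0 + mat a0 \<and> Z1 = mat m ** E1 + mat a1 \<and> Z2 = mat m ** E2 + mat a2" by blast
    qed
  qed
  \<comment> \<open>Degrees range from \<open>- k0\<close> to \<open>k0\<close>, which takes
    \<open>2 * k0 + 1\<close> steps starting from the zero space.\<close>
  note ind = this[of "2 * k0 + 1", rule_format, of Z0 Z1 Z2, OF assms]
  have top: "int (2 * k0 + 1) - int k0 - 1 = int k0" by simp
  have "\<not> int k0 < int (\<iota>0 i) - int (\<iota>0 j)" "\<not> int k0 < int (\<iota>1 i') - int (\<iota>1 j')" "\<not> int k0 < int (\<iota>2 i'') - int (\<iota>2 j'')" for i j i' j' i'' j''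
    using i0.index_le[of i] i1.index_le[of i'] i2.index_le[of i''] k012(1) by linarith+
  then have "i0.degree_le (int k0) Z0" "i1.degree_le (int k0) Z1" "i2.degree_le (int k0) Z2"
    unfolding i0.degree_le_def i1.degree_le_def i2.degree_le_def by blast+
  then show ?thesis by (intro ind) (simp_all only: top)
qed

end

end

section \<open>From the Lie algebra to the identity component without a torus\<close>

definition upper :: "(complex^2^2) set" where
  "upper = range (\<lambda>t. mk 1 t 0 1)"

lemma upper_group: "upper \<subseteq> SL" "connected upper" "mat 1 \<in> upper" "\<And>g h. g \<in> upper \<Longrightarrow> h \<in> upper \<Longrightarrow> g ** h \<in> upper"
  "\<And>g. g \<in> upper \<Longrightarrow> \<exists>h\<in>upper. g ** h = mat 1 \<and> h ** g = mat 1"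
proof -
  show "upper \<subseteq> SL" by (auto simp: upper_def mk_in_SL)
  show "connected upper" unfolding upper_def
    by (intro connected_continuous_image continuous_intros connected_UNIV)
  show "mat 1 \<in> upper" by (auto simp: upper_def mk_one)
  show "g ** h \<in> upper" if "g \<in> upper" "h \<in> upper" for g h
    using that by (auto simp: upper_def mk_mult)
  show "\<exists>h\<in>upper. g ** h = mat 1 \<and> h ** g = mat 1" if g: "g \<in> upper" for g
  proof -
    obtain t where "g = mk 1 t 0 1" using g by (auto simp: upper_def)
    then show ?thesis by (intro bexI[of _ "mk 1 (- t) 0 1"]) (auto simp: upper_def mk_mult mk_one)
  qed
qed

lemma Ln_bounds:
  assumes "n \<le> k + 1" "cmod (Ln z) < pi / (3 * (real k + 1))" "n > 0"
  shows "cmod (Ln z) < pi / real n"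
proof -
  have "pi / (3 * (real k + 1)) \<le> pi / real n"
    using assms by (intro divide_left_mono) auto
  then show ?thesis using assms(2) by linarith
qed

context index
begin

lemma nilp_jmat_scalar:
  assumes "nilp ((*v) (mat m ** jmat \<iota> + mat a))"
  shows "a = 0"
proof -
  obtain p where p: "\<iota> p = 0" using index_surj[of 0] by auto
  have "jmat \<iota> *v axis p 1 = 0" unfolding vec_eq_iff mult_axis using p by (simp add: jmat_def)
  then have "(mat m ** jmat \<iota> + mat a) *v axis p 1 = a *s axis p 1"
    by (simp add: matrix_vector_mult_add_rdistrib mat_mult_vec flip: matrix_vector_mul_assoc)
  then show ?thesis using nilp_eigenvalue[OF assms] by (metis axis_eq_0_iff zero_neq_one)
qed

lemma rho_upper_scaled: "one_param (\<lambda>t. rho \<iota> k (mk 1 (t * c) 0 1)) (mat c ** jmat \<iota>)"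
  unfolding one_param_def
proof (intro conjI allI)
  show "rho \<iota> k (mk 1 (0 * c) 0 1) = mat 1" using rho_one by (simp add: mk_one)
  show "rho \<iota> k (mk 1 ((s + t) * c) 0 1) = rho \<iota> k (mk 1 (s * c) 0 1) ** rho \<iota> k (mk 1 (t * c) 0 1)" for s t
    by (simp flip: rho_mult add: mk_mult algebra_simps)
  have "drho \<iota> k 0 c 0 = mat c ** jmat \<iota>" by (simp add: vec_eq_iff mat_mult_entry drho_def jmat_def)
  then show "mderiv (\<lambda>t. rho \<iota> k (mk 1 (t * c) 0 1)) (mat c ** jmat \<iota>) 0"
    using rho_mderiv[of 0 c 0] by simp
qed

end

context boundary_index
begin

text \<open>Each component close to one has a single eigenvalue, and the three eigenvalues multiply
  to \<open>c\<close>. Dividing by them gives a unipotent triple fixing \<open>A\<close> exactly,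
  hence a one-parameter group whose generator lies in the Lie algebra.\<close>

lemma stab_near_unipotent:
  fixes A :: "('n0, 'n1, 'n2) tensor"
  assumes bb: "block_bounded A" and nd: "\<not> diagonalizable k0 k1 k2 A"
  shows "\<exists>e>0. \<forall>g0 g1 g2. (g0, g1, g2) \<in> Stab A \<longrightarrow> (\<forall>i j. cmod ((g0 - mat 1) $ i $ j) < e) \<longrightarrow>
    (\<forall>i j. cmod ((g1 - mat 1) $ i $ j) < e) \<longrightarrow> (\<forall>i j. cmod ((g2 - mat 1) $ i $ j) < e) \<longrightarrow>
    (\<exists>a0 a1 a2 F0 F1 F2 N0 N1 N2. a0 \<noteq> 0 \<and> cmod (Ln a0) < pi / real (k0 + 1) \<and>
      a1 \<noteq> 0 \<and> cmod (Ln a1) < pi / real (k1 + 1) \<and> a2 \<noteq> 0 \<and> cmod (Ln a2) < pi / real (k2 + 1) \<and>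
      one_param F0 N0 \<and> one_param F1 N1 \<and> one_param F2 N2 \<and>
      nilp ((*v) N0) \<and> nilp ((*v) N1) \<and> nilp ((*v) N2) \<and> lie_act (N0, N1, N2) A = 0 \<and>
      g0 = mat a0 ** F0 1 \<and> g1 = mat a1 ** F1 1 \<and> g2 = mat a2 ** F2 1)"
proof -
  obtain d where d: "d > 0" "\<And>z. cmod (z - 1) < d \<Longrightarrow> z \<noteq> 0 \<and> cmod (Ln z) < pi / (3 * (real k0 + 1))"
    using Ln_small[of "pi / (3 * (real k0 + 1))"] by auto
  \<comment> \<open>The eigenvalue estimate loses a factor equal to the dimension, at most
    \<open>k0 + 1\<close>; the further factor two makes the inequality strict.\<close>
  define e where "e = d / (2 * (real k0 + 1))"
  have e0: "e > 0" using d(1) by (simp add: e_def)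
  have ke: "(real k + 1) * e < d" if "k \<le> k0" for k
  proof -
    have "(real k + 1) * e \<le> (real k0 + 1) * e" using that e0 by (intro mult_right_mono) auto
    also have "\<dots> = d / 2" by (simp add: e_def divide_simps del: of_nat_Suc)
    also have "\<dots> < d" using d(1) by simp
    finally show ?thesis .
  qed
  have ce: "real CARD('n0) * e < d" "real CARD('n1) * e < d" "real CARD('n2) * e < d"
    using ke[of k0] ke[of k1] ke[of k2] k012(1) by (simp_all add: i0.index_card i1.index_card i2.index_card add.commute)
  have d3: "z \<noteq> 0 \<and> cmod (Ln z) < pi / 3" if "cmod (z - 1) < d" for z
  proof -
    have "pi / (3 * (real k0 + 1)) \<le> pi / 3" by (intro divide_left_mono) auto
    then show ?thesis using d(2)[OF that] by (metis order.strict_trans2)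
  qed
  show ?thesis
  proof (intro exI[of _ e] conjI e0 allI impI)
    fix g0 g1 g2
    assume S: "(g0, g1, g2) \<in> Stab A" and near: "\<forall>i j. cmod ((g0 - mat 1) $ i $ j) < e"
      "\<forall>i j. cmod ((g1 - mat 1) $ i $ j) < e" "\<forall>i j. cmod ((g2 - mat 1) $ i $ j) < e"
    obtain c where c: "c \<noteq> 0" "tensor_act (g0, g1, g2) A = scale3 c A" using S by (auto simp: Stab_def)
    have near': "cmod ((g0 - mat 1) $ i0 $ j0) \<le> e" "cmod ((g1 - mat 1) $ i1 $ j1) \<le> e" "cmod ((g2 - mat 1) $ i2 $ j2) \<le> e"
      for i0 j0 i1 j1 i2 j2 using near by (simp_all add: less_imp_le)
    have "\<exists>a0 a1 a2. a0 * a1 * a2 = c \<and> cmod (a0 - 1) < d \<and> cmod (a1 - 1) < d \<and> cmod (a2 - 1) < d \<and>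
      nilp ((*v) (g0 - mat a0)) \<and> nilp ((*v) (g1 - mat a1)) \<and> nilp ((*v) (g2 - mat a2))"
      by (rule stab_nondiag_near_one[OF i0.index_card i1.index_card i2.index_card k012 bb nd c(2) _ near' ce]) (erule d3)
    then obtain a0 a1 a2 where a: "a0 * a1 * a2 = c" "cmod (a0 - 1) < d" "cmod (a1 - 1) < d" "cmod (a2 - 1) < d"
      "nilp ((*v) (g0 - mat a0))" "nilp ((*v) (g1 - mat a1))" "nilp ((*v) (g2 - mat a2))"
      by (elim exE conjE) (rule that)
    have a0: "a0 \<noteq> 0" "a1 \<noteq> 0" "a2 \<noteq> 0" using d(2) a(2-4) by blast+
    have nil: "nilp ((*v) (mat (inverse a) ** g - mat 1))" if "nilp ((*v) (g - mat a))" "a \<noteq> 0"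
      for g :: "complex^'x::finite^'x" and a
    proof -
      have "mat (inverse a) ** (g - mat a) = mat (inverse a) ** g - mat 1"
        using that(2) by (simp add: vec_eq_iff mat_mult_entry algebra_simps) (simp add: mat_def)
      then show ?thesis using nilp_scaled[OF that(1), of "inverse a"] by simp
    qed
    have "inverse a0 * inverse a1 * inverse a2 * (a0 * a1 * a2) = 1" using a0 by (simp add: field_simps)
    then have "tensor_act (mat (inverse a0) ** g0, mat (inverse a1) ** g1, mat (inverse a2) ** g2) A = A"
      unfolding tensor_act_mult c(2) tensor_act_mat scale3_scale3 by (simp add: scale3_one flip: a(1))
    from stab_unipotent_one_param[OF this nil[OF a(5) a0(1)] nil[OF a(6) a0(2)] nil[OF a(7) a0(3)]]
    obtain F0 F1 F2 N0 N1 N2 where F: "one_param F0 N0" "one_param F1 N1" "one_param F2 N2"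
      "F0 1 = mat (inverse a0) ** g0" "F1 1 = mat (inverse a1) ** g1" "F2 1 = mat (inverse a2) ** g2"
      "nilp ((*v) N0)" "nilp ((*v) N1)" "nilp ((*v) N2)" "lie_act (N0, N1, N2) A = 0" by blast
    have recover: "g = mat a ** (mat (inverse a) ** g)" if "a \<noteq> 0" for a and g :: "complex^'x::finite^'x"
      using that by (simp add: matrix_mul_assoc mat_mult_mat)
    have L: "cmod (Ln a0) < pi / real (k0 + 1)" "cmod (Ln a1) < pi / real (k1 + 1)" "cmod (Ln a2) < pi / real (k2 + 1)"
      using k012(1) by (auto intro!: Ln_bounds[OF _ d(2)[OF a(2), THEN conjunct2]] Ln_bounds[OF _ d(2)[OF a(3), THEN conjunct2]]
          Ln_bounds[OF _ d(2)[OF a(4), THEN conjunct2]] simp del: of_nat_add of_nat_Suc)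
    have G: "g0 = mat a0 ** F0 1" "g1 = mat a1 ** F1 1" "g2 = mat a2 ** F2 1"
      unfolding F(4-6) by (rule recover[OF a0(1)] recover[OF a0(2)] recover[OF a0(3)])+
    show "\<exists>a0 a1 a2 F0 F1 F2 N0 N1 N2. a0 \<noteq> 0 \<and> cmod (Ln a0) < pi / real (k0 + 1) \<and>
      a1 \<noteq> 0 \<and> cmod (Ln a1) < pi / real (k1 + 1) \<and> a2 \<noteq> 0 \<and> cmod (Ln a2) < pi / real (k2 + 1) \<and>
      one_param F0 N0 \<and> one_param F1 N1 \<and> one_param F2 N2 \<and>
      nilp ((*v) N0) \<and> nilp ((*v) N1) \<and> nilp ((*v) N2) \<and> lie_act (N0, N1, N2) A = 0 \<and>
      g0 = mat a0 ** F0 1 \<and> g1 = mat a1 ** F1 1 \<and> g2 = mat a2 ** F2 1"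
      by (rule exI[of _ a0], rule exI[of _ a1], rule exI[of _ a2], rule exI[of _ F0], rule exI[of _ F1], rule exI[of _ F2],
        rule exI[of _ N0], rule exI[of _ N1], rule exI[of _ N2])
        (intro conjI F(1-3) F(7-10) a0 L G)
  qed
qed

lemma eventually_Stab_subset:
  fixes A :: "('n0, 'n1, 'n2) tensor"
  assumes bb: "block_bounded A" and nd: "\<not> diagonalizable k0 k1 k2 A"
    and P: "\<And>g0 g1 g2 a0 a1 a2 F0 F1 F2 N0 N1 N2. (g0, g1, g2) \<in> Stab A \<Longrightarrow> a0 \<noteq> 0 \<Longrightarrow> cmod (Ln a0) < pi / real (k0 + 1) \<Longrightarrow>
      a1 \<noteq> 0 \<Longrightarrow> cmod (Ln a1) < pi / real (k1 + 1) \<Longrightarrow> a2 \<noteq> 0 \<Longrightarrow> cmod (Ln a2) < pi / real (k2 + 1) \<Longrightarrow>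
      one_param F0 N0 \<Longrightarrow> one_param F1 N1 \<Longrightarrow> one_param F2 N2 \<Longrightarrow>
      nilp ((*v) N0) \<Longrightarrow> nilp ((*v) N1) \<Longrightarrow> nilp ((*v) N2) \<Longrightarrow> lie_act (N0, N1, N2) A = 0 \<Longrightarrow>
      g0 = mat a0 ** F0 1 \<Longrightarrow> g1 = mat a1 ** F1 1 \<Longrightarrow> g2 = mat a2 ** F2 1 \<Longrightarrow> (g0, g1, g2) \<in> K"
  shows "\<forall>\<^sub>F g in nhds tone. g \<in> Stab A \<longrightarrow> g \<in> K"
proof -
  obtain e where e: "e > 0" and ex: "\<forall>g0 g1 g2. (g0, g1, g2) \<in> Stab A \<longrightarrow> (\<forall>i j. cmod ((g0 - mat 1) $ i $ j) < e) \<longrightarrow>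
    (\<forall>i j. cmod ((g1 - mat 1) $ i $ j) < e) \<longrightarrow> (\<forall>i j. cmod ((g2 - mat 1) $ i $ j) < e) \<longrightarrow>
    (\<exists>a0 a1 a2 F0 F1 F2 N0 N1 N2. a0 \<noteq> 0 \<and> cmod (Ln a0) < pi / real (k0 + 1) \<and>
      a1 \<noteq> 0 \<and> cmod (Ln a1) < pi / real (k1 + 1) \<and> a2 \<noteq> 0 \<and> cmod (Ln a2) < pi / real (k2 + 1) \<and>
      one_param F0 N0 \<and> one_param F1 N1 \<and> one_param F2 N2 \<and>
      nilp ((*v) N0) \<and> nilp ((*v) N1) \<and> nilp ((*v) N2) \<and> lie_act (N0, N1, N2) A = 0 \<and>
      g0 = mat a0 ** F0 1 \<and> g1 = mat a1 ** F1 1 \<and> g2 = mat a2 ** F2 1)"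
    using stab_near_unipotent[OF bb nd] by (elim exE conjE) (rule that)
  show ?thesis
    using eventually_tone_near_one[OF e]
  proof (rule eventually_mono, intro impI)
    fix g :: "('n0, 'n1, 'n2) triple"
    assume n: "(\<forall>i j. cmod ((fst g - mat 1) $ i $ j) < e) \<and>
      (\<forall>i j. cmod ((fst (snd g) - mat 1) $ i $ j) < e) \<and> (\<forall>i j. cmod ((snd (snd g) - mat 1) $ i $ j) < e)"
      and S: "g \<in> Stab A"
    obtain g0 g1 g2 where g: "g = (g0, g1, g2)" by (cases g)
    have n': "\<forall>i j. cmod ((g0 - mat 1) $ i $ j) < e" "\<forall>i j. cmod ((g1 - mat 1) $ i $ j) < e"
      "\<forall>i j. cmod ((g2 - mat 1) $ i $ j) < e" using n unfolding g fst_conv snd_conv by blast+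
    from ex[THEN spec, THEN spec, THEN spec, THEN mp, THEN mp, THEN mp, THEN mp, OF S[unfolded g] n'] show "g \<in> K"
      unfolding g by (elim exE conjE) (rule P[OF S[unfolded g]])
  qed
qed

text \<open>The determinants make \<open>a\<close> a root of unity of order dividing
  \<open>k + 1\<close>, and one is the only such root with so small a logarithm.\<close>

lemma scalar_factor_one:
  fixes g F :: "complex^'x::finite^'x"
  assumes "det g = 1" "g = mat a ** F" "det F = 1" "a \<noteq> 0" "cmod (Ln a) < pi / real (k + 1)" "CARD('x) = Suc k"
  shows "g = F"
proof -
  have "a ^ (k + 1) = 1" using assms(1,3) unfolding assms(2) by (simp add: det_mul det_mat assms(6))
  then have "a = 1" by (intro root_near_one[OF assms(4,5)]) simp_all
  then show ?thesis using assms(2) by simp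
qed

lemma Stab0_trivial:
  fixes A :: "('n0, 'n1, 'n2) tensor"
  assumes bb: "block_bounded A" and nd: "\<not> diagonalizable k0 k1 k2 A"
    and none: "\<And>N0 N1 N2. nilp ((*v) N0) \<Longrightarrow> nilp ((*v) N1) \<Longrightarrow> nilp ((*v) N2) \<Longrightarrow> lie_act (N0, N1, N2) A = 0 \<Longrightarrow>
      N0 = 0 \<and> N1 = 0 \<and> N2 = 0"
  shows "Stab0 A = {tone}"
proof (rule Stab0_eqI)
  show "\<forall>\<^sub>F g in nhds tone. g \<in> Stab A \<longrightarrow> g \<in> {tone}"
  proof (rule eventually_Stab_subset[OF bb nd])
    fix g0 g1 g2 a0 a1 a2 F0 F1 F2 N0 N1 N2
    assume S: "(g0, g1, g2) \<in> Stab A" and a: "a0 \<noteq> 0" "cmod (Ln a0) < pi / real (k0 + 1)"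
      "a1 \<noteq> 0" "cmod (Ln a1) < pi / real (k1 + 1)" "a2 \<noteq> 0" "cmod (Ln a2) < pi / real (k2 + 1)"
      and F: "one_param F0 N0" "one_param F1 N1" "one_param F2 N2"
      and N: "nilp ((*v) N0)" "nilp ((*v) N1)" "nilp ((*v) N2)" "lie_act (N0, N1, N2) A = 0"
      and g: "g0 = mat a0 ** F0 1" "g1 = mat a1 ** F1 1" "g2 = mat a2 ** F2 1"
    have z: "F t = mat 1" if "one_param F 0" for F :: "complex \<Rightarrow> complex^'x::finite^'x" and t
      by (rule one_param_unique[OF that]) (simp add: one_param_def mderiv_const)
    have N0: "N0 = 0" "N1 = 0" "N2 = 0" using none[OF N] by simp_all
    have F1: "F0 1 = mat 1" "F1 1 = mat 1" "F2 1 = mat 1"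
      by (rule z[OF F(1)[unfolded N0]] z[OF F(2)[unfolded N0]] z[OF F(3)[unfolded N0]])+
    have det: "det g0 = 1" "det g1 = 1" "det g2 = 1" using S by (auto simp: Stab_def SL_def)
    show "(g0, g1, g2) \<in> {tone}"
      using scalar_factor_one[OF det(1) g(1) _ a(1,2) i0.index_card] scalar_factor_one[OF det(2) g(2) _ a(3,4) i1.index_card]
        scalar_factor_one[OF det(3) g(3) _ a(5,6) i2.index_card] by (simp add: F1)
  qed
  show "{tone} \<subseteq> Stab A" by (simp add: Stab_one)
  show "\<exists>h\<in>{tone}. tmul g h = tone \<and> tmul h g = tone" if "g \<in> {tone}" for g :: "('n0, 'n1, 'n2) triple"
    using that by simp
  show "tmul g h \<in> {tone}" if "g \<in> {tone}" "h \<in> {tone}" for g h :: "('n0, 'n1, 'n2) triple"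
    using that by simp
  show "connected {tone :: ('n0, 'n1, 'n2) triple}" by (rule connected_sing)
qed (rule singletonI)

lemma Stab0_upper:
  fixes A :: "('n0, 'n1, 'n2) tensor"
  assumes bb: "block_bounded A" and nd: "\<not> diagonalizable k0 k1 k2 A" and E: "lie_act (E0, E1, E2) A = 0"
  shows "Stab0 A = rho3 ` upper"
proof (rule Stab0_rho3I[OF upper_group])
  show "\<exists>c. c \<noteq> 0 \<and> tensor_act (rho3 g) A = scale3 c A" if "g \<in> upper" for g
  proof -
    obtain t where t: "g = mk 1 t 0 1" using \<open>g \<in> upper\<close> by (auto simp: upper_def)
    have "tensor_act (rho3 g) A = A" unfolding rho3_def t
      by (rule one_param_stabilizes[OF i0.rho_upper_one_param i1.rho_upper_one_param i2.rho_upper_one_param])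
        (simp add: drho_jmat E)
    then show ?thesis by (intro exI[of _ 1]) (simp add: scale3_one)
  qed
  show "\<forall>\<^sub>F g in nhds tone. g \<in> Stab A \<longrightarrow> g \<in> rho3 ` upper"
  proof (rule eventually_Stab_subset[OF bb nd])
    fix g0 g1 g2 a0 a1 a2 F0 F1 F2 N0 N1 N2
    assume S: "(g0, g1, g2) \<in> Stab A" and a: "a0 \<noteq> 0" "cmod (Ln a0) < pi / real (k0 + 1)"
      "a1 \<noteq> 0" "cmod (Ln a1) < pi / real (k1 + 1)" "a2 \<noteq> 0" "cmod (Ln a2) < pi / real (k2 + 1)"
      and F: "one_param F0 N0" "one_param F1 N1" "one_param F2 N2"
      and N: "nilp ((*v) N0)" "nilp ((*v) N1)" "nilp ((*v) N2)" "lie_act (N0, N1, N2) A = 0"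
      and g: "g0 = mat a0 ** F0 1" "g1 = mat a1 ** F1 1" "g2 = mat a2 ** F2 1"
    obtain m b0 b1 b2 where b: "N0 = mat m ** E0 + mat b0" "N1 = mat m ** E1 + mat b1" "N2 = mat m ** E2 + mat b2"
      using nondiag_lie_algebra[OF bb nd E N(4)] by blast
    have "b0 = 0" "b1 = 0" "b2 = 0"
      using i0.nilp_jmat_scalar[OF N(1)[unfolded b]] i1.nilp_jmat_scalar[OF N(2)[unfolded b]]
        i2.nilp_jmat_scalar[OF N(3)[unfolded b]] by simp_all
    moreover have m0: "mat 0 = (0 :: complex^'x^'x)" by (simp add: vec_eq_iff mat_def)
    ultimately have N: "N0 = mat m ** E0" "N1 = mat m ** E1" "N2 = mat m ** E2" using b by (simp_all add: m0)
    have F1: "F0 1 = rho \<iota>0 k0 (mk 1 m 0 1)" "F1 1 = rho \<iota>1 k1 (mk 1 m 0 1)" "F2 1 = rho \<iota>2 k2 (mk 1 m 0 1)"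
      using one_param_unique[OF F(1)[unfolded N] i0.rho_upper_scaled, of 1] one_param_unique[OF F(2)[unfolded N] i1.rho_upper_scaled, of 1]
       one_param_unique[OF F(3)[unfolded N] i2.rho_upper_scaled, of 1] by simp_all
    have sl: "mk 1 m 0 1 \<in> SL" by (simp add: mk_in_SL)
    have det: "det g0 = 1" "det g1 = 1" "det g2 = 1" using S by (auto simp: Stab_def SL_def)
    have "(g0, g1, g2) = rho3 (mk 1 m 0 1)"
      using scalar_factor_one[OF det(1) g(1) _ a(1,2) i0.index_card] scalar_factor_one[OF det(2) g(2) _ a(3,4) i1.index_card]
        scalar_factor_one[OF det(3) g(3) _ a(5,6) i2.index_card]
      by (simp add: F1 rho3_def i0.det_rho_one[OF sl] i1.det_rho_one[OF sl] i2.det_rho_one[OF sl])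
    then show "(g0, g1, g2) \<in> rho3 ` upper" by (auto simp: upper_def)
  qed
qed

end

section \<open>Classification of the stabilizers\<close>

lemma block_bounded_act:
  fixes A :: "('n0::finite, 'n1::finite, 'n2::finite) tensor"
  assumes "block_bounded A" "invertible P0" "invertible P1" "invertible P2"
  shows "block_bounded (tensor_act (P0, P1, P2) A)"
  unfolding block_bounded_def
proof (intro allI impI)
  fix Q0 Q1 Q2 I J L
  assume "invertible Q0 \<and> invertible Q1 \<and> invertible Q2 \<and> J \<noteq> {} \<and> L \<noteq> {} \<and>
     (\<forall>i\<in>I. \<forall>j\<in>J. \<forall>l\<in>L. tensor_act (Q0, Q1, Q2) (tensor_act (P0, P1, P2) A) $ i $ j $ l = 0)"
  then show "card I + card J + card L \<le> CARD('n1) + CARD('n2)"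
    using assms(1)[unfolded block_bounded_def, rule_format, of "Q0 ** P0" "Q1 ** P1" "Q2 ** P2" J L I] assms(2-4)
    by (simp add: tensor_act_mult invertible_mult)
qed

lemma diagonalizable_act:
  assumes "diagonalizable k0 k1 k2 (tensor_act (P0, P1, P2) A)" and P: "invertible P0" "invertible P1" "invertible P2"
  shows "diagonalizable k0 k1 k2 A"
proof -
  obtain Q0 Q1 Q2 \<iota>0 \<iota>1 \<iota>2 where "invertible Q0" "invertible Q1" "invertible Q2" "boundary_index \<iota>0 \<iota>1 \<iota>2 k0 k1 k2"
    "boundary_index.diag_type \<iota>0 \<iota>1 \<iota>2 k0 (tensor_act (Q0, Q1, Q2) (tensor_act (P0, P1, P2) A))"
    using assms(1) unfolding diagonalizable_def by (elim exE conjE) (rule that)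
  then show ?thesis using P unfolding diagonalizable_def tensor_act_mult[symmetric]
    by (intro exI[of _ "Q0 ** P0"] exI[of _ "Q1 ** P1"] exI[of _ "Q2 ** P2"] exI[of _ \<iota>0] exI[of _ \<iota>1] exI[of _ \<iota>2])
      (simp add: invertible_mult)
qed

context boundary_index
begin

lemma std_identity:
  assumes "invertible P0" "invertible P1" "invertible P2" "tensor_act (P0, P1, P2) A = std"
  shows "is_identity k0 k1 k2 A"
  by (rule product_form_identity[OF assms(1-3), where p = "\<lambda>m. (- 1) ^ m" and q = "\<lambda>m. of_nat (k1 choose m)"
        and r = "\<lambda>m. of_nat (k2 choose m)"]) (simp_all add: assms(4) std_def)

lemma is_identity_act:
  fixes A :: "('n0, 'n1, 'n2) tensor"
  assumes "is_identity k0 k1 k2 (tensor_act (P0, P1, P2) A)" and P: "invertible P0" "invertible P1" "invertible P2"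
  shows "is_identity k0 k1 k2 A"
proof -
  obtain Q0 Q1 Q2 where "invertible Q0" "invertible Q1" "invertible Q2" "tensor_act (Q0, Q1, Q2) (tensor_act (P0, P1, P2) A) = std"
    using identity_std[OF assms(1)] by blast
  then show ?thesis using P by (intro std_identity[of "Q0 ** P0" "Q1 ** P1" "Q2 ** P2"]) (simp_all add: tensor_act_mult invertible_mult)
qed

end

text \<open>Taking the orderings as arguments allows \<open>rho3\<close> to be mentioned under an
  existential quantifier over them.\<close>

definition conj_image where
  "conj_image \<iota>0 \<iota>1 \<iota>2 k0 k1 k2 P Q H = (\<lambda>g. tmul Q (tmul (boundary_index.rho3 \<iota>0 \<iota>1 \<iota>2 k0 k1 k2 g) P)) ` H"

text \<open>The group \<open>H\<close> is \<open>SL\<close> exactly for identities and commutative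
  otherwise, which will decide the equivalence in the theorem. Without a torus, the alternative is
  whether a nonzero nilpotent triple kills \<open>A\<close>; if so, all its components are regular
  and a change of bases makes it the raising operator.\<close>

theorem Stab0_classification:
  fixes A :: "('n0::finite, 'n1::finite, 'n2::finite) tensor"
  assumes card: "CARD('n0) = Suc k0" "CARD('n1) = Suc k1" "CARD('n2) = Suc k2"
    and k: "k0 = k1 + k2" "k1 \<ge> 1" "k2 \<ge> 1"
    and A: "block_bounded A"
  shows "\<exists>\<iota>0 \<iota>1 \<iota>2 P Q H. boundary_index \<iota>0 \<iota>1 \<iota>2 k0 k1 k2 \<and> tmul P Q = tone \<and> tmul Q P = tone \<and>
    Stab0 A = conj_image \<iota>0 \<iota>1 \<iota>2 k0 k1 k2 P Q H \<and>
    (if is_identity k0 k1 k2 A then H = SL else H \<in> {{mat 1}, upper, torus})"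
proof -
  have conj: ?thesis
    if \<iota>: "boundary_index \<iota>0 \<iota>1 \<iota>2 k0 k1 k2" and H: "if is_identity k0 k1 k2 A then H = SL else H \<in> {{mat 1}, upper, torus}" and P: "invertible P0" "invertible P1" "invertible P2" and S: "Stab0 (tensor_act (P0, P1, P2) A) = boundary_index.rho3 \<iota>0 \<iota>1 \<iota>2 k0 k1 k2 ` H"
    for P0 P1 P2 \<iota>0 \<iota>1 \<iota>2 H
  proof -
    obtain Q0 Q1 Q2 where Q: "P0 ** Q0 = mat 1" "Q0 ** P0 = mat 1" "P1 ** Q1 = mat 1" "Q1 ** P1 = mat 1"
      "P2 ** Q2 = mat 1" "Q2 ** P2 = mat 1"
      using invertibleE[OF P(1)] invertibleE[OF P(2)] invertibleE[OF P(3)] by metis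
    have e: "tmul (P0, P1, P2) (Q0, Q1, Q2) = tone" "tmul (Q0, Q1, Q2) (P0, P1, P2) = tone" by (simp_all add: Q)
    show ?thesis
      by (rule exI[of _ \<iota>0], rule exI[of _ \<iota>1], rule exI[of _ \<iota>2], rule exI[of _ "(P0, P1, P2)"], rule exI[of _ "(Q0, Q1, Q2)"],
        rule exI[of _ H]) (intro conjI \<iota> e H, simp only: Stab0_conj[OF e, of A] S conj_image_def image_image)
  qed
  have inv1: "invertible (mat 1 :: complex^'x::finite^'x)" by (rule invertibleI[of _ "mat 1"]) simp_all
  obtain j0 j1 j2 where j: "boundary_index (j0 :: 'n0 \<Rightarrow> nat) (j1 :: 'n1 \<Rightarrow> nat) (j2 :: 'n2 \<Rightarrow> nat) k0 k1 k2"
    using sorting_index[OF card(1), of "\<lambda>_. 0"] sorting_index[OF card(2), of "\<lambda>_. 0"] sorting_index[OF card(3), of "\<lambda>_. 0"] k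
    unfolding boundary_index_def by blast
  interpret b: boundary_index j0 j1 j2 k0 k1 k2 by (rule j)
  consider (id) "is_identity k0 k1 k2 A" | (diag) "\<not> is_identity k0 k1 k2 A" "diagonalizable k0 k1 k2 A"
    | (nondiag) "\<not> is_identity k0 k1 k2 A" "\<not> diagonalizable k0 k1 k2 A" by blast
  then show ?thesis
  proof cases
    case id
    obtain P0 P1 P2 where P: "invertible P0" "invertible P1" "invertible P2" "tensor_act (P0, P1, P2) A = b.std"
      using b.identity_std[OF id] by blast
    have "block_bounded b.std" using block_bounded_act[OF A P(1-3)] P(4) by simp
    then have "Stab0 (tensor_act (P0, P1, P2) A) = b.rho3 ` SL" unfolding P(4) by (rule b.Stab0_std)
    from conj[OF j _ P(1-3) this] show ?thesis using id by simp
  next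
    case diag
    obtain P0 P1 P2 \<iota>0 \<iota>1 \<iota>2 where P: "invertible P0" "invertible P1" "invertible P2" and i: "boundary_index \<iota>0 \<iota>1 \<iota>2 k0 k1 k2"
      and dt: "boundary_index.diag_type \<iota>0 \<iota>1 \<iota>2 k0 (tensor_act (P0, P1, P2) A)"
      using diag(2) unfolding diagonalizable_def by (elim exE conjE) (rule that)
    interpret i: boundary_index \<iota>0 \<iota>1 \<iota>2 k0 k1 k2 by (rule i)
    have "\<not> is_identity k0 k1 k2 (tensor_act (P0, P1, P2) A)" using i.is_identity_act[OF _ P] diag(1) by blast
    then have "Stab0 (tensor_act (P0, P1, P2) A) = i.rho3 ` torus"
      by (rule i.Stab0_diag[OF block_bounded_act[OF A P] dt])
    from conj[OF i _ P this] show ?thesis using diag(1) by simp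
  next
    case nondiag
    show ?thesis
    proof (cases "\<forall>N0 N1 N2. nilp ((*v) N0) \<longrightarrow> nilp ((*v) N1) \<longrightarrow> nilp ((*v) N2) \<longrightarrow> lie_act (N0, N1, N2) A = 0 \<longrightarrow>
      N0 = 0 \<and> N1 = 0 \<and> N2 = 0")
      case True
      have "Stab0 A = {tone}" by (rule b.Stab0_trivial[OF A nondiag(2)]) (use True in blast)+
      then have "Stab0 (tensor_act tone A) = b.rho3 ` {mat 1}" by (simp add: tensor_act_one b.rho3_one)
      from conj[OF j _ inv1 inv1 inv1 this] show ?thesis using nondiag(1) by simp
    next
      case False
      then obtain N0 N1 N2 where N: "nilp ((*v) N0)" "nilp ((*v) N1)" "nilp ((*v) N2)" "lie_act (N0, N1, N2) A = 0"
        "N0 \<noteq> 0 \<or> N1 \<noteq> 0 \<or> N2 \<noteq> 0" by blast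
      have reg: "regular_nilp N0" "regular_nilp N1" "regular_nilp N2"
        using lie_act_regular[OF b.cards A N(4,2,3,5)] by blast+
      have nf: "\<exists>R. invertible R \<and> jmat \<iota> ** R = R ** N" if N: "bij_betw \<iota> (UNIV :: 'x set) {..k}" "regular_nilp N"
        for N :: "complex^'x::finite^'x" and \<iota> k
      proof -
        obtain Q where Q: "invertible Q" "N ** Q = Q ** jmat \<iota>" using regular_normal_form[OF N] by blast
        obtain R where R: "Q ** R = mat 1" "R ** Q = mat 1" "invertible R" using invertibleE[OF Q(1)] by blast
        have "jmat \<iota> ** R = R ** (Q ** jmat \<iota>) ** R" by (simp add: R matrix_mul_assoc)
        also have "\<dots> = R ** N" unfolding Q(2)[symmetric] by (simp add: R flip: matrix_mul_assoc)
        finally show ?thesis using R(3) by blast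
      qed
      obtain R0 R1 R2 where R: "invertible R0" "invertible R1" "invertible R2" "b.E0 ** R0 = R0 ** N0"
        "b.E1 ** R1 = R1 ** N1" "b.E2 ** R2 = R2 ** N2"
        using nf[OF b.bij0 reg(1)] nf[OF b.bij1 reg(2)] nf[OF b.bij2 reg(3)] by blast
      let ?B = "tensor_act (R0, R1, R2) A"
      have "lie_act (b.E0, b.E1, b.E2) ?B = tensor_act (R0, R1, R2) 0" using lie_act_conj[OF R(4-6), of A] by (simp add: N(4))
      also have "\<dots> = 0" by (rule tensor_eq_tri) (simp add: tri_tensor_act, simp add: tri_def contr_0)
      finally have "Stab0 ?B = b.rho3 ` upper"
        using b.Stab0_upper[OF block_bounded_act[OF A R(1-3)]] diagonalizable_act[OF _ R(1-3)] nondiag(2) by blast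
      from conj[OF j _ R(1-3) this] show ?thesis using nondiag(1) by simp
    qed
  qed
qed

section \<open>Regular functions on the image of the special linear group\<close>

lemma regular_on_intros:
  "(\<lambda>_. c) \<in> regular_on S L"
  "p \<in> regular_on S L \<Longrightarrow> q \<in> regular_on S L \<Longrightarrow> (\<lambda>x. p x + q x) \<in> regular_on S L"
  "p \<in> regular_on S L \<Longrightarrow> q \<in> regular_on S L \<Longrightarrow> (\<lambda>x. p x * q x) \<in> regular_on S L"
  "l \<in> L \<Longrightarrow> l \<in> regular_on S L"
proof -
  show "(\<lambda>_. c) \<in> regular_on S L" unfolding regular_on_def
    by (intro CollectI bexI[of _ "\<lambda>_. c"] ballI refl generated_algebra.const)
  show "l \<in> regular_on S L" if "l \<in> L" unfolding regular_on_def using generated_algebra.gen[OF that] by auto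
  show "(\<lambda>x. p x + q x) \<in> regular_on S L" if pq: "p \<in> regular_on S L" "q \<in> regular_on S L"
  proof -
    obtain p' q' where "p' \<in> generated_algebra L" "q' \<in> generated_algebra L" "\<forall>x\<in>S. p x = p' x" "\<forall>x\<in>S. q x = q' x"
      using pq unfolding regular_on_def by blast
    then show ?thesis unfolding regular_on_def by (auto intro!: bexI[OF _ generated_algebra.add[of p' L q']])
  qed
  show "(\<lambda>x. p x * q x) \<in> regular_on S L" if pq: "p \<in> regular_on S L" "q \<in> regular_on S L"
  proof -
    obtain p' q' where "p' \<in> generated_algebra L" "q' \<in> generated_algebra L" "\<forall>x\<in>S. p x = p' x" "\<forall>x\<in>S. q x = q' x"
      using pq unfolding regular_on_def by blast
    then show ?thesis unfolding regular_on_def by (auto intro!: bexI[OF _ generated_algebra.mult[of p' L q']])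
  qed
qed

lemma regular_on_cong: "p \<in> regular_on S L \<Longrightarrow> (\<And>x. x \<in> S \<Longrightarrow> q x = p x) \<Longrightarrow> q \<in> regular_on S L"
  unfolding regular_on_def by auto

lemma regular_on_sum:
  "finite I \<Longrightarrow> (\<And>i. i \<in> I \<Longrightarrow> f i \<in> regular_on S L) \<Longrightarrow> (\<lambda>x. \<Sum>i\<in>I. f i x) \<in> regular_on S L"
  by (induction I rule: finite_induct) (auto intro: regular_on_intros)

lemma regular_on_power: "p \<in> regular_on S L \<Longrightarrow> (\<lambda>x. p x ^ n) \<in> regular_on S L"
  by (induction n) (auto intro: regular_on_intros)

lemma regular_on_uminus: "p \<in> regular_on S L \<Longrightarrow> (\<lambda>x. - p x) \<in> regular_on S L"
  using regular_on_intros(3)[OF regular_on_intros(1)[of "- 1"]] by fastforce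

lemma regular_on_poly: "t \<in> regular_on S L \<Longrightarrow> (\<lambda>x. poly f (t x)) \<in> regular_on S L"
  by (induction f) (auto intro: regular_on_intros)

text \<open>The polynomials \<open>f\<close> and \<open>t ^ n\<close> are coprime, so
  \<open>x\<close> is a combination of the two given multiples. The exponent is lowered one at a
  time by solving for the constant term of \<open>f\<close>.\<close>

lemma regular_on_coprime:
  assumes t: "t \<in> regular_on S L" and f: "(\<lambda>g. x g * poly f (t g)) \<in> regular_on S L" "poly f 0 \<noteq> 0"
    and n: "(\<lambda>g. x g * t g ^ n) \<in> regular_on S L"
  shows "x \<in> regular_on S L"
  using n
proof (induction n)
  case 0
  then show ?case by simp
next
  case (Suc n)
  obtain c h where h: "f = pCons c h" by (cases f)
  then have c: "c \<noteq> 0" using f(2) by simp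
  have "(\<lambda>g. inverse c * (x g * poly f (t g) * t g ^ n + - (x g * t g ^ Suc n * poly h (t g)))) \<in> regular_on S L"
    by (intro regular_on_intros(1-3) regular_on_uminus regular_on_power regular_on_poly f(1) t Suc.prems)
  moreover have "inverse c * (x g * poly f (t g) * t g ^ n + - (x g * t g ^ Suc n * poly h (t g))) = x g * t g ^ n" for g
    using c by (simp add: h field_simps)
  ultimately have "(\<lambda>g. x g * t g ^ n) \<in> regular_on S L" by simp
  then show ?case by (rule Suc.IH)
qed

lemma SL_det2: "g \<in> SL \<longleftrightarrow> g $ 1 $ 1 * g $ 2 $ 2 - g $ 1 $ 2 * g $ 2 $ 1 = 1" for g :: "complex^2^2"
  by (subst mk_eq[of g]) (simp only: mk_in_SL)

context index
begin

text \<open>The functions on \<open>SL\<close> that are polynomial in the entries of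
  \<open>rho\<close>. An isomorphism of algebraic groups requires that the coordinates of
  \<open>g\<close> be recovered in this way; the aim is that \<open>R\<close> contains all even
  functions, and all regular functions if \<open>k\<close> is odd.\<close>

abbreviation "R \<equiv> regular_on (SL :: (complex^2^2) set) {\<lambda>g. rho \<iota> k g $ i $ j | i j. True}"

lemma R_entry: "(\<lambda>g. rho \<iota> k g $ i $ j) \<in> R"
  by (rule regular_on_intros) blast

text \<open>With the Weyl element as \<open>h\<close>, invariance under translations lets one matrix
  entry stand for all four.\<close>

lemma R_translate:
  assumes q: "q \<in> R" and h: "h \<in> SL"
  shows "(\<lambda>g. q (h ** g)) \<in> R" "(\<lambda>g. q (g ** h)) \<in> R"
proof -
  obtain p where p: "p \<in> generated_algebra {\<lambda>g. rho \<iota> k g $ i $ j | i j. True}" "\<And>g. g \<in> SL \<Longrightarrow> q g = p g"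
    using q unfolding regular_on_def by blast
  have "(\<lambda>g. p (h ** g)) \<in> R \<and> (\<lambda>g. p (g ** h)) \<in> R"
    using p(1)
  proof (induction rule: generated_algebra.induct)
    case (gen l)
    then obtain i j where l: "l = (\<lambda>g. rho \<iota> k g $ i $ j)" by blast
    have "(\<lambda>g. l (h ** g)) = (\<lambda>g. \<Sum>m\<in>UNIV. rho \<iota> k h $ i $ m * rho \<iota> k g $ m $ j)"
      "(\<lambda>g. l (g ** h)) = (\<lambda>g. \<Sum>m\<in>UNIV. rho \<iota> k g $ i $ m * rho \<iota> k h $ m $ j)"
      unfolding l rho_mult by (simp_all add: matrix_matrix_mult_def)
    moreover have "(\<lambda>g. \<Sum>m\<in>UNIV. rho \<iota> k h $ i $ m * rho \<iota> k g $ m $ j) \<in> R"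
      "(\<lambda>g. \<Sum>m\<in>UNIV. rho \<iota> k g $ i $ m * rho \<iota> k h $ m $ j) \<in> R"
      by (rule regular_on_sum, simp, intro regular_on_intros(1,3) R_entry)+
    ultimately show ?case by simp
  next
    case (const c)
    show ?case by (intro conjI regular_on_intros(1))
  next
    case (add p q)
    then show ?case by (intro conjI regular_on_intros(2)) simp_all
  next
    case (mult p q)
    then show ?case by (intro conjI regular_on_intros(3)) simp_all
  qed
  then have "(\<lambda>g. p (h ** g)) \<in> R" "(\<lambda>g. p (g ** h)) \<in> R" by blast+
  then show "(\<lambda>g. q (h ** g)) \<in> R" "(\<lambda>g. q (g ** h)) \<in> R"
    using p(2)[OF SL_group(1)[OF h]] p(2)[OF SL_group(1)[OF _ h]] by (auto elim: regular_on_cong)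
qed

text \<open>The extreme columns of \<open>rho\<close> list the coefficients of powers of a single
  linear form, so only binomial coefficients must be divided out.\<close>

lemma R_column0: "m \<le> k \<Longrightarrow> (\<lambda>g. g $ 1 $ 1 ^ (k - m) * g $ 2 $ 1 ^ m) \<in> R"
  and R_columnk: "m \<le> k \<Longrightarrow> (\<lambda>g. g $ 1 $ 2 ^ (k - m) * g $ 2 $ 2 ^ m) \<in> R"
proof -
  assume m: "m \<le> k"
  obtain i e0 ek where i: "\<iota> i = m" "\<iota> e0 = 0" "\<iota> ek = k" using index_surj[of m] index_surj[of 0] index_surj[of k] m by auto
  have c: "of_nat (k choose m) \<noteq> (0::complex)" using m by simp
  have *: "rho \<iota> k g $ i $ e0 = of_nat (k choose m) * (g $ 1 $ 1 ^ (k - m) * g $ 2 $ 1 ^ m)"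
    "rho \<iota> k g $ i $ ek = of_nat (k choose m) * (g $ 1 $ 2 ^ (k - m) * g $ 2 $ 2 ^ m)" for g
    by (simp_all add: rho_def i coeff_linear_poly_power[OF m] mult_ac)
  have "(\<lambda>g. inverse (of_nat (k choose m)) * rho \<iota> k g $ i $ e0) \<in> R" "(\<lambda>g. inverse (of_nat (k choose m)) * rho \<iota> k g $ i $ ek) \<in> R"
    by (intro regular_on_intros(1,3) R_entry)+
  then show "(\<lambda>g. g $ 1 $ 1 ^ (k - m) * g $ 2 $ 1 ^ m) \<in> R" "(\<lambda>g. g $ 1 $ 2 ^ (k - m) * g $ 2 $ 2 ^ m) \<in> R"
    unfolding * using c by (simp_all add: mult.assoc[symmetric] del: binomial_eq_0_iff)
qed

text \<open>The extreme rows consist of constant and leading coefficients of products, hence of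
  plain products without binomial factors.\<close>

lemma R_row0: "m \<le> k \<Longrightarrow> (\<lambda>g. g $ 1 $ 1 ^ (k - m) * g $ 1 $ 2 ^ m) \<in> R"
  and R_rowk: "m \<le> k \<Longrightarrow> (\<lambda>g. g $ 2 $ 1 ^ (k - m) * g $ 2 $ 2 ^ m) \<in> R"
proof -
  assume m: "m \<le> k"
  obtain i e0 ek where i: "\<iota> i = m" "\<iota> e0 = 0" "\<iota> ek = k" using index_surj[of m] index_surj[of 0] index_surj[of k] m by auto
  have 0: "coeff ([:a, b:] ^ p * [:c, d:] ^ q) 0 = a ^ p * c ^ q" for a b c d :: complex and p q
    by (simp add: coeff_mult coeff_linear_poly_power)
  have top: "coeff ([:a, b:] ^ p * [:c, d:] ^ q) (p + q) = b ^ p * d ^ q" for a b c d :: complex and p q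
  proof -
    have l: "degree ([:a, b:] ^ p) \<le> p" for a b :: complex and p
      using degree_power_le[of "[:a, b:]" p] by (rule order.trans) (cases "b = 0"; simp)
    have "coeff ([:a, b:] ^ p * [:c, d:] ^ q) (p + q) = (\<Sum>i\<le>p + q. if i = p then b ^ p * d ^ q else 0)"
      unfolding coeff_mult
    proof (intro sum.cong refl)
      fix i assume "i \<in> {..p + q}"
      consider "i < p" | "i = p" | "i > p" by linarith
      then show "coeff ([:a, b:] ^ p) i * coeff ([:c, d:] ^ q) (p + q - i) = (if i = p then b ^ p * d ^ q else 0)"
      proof cases
        case 1
        then show ?thesis using l[of c d q] by (simp add: coeff_eq_0)
      next
        case 2
        then show ?thesis by (simp add: coeff_linear_poly_power)
      next
        case 3
        then show ?thesis using l[of a b p] by (simp add: coeff_eq_0)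
      qed
    qed
    then show ?thesis by simp
  qed
  have "rho \<iota> k g $ e0 $ i = g $ 1 $ 1 ^ (k - m) * g $ 1 $ 2 ^ m" for g by (simp add: rho_def i 0)
  then show "(\<lambda>g. g $ 1 $ 1 ^ (k - m) * g $ 1 $ 2 ^ m) \<in> R" using R_entry[of e0 i] by simp
  have "rho \<iota> k g $ ek $ i = g $ 2 $ 1 ^ (k - m) * g $ 2 $ 2 ^ m" for g
    using top[of "g $ 1 $ 1" "g $ 2 $ 1" "k - m" "g $ 1 $ 2" "g $ 2 $ 2" m] m by (simp add: rho_def i)
  then show "(\<lambda>g. g $ 2 $ 1 ^ (k - m) * g $ 2 $ 2 ^ m) \<in> R" using R_entry[of ek i] by simp
qed

text \<open>Multiply by \<open>(ad - bc)\<^bsup>k - 1\<^esup>\<close> and expand.\<close>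

lemma R_expand:
  assumes k: "k \<ge> 1" and xy: "\<And>m. m \<le> k - 1 \<Longrightarrow>
      (\<lambda>g. (g $ 1 $ 2 * g $ 2 $ 1) ^ m * (g $ 1 $ 1 * g $ 2 $ 2) ^ (k - 1 - m) * x g) \<in> R"
  shows "x \<in> R"
proof -
  have "(\<lambda>g. \<Sum>m\<le>k - 1. of_nat ((k - 1) choose m) * (- 1) ^ m *
      ((g $ 1 $ 2 * g $ 2 $ 1) ^ m * (g $ 1 $ 1 * g $ 2 $ 2) ^ (k - 1 - m) * x g)) \<in> R"
    by (rule regular_on_sum, simp, rule regular_on_intros(3)[OF regular_on_intros(1)], rule xy, simp)
  then show ?thesis
  proof (rule regular_on_cong)
    fix g :: "complex^2^2" assume g: "g \<in> SL"
    have "(- (g $ 1 $ 2 * g $ 2 $ 1)) + g $ 1 $ 1 * g $ 2 $ 2 = 1" using g by (simp add: SL_det2)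
    then have "1 = (- (g $ 1 $ 2 * g $ 2 $ 1) + g $ 1 $ 1 * g $ 2 $ 2) ^ (k - 1)" by (simp only: power_one)
    then have "1 = (\<Sum>m\<le>k - 1. of_nat ((k - 1) choose m) * (- (g $ 1 $ 2 * g $ 2 $ 1)) ^ m * (g $ 1 $ 1 * g $ 2 $ 2) ^ (k - 1 - m))"
      using binomial_ring[of "- (g $ 1 $ 2 * g $ 2 $ 1)" "g $ 1 $ 1 * g $ 2 $ 2" "k - 1"] by (rule trans)
    then have "x g = (\<Sum>m\<le>k - 1. of_nat ((k - 1) choose m) * (- (g $ 1 $ 2 * g $ 2 $ 1)) ^ m * (g $ 1 $ 1 * g $ 2 $ 2) ^ (k - 1 - m)) * x g"
      by simp
    also have "\<dots> = (\<Sum>m\<le>k - 1. of_nat ((k - 1) choose m) * (- 1) ^ m *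
      ((g $ 1 $ 2 * g $ 2 $ 1) ^ m * (g $ 1 $ 1 * g $ 2 $ 2) ^ (k - 1 - m) * x g))"
      unfolding sum_distrib_right
      by (intro sum.cong refl) (simp add: power_minus[of "g $ 1 $ 2 * g $ 2 $ 1"] mult.assoc)
    finally show "x g = (\<Sum>m\<le>k - 1. of_nat ((k - 1) choose m) * (- 1) ^ m *
      ((g $ 1 $ 2 * g $ 2 $ 1) ^ m * (g $ 1 $ 1 * g $ 2 $ 2) ^ (k - 1 - m) * x g))" .
  qed
qed

text \<open>After the expansion of \<open>R_expand\<close>, each term is the product of one entry
  from each extreme column, or from each extreme row, up to constants.\<close>

lemma R_mixed:
  assumes k: "k \<ge> 1"
  shows "(\<lambda>g. g $ 1 $ 1 * g $ 1 $ 2) \<in> R" "(\<lambda>g. g $ 1 $ 1 * g $ 2 $ 1) \<in> R" "(\<lambda>g. g $ 1 $ 1 * g $ 2 $ 2) \<in> R"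
proof -
  have q: "m \<le> k" "k - 1 - m \<le> k" "Suc (k - 1 - m) \<le> k" "k - m = Suc (k - 1 - m)" "k - (k - 1 - m) = Suc m" "k - Suc (k - 1 - m) = m"
    if "m \<le> k - 1" for m using that k by auto
  show "(\<lambda>g. g $ 1 $ 1 * g $ 1 $ 2) \<in> R"
  proof (rule R_expand[OF k])
    fix m assume m: "m \<le> k - 1"
    define p where "p = k - 1 - m"
    note q = q[OF m, folded p_def]
    from regular_on_intros(3)[OF R_column0[OF q(1)] R_columnk[OF q(2)]]
    show "(\<lambda>g. (g $ 1 $ 2 * g $ 2 $ 1) ^ m * (g $ 1 $ 1 * g $ 2 $ 2) ^ (k - 1 - m) * (g $ 1 $ 1 * g $ 1 $ 2)) \<in> R"
      by (simp only: p_def[symmetric] q(4-6) power_Suc power_mult_distrib mult_ac)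
  qed
  show "(\<lambda>g. g $ 1 $ 1 * g $ 2 $ 1) \<in> R"
  proof (rule R_expand[OF k])
    fix m assume m: "m \<le> k - 1"
    define p where "p = k - 1 - m"
    note q = q[OF m, folded p_def]
    from regular_on_intros(3)[OF R_row0[OF q(1)] R_rowk[OF q(2)]]
    show "(\<lambda>g. (g $ 1 $ 2 * g $ 2 $ 1) ^ m * (g $ 1 $ 1 * g $ 2 $ 2) ^ (k - 1 - m) * (g $ 1 $ 1 * g $ 2 $ 1)) \<in> R"
      by (simp only: p_def[symmetric] q(4-6) power_Suc power_mult_distrib mult_ac)
  qed
  show "(\<lambda>g. g $ 1 $ 1 * g $ 2 $ 2) \<in> R"
  proof (rule R_expand[OF k])
    fix m assume m: "m \<le> k - 1"
    define p where "p = k - 1 - m"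
    note q = q[OF m, folded p_def]
    from regular_on_intros(3)[OF R_column0[OF q(1)] R_columnk[OF q(3)]]
    show "(\<lambda>g. (g $ 1 $ 2 * g $ 2 $ 1) ^ m * (g $ 1 $ 1 * g $ 2 $ 2) ^ (k - 1 - m) * (g $ 1 $ 1 * g $ 2 $ 2)) \<in> R"
      by (simp only: p_def[symmetric] q(4-6) power_Suc power_mult_distrib mult_ac)
  qed
qed

lemma R_bc: "k \<ge> 1 \<Longrightarrow> (\<lambda>g. g $ 1 $ 2 * g $ 2 $ 1) \<in> R"
  using regular_on_intros(2)[OF R_mixed(3) regular_on_intros(1)[of "- 1"]]
  by (rule regular_on_cong) (auto simp: SL_det2 algebra_simps)

text \<open>This is the diagonal entry at index \<open>n\<close>. With \<open>ad = 1 + bc\<close> it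
  becomes a power of \<open>a\<close> times a polynomial in \<open>bc\<close>, whose constant term
  comes from \<open>s = 0\<close> alone and equals one.\<close>

lemma R_middle:
  assumes "2 * n + e = k"
  shows "\<exists>f. poly f 0 \<noteq> 0 \<and> (\<lambda>g. g $ 1 $ 1 ^ e * poly f (g $ 1 $ 2 * g $ 2 $ 1)) \<in> R"
proof -
  obtain i where i: "\<iota> i = n" using index_surj[of n] assms by auto
  define f :: "complex poly" where
    "f = (\<Sum>s\<le>n. [:of_nat ((n + e) choose s) * of_nat (n choose (n - s)):] * ([:1, 1:] ^ (n - s) * [:0, 1:] ^ s))"
  have "poly f 0 = (\<Sum>s\<le>n. if s = 0 then 1 else 0)"
    unfolding f_def poly_sum by (intro sum.cong) (auto simp: power_0_left)
  then have "poly f 0 \<noteq> 0" by simp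
  moreover have "(\<lambda>g. g $ 1 $ 1 ^ e * poly f (g $ 1 $ 2 * g $ 2 $ 1)) \<in> R"
    using R_entry[of i i]
  proof (rule regular_on_cong)
    fix g :: "complex^2^2" assume g: "g \<in> SL"
    define a b c d where "a = g $ 1 $ 1" and "b = g $ 1 $ 2" and "c = g $ 2 $ 1" and "d = g $ 2 $ 2"
    have ad: "1 + b * c = a * d" using g by (simp add: SL_det2 a_def b_def c_def d_def algebra_simps)
    have "k - n = n + e" using assms by simp
    then have "rho \<iota> k g $ i $ i = (\<Sum>s\<le>n. coeff ([:a, c:] ^ (n + e)) s * coeff ([:b, d:] ^ n) (n - s))"
      by (simp add: rho_def i coeff_mult a_def b_def c_def d_def)
    also have "\<dots> = (\<Sum>s\<le>n. a ^ e * (of_nat ((n + e) choose s) * of_nat (n choose (n - s)) * ((a * d) ^ (n - s) * (b * c) ^ s)))"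
    proof (intro sum.cong refl)
      fix s assume "s \<in> {..n}"
      then have s: "n + e - s = e + (n - s)" "n - (n - s) = s" "s \<le> n + e" by auto
      show "coeff ([:a, c:] ^ (n + e)) s * coeff ([:b, d:] ^ n) (n - s) =
        a ^ e * (of_nat ((n + e) choose s) * of_nat (n choose (n - s)) * ((a * d) ^ (n - s) * (b * c) ^ s))"
        unfolding coeff_linear_poly_power[OF s(3)] coeff_linear_poly_power[OF diff_le_self] s(1,2) power_add[of a e "n - s"] power_mult_distrib
        by (simp add: mult_ac)
    qed
    also have "\<dots> = a ^ e * poly f (b * c)"
      by (simp add: f_def poly_sum sum_distrib_left mult.assoc flip: ad)
    finally show "g $ 1 $ 1 ^ e * poly f (g $ 1 $ 2 * g $ 2 $ 1) = rho \<iota> k g $ i $ i"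
      by (simp add: a_def b_def c_def)
  qed
  ultimately show ?thesis by blast
qed

text \<open>For even \<open>k\<close> the exponent \<open>e = 2\<close> is available in
  \<open>R_middle\<close>, for odd \<open>k\<close> the case \<open>e = 1\<close> is squared. The
  factor \<open>f\<close> is removed by coprimality, since \<open>a a b c\<close> is the product of
  \<open>a b\<close> and \<open>a c\<close>.\<close>

lemma R_square:
  assumes k: "k \<ge> 1"
  shows "(\<lambda>g. g $ 1 $ 1 * g $ 1 $ 1) \<in> R"
proof -
  have "\<exists>f. poly f 0 \<noteq> 0 \<and> (\<lambda>g. (g $ 1 $ 1 * g $ 1 $ 1) * poly f (g $ 1 $ 2 * g $ 2 $ 1)) \<in> R"
  proof (cases "even k")
    case True
    then obtain n where "k = 2 * n" by (rule evenE)
    then have "2 * (n - 1) + 2 = k" using k by simp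
    from R_middle[OF this] show ?thesis by (simp add: power2_eq_square)
  next
    case False
    then obtain n where "2 * n + 1 = k" by (auto elim: oddE)
    from R_middle[OF this] obtain f where f: "poly f 0 \<noteq> 0" "(\<lambda>g. g $ 1 $ 1 * poly f (g $ 1 $ 2 * g $ 2 $ 1)) \<in> R"
      by auto
    from regular_on_intros(3)[OF f(2) f(2)]
    have "(\<lambda>g. (g $ 1 $ 1 * g $ 1 $ 1) * poly (f * f) (g $ 1 $ 2 * g $ 2 $ 1)) \<in> R" by (simp add: mult_ac)
    then show ?thesis using f(1) by (intro exI[of _ "f * f"]) simp
  qed
  then obtain f where f: "poly f 0 \<noteq> 0" "(\<lambda>g. (g $ 1 $ 1 * g $ 1 $ 1) * poly f (g $ 1 $ 2 * g $ 2 $ 1)) \<in> R" by blast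
  show ?thesis
    by (rule regular_on_coprime[OF R_bc[OF k] f(2,1), of 1])
      (use regular_on_intros(3)[OF R_mixed(1,2)[OF k]] in \<open>simp add: mult_ac\<close>)
qed

abbreviation "weyl \<equiv> mk 0 1 (- 1) 0"

lemma weyl: "weyl \<in> SL" "(weyl ** g) $ 1 $ j = g $ 2 $ j" "(weyl ** g) $ 2 $ j = - g $ 1 $ j"
  "(g ** weyl) $ j $ 1 = - g $ j $ 2" "(g ** weyl) $ j $ 2 = g $ j $ 1"
  by (simp_all add: mk_in_SL matrix_matrix_mult_def sum_2)

lemma R_quadratic:
  assumes k: "k \<ge> 1"
  shows "(\<lambda>g. g $ i $ j * g $ i' $ j') \<in> R"
proof -
  have 1: "(\<lambda>g. g $ 1 $ 1 * g $ x $ y) \<in> R" for x y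
    using exhaust_2[of x] exhaust_2[of y] R_square[OF k] R_mixed[OF k] by auto
  have 2: "(\<lambda>g. g $ 2 $ 1 * g $ x $ y) \<in> R" for x y
  proof -
    have "(\<lambda>g. g $ 2 $ 1 * - g $ 1 $ y) \<in> R" "(\<lambda>g. g $ 2 $ 1 * g $ 2 $ y) \<in> R"
      using R_translate(1)[OF 1[of 2 y] weyl(1)] R_translate(1)[OF 1[of 1 y] weyl(1)] by (simp_all add: weyl)
    then show ?thesis using exhaust_2[of x] regular_on_uminus[of "\<lambda>g. g $ 2 $ 1 * - g $ 1 $ y"] by auto
  qed
  have 3: "(\<lambda>g. g $ i $ 1 * g $ x $ y) \<in> R" for i x y using exhaust_2[of i] 1 2 by auto
  have 4: "(\<lambda>g. g $ i $ 2 * g $ x $ y) \<in> R" for i x y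
  proof -
    have a: "(\<lambda>g. - g $ i $ 2 * - g $ x $ 2) \<in> R" "(\<lambda>g. - g $ i $ 2 * g $ x $ 1) \<in> R"
      using R_translate(2)[OF 3[of i x 1] weyl(1)] R_translate(2)[OF 3[of i x 2] weyl(1)] by (simp_all add: weyl)
    then show ?thesis using exhaust_2[of y] regular_on_uminus[OF a(2)] by auto
  qed
  show ?thesis using exhaust_2[of j] 3 4 by auto
qed

text \<open>Besides \<open>a f(bc)\<close>, the algebra contains \<open>a (bc)^(2 n)\<close>: the
  factor \<open>a c^(2 n)\<close> is an entry of the first column up to a constant, and
  \<open>b^(2 n)\<close> is a power of a quadratic monomial. Coprimality then isolates
  \<open>a\<close>.\<close>

lemma R_linear:
  assumes "odd k"
  shows "(\<lambda>g. g $ i $ j) \<in> R"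
proof -
  obtain n where n: "k = 2 * n + 1" using assms by (rule oddE)
  then have k: "k \<ge> 1" by simp
  obtain f where f: "poly f 0 \<noteq> 0" "(\<lambda>g. g $ 1 $ 1 * poly f (g $ 1 $ 2 * g $ 2 $ 1)) \<in> R"
    using R_middle[of n 1] n by auto
  have 1: "(\<lambda>g. g $ 1 $ 1) \<in> R"
  proof (rule regular_on_coprime[OF R_bc[OF k] f(2,1)])
    have "(\<lambda>g. (g $ 1 $ 1 ^ (k - 2 * n) * g $ 2 $ 1 ^ (2 * n)) * (g $ 1 $ 2 * g $ 1 $ 2) ^ n) \<in> R"
      by (intro regular_on_intros(3) R_column0 regular_on_power R_quadratic k) (simp add: n)
    then show "(\<lambda>g. g $ 1 $ 1 * (g $ 1 $ 2 * g $ 2 $ 1) ^ (2 * n)) \<in> R"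
      by (rule regular_on_cong) (simp add: n power_mult_distrib mult_2 mult_2_right power_add mult_ac)
  qed
  have 2: "(\<lambda>g. g $ 2 $ 1) \<in> R" using R_translate(1)[OF 1 weyl(1)] by (simp add: weyl)
  have 3: "(\<lambda>g. g $ i $ 1) \<in> R" for i using exhaust_2[of i] 1 2 by auto
  have "(\<lambda>g. - g $ i $ 2) \<in> R" for i using R_translate(2)[OF 3[of i] weyl(1)] by (simp add: weyl)
  then have "(\<lambda>g. g $ i $ 2) \<in> R" for i using regular_on_uminus[of "\<lambda>g. - g $ i $ 2"] by auto
  then show ?thesis using exhaust_2[of j] 3 by auto
qed

text \<open>The induction over products needs the odd parts as well, which lie in \<open>R\<close>
  only after multiplication by an entry. For odd parts \<open>P\<close> and \<open>Q\<close>, the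
  relation \<open>ad - bc = 1\<close> recovers the product as
  \<open>P Q = (a P) (d Q) - (b P) (c Q)\<close>.\<close>

lemma R_even_odd_parts:
  assumes k: "k \<ge> 1" and f: "f \<in> generated_algebra {\<lambda>g. g $ i $ j | i j. True}"
  shows "(\<lambda>g. f g + f (- g)) \<in> R \<and> (\<forall>i j. (\<lambda>g. g $ i $ j * (f g - f (- g))) \<in> R)"
  using f
proof (induction rule: generated_algebra.induct)
  case (const c)
  then show ?case using regular_on_intros(1) by auto
next
  case (gen l)
  then obtain i j where l: "l = (\<lambda>g. g $ i $ j)" by blast
  have "(\<lambda>g. 2 * (g $ x $ y * g $ i $ j)) \<in> R" for x y
    by (intro regular_on_intros(1,3) R_quadratic k)
  then show ?case using regular_on_intros(1)[of 0] by (simp add: l algebra_simps)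
next
  case (add p q)
  have "(\<lambda>g. (p g + p (- g)) + (q g + q (- g))) \<in> R"
    by (intro regular_on_intros(2) add.IH[THEN conjunct1])
  moreover have "(\<lambda>g. g $ i $ j * (p g - p (- g)) + g $ i $ j * (q g - q (- g))) \<in> R" for i j
    by (intro regular_on_intros(2) add.IH(1)[THEN conjunct2, rule_format] add.IH(2)[THEN conjunct2, rule_format])
  ultimately show ?case by (simp add: algebra_simps)
next
  case (mult p q)
  note e = mult.IH[THEN conjunct1] and o1 = mult.IH(1)[THEN conjunct2, rule_format] and o2 = mult.IH(2)[THEN conjunct2, rule_format]
  let ?oo = "\<lambda>g. g $ 1 $ 1 * (p g - p (- g)) * (g $ 2 $ 2 * (q g - q (- g))) + - (g $ 1 $ 2 * (p g - p (- g)) * (g $ 2 $ 1 * (q g - q (- g))))"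
  have "?oo \<in> R" by (intro regular_on_intros(2,3) regular_on_uminus o1 o2)
  then have oo: "(\<lambda>g. (p g - p (- g)) * (q g - q (- g))) \<in> R"
  proof (rule regular_on_cong)
    fix g :: "complex^2^2" assume "g \<in> SL"
    then have 1: "g $ 1 $ 1 * g $ 2 $ 2 - g $ 1 $ 2 * g $ 2 $ 1 = 1" by (simp add: SL_det2)
    have *: "a * P * (d * Q) + - (b * P * (c * Q)) = (a * d - b * c) * (P * Q)" for a b c d P Q :: complex
      by (simp add: algebra_simps)
    have "?oo g = (g $ 1 $ 1 * g $ 2 $ 2 - g $ 1 $ 2 * g $ 2 $ 1) * ((p g - p (- g)) * (q g - q (- g)))"
      by (rule *)
    then show "(p g - p (- g)) * (q g - q (- g)) = ?oo g" unfolding 1 by simp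
  qed
  have "(\<lambda>g. 1 / 2 * ((p g + p (- g)) * (q g + q (- g)) + (p g - p (- g)) * (q g - q (- g)))) \<in> R"
    by (intro regular_on_intros(1-3) e oo)
  then have "(\<lambda>g. p g * q g + p (- g) * q (- g)) \<in> R"
    by (rule regular_on_cong) (simp add: field_simps)
  moreover have "(\<lambda>g. g $ i $ j * (p g * q g - p (- g) * q (- g))) \<in> R" for i j
  proof -
    have "(\<lambda>g. 1 / 2 * ((p g + p (- g)) * (g $ i $ j * (q g - q (- g))) + g $ i $ j * (p g - p (- g)) * (q g + q (- g)))) \<in> R"
      by (intro regular_on_intros(1-3) e o1 o2)
    then show ?thesis by (rule regular_on_cong) (simp add: field_simps)
  qed
  ultimately show ?case by blast
qed

lemma R_even:
  assumes k: "k \<ge> 1" and q: "q \<in> SL2_regular" and even: "\<And>g. g \<in> SL \<Longrightarrow> q (- g) = q g"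
  shows "q \<in> R"
proof -
  obtain f where f: "f \<in> generated_algebra {\<lambda>g. g $ i $ j | i j. True}" "\<And>g. g \<in> SL \<Longrightarrow> q g = f g"
    using q unfolding SL2_regular_def regular_on_def by blast
  have "(\<lambda>g. 1 / 2 * (f g + f (- g))) \<in> R"
    using R_even_odd_parts[OF k f(1)] by (intro regular_on_intros(1,3)) blast
  then show ?thesis
  proof (rule regular_on_cong)
    fix g :: "complex^2^2" assume g: "g \<in> SL"
    then have "- g \<in> SL" by (simp add: SL_det2)
    then have "f g = q g" "f (- g) = q g" using f(2)[OF g] f(2)[OF \<open>- g \<in> SL\<close>] even[OF g] by simp_all
    then show "q g = 1 / 2 * (f g + f (- g))" by simp
  qed
qed

lemma R_odd: "odd k \<Longrightarrow> q \<in> SL2_regular \<Longrightarrow> q \<in> R"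
proof -
  assume k: "odd k" and q: "q \<in> SL2_regular"
  obtain f where f: "f \<in> generated_algebra {\<lambda>g. g $ i $ j | i j. True}" "\<And>g. g \<in> SL \<Longrightarrow> q g = f g"
    using q unfolding SL2_regular_def regular_on_def by blast
  have "f \<in> R"
    using f(1)
  proof (induction rule: generated_algebra.induct)
    case (gen l)
    then obtain i j where l: "l = (\<lambda>g. g $ i $ j)" by blast
    show ?case unfolding l by (rule R_linear[OF k])
  qed (rule regular_on_intros; assumption?)+
  then show "q \<in> R" using f(2) by (rule regular_on_cong)
qed

end

section \<open>Isomorphisms of algebraic groups\<close>

lemma generated_algebra_lift:
  assumes "p \<in> generated_algebra L" and "\<And>l. l \<in> L \<Longrightarrow> \<exists>q\<in>generated_algebra L'. \<forall>x\<in>X. l x = q (\<Delta> x)"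
  shows "\<exists>q\<in>generated_algebra L'. \<forall>x\<in>X. p x = q (\<Delta> x)"
  using assms(1)
proof (induction rule: generated_algebra.induct)
  case (const c)
  show ?case by (rule bexI[of _ "\<lambda>_. c"]) (auto intro: generated_algebra.const)
next
  case (gen l)
  then show ?case by (rule assms(2))
next
  case (add p q)
  then obtain p' q' where pq: "p' \<in> generated_algebra L'" "q' \<in> generated_algebra L'"
    "\<forall>x\<in>X. p x = p' (\<Delta> x)" "\<forall>x\<in>X. q x = q' (\<Delta> x)" by blast
  show ?case by (rule bexI[OF _ generated_algebra.add[OF pq(1,2)]]) (use pq in simp)
next
  case (mult p q)
  then obtain p' q' where pq: "p' \<in> generated_algebra L'" "q' \<in> generated_algebra L'"
    "\<forall>x\<in>X. p x = p' (\<Delta> x)" "\<forall>x\<in>X. q x = q' (\<Delta> x)" by blast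
  show ?case by (rule bexI[OF _ generated_algebra.mult[OF pq(1,2)]]) (use pq in simp)
qed

lemma regular_on_lift:
  assumes "p \<in> regular_on X L" and "\<And>l. l \<in> L \<Longrightarrow> \<exists>q\<in>generated_algebra L'. \<forall>x\<in>X. l x = q (\<Delta> x)"
  shows "\<exists>q\<in>generated_algebra L'. \<forall>x\<in>X. p x = q (\<Delta> x)"
proof -
  obtain p' where p': "p' \<in> generated_algebra L" "\<forall>x\<in>X. p x = p' x" using assms(1) unfolding regular_on_def by blast
  then show ?thesis using generated_algebra_lift[OF p'(1) assms(2)] by auto
qed

lemma regular_on_comp:
  assumes "p \<in> generated_algebra L" and "\<And>l. l \<in> L \<Longrightarrow> (\<lambda>x. l (m x)) \<in> regular_on X L'"
  shows "(\<lambda>x. p (m x)) \<in> regular_on X L'"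
  using assms(1)
proof (induction rule: generated_algebra.induct)
  case (gen l)
  then show ?case by (rule assms(2))
qed (rule regular_on_intros; assumption)+

abbreviation triple_gens :: "(('n0::finite, 'n1::finite, 'n2::finite) triple \<Rightarrow> complex) set" where
  "triple_gens \<equiv> {\<lambda>(g0, g1, g2). g0 $ i $ j | i j. True} \<union> {\<lambda>(g0, g1, g2). g1 $ i $ j | i j. True} \<union>
     {\<lambda>(g0, g1, g2). g2 $ i $ j | i j. True}"

lemma triple_gens_iff: "l \<in> triple_gens \<longleftrightarrow> (\<exists>i j. l = (\<lambda>g. fst g $ i $ j)) \<or> (\<exists>i j. l = (\<lambda>g. fst (snd g) $ i $ j)) \<or>
    (\<exists>i j. l = (\<lambda>g. snd (snd g) $ i $ j))"
  unfolding Un_iff mem_Collect_eq case_prod_unfold by simp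

lemma triple_gens_algebra:
  "(\<lambda>g. fst g $ i $ j) \<in> generated_algebra triple_gens" "(\<lambda>g. fst (snd g) $ i' $ j') \<in> generated_algebra triple_gens"
  "(\<lambda>g. snd (snd g) $ i'' $ j'') \<in> generated_algebra triple_gens"
  by (rule generated_algebra.gen, unfold triple_gens_iff, blast)+

lemma tmul_sel: "fst (tmul g h) = fst g ** fst h" "fst (snd (tmul g h)) = fst (snd g) ** fst (snd h)"
  "snd (snd (tmul g h)) = snd (snd g) ** snd (snd h)"
  by (cases g; cases h; simp)+

lemma triple_gens_conj:
  assumes "p \<in> generated_algebra triple_gens"
  shows "(\<lambda>g. p (tmul Q (tmul g P))) \<in> generated_algebra triple_gens"
  using assms
proof (induction rule: generated_algebra.induct)
  case (gen l)
  then show ?case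
    unfolding triple_gens_iff
    by (elim disjE exE) (simp_all only: tmul_sel matrix_matrix_mult_def vec_lambda_beta,
        (intro generated_algebra_sum generated_algebra.mult generated_algebra.const triple_gens_algebra finite)+)
qed (rule generated_algebra.intros; assumption)+

lemma Stab0_group_mult: "mult (Stab0_group A) = tmul"
  by (intro ext) (auto simp: Stab0_group_def)

text \<open>The isomorphism is the inverse of the parametrization by \<open>\<Delta>\<close>
  followed by conjugation, which preserves polynomial functions of the entries. Regularity in one
  direction is \<open>ent\<close>, in the other \<open>rec\<close>. The class \<open>S\<close> is
  kept abstract because the regular functions on \<open>PSL2\<close> are defined by
  pullback.\<close>

lemma conj_alg_iso:
  fixes A :: "('n0::finite, 'n1::finite, 'n2::finite) tensor" and M :: "'m monoid"
  assumes PQ: "tmul P Q = tone" "tmul Q P = tone"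
    and G: "Stab0 A = (\<lambda>g. tmul Q (tmul g P)) ` \<Delta> ` carrier M"
    and hom: "\<And>x y. x \<in> carrier M \<Longrightarrow> y \<in> carrier M \<Longrightarrow> \<Delta> (x \<otimes>\<^bsub>M\<^esub> y) = tmul (\<Delta> x) (\<Delta> y)"
      "\<And>x y. x \<in> carrier M \<Longrightarrow> y \<in> carrier M \<Longrightarrow> x \<otimes>\<^bsub>M\<^esub> y \<in> carrier M"
    and S: "\<And>c. (\<lambda>_. c) \<in> S" "\<And>p q. p \<in> S \<Longrightarrow> q \<in> S \<Longrightarrow> (\<lambda>x. p x + q x) \<in> S" "\<And>p q. p \<in> S \<Longrightarrow> q \<in> S \<Longrightarrow> (\<lambda>x. p x * q x) \<in> S"
      "\<And>p q. p \<in> S \<Longrightarrow> (\<And>x. x \<in> carrier M \<Longrightarrow> q x = p x) \<Longrightarrow> q \<in> S"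
    and ent: "\<And>l. l \<in> triple_gens \<Longrightarrow> (\<lambda>x. l (\<Delta> x)) \<in> S"
    and rec: "\<And>q. q \<in> S \<Longrightarrow> \<exists>p\<in>generated_algebra triple_gens. \<forall>x\<in>carrier M. q x = p (\<Delta> x)"
    and sep: "\<And>x y. x \<in> carrier M \<Longrightarrow> y \<in> carrier M \<Longrightarrow> (\<And>q. q \<in> S \<Longrightarrow> q x = q y) \<Longrightarrow> x = y"
  shows "alg_group_iso (Stab0_group A) (Stab0_regular A) M S"
proof -
  define \<psi> where "\<psi> x = tmul Q (tmul (\<Delta> x) P)" for x
  have recover: "tmul P (tmul (\<psi> x) Q) = \<Delta> x" for x
    by (simp add: \<psi>_def tmul_assoc PQ) (simp flip: tmul_assoc add: PQ)
  have img: "Stab0 A = \<psi> ` carrier M" by (simp add: G \<psi>_def image_image)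
  have inj: "inj_on \<psi> (carrier M)"
  proof (rule inj_onI)
    fix x y assume xy: "x \<in> carrier M" "y \<in> carrier M" "\<psi> x = \<psi> y"
    then have "\<Delta> x = \<Delta> y" using recover by metis
    then show "x = y" using rec xy(1,2) by (intro sep) metis+
  qed
  define f where "f = inv_into (carrier M) \<psi>"
  have f: "f (\<psi> x) = x" if "x \<in> carrier M" for x using that inj by (simp add: f_def)
  have mult: "\<psi> (x \<otimes>\<^bsub>M\<^esub> y) = tmul (\<psi> x) (\<psi> y)" if "x \<in> carrier M" "y \<in> carrier M" for x y
  proof -
    have "tmul (\<psi> x) (\<psi> y) = tmul Q (tmul (\<Delta> x) (tmul (tmul P Q) (tmul (\<Delta> y) P)))" by (simp add: \<psi>_def tmul_assoc)
    then show ?thesis using that by (simp add: PQ \<psi>_def hom tmul_assoc)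
  qed
  have carrier: "carrier (Stab0_group A) = \<psi> ` carrier M" by (simp add: Stab0_group_def img)
  have "f \<in> iso (Stab0_group A) M"
    unfolding iso_def
  proof (intro CollectI conjI homI)
    show "bij_betw f (carrier (Stab0_group A)) (carrier M)"
      unfolding carrier f_def using inj by (intro bij_betw_inv_into) (simp add: bij_betw_def)
    show "f g \<in> carrier M" if g: "g \<in> carrier (Stab0_group A)" for g
    proof -
      obtain x where x: "x \<in> carrier M" "g = \<psi> x" using g unfolding carrier by blast
      then show ?thesis using f by simp
    qed
    show "f (g \<otimes>\<^bsub>Stab0_group A\<^esub> h) = f g \<otimes>\<^bsub>M\<^esub> f h" if gh: "g \<in> carrier (Stab0_group A)" "h \<in> carrier (Stab0_group A)" for g h
    proof -
      obtain x y where "x \<in> carrier M" "y \<in> carrier M" "g = \<psi> x" "h = \<psi> y" using gh unfolding carrier by blast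
      then show ?thesis by (simp add: Stab0_group_mult f hom(2) flip: mult)
    qed
  qed
  moreover have "q \<in> S \<longleftrightarrow> q \<circ> f \<in> Stab0_regular A" for q
  proof
    assume "q \<in> S"
    then obtain p where p: "p \<in> generated_algebra triple_gens" "\<forall>x\<in>carrier M. q x = p (\<Delta> x)" using rec by blast
    have "(q \<circ> f) g = p (tmul P (tmul g Q))" if g: "g \<in> Stab0 A" for g
    proof -
      obtain x where x: "x \<in> carrier M" "g = \<psi> x" using g unfolding img by blast
      show ?thesis unfolding x(2) o_apply f[OF x(1)] recover using p(2) x(1) by blast
    qed
    then show "q \<circ> f \<in> Stab0_regular A"
      unfolding Stab0_regular_def regular_on_def
      by (intro CollectI bexI[OF _ triple_gens_conj[OF p(1), of P Q]] ballI)
  next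
    assume "q \<circ> f \<in> Stab0_regular A"
    then obtain p where p: "p \<in> generated_algebra triple_gens" "\<forall>g\<in>Stab0 A. (q \<circ> f) g = p g"
      unfolding Stab0_regular_def regular_on_def by blast
    have "(\<lambda>x. p' (\<Delta> x)) \<in> S" if "p' \<in> generated_algebra triple_gens" for p'
      using that
    proof (induction rule: generated_algebra.induct)
      case (gen l)
      then show ?case by (rule ent)
    qed (rule S(1) S(2) S(3); assumption)+
    from this[OF triple_gens_conj[OF p(1), of Q P]]
    show "q \<in> S" by (rule S(4)) (use p(2) in \<open>simp add: img f \<psi>_def[symmetric]\<close>)
  qed
  ultimately show ?thesis unfolding alg_group_iso_def by blast
qed

lemma conj_alg_iso_regular_on:
  fixes A :: "('n0::finite, 'n1::finite, 'n2::finite) tensor" and M :: "'m monoid"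
  assumes PQ: "tmul P Q = tone" "tmul Q P = tone"
    and G: "Stab0 A = (\<lambda>g. tmul Q (tmul g P)) ` \<Delta> ` carrier M"
    and hom: "\<And>x y. x \<in> carrier M \<Longrightarrow> y \<in> carrier M \<Longrightarrow> \<Delta> (x \<otimes>\<^bsub>M\<^esub> y) = tmul (\<Delta> x) (\<Delta> y)"
      "\<And>x y. x \<in> carrier M \<Longrightarrow> y \<in> carrier M \<Longrightarrow> x \<otimes>\<^bsub>M\<^esub> y \<in> carrier M"
    and ent: "\<And>l. l \<in> triple_gens \<Longrightarrow> (\<lambda>x. l (\<Delta> x)) \<in> regular_on (carrier M) L"
    and rec: "\<And>l. l \<in> L \<Longrightarrow> \<exists>p\<in>generated_algebra triple_gens. \<forall>x\<in>carrier M. l x = p (\<Delta> x)"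
    and sep: "\<And>x y. x \<in> carrier M \<Longrightarrow> y \<in> carrier M \<Longrightarrow> (\<And>l. l \<in> L \<Longrightarrow> l x = l y) \<Longrightarrow> x = y"
  shows "alg_group_iso (Stab0_group A) (Stab0_regular A) M (regular_on (carrier M) L)"
proof (rule conj_alg_iso[where S = "regular_on (carrier M) L" and \<Delta> = \<Delta>, OF PQ G hom])
  show "(\<lambda>_. c) \<in> regular_on (carrier M) L" for c by (rule regular_on_intros)
  show "(\<lambda>x. p x + q x) \<in> regular_on (carrier M) L" "(\<lambda>x. p x * q x) \<in> regular_on (carrier M) L"
    if "p \<in> regular_on (carrier M) L" "q \<in> regular_on (carrier M) L" for p q
    using that by (rule regular_on_intros)+
  show "q \<in> regular_on (carrier M) L" if "p \<in> regular_on (carrier M) L" "\<And>x. x \<in> carrier M \<Longrightarrow> q x = p x" for p q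
    using that by (rule regular_on_cong)
  show "(\<lambda>x. l (\<Delta> x)) \<in> regular_on (carrier M) L" if "l \<in> triple_gens" for l using that by (rule ent)
  show "\<exists>p\<in>generated_algebra triple_gens. \<forall>x\<in>carrier M. q x = p (\<Delta> x)" if "q \<in> regular_on (carrier M) L" for q
    by (rule regular_on_lift[OF that rec])
  show "x = y" if "x \<in> carrier M" "y \<in> carrier M" "\<And>q. q \<in> regular_on (carrier M) L \<Longrightarrow> q x = q y" for x y
    by (rule sep[OF that(1,2) that(3)[OF regular_on_intros(4)]])
qed

text \<open>Commutativity is the invariant that tells the trivial group, \<open>Ga\<close> and
  \<open>Gm\<close> apart from \<open>SL2\<close> and \<open>PSL2\<close>.\<close>

lemma alg_group_iso_commutative:
  assumes iso: "alg_group_iso G R H S" and comm: "\<And>x y. x \<in> carrier G \<Longrightarrow> y \<in> carrier G \<Longrightarrow> x \<otimes>\<^bsub>G\<^esub> y = y \<otimes>\<^bsub>G\<^esub> x"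
    and xy: "x \<in> carrier H" "y \<in> carrier H"
  shows "x \<otimes>\<^bsub>H\<^esub> y = y \<otimes>\<^bsub>H\<^esub> x"
proof -
  obtain f where f: "f \<in> hom G H" "f ` carrier G = carrier H"
    using iso unfolding alg_group_iso_def iso_def bij_betw_def by blast
  obtain a b where ab: "a \<in> carrier G" "b \<in> carrier G" "x = f a" "y = f b" using xy f(2) by blast
  then show ?thesis using comm[OF ab(1,2)] hom_mult[OF f(1)] by metis
qed

section \<open>The four groups\<close>

lemma PSL2_coset: "{mat 1, - mat 1} #>\<^bsub>SL2\<^esub> g = {g, - g}"
  by (auto simp: r_coset_def SL2_def matrix_mul_uminus)

lemma PSL2_carrier: "carrier PSL2 = {{g, - g} | g. g \<in> SL}"
  by (auto simp: PSL2_def FactGroup_def RCOSETS_def PSL2_coset) (auto simp: SL2_def)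

lemma PSL2_mult: "{g, - g} \<otimes>\<^bsub>PSL2\<^esub> {h, - h} = {g ** h, - (g ** h)}"
  by (auto simp: PSL2_def FactGroup_def set_mult_def SL2_def matrix_mul_uminus)

definition coset_rep :: "(complex^2^2) set \<Rightarrow> complex^2^2" where
  "coset_rep C = (SOME g. g \<in> C)"

lemma coset_rep: "coset_rep {g, - g} = g \<or> coset_rep {g, - g} = - g"
  using someI[of "\<lambda>x. x \<in> {g, - g}" g] by (auto simp: coset_rep_def)

lemma SL2_not_commutative: "\<exists>x\<in>carrier SL2. \<exists>y\<in>carrier SL2. x \<otimes>\<^bsub>SL2\<^esub> y \<noteq> y \<otimes>\<^bsub>SL2\<^esub> x"
  by (rule bexI[of _ "mk 1 1 0 1"], rule bexI[of _ "mk 1 0 1 1"]) (auto simp: SL2_def mk_mult mk_inject mk_in_SL)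

lemma PSL2_not_commutative: "\<exists>x\<in>carrier PSL2. \<exists>y\<in>carrier PSL2. x \<otimes>\<^bsub>PSL2\<^esub> y \<noteq> y \<otimes>\<^bsub>PSL2\<^esub> x"
proof (rule bexI[of _ "{mk 1 1 0 1, - mk 1 1 0 1}"], rule bexI[of _ "{mk 1 0 1 1, - mk 1 0 1 1}"])
  have "mk 2 1 1 1 \<noteq> mk 1 1 1 2" "mk 2 1 1 1 \<noteq> - mk 1 1 1 2"
    by (auto simp: mk_inject vec_eq_iff forall_2)
  then show "{mk 1 1 0 1, - mk 1 1 0 1} \<otimes>\<^bsub>PSL2\<^esub> {mk 1 0 1 1, - mk 1 0 1 1} \<noteq> {mk 1 0 1 1, - mk 1 0 1 1} \<otimes>\<^bsub>PSL2\<^esub> {mk 1 1 0 1, - mk 1 1 0 1}"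
    unfolding PSL2_mult mk_mult by auto
qed (auto simp: PSL2_carrier mk_in_SL)

lemma (in index) rho_uminus:
  assumes "even k"
  shows "rho \<iota> k (- g) = rho \<iota> k g"
proof -
  have "- g = mk (- 1) 0 0 (- 1) ** g" by (subst (1 2) mk_eq[of g]) (simp add: mk_mult vec_eq_iff forall_2)
  moreover have "rho \<iota> k (mk (- 1) 0 0 (- 1)) = mat 1"
    using assms index_le by (auto simp: vec_eq_iff rho_diag mat_def simp flip: power_add)
  ultimately show ?thesis by (simp add: rho_mult)
qed

text \<open>If \<open>k\<close> is even, \<open>rho\<close> of \<open>mk s 0 0 (inverse s)\<close>
  depends only on \<open>t = s * s\<close>; in the all-even case \<open>t\<close> is the faithful
  parameter of the torus.\<close>

definition even_torus :: "('n::finite \<Rightarrow> nat) \<Rightarrow> nat \<Rightarrow> complex \<Rightarrow> complex^'n^'n" where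
  "even_torus \<iota> k t = (\<chi> i j. if i = j then t ^ (k div 2) * inverse t ^ \<iota> i else 0)"

context boundary_index
begin

lemma rho3_sel: "fst (rho3 g) = rho \<iota>0 k0 g" "fst (snd (rho3 g)) = rho \<iota>1 k1 g" "snd (snd (rho3 g)) = rho \<iota>2 k2 g"
  by (simp_all add: rho3_def)

lemma R_triple_gens:
  "q \<in> i0.R \<Longrightarrow> \<exists>p\<in>generated_algebra triple_gens. \<forall>g\<in>SL. q g = p (rho3 g)"
  "q \<in> i1.R \<Longrightarrow> \<exists>p\<in>generated_algebra triple_gens. \<forall>g\<in>SL. q g = p (rho3 g)"
  "q \<in> i2.R \<Longrightarrow> \<exists>p\<in>generated_algebra triple_gens. \<forall>g\<in>SL. q g = p (rho3 g)"
proof -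
  show "\<exists>p\<in>generated_algebra triple_gens. \<forall>g\<in>SL. q g = p (rho3 g)" if "q \<in> i0.R"
  proof (rule regular_on_lift[OF that])
    fix l assume "l \<in> {\<lambda>g. rho \<iota>0 k0 g $ i $ j | i j. True}"
    then obtain i j where "l = (\<lambda>g. rho \<iota>0 k0 g $ i $ j)" by blast
    then show "\<exists>q\<in>generated_algebra triple_gens. \<forall>x\<in>SL. l x = q (rho3 x)"
      by (intro bexI[OF _ triple_gens_algebra(1)[of i j]]) (simp add: rho3_sel)
  qed
  show "\<exists>p\<in>generated_algebra triple_gens. \<forall>g\<in>SL. q g = p (rho3 g)" if "q \<in> i1.R"
  proof (rule regular_on_lift[OF that])
    fix l assume "l \<in> {\<lambda>g. rho \<iota>1 k1 g $ i $ j | i j. True}"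
    then obtain i j where "l = (\<lambda>g. rho \<iota>1 k1 g $ i $ j)" by blast
    then show "\<exists>q\<in>generated_algebra triple_gens. \<forall>x\<in>SL. l x = q (rho3 x)"
      by (intro bexI[OF _ triple_gens_algebra(2)[of i j]]) (simp add: rho3_sel)
  qed
  show "\<exists>p\<in>generated_algebra triple_gens. \<forall>g\<in>SL. q g = p (rho3 g)" if "q \<in> i2.R"
  proof (rule regular_on_lift[OF that])
    fix l assume "l \<in> {\<lambda>g. rho \<iota>2 k2 g $ i $ j | i j. True}"
    then obtain i j where "l = (\<lambda>g. rho \<iota>2 k2 g $ i $ j)" by blast
    then show "\<exists>q\<in>generated_algebra triple_gens. \<forall>x\<in>SL. l x = q (rho3 x)"
      by (intro bexI[OF _ triple_gens_algebra(3)[of i j]]) (simp add: rho3_sel)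
  qed
qed

lemma rho3_regular_comp:
  assumes "l \<in> triple_gens" and "\<And>i j. (\<lambda>x. m x $ i $ j) \<in> regular_on X L'"
  shows "(\<lambda>x. l (rho3 (m x))) \<in> regular_on X L'"
proof -
  have 1: "(\<lambda>x. rho \<iota> k (m x) $ i $ j) \<in> regular_on X L'" for \<iota> :: "'x::finite \<Rightarrow> nat" and k i j
    by (rule regular_on_comp[OF rho_regular]) (use assms(2) in blast)
  show ?thesis using assms(1) unfolding triple_gens_iff
    by (elim disjE exE) (simp_all only: rho3_sel 1)
qed

lemma odd_triple_gens:
  assumes "odd k0 \<or> odd k1 \<or> odd k2" "q \<in> SL2_regular"
  shows "\<exists>p\<in>generated_algebra triple_gens. \<forall>g\<in>SL. q g = p (rho3 g)"
  using assms(1)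
proof (elim disjE)
  assume "odd k0" then show ?thesis by (rule R_triple_gens(1)[OF i0.R_odd[OF _ assms(2)]])
next
  assume "odd k1" then show ?thesis by (rule R_triple_gens(2)[OF i1.R_odd[OF _ assms(2)]])
next
  assume "odd k2" then show ?thesis by (rule R_triple_gens(3)[OF i2.R_odd[OF _ assms(2)]])
qed

lemma SL2_regular_entry: "(\<lambda>g. g $ i $ j) \<in> SL2_regular"
  unfolding SL2_regular_def by (rule regular_on_intros(4)) blast

context
  fixes A :: "('n0, 'n1, 'n2) tensor" and P Q :: "('n0, 'n1, 'n2) triple"
  assumes PQ: "tmul P Q = tone" "tmul Q P = tone"
begin

lemma iso_SL2:
  assumes S: "Stab0 A = (\<lambda>g. tmul Q (tmul (rho3 g) P)) ` SL" and odd: "odd k0 \<or> odd k1 \<or> odd k2"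
  shows "alg_group_iso (Stab0_group A) (Stab0_regular A) SL2 SL2_regular"
proof -
  have c: "carrier SL2 = SL" by (simp add: SL2_def)
  have "alg_group_iso (Stab0_group A) (Stab0_regular A) SL2 (regular_on (carrier SL2) {\<lambda>g. g $ i $ j | i j. True})"
  proof (rule conj_alg_iso_regular_on[OF PQ, of _ rho3])
    show "Stab0 A = (\<lambda>g. tmul Q (tmul g P)) ` rho3 ` carrier SL2" by (simp add: S c image_image)
    show "rho3 (x \<otimes>\<^bsub>SL2\<^esub> y) = tmul (rho3 x) (rho3 y)" "x \<otimes>\<^bsub>SL2\<^esub> y \<in> carrier SL2"
      if "x \<in> carrier SL2" "y \<in> carrier SL2" for x y
      using that SL_group(1) by (simp_all add: SL2_def rho3_mult)
    show "(\<lambda>x. l (rho3 x)) \<in> regular_on (carrier SL2) {\<lambda>g. g $ i $ j | i j. True}" if "l \<in> triple_gens" for l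
      by (rule rho3_regular_comp[OF that, where m = "\<lambda>x. x"], rule regular_on_intros(4), blast)
    show "\<exists>p\<in>generated_algebra triple_gens. \<forall>x\<in>carrier SL2. l x = p (rho3 x)" if l: "l \<in> {\<lambda>g. g $ i $ j | i j. True}" for l
      unfolding c by (rule odd_triple_gens[OF odd]) (use l in \<open>unfold SL2_regular_def, rule regular_on_intros(4)\<close>)
    show "x = y" if "\<And>l. l \<in> {\<lambda>g. g $ i $ j | i j. True} \<Longrightarrow> l x = l y" for x y :: "complex^2^2"
    proof -
      have "x $ i $ j = y $ i $ j" for i j by (rule that) blast
      then show ?thesis by (simp add: vec_eq_iff)
    qed
  qed
  then show ?thesis by (simp add: SL2_regular_def c)
qed

text \<open>Functions on the quotient are the even functions on \<open>SL\<close>, and by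
  \<open>R_even\<close> the second factor already recovers all of them from its matrix
  entries.\<close>

lemma iso_PSL2:
  assumes S: "Stab0 A = (\<lambda>g. tmul Q (tmul (rho3 g) P)) ` SL" and even: "even k0" "even k1" "even k2"
  shows "alg_group_iso (Stab0_group A) (Stab0_regular A) PSL2 PSL2_regular"
proof -
  define \<Delta> where "\<Delta> C = rho3 (coset_rep C)" for C
  have neg: "rho3 (- g) = rho3 g" for g
    by (simp add: rho3_def i0.rho_uminus i1.rho_uminus i2.rho_uminus even)
  have \<Delta>: "\<Delta> {g, - g} = rho3 g" for g
    unfolding \<Delta>_def using coset_rep[of g] neg by metis
  have reg: "p \<in> PSL2_regular \<longleftrightarrow> (\<lambda>g. p {g, - g}) \<in> regular_on SL {\<lambda>g. g $ i $ j | i j. True}" for p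
    by (simp add: PSL2_regular_def PSL2_coset SL2_regular_def)
  show ?thesis
  proof (rule conj_alg_iso[OF PQ, of _ \<Delta>])
    show "Stab0 A = (\<lambda>g. tmul Q (tmul g P)) ` \<Delta> ` carrier PSL2"
    proof -
      have "carrier PSL2 = (\<lambda>g. {g, - g}) ` SL" unfolding PSL2_carrier by blast
      then show ?thesis by (simp only: S image_image \<Delta>)
    qed
    show "\<Delta> (x \<otimes>\<^bsub>PSL2\<^esub> y) = tmul (\<Delta> x) (\<Delta> y)" "x \<otimes>\<^bsub>PSL2\<^esub> y \<in> carrier PSL2"
      if xy: "x \<in> carrier PSL2" "y \<in> carrier PSL2" for x y
    proof -
      obtain g h where gh: "x = {g, - g}" "y = {h, - h}" "g \<in> SL" "h \<in> SL" using xy by (auto simp: PSL2_carrier)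
      show "\<Delta> (x \<otimes>\<^bsub>PSL2\<^esub> y) = tmul (\<Delta> x) (\<Delta> y)" unfolding gh PSL2_mult \<Delta> rho3_mult ..
      show "x \<otimes>\<^bsub>PSL2\<^esub> y \<in> carrier PSL2" unfolding gh PSL2_mult PSL2_carrier using SL_group(1)[OF gh(3,4)] by blast
    qed
    show "(\<lambda>_. c) \<in> PSL2_regular" for c unfolding reg by (rule regular_on_intros)
    show "(\<lambda>x. p x + q x) \<in> PSL2_regular" "(\<lambda>x. p x * q x) \<in> PSL2_regular" if "p \<in> PSL2_regular" "q \<in> PSL2_regular" for p q
      using that unfolding reg by (rule regular_on_intros)+
    show "q \<in> PSL2_regular" if p: "p \<in> PSL2_regular" and eq: "\<And>x. x \<in> carrier PSL2 \<Longrightarrow> q x = p x" for p q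
      using p unfolding reg by (rule regular_on_cong) (auto intro!: eq simp: PSL2_carrier)
    show "(\<lambda>x. l (\<Delta> x)) \<in> PSL2_regular" if "l \<in> triple_gens" for l
      unfolding reg \<Delta> by (rule rho3_regular_comp[OF that, where m = "\<lambda>x. x"], rule regular_on_intros(4), blast)
    show "\<exists>p\<in>generated_algebra triple_gens. \<forall>x\<in>carrier PSL2. q x = p (\<Delta> x)" if "q \<in> PSL2_regular" for q
    proof -
      have "(\<lambda>g. q {g, - g}) \<in> i1.R"
        by (rule i1.R_even[OF k012(2)]) (use that in \<open>simp_all add: reg SL2_regular_def insert_commute\<close>)
      from R_triple_gens(2)[OF this] obtain p where p: "p \<in> generated_algebra triple_gens" "\<forall>g\<in>SL. q {g, - g} = p (rho3 g)" by blast
      show ?thesis by (rule bexI[OF _ p(1)]) (use p(2) in \<open>auto simp: PSL2_carrier \<Delta>\<close>)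
    qed
    show "x = y" if xy: "x \<in> carrier PSL2" "y \<in> carrier PSL2" and eq: "\<And>q. q \<in> PSL2_regular \<Longrightarrow> q x = q y" for x y
    proof -
      obtain g h where gh: "x = {g, - g}" "y = {h, - h}" "g \<in> SL" "h \<in> SL" using xy by (auto simp: PSL2_carrier)
      \<comment> \<open>Products of two entries do not change under \<open>g \<mapsto> - g\<close>,
        and they determine \<open>g\<close> up to sign.\<close>
      define m where "m i j i' j' C = coset_rep C $ i $ j * coset_rep C $ i' $ j'" for i j i' j' C
      have m: "m i j i' j' {g, - g} = g $ i $ j * g $ i' $ j'" for i j i' j' g
        using coset_rep[of g] by (auto simp: m_def)
      have "m i j i' j' \<in> PSL2_regular" for i j i' j'
        unfolding reg m by (intro regular_on_intros(3) regular_on_intros(4)) blast+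
      from eq[OF this] have pr: "g $ i $ j * g $ i' $ j' = h $ i $ j * h $ i' $ j'" for i j i' j'
        unfolding gh m .
      have "g \<noteq> 0" using gh(3) by (auto simp: SL_det2)
      then obtain i j where ij: "g $ i $ j \<noteq> 0" by (auto simp: vec_eq_iff)
      have "g = h \<or> g = - h"
      proof (cases "h $ i $ j = g $ i $ j")
        case True
        then have "g $ i' $ j' = h $ i' $ j'" for i' j' using pr[of i j i' j'] ij by simp
        then show ?thesis by (simp add: vec_eq_iff)
      next
        case False
        then have "h $ i $ j = - g $ i $ j" using pr[of i j i j] by (metis square_eq_iff)
        then have "g $ i' $ j' = - h $ i' $ j'" for i' j' using pr[of i j i' j'] ij
          by (metis minus_mult_commute mult_cancel_left)
        then show ?thesis by (simp add: vec_eq_iff)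
      qed
      then show ?thesis unfolding gh by (auto simp: insert_commute)
    qed
  qed
qed

lemma iso_Ga:
  assumes S: "Stab0 A = (\<lambda>g. tmul Q (tmul (rho3 g) P)) ` upper"
  shows "alg_group_iso (Stab0_group A) (Stab0_regular A) Ga Ga_regular"
proof -
  have c: "carrier Ga = UNIV" by (simp add: Ga_def)
  have "alg_group_iso (Stab0_group A) (Stab0_regular A) Ga (regular_on (carrier Ga) {\<lambda>t. t})"
  proof (rule conj_alg_iso_regular_on[OF PQ, of _ "\<lambda>t. rho3 (mk 1 t 0 1)"])
    show "Stab0 A = (\<lambda>g. tmul Q (tmul g P)) ` (\<lambda>t. rho3 (mk 1 t 0 1)) ` carrier Ga"
      by (simp add: S c image_image upper_def)
    show "rho3 (mk 1 (x \<otimes>\<^bsub>Ga\<^esub> y) 0 1) = tmul (rho3 (mk 1 x 0 1)) (rho3 (mk 1 y 0 1))" for x y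
      by (simp add: Ga_def rho3_mult mk_mult add.commute)
    show "x \<otimes>\<^bsub>Ga\<^esub> y \<in> carrier Ga" for x y by (simp add: Ga_def)
    show "(\<lambda>x. l (rho3 (mk 1 x 0 1))) \<in> regular_on (carrier Ga) {\<lambda>t. t}" if "l \<in> triple_gens" for l
    proof (rule rho3_regular_comp[OF that])
      fix i j :: 2
      show "(\<lambda>x. mk 1 x 0 1 $ i $ j) \<in> regular_on (carrier Ga) {\<lambda>t. t}"
        using exhaust_2[of i] exhaust_2[of j] by (auto intro: regular_on_intros(1,4))
    qed
    show "\<exists>p\<in>generated_algebra triple_gens. \<forall>x\<in>carrier Ga. l x = p (rho3 (mk 1 x 0 1))" if "l \<in> {\<lambda>t. t}" for l
    proof -
      \<comment> \<open>At this position the matrix of the unipotent element has the parameter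
        itself as entry.\<close>
      obtain i j where "\<iota>1 i = 0" "\<iota>1 j = 1" using i1.index_surj[of 0] i1.index_surj[of 1] k012 by auto
      then have "rho \<iota>1 k1 (mk 1 t 0 1) $ i $ j = t" for t by (simp add: rho_def flip: one_pCons)
      then show ?thesis using that by (intro bexI[OF _ triple_gens_algebra(2)[of i j]]) (simp add: rho3_sel)
    qed
  qed auto
  then show ?thesis by (simp add: Ga_regular_def c)
qed

text \<open>The parametrization by \<open>s\<close> is injective unless all three degrees are even,
  in which case \<open>s\<close> and \<open>- s\<close> act alike and \<open>s * s\<close> must be
  used as parameter.\<close>

lemma iso_Gm:
  assumes S: "Stab0 A = (\<lambda>g. tmul Q (tmul (rho3 g) P)) ` torus"
  shows "alg_group_iso (Stab0_group A) (Stab0_regular A) Gm Gm_regular"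
proof -
  have c: "carrier Gm = UNIV - {0}" by (simp add: Gm_def)
  let ?L = "{\<lambda>t::complex. t, \<lambda>t. inverse t}"
  have sep: "x = y" if "\<And>l. l \<in> ?L \<Longrightarrow> l x = l y" for x y using that[of "\<lambda>t. t"] by simp
  have "alg_group_iso (Stab0_group A) (Stab0_regular A) Gm (regular_on (carrier Gm) ?L)"
  proof (cases "even k0 \<and> even k1 \<and> even k2")
    case False
    show ?thesis
    proof (rule conj_alg_iso_regular_on[OF PQ, of _ "\<lambda>t. rho3 (mk t 0 0 (inverse t))"])
      show "Stab0 A = (\<lambda>g. tmul Q (tmul g P)) ` (\<lambda>t. rho3 (mk t 0 0 (inverse t))) ` carrier Gm"
        unfolding S c torus_def by (auto simp: image_iff)
      show "rho3 (mk (x \<otimes>\<^bsub>Gm\<^esub> y) 0 0 (inverse (x \<otimes>\<^bsub>Gm\<^esub> y))) = tmul (rho3 (mk x 0 0 (inverse x))) (rho3 (mk y 0 0 (inverse y)))" for x y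
        by (simp add: Gm_def rho3_mult mk_mult)
      show "x \<otimes>\<^bsub>Gm\<^esub> y \<in> carrier Gm" if "x \<in> carrier Gm" "y \<in> carrier Gm" for x y using that by (simp add: Gm_def)
      show "(\<lambda>x. l (rho3 (mk x 0 0 (inverse x)))) \<in> regular_on (carrier Gm) ?L" if "l \<in> triple_gens" for l
      proof (rule rho3_regular_comp[OF that])
        fix i j :: 2
        show "(\<lambda>x. mk x 0 0 (inverse x) $ i $ j) \<in> regular_on (carrier Gm) ?L"
          using exhaust_2[of i] exhaust_2[of j] by (auto intro: regular_on_intros(1,4))
      qed
      show "\<exists>p\<in>generated_algebra triple_gens. \<forall>x\<in>carrier Gm. l x = p (rho3 (mk x 0 0 (inverse x)))" if l: "l \<in> ?L" for l
      proof -
        have "\<exists>i j. \<forall>x. l x = mk x 0 0 (inverse x) $ i $ j" using l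
          by (elim insertE emptyE) (rule exI[of _ 1], rule exI[of _ 1], simp, rule exI[of _ 2], rule exI[of _ 2], simp)
        then obtain i j where ij: "\<And>x. l x = mk x 0 0 (inverse x) $ i $ j" by blast
        obtain p where "p \<in> generated_algebra triple_gens" "\<forall>g\<in>SL. g $ i $ j = p (rho3 g)"
          using odd_triple_gens[OF _ SL2_regular_entry[of i j]] False by blast
        then show ?thesis by (intro bexI[of _ p]) (auto simp: ij c mk_in_SL)
      qed
    qed (rule sep)
  next
    case True
    define \<Delta> where "\<Delta> t = (even_torus \<iota>0 k0 t, even_torus \<iota>1 k1 t, even_torus \<iota>2 k2 t)" for t
    have Dr: "rho \<iota> k (mk s 0 0 (inverse s)) = even_torus \<iota> k (s * s)" if \<iota>: "index \<iota> k" and k: "even k" and s: "s \<noteq> 0"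
      for \<iota> :: "'x::finite \<Rightarrow> nat" and k s
    proof -
      interpret index \<iota> k by (rule \<iota>)
      have "s ^ (k - \<iota> i) * inverse s ^ \<iota> i = (s * s) ^ (k div 2) * inverse (s * s) ^ \<iota> i" for i
      proof -
        have "(s * s) ^ (k div 2) = s ^ k" using k by (metis dvd_mult_div_cancel power2_eq_square power_mult)
        then show ?thesis using index_le[of i] s by (simp add: power_diff power_mult_distrib field_simps)
      qed
      then show ?thesis by (simp add: vec_eq_iff rho_diag even_torus_def)
    qed
    have \<Delta>r: "rho3 (mk s 0 0 (inverse s)) = \<Delta> (s * s)" if "s \<noteq> 0" for s
      unfolding rho3_def \<Delta>_def using Dr[OF i0.index_axioms _ that] Dr[OF i1.index_axioms _ that] Dr[OF i2.index_axioms _ that] True by simp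
    have Dm: "even_torus \<iota> k (x * y) = even_torus \<iota> k x ** even_torus \<iota> k y" for \<iota> :: "'x::finite \<Rightarrow> nat" and k x y
    proof -
      have "(even_torus \<iota> k x ** even_torus \<iota> k y) $ i $ j =
          (\<Sum>l\<in>UNIV. if l = i then even_torus \<iota> k (x * y) $ i $ j else 0)" for i j
        unfolding matrix_matrix_mult_def vec_lambda_beta
        by (intro sum.cong refl) (auto simp: even_torus_def power_mult_distrib)
      then show ?thesis by (simp add: vec_eq_iff)
    qed
    show ?thesis
    proof (rule conj_alg_iso_regular_on[OF PQ, of _ \<Delta>])
      have "\<Delta> ` carrier Gm = rho3 ` torus"
      proof
        show "\<Delta> ` carrier Gm \<subseteq> rho3 ` torus"
        proof
          fix g assume "g \<in> \<Delta> ` carrier Gm"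
          then obtain z where z: "z \<noteq> 0" "g = \<Delta> z" by (auto simp: c)
          \<comment> \<open>Every nonzero \<open>z\<close> is a square, so the new parametrization
            still covers the whole torus.\<close>
          have "csqrt z * csqrt z = z" using power2_csqrt[of z] by (simp add: power2_eq_square)
          then have "g = rho3 (mk (csqrt z) 0 0 (inverse (csqrt z)))" using z \<Delta>r[of "csqrt z"] by simp
          moreover have "mk (csqrt z) 0 0 (inverse (csqrt z)) \<in> torus"
            unfolding torus_def using z(1) by (intro CollectI exI[of _ "csqrt z"]) simp
          ultimately show "g \<in> rho3 ` torus" by blast
        qed
        show "rho3 ` torus \<subseteq> \<Delta> ` carrier Gm" by (auto simp: torus_def \<Delta>r c)
      qed
      then show "Stab0 A = (\<lambda>g. tmul Q (tmul g P)) ` \<Delta> ` carrier Gm" by (simp add: S image_image)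
      show "\<Delta> (x \<otimes>\<^bsub>Gm\<^esub> y) = tmul (\<Delta> x) (\<Delta> y)" for x y
        by (simp add: Gm_def \<Delta>_def Dm)
      show "x \<otimes>\<^bsub>Gm\<^esub> y \<in> carrier Gm" if "x \<in> carrier Gm" "y \<in> carrier Gm" for x y using that by (simp add: Gm_def)
      have De: "(\<lambda>x. even_torus \<iota> k x $ i $ j) \<in> regular_on (carrier Gm) ?L" for \<iota> :: "'x::finite \<Rightarrow> nat" and k i j
      proof (cases "i = j")
        case True
        have "(\<lambda>x. x ^ (k div 2) * inverse x ^ \<iota> i) \<in> regular_on (carrier Gm) ?L"
          by (intro regular_on_intros(3) regular_on_power regular_on_intros(4)) auto
        then show ?thesis using True by (simp add: even_torus_def)
      next
        case False
        then show ?thesis using regular_on_intros(1)[of 0] by (simp add: even_torus_def)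
      qed
      show "(\<lambda>x. l (\<Delta> x)) \<in> regular_on (carrier Gm) ?L" if "l \<in> triple_gens" for l
        using that unfolding triple_gens_iff by (elim disjE exE) (simp_all only: \<Delta>_def fst_conv snd_conv De)
      show "\<exists>p\<in>generated_algebra triple_gens. \<forall>x\<in>carrier Gm. l x = p (\<Delta> x)" if l: "l \<in> ?L" for l
      proof -
        \<comment> \<open>The diagonal exponents are \<open>k1 div 2\<close> minus the index; the
          indices next to the middle one have exponents \<open>1\<close> and \<open>- 1\<close>,
          giving the two generators of the coordinate ring.\<close>
        obtain n where n: "k1 = 2 * Suc n"
        proof -
          obtain m where "k1 = 2 * m" using True by (auto elim: evenE)
          then show ?thesis using that[of "m - 1"] k012(2) by (cases m) auto
        qed
        obtain i j where ij: "\<iota>1 i = n" "\<iota>1 j = Suc (Suc n)"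
          using i1.index_surj[of n] i1.index_surj[of "Suc (Suc n)"] n by auto
        have D: "even_torus \<iota>1 k1 x $ i $ i = x" "even_torus \<iota>1 k1 x $ j $ j = inverse x" if "x \<in> carrier Gm" for x
          using that by (simp_all add: even_torus_def ij n c field_simps)
        from l show ?thesis
          by (elim insertE emptyE)
            (rule bexI[OF _ triple_gens_algebra(2)[of i i]], simp add: \<Delta>_def D,
             rule bexI[OF _ triple_gens_algebra(2)[of j j]], simp add: \<Delta>_def D)
      qed
    qed (rule sep)
  qed
  then show ?thesis by (simp add: Gm_regular_def c)
qed

end

end

section \<open>Symmetric powers\<close>

context index
begin

lemma form_bij: "bij_betw (form \<iota> k) UNIV (sym_power k)"
  unfolding bij_betw_def
proof
  show "inj (form \<iota> k)" by (rule injI, rule form_inj) simp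
  have f: "form \<iota> k u \<xi> = (\<Sum>m\<le>k. c m * (\<xi> $ 1) ^ (k - m) * (\<xi> $ 2) ^ m)" if "\<And>i. u $ i = c (\<iota> i)" for u c \<xi>
    using sum_index[of "\<lambda>m. c m * (\<xi> $ 1) ^ (k - m) * (\<xi> $ 2) ^ m"] by (simp add: form_def mvec_def that mult.assoc)
  show "range (form \<iota> k) = sym_power k"
  proof
    have "form \<iota> k u \<in> sym_power k" for u
    proof -
      have "u $ i = u $ inv_into UNIV \<iota> (\<iota> i)" for i using index_inj by (simp add: inj_def)
      from f[of u "\<lambda>m. u $ inv_into UNIV \<iota> m", OF this] show ?thesis unfolding sym_power_def
        by (intro CollectI exI[of _ "\<lambda>m. u $ inv_into UNIV \<iota> m"] allI)
    qed
    then show "range (form \<iota> k) \<subseteq> sym_power k" by blast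
    show "sym_power k \<subseteq> range (form \<iota> k)"
    proof
      fix p assume "p \<in> sym_power k"
      then obtain c where "\<forall>\<xi>. p \<xi> = (\<Sum>i\<le>k. c i * (\<xi> $ 1) ^ (k - i) * (\<xi> $ 2) ^ i)" unfolding sym_power_def by blast
      then have "p = form \<iota> k (\<chi> i. c (\<iota> i))" using f[of "\<chi> i. c (\<iota> i)" c] by auto
      then show "p \<in> range (form \<iota> k)" by blast
    qed
  qed
qed

definition sym_iso :: "complex^'n^'n \<Rightarrow> (complex^2 \<Rightarrow> complex) \<Rightarrow> complex^'n" where
  "sym_iso Q f = Q *v inv_into UNIV (form \<iota> k) f"

lemma sym_iso_form: "sym_iso Q (form \<iota> k u) = Q *v u"
  using form_bij by (simp add: sym_iso_def bij_betw_def)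

lemma sym_power_form: "f \<in> sym_power k \<Longrightarrow> \<exists>u. f = form \<iota> k u"
  using form_bij unfolding bij_betw_def by blast

lemma sym_power_iso_sym_iso:
  assumes PQ: "P ** Q = mat 1" "Q ** P = mat 1"
  shows "sym_power_iso k (sym_iso Q)"
  unfolding sym_power_iso_def
proof (intro conjI ballI allI)
  have "bij ((*v) Q)"
    by (rule o_bij[of "(*v) P"]) (simp_all add: fun_eq_iff PQ)
  from bij_betw_trans[OF bij_betw_inv_into[OF form_bij] this]
  show "bij_betw (sym_iso Q) (sym_power k) UNIV" by (simp add: sym_iso_def[abs_def] o_def)
  fix f assume "f \<in> sym_power k"
  then obtain u where u: "f = form \<iota> k u" using sym_power_form by blast
  show "sym_iso Q (\<lambda>\<xi>. f \<xi> + g \<xi>) = sym_iso Q f + sym_iso Q g" if "g \<in> sym_power k" for g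
  proof -
    obtain v where v: "g = form \<iota> k v" using \<open>g \<in> sym_power k\<close> sym_power_form by blast
    have "(\<lambda>\<xi>. f \<xi> + g \<xi>) = form \<iota> k (u + v)" by (simp add: u v form_def fun_eq_iff distrib_right sum.distrib)
    then show ?thesis by (simp add: u v sym_iso_form matrix_vector_right_distrib)
  qed
  show "sym_iso Q (\<lambda>\<xi>. c * f \<xi>) = c *s sym_iso Q f" for c
  proof -
    have "(\<lambda>\<xi>. c * f \<xi>) = form \<iota> k (c *s u)" by (simp add: u form_def fun_eq_iff sum_distrib_left mult.assoc)
    then show ?thesis by (simp add: u sym_iso_form vector_scalar_commute)
  qed
qed

lemma sym_iso_equivariant:
  assumes "P ** Q = mat 1" "f \<in> sym_power k"
  shows "(Q ** (rho \<iota> k g ** P)) *v sym_iso Q f = sym_iso Q (sym_act g f)"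
proof -
  obtain u where u: "f = form \<iota> k u" using assms(2) sym_power_form by blast
  have "sym_act g f = form \<iota> k (rho \<iota> k g *v u)" by (simp add: fun_eq_iff sym_act_def u form_rho)
  then show ?thesis using assms(1) by (simp add: u sym_iso_form flip: matrix_vector_mul_assoc)
qed

end

theorem theorem2p6:
  fixes A :: "('n0::finite, 'n1::finite, 'n2::finite) tensor"
    and D :: "('n0, 'n1, 'n2) tensor \<Rightarrow> complex"
    and k0 k1 k2 :: nat
  assumes "CARD('n0) = k0 + 1" and "CARD('n1) = k1 + 1" and "CARD('n2) = k2 + 1"
    and "k0 = k1 + k2" and "k1 \<ge> 1" and "k2 \<ge> 1"
    and "A \<noteq> 0"
    and "is_hyperdeterminant D" and "D A \<noteq> 0"
  shows "(\<exists>\<phi>0 \<phi>1 \<phi>2. sym_power_iso k0 \<phi>0 \<and> sym_power_iso k1 \<phi>1 \<and> sym_power_iso k2 \<phi>2 \<and>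
            Stab0 A \<subseteq> SL_U_image k0 k1 k2 \<phi>0 \<phi>1 \<phi>2) \<and>
         (Stab0 A = {(mat 1, mat 1, mat 1)} \<or>
          alg_group_iso (Stab0_group A) (Stab0_regular A) Ga Ga_regular \<or>
          alg_group_iso (Stab0_group A) (Stab0_regular A) Gm Gm_regular \<or>
          Stab0_is_SL2 k0 k1 k2 A) \<and>
         (Stab0_is_SL2 k0 k1 k2 A \<longleftrightarrow> is_identity k0 k1 k2 A)"
proof -
  have card: "CARD('n0) = Suc k0" "CARD('n1) = Suc k1" "CARD('n2) = Suc k2" using assms(1-3) by simp_all
  have "block_bounded A"
    by (rule hyperdeterminant_block_bounded[OF _ assms(8,9)]) (simp add: card assms(4))
  from Stab0_classification[OF card assms(4-6) this]
  obtain \<iota>0 \<iota>1 \<iota>2 P Q H where b: "boundary_index (\<iota>0 :: 'n0 \<Rightarrow> nat) (\<iota>1 :: 'n1 \<Rightarrow> nat) (\<iota>2 :: 'n2 \<Rightarrow> nat) k0 k1 k2"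
    and PQ: "tmul P Q = tone" "tmul Q P = tone" and S: "Stab0 A = conj_image \<iota>0 \<iota>1 \<iota>2 k0 k1 k2 P Q H"
    and H: "if is_identity k0 k1 k2 A then H = SL else H \<in> {{mat 1}, upper, torus}" by (elim exE conjE) (rule that)
  interpret b: boundary_index \<iota>0 \<iota>1 \<iota>2 k0 k1 k2 by (rule b)
  have S: "Stab0 A = (\<lambda>g. tmul Q (tmul (b.rho3 g) P)) ` H" using S by (simp add: conj_image_def)
  have HSL: "H \<subseteq> SL" using H upper_group(1) b.torus_group(1) by (auto simp: SL_def split: if_splits)
  have 1: "\<exists>\<phi>0 \<phi>1 \<phi>2. sym_power_iso k0 \<phi>0 \<and> sym_power_iso k1 \<phi>1 \<and> sym_power_iso k2 \<phi>2 \<and>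
            Stab0 A \<subseteq> SL_U_image k0 k1 k2 \<phi>0 \<phi>1 \<phi>2"
  proof -
    obtain P0 P1 P2 Q0 Q1 Q2 where p: "P = (P0, P1, P2)" "Q = (Q0, Q1, Q2)" by (cases P; cases Q)
    have pq: "P0 ** Q0 = mat 1" "Q0 ** P0 = mat 1" "P1 ** Q1 = mat 1" "Q1 ** P1 = mat 1" "P2 ** Q2 = mat 1" "Q2 ** P2 = mat 1"
      using PQ by (simp_all add: p)
    show ?thesis
    proof (rule exI[of _ "b.i0.sym_iso Q0"], rule exI[of _ "b.i1.sym_iso Q1"], rule exI[of _ "b.i2.sym_iso Q2"], intro conjI subsetI
        b.i0.sym_power_iso_sym_iso[OF pq(1,2)] b.i1.sym_power_iso_sym_iso[OF pq(3,4)] b.i2.sym_power_iso_sym_iso[OF pq(5,6)])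
      fix h assume "h \<in> Stab0 A"
      then obtain g where "g \<in> SL" "h = tmul Q (tmul (b.rho3 g) P)" using S HSL by auto
      then show "h \<in> SL_U_image k0 k1 k2 (b.i0.sym_iso Q0) (b.i1.sym_iso Q1) (b.i2.sym_iso Q2)"
        using b.i0.sym_iso_equivariant[OF pq(1)] b.i1.sym_iso_equivariant[OF pq(3)] b.i2.sym_iso_equivariant[OF pq(5)]
        by (auto simp: SL_U_image_def p b.rho3_def)
    qed
  qed
  show ?thesis
  proof (cases "is_identity k0 k1 k2 A")
    case True
    then have S: "Stab0 A = (\<lambda>g. tmul Q (tmul (b.rho3 g) P)) ` SL" using S H by simp
    have "Stab0_is_SL2 k0 k1 k2 A"
      unfolding Stab0_is_SL2_def using b.iso_PSL2[OF PQ S] b.iso_SL2[OF PQ S] by auto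
    then show ?thesis using 1 True by blast
  next
    case False
    then have H: "H \<in> {{mat 1}, upper, torus}" using H by simp
    have 2: "Stab0 A = {tone} \<or> alg_group_iso (Stab0_group A) (Stab0_regular A) Ga Ga_regular \<or>
      alg_group_iso (Stab0_group A) (Stab0_regular A) Gm Gm_regular"
    proof -
      consider "H = {mat 1}" | "H = upper" | "H = torus" using H by blast
      then show ?thesis
      proof cases
        case 1
        then have "Stab0 A = {tone}" using S by (simp add: b.rho3_one PQ)
        then show ?thesis by blast
      next
        case 2
        then show ?thesis using b.iso_Ga[OF PQ] S by blast
      next
        case 3
        then show ?thesis using b.iso_Gm[OF PQ] S by blast
      qed
    qed
    \<comment> \<open>In the three remaining cases \<open>H\<close> is commutative, whereas
      \<open>SL2\<close> and \<open>PSL2\<close> are not; this yields the converse direction of the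
      equivalence.\<close>
    have Hc: "g ** h = h ** g" if "g \<in> H" "h \<in> H" for g h
      using that H by (auto simp: upper_def torus_def mk_mult mk_inject add.commute mult.commute)
    have comm: "x \<otimes>\<^bsub>Stab0_group A\<^esub> y = y \<otimes>\<^bsub>Stab0_group A\<^esub> x"
      if xy: "x \<in> carrier (Stab0_group A)" "y \<in> carrier (Stab0_group A)" for x y
    proof -
      obtain g h where gh: "g \<in> H" "h \<in> H" "x = tmul Q (tmul (b.rho3 g) P)" "y = tmul Q (tmul (b.rho3 h) P)"
        using xy S by (auto simp: Stab0_group_def)
      have m: "tmul (tmul Q (tmul (b.rho3 g) P)) (tmul Q (tmul (b.rho3 h) P)) = tmul Q (tmul (b.rho3 (g ** h)) P)" for g h
      proof -
        have "tmul (tmul Q (tmul (b.rho3 g) P)) (tmul Q (tmul (b.rho3 h) P)) =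
          tmul Q (tmul (b.rho3 g) (tmul (tmul P Q) (tmul (b.rho3 h) P)))" by (simp only: tmul_assoc)
        then show ?thesis by (simp add: PQ tmul_assoc flip: b.rho3_mult)
      qed
      show ?thesis unfolding Stab0_group_mult gh m Hc[OF gh(1,2)] ..
    qed
    have "\<not> Stab0_is_SL2 k0 k1 k2 A"
      unfolding Stab0_is_SL2_def
      using alg_group_iso_commutative[OF _ comm] SL2_not_commutative PSL2_not_commutative by (metis (full_types))
    then show ?thesis using 1 2 False by blast
  qed
qed

end
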